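(* Let $0\le d\le r-3$, let $(f_p)_{p\in I\times J}$, $p=(a,b)$, be a two-parameter $C^{d,r}$-family of surface diffeomorphisms with a persistent piece $\mathfrak d=(Y_{\mathfrak d},n_{\mathfrak d})$ and affine-like representation $(A_p,B_p)_p$ whose domain contains $0$. Put $$V_p(y):=A_p(0,y),\quad H_p(x):=B_p(x,0),\quad z_0(p):=(A_p(0,0),0),\quad z_1(p):=(0,B_p(0,0)),$$ $W^s_p:=\{(V_p(y),y):y\}$ and $W^u_p:=\{(x,H_p(x)):x\}$. Assume there is a $C^d$-function $b\in J\mapsto a(b)\in I$ such that, with $p(b):=(a(b),b)$: (i) Restricted to a neighborhood of $(x,y)\in\{z_1(p):p\}$ and $p\in\{p(b):b\in J\}$, the family $(f_p)_p$ is of the form $f_p(x,y)=(g_p(x,y),x)$. (ii) For every $b$, the curve $W^u_{p(b)}$ is sent by $f_{p(b)}$ to a curve tangent to $W^s_{p(b)}$ at $f_p(z_1(p))=(V_p(0),0)$, $p=p(b)$. Moreover for every $p$ close to $\{p(b):b\}$, $x=0$ is a critical point of $x\mapsto\|f_p(x,H_p(x))-(V_p(x),x)\|$; in other words, $$g_p(x,y+H_p(x))-V_p(x)=\mu_p+x^2-d_p\,y+r_p(x,d_p\,y),$$ with $d_p:=\det D_{z_1(p)}f_p$, $p\mapsto\mu_p$ a $C^d$-function with $\mu_{p(b)}=0$ for every $b$, and $(r_p)_p$ a $C^{d,r}$-family of functions with $0=r_p(0)=\partial_yr_p(0)=\partial_xr_p(0)=\partial_x^2r_p(0)$ for every $p$.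 (iii) There is $M\ge1$ such that for all $b\in J$, at $p=p(b)$, $$\det\partial_p\left(\mu_p,\sqrt[M]{\det D_{z_0(p)}f_p^{n_{\mathfrak d}+1}}\right)\ne0.$$ Let $\sigma_p:=\partial_xA_p(0)$, $\lambda_p:=\partial_yB_p(0)$ and $\phi_p(X,Y):=(\sigma_pX,\;H_p(\sigma_pX)+\sigma_p\lambda_pY)$. Then $F_p:=\phi_p^{-1}\circ f_p^{n_{\mathfrak d}+1}\circ\phi_p$ is of the form $$F_{\bar p}(X,Y)=(X^2+\bar a-\bar b^MY,\;X)+(Z_{\bar p},\Xi_{\bar p})(X,\bar b^MY),$$ with $\bar a=\mu_p/\sigma_p^2$, $\bar b:=\sqrt[M]{\det D_{z_0(p)}f_p^{n_{\mathfrak d}+1}}$ and $\bar p:=(\bar a,\bar b)$. For every $\bar\delta>0$ and $R>0$, with $\Delta_p:=[-R,R]\times[-R/\bar b^M,R/\bar b^M]$, the family $(F_{\bar p})_{\bar p}$ of Hénon-like maps $F_{\bar p}$ restricted to $\Delta_p\cap F_p^{-1}(\Delta_p)\cap\phi_p^{-1}(f_p^{-1}(Y_{\mathfrak d}))$ is $\bar\delta$-$C^{d,r}$-Hénon-like with multiplicity $M$, provided $(\sigma_p)_p$ is sufficiently small (in function of $\bar\delta$ and) in function of $$R,\quad\|\bar p\mapsto p\|_{C^d},\quad\|(r_p)_p\|_{C^{d,r}}\quad\text{and}\quad\mathcal B_1^{d,r}(\mathfrak d).$$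
   Context: $C^{d,r}$-families: a family $(g_p)_p$ is of class $C^{d,r}$ if all $\partial_p^iD^jg_p(x)$ with $i+j\le r$, $i\le d$ exist and are continuous ($D$ = differential in the space variable); its $C^{d,r}$-norm is the maximum over such $i,j$ of $\sup_{p,x}\|\partial_p^iD^jg_p(x)\|$. Pieces: fix $c_h,c_v>0$ with $c_hc_v<1$ and let $C_h=\{(u_x,u_y):|u_y|\le c_h|u_x|\}$, $C_v=\{(u_x,u_y):|u_x|\le c_v|u_y|\}$. A tame box is a set $Y\subset\mathbb R^2$ diffeomorphic to $[-1,1]^2$ of the form $\{(x,y):\psi^-(x)\le y\le\psi^+(x),\ \phi^-(y)\le x\le\phi^+(y)\}$ with $\psi^\pm,\phi^\pm$ of class $C^r$, $|D\phi^\pm|\le c_v$, $|D\psi^\pm|\le c_h$; $\partial^uY$ is the part of $Y$ where $y\in\{\psi^\pm(x)\}$ and $\partial^sY$ the part where $x\in\{\phi^\pm(y)\}$. A piece $\mathfrak d=(Y_{\mathfrak d},n_{\mathfrak d})$ of a diffeomorphism $f$ is a tame box $Y_{\mathfrak d}$ and an integer $n_{\mathfrak d}\geq 0$ such that $Y^{\mathfrak d}:=f^{n_{\mathfrak d}}(Y_{\mathfrak d})$ is a tame box and $Df^{n_{\mathfrak d}}(\mathbb R^2\setminus C_v)\subset C_h$ at points of $Y_{\mathfrak d}$. A persistent piece of $(f_p)_p$ is a piece of $f_p$ for every $p$, with constant $n_{\mathfrak d}$ and $\partial^sY_{\mathfrak d},\partial^uY_{\mathfrak d}$ made of $C^r$-curves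 depending continuously on $p$. The affine-like representation $(A_p,B_p)$ of $\mathfrak d$ is the pair of functions such that for $(x_0,y_0)\in Y_{\mathfrak d}$, $(x_1,y_1)\in Y^{\mathfrak d}$: $f_p^{n_{\mathfrak d}}(x_0,y_0)=(x_1,y_1)$ iff $x_0=A_p(x_1,y_0)$ and $y_1=B_p(x_1,y_0)$. Distortion: $\mathcal B_1^{d,r}(\mathfrak d):=\|(D\log|\partial_xA_p|,D\log|\partial_yB_p|)_p\|_{C^{d',r-2}}$, $d'=\min(d,r-2)$, $D$ = differential in $(x,y)$. Hénon-like family: a family $(F_{\bar p})_{\bar p=(\bar a,\bar b)}$ is $\bar\delta$-$C^{d,r}$-Hénon-like of multiplicity $M$ if $F_{\bar p}(X,Y)=(X^2+\bar a-\bar b^MY+Z_{\bar p}(X,\bar b^MY),X+\Xi_{\bar p}(X,\bar b^MY))$ with $(Z_{\bar p})$, $(\Xi_{\bar p})$ $C^{d,r}$-families of functions of norm at most $\bar\delta$. By (iii), $p\mapsto\bar p$ is a local change of parameters near $\{p(b):b\in J\}$, used to index the family by $\bar p$. The expression for $f_p(x, H_p(x))$ in (ii) is for $p$ near $\{p(b)\}$ and $(x,y)$ near $0$. The normalization (quadratic coefficient equal to $1$ and base point $c(p)=0$) is the paper's convention, obtained by a preliminary change of coordinates. "$(\sigma_p)_p$ small" is understood in the $C^d$-norm.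
   Formalization: Smallness of σ for the full C^{d,r} bound also depends on the C^{d,r}-norm of ((A−V)/σ,(B−H)/λ) (false otherwise; C^{d,r−1} holds as listed); φ_p(Δ_p) must lie where (i),(ii) hold; det>0 if M is even; for d=0 the parameter change is assumed; surfaces are planar. *)

theory Defs
  imports "HOL-Analysis.Analysis"
begin

type_synonym plane = "real \<times> real"

section \<open>Differentiability classes and norms\<close>

definition ddir :: "'a::real_normed_vector \<Rightarrow> ('a \<Rightarrow> 'b::real_normed_vector) \<Rightarrow> 'a \<Rightarrow> 'b" where
  "ddir v h x = frechet_derivative h (at x) v"

text \<open>
  \<open>D\<^sup>j h (x)\<close> is handled as a multilinear form: its value on \<open>(v\<^sub>1, \<dots>, v\<^sub>j)\<close> is
  \<open>foldr ddir [v\<^sub>1, \<dots>, v\<^sub>j] h x\<close>.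
\<close>

definition Ck_on :: "nat \<Rightarrow> 'a::real_normed_vector set \<Rightarrow> ('a \<Rightarrow> 'b::real_normed_vector) \<Rightarrow> bool" where
  "Ck_on k U h \<longleftrightarrow>
     (\<forall>vs. length vs < k \<longrightarrow> (\<forall>x\<in>U. foldr ddir vs h differentiable (at x))) \<and>
     (\<forall>vs. length vs \<le> k \<longrightarrow> continuous_on U (foldr ddir vs h))"

definition Ck_norm :: "nat \<Rightarrow> 'a::real_normed_vector set \<Rightarrow> ('a \<Rightarrow> 'b::real_normed_vector) \<Rightarrow> ennreal" where
  "Ck_norm k U h =
     (SUP vs\<in>{vs. length vs \<le> k \<and> (\<forall>v\<in>set vs. norm v \<le> 1)}. SUP x\<in>U. ennreal (norm (foldr ddir vs h x)))"

definition Ck_diffeo_on :: "nat \<Rightarrow> 'a::real_normed_vector set \<Rightarrow> ('a \<Rightarrow> 'b::real_normed_vector) \<Rightarrow> bool" where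
  "Ck_diffeo_on k U h \<longleftrightarrow>
     open U \<and> inj_on h U \<and> open (h ` U) \<and> Ck_on k U h \<and> Ck_on k (h ` U) (the_inv_into U h)"

text \<open>
  For a family \<open>g p x\<close>, the value of \<open>\<partial>\<^sub>p\<^sup>i D\<^sup>j g\<^sub>p(x)\<close> on the parameter directions \<open>us\<close>
  (\<open>i = length us\<close>) and the space directions \<open>vs\<close> (\<open>j = length vs\<close>).
\<close>

definition dpar :: "'p::real_normed_vector \<Rightarrow> ('p \<Rightarrow> 'a \<Rightarrow> 'b::real_normed_vector) \<Rightarrow> 'p \<Rightarrow> 'a \<Rightarrow> 'b" where
  "dpar u g = (\<lambda>p x. ddir u (\<lambda>p'. g p' x) p)"

definition dspace :: "'a::real_normed_vector \<Rightarrow> ('p \<Rightarrow> 'a \<Rightarrow> 'b::real_normed_vector) \<Rightarrow> 'p \<Rightarrow> 'a \<Rightarrow> 'b" where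
  "dspace v g = (\<lambda>p. ddir v (g p))"

definition mixed ::
  "'p::real_normed_vector list \<Rightarrow> 'a::real_normed_vector list \<Rightarrow> ('p \<Rightarrow> 'a \<Rightarrow> 'b::real_normed_vector) \<Rightarrow> 'p \<Rightarrow> 'a \<Rightarrow> 'b"
  where "mixed us vs g = foldr dpar us (foldr dspace vs g)"

definition Cdr_on ::
  "nat \<Rightarrow> nat \<Rightarrow> ('p::real_normed_vector \<times> 'a::real_normed_vector) set \<Rightarrow> ('p \<Rightarrow> 'a \<Rightarrow> 'b::real_normed_vector) \<Rightarrow> bool"
  where
  "Cdr_on d r \<Omega> g \<longleftrightarrow>
     (\<forall>vs. length vs < r \<longrightarrow> (\<forall>(p, x)\<in>\<Omega>. mixed [] vs g p differentiable (at x))) \<and>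
     (\<forall>us vs. length us < d \<and> length us + length vs < r \<longrightarrow>
        (\<forall>(p, x)\<in>\<Omega>. (\<lambda>p'. mixed us vs g p' x) differentiable (at p))) \<and>
     (\<forall>us vs. length us \<le> d \<and> length us + length vs \<le> r \<longrightarrow>
        continuous_on \<Omega> (\<lambda>(p, x). mixed us vs g p x))"

definition Cdr_norm ::
  "nat \<Rightarrow> nat \<Rightarrow> ('p::real_normed_vector \<times> 'a::real_normed_vector) set \<Rightarrow> ('p \<Rightarrow> 'a \<Rightarrow> 'b::real_normed_vector) \<Rightarrow> ennreal"
  where
  "Cdr_norm d r \<Omega> g =
     (SUP (us, vs)\<in>{(us, vs). length us \<le> d \<and> length us + length vs \<le> r \<and>
                       (\<forall>u\<in>set us. norm u \<le> 1) \<and> (\<forall>v\<in>set vs. norm v \<le> 1)}.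
      SUP (p, x)\<in>\<Omega>. ennreal (norm (mixed us vs g p x)))"

definition jac :: "(plane \<Rightarrow> plane) \<Rightarrow> plane \<Rightarrow> real" where
  "jac h z = fst (ddir (1, 0) h z) * snd (ddir (0, 1) h z) - fst (ddir (0, 1) h z) * snd (ddir (1, 0) h z)"


section \<open>Pieces and affine-like representations\<close>

definition cone_h :: "real \<Rightarrow> plane set" where
  "cone_h ch = {(ux, uy). \<bar>uy\<bar> \<le> ch * \<bar>ux\<bar>}"

definition cone_v :: "real \<Rightarrow> plane set" where
  "cone_v cv = {(ux, uy). \<bar>ux\<bar> \<le> cv * \<bar>uy\<bar>}"

definition tame_box_with ::
  "nat \<Rightarrow> real \<Rightarrow> real \<Rightarrow> (real \<Rightarrow> real) \<Rightarrow> (real \<Rightarrow> real) \<Rightarrow> (real \<Rightarrow> real) \<Rightarrow> (real \<Rightarrow> real) \<Rightarrow> plane set \<Rightarrow> bool"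
  where
  "tame_box_with r ch cv \<psi>m \<psi>p \<phi>m \<phi>p Y \<longleftrightarrow>
     Ck_on r UNIV \<psi>m \<and> Ck_on r UNIV \<psi>p \<and> Ck_on r UNIV \<phi>m \<and> Ck_on r UNIV \<phi>p \<and>
     Y = {(x, y). \<psi>m x \<le> y \<and> y \<le> \<psi>p x \<and> \<phi>m y \<le> x \<and> x \<le> \<phi>p y} \<and>
     (\<forall>x\<in>fst ` Y. \<bar>deriv \<psi>m x\<bar> \<le> ch \<and> \<bar>deriv \<psi>p x\<bar> \<le> ch) \<and>
     (\<forall>y\<in>snd ` Y. \<bar>deriv \<phi>m y\<bar> \<le> cv \<and> \<bar>deriv \<phi>p y\<bar> \<le> cv) \<and>
     (\<exists>U. \<exists>h :: plane \<Rightarrow> plane. {-1..1} \<times> {-1..1} \<subseteq> U \<and> Ck_diffeo_on r U h \<and> h ` ({-1..1} \<times> {-1..1}) = Y)"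

definition tame_box :: "nat \<Rightarrow> real \<Rightarrow> real \<Rightarrow> plane set \<Rightarrow> bool" where
  "tame_box r ch cv Y \<longleftrightarrow> (\<exists>\<psi>m \<psi>p \<phi>m \<phi>p. tame_box_with r ch cv \<psi>m \<psi>p \<phi>m \<phi>p Y)"

definition piece ::
  "nat \<Rightarrow> real \<Rightarrow> real \<Rightarrow> plane set \<Rightarrow> (plane \<Rightarrow> plane) \<Rightarrow> plane set \<Rightarrow> nat \<Rightarrow> bool" where
  "piece r ch cv S f Y n \<longleftrightarrow>
     Y \<subseteq> S \<and> tame_box r ch cv Y \<and> tame_box r ch cv ((f ^^ n) ` Y) \<and>
     (\<forall>z\<in>Y. \<forall>u. u \<notin> cone_v cv \<longrightarrow> ddir u (f ^^ n) z \<in> cone_h ch)"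

definition persistent_piece ::
  "nat \<Rightarrow> real \<Rightarrow> real \<Rightarrow> plane set \<Rightarrow> plane set \<Rightarrow> (plane \<Rightarrow> plane \<Rightarrow> plane) \<Rightarrow> (plane \<Rightarrow> plane set) \<Rightarrow> nat \<Rightarrow> bool"
  where
  "persistent_piece r ch cv P S f Y n \<longleftrightarrow>
     (\<forall>p\<in>P. piece r ch cv S (f p) (Y p) n) \<and>
     (\<exists>\<psi>m \<psi>p \<phi>m \<phi>p :: plane \<Rightarrow> real \<Rightarrow> real.
        (\<forall>p\<in>P. tame_box_with r ch cv (\<psi>m p) (\<psi>p p) (\<phi>m p) (\<phi>p p) (Y p)) \<and>
        (\<forall>c\<in>{\<psi>m, \<psi>p, \<phi>m, \<phi>p}. continuous_on (P \<times> UNIV) (\<lambda>(p, t). c p t)))"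

definition affine_like_rep ::
  "(plane \<Rightarrow> plane) \<Rightarrow> plane set \<Rightarrow> nat \<Rightarrow> (plane \<Rightarrow> real) \<Rightarrow> (plane \<Rightarrow> real) \<Rightarrow> bool" where
  "affine_like_rep f Y n A B \<longleftrightarrow>
     (\<forall>(x0, y0)\<in>Y. \<forall>(x1, y1)\<in>(f ^^ n) ` Y.
        (f ^^ n) (x0, y0) = (x1, y1) \<longleftrightarrow> x0 = A (x1, y0) \<and> y1 = B (x1, y0))"

definition rep_domain :: "(plane \<Rightarrow> plane) \<Rightarrow> plane set \<Rightarrow> nat \<Rightarrow> plane set" where
  "rep_domain f Y n = {(x1, y0). \<exists>x0 y1. (x0, y0) \<in> Y \<and> (f ^^ n) (x0, y0) = (x1, y1)}"

text \<open>
  The differentials \<open>D log |\<partial>\<^sub>x A|\<close> and \<open>D log |\<partial>\<^sub>y B|\<close> are given by their gradients, whose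
  Euclidean norms are the norms of the differentials.
\<close>

definition log_distortion ::
  "(plane \<Rightarrow> plane \<Rightarrow> real) \<Rightarrow> (plane \<Rightarrow> plane \<Rightarrow> real) \<Rightarrow> plane \<Rightarrow> plane \<Rightarrow> plane \<times> plane" where
  "log_distortion A B p z =
     (let lA = (\<lambda>z. ln \<bar>ddir (1, 0) (A p) z\<bar>); lB = (\<lambda>z. ln \<bar>ddir (0, 1) (B p) z\<bar>)
      in ((ddir (1, 0) lA z, ddir (0, 1) lA z), (ddir (1, 0) lB z, ddir (0, 1) lB z)))"

definition distortion ::
  "nat \<Rightarrow> nat \<Rightarrow> (plane \<times> plane) set \<Rightarrow> (plane \<Rightarrow> plane \<Rightarrow> real) \<Rightarrow> (plane \<Rightarrow> plane \<Rightarrow> real) \<Rightarrow> ennreal" where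
  "distortion d r \<Omega> A B = Cdr_norm (min d (r - 2)) (r - 2) \<Omega> (log_distortion A B)"


section \<open>Henon-like families\<close>

text \<open>
  \<open>\<Omega>\<close> is an open set of pairs (parameter, point). The family has class \<open>C\<^sup>d\<^sup>,\<^sup>r\<close>, and the norms of
  \<open>Z\<close> and \<open>\<Xi>\<close> are taken in \<open>C\<^sup>d\<^sup>,\<^sup>s\<close>; \<open>s = r\<close> is the usual notion.
\<close>

definition henon_like ::
  "nat \<Rightarrow> nat \<Rightarrow> nat \<Rightarrow> ennreal \<Rightarrow> nat \<Rightarrow> (plane \<times> plane) set \<Rightarrow> (plane \<Rightarrow> plane \<Rightarrow> plane) \<Rightarrow> bool" where
  "henon_like d r s \<delta> M \<Omega> F \<longleftrightarrow>
     (\<exists>W. \<exists>Z \<Xi> :: plane \<Rightarrow> plane \<Rightarrow> real.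
        open W \<and> Cdr_on d r W Z \<and> Cdr_on d r W \<Xi> \<and> Cdr_norm d s W Z \<le> \<delta> \<and> Cdr_norm d s W \<Xi> \<le> \<delta> \<and>
        (\<forall>((a, b), (X, Y))\<in>\<Omega>.
           ((a, b), (X, b ^ M * Y)) \<in> W \<and>
           F (a, b) (X, Y) =
             (X ^ 2 + a - b ^ M * Y + Z (a, b) (X, b ^ M * Y), X + \<Xi> (a, b) (X, b ^ M * Y))))"

text \<open>
  The restriction of a family to a set \<open>D\<close> that need not be open: the derivatives on \<open>D\<close> are those of
  the family on an open neighbourhood.
\<close>

definition henon_like_restricted ::
  "nat \<Rightarrow> nat \<Rightarrow> nat \<Rightarrow> ennreal \<Rightarrow> nat \<Rightarrow> (plane \<times> plane) set \<Rightarrow> (plane \<Rightarrow> plane \<Rightarrow> plane) \<Rightarrow> bool" where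
  "henon_like_restricted d r s \<delta> M D F \<longleftrightarrow> (\<exists>\<Omega>. open \<Omega> \<and> D \<subseteq> \<Omega> \<and> henon_like d r s \<delta> M \<Omega> F)"


section \<open>Unfoldings of a homoclinic tangency\<close>

text \<open>
  \<open>nbhd\<close> is the neighbourhood of \<open>{p(b)}\<close>, and \<open>rad p\<close> the size at the parameter \<open>p\<close> of the
  neighbourhoods of \<open>0\<close> and of \<open>z\<^sub>1(p)\<close>, on which the local expressions of the maps are valid.
\<close>

record tangency_data =
  hslope :: real
  vslope :: real
  surf :: "plane set"
  ivalI :: "real set"
  ivalJ :: "real set"
  fam :: "plane \<Rightarrow> plane \<Rightarrow> plane"
  pbox :: "plane \<Rightarrow> plane set"
  ptime :: nat
  repA :: "plane \<Rightarrow> plane \<Rightarrow> real"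
  repB :: "plane \<Rightarrow> plane \<Rightarrow> real"
  curve :: "real \<Rightarrow> real"
  nbhd :: "plane set"
  rad :: "plane \<Rightarrow> real"
  gmap :: "plane \<Rightarrow> plane \<Rightarrow> real"
  mu :: "plane \<Rightarrow> real"
  remainder :: "plane \<Rightarrow> plane \<Rightarrow> real"
  multM :: nat

definition Vfun :: "tangency_data \<Rightarrow> plane \<Rightarrow> real \<Rightarrow> real" where
  "Vfun T p y = repA T p (0, y)"

definition Hfun :: "tangency_data \<Rightarrow> plane \<Rightarrow> real \<Rightarrow> real" where
  "Hfun T p x = repB T p (x, 0)"

definition z0 :: "tangency_data \<Rightarrow> plane \<Rightarrow> plane" where
  "z0 T p = (repA T p (0, 0), 0)"

definition z1 :: "tangency_data \<Rightarrow> plane \<Rightarrow> plane" where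
  "z1 T p = (0, repB T p (0, 0))"

definition sigmap :: "tangency_data \<Rightarrow> plane \<Rightarrow> real" where
  "sigmap T p = ddir (1, 0) (repA T p) (0, 0)"

definition lambdap :: "tangency_data \<Rightarrow> plane \<Rightarrow> real" where
  "lambdap T p = ddir (0, 1) (repB T p) (0, 0)"

definition fold_jac :: "tangency_data \<Rightarrow> plane \<Rightarrow> real" where
  "fold_jac T p = jac (fam T p) (z1 T p)"

definition ret_jac :: "tangency_data \<Rightarrow> plane \<Rightarrow> real" where
  "ret_jac T p = jac (fam T p ^^ (ptime T + 1)) (z0 T p)"

definition abar :: "tangency_data \<Rightarrow> plane \<Rightarrow> real" where
  "abar T p = mu T p / (sigmap T p) ^ 2"

definition bbar :: "tangency_data \<Rightarrow> plane \<Rightarrow> real" where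
  "bbar T p = root (multM T) (ret_jac T p)"

definition pbar :: "tangency_data \<Rightarrow> plane \<Rightarrow> plane" where
  "pbar T p = (abar T p, bbar T p)"

definition pcurve :: "tangency_data \<Rightarrow> real \<Rightarrow> plane" where
  "pcurve T b = (curve T b, b)"

definition small_box :: "tangency_data \<Rightarrow> plane \<Rightarrow> plane set" where
  "small_box T p = {(x, y). \<bar>x\<bar> < rad T p \<and> \<bar>y\<bar> < rad T p}"

definition tube :: "tangency_data \<Rightarrow> plane \<Rightarrow> plane set" where
  "tube T p = {(x, Hfun T p x + y) |x y. (x, y) \<in> small_box T p}"

text \<open>The second variable of the remainder is \<open>w = d\<^sub>p y\<close>, where \<open>|y| < rad p\<close>.\<close>

definition rem_domain :: "tangency_data \<Rightarrow> plane set \<Rightarrow> (plane \<times> plane) set" where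
  "rem_domain T P = {(p, (x, w)). p \<in> P \<and> \<bar>x\<bar> < rad T p \<and> \<bar>w\<bar> < \<bar>fold_jac T p\<bar> * rad T p}"

definition piece_setting :: "nat \<Rightarrow> nat \<Rightarrow> tangency_data \<Rightarrow> bool" where
  "piece_setting d r T \<longleftrightarrow>
     0 < hslope T \<and> 0 < vslope T \<and> hslope T * vslope T < 1 \<and>
     open (surf T) \<and> open (ivalI T) \<and> is_interval (ivalI T) \<and> open (ivalJ T) \<and> is_interval (ivalJ T) \<and>
     Cdr_on d r ((ivalI T \<times> ivalJ T) \<times> surf T) (fam T) \<and>
     (\<forall>p\<in>ivalI T \<times> ivalJ T. Ck_diffeo_on r (surf T) (fam T p) \<and> fam T p ` surf T = surf T) \<and>
     persistent_piece r (hslope T) (vslope T) (ivalI T \<times> ivalJ T) (surf T) (fam T) (pbox T) (ptime T) \<and>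
     (\<forall>p\<in>ivalI T \<times> ivalJ T.
        affine_like_rep (fam T p) (pbox T p) (ptime T) (repA T p) (repB T p) \<and>
        (0, 0) \<in> rep_domain (fam T p) (pbox T p) (ptime T))"

definition curve_setting :: "nat \<Rightarrow> tangency_data \<Rightarrow> bool" where
  "curve_setting d T \<longleftrightarrow>
     Ck_on d (ivalJ T) (curve T) \<and> curve T ` ivalJ T \<subseteq> ivalI T \<and>
     open (nbhd T) \<and> pcurve T ` ivalJ T \<subseteq> nbhd T \<and> nbhd T \<subseteq> ivalI T \<times> ivalJ T \<and>
     continuous_on (nbhd T) (rad T) \<and>
     (\<forall>p\<in>nbhd T. 0 < rad T p \<and> small_box T p \<subseteq> rep_domain (fam T p) (pbox T p) (ptime T))"

definition local_form :: "tangency_data \<Rightarrow> bool" where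
  "local_form T \<longleftrightarrow>
     (\<forall>p\<in>nbhd T. tube T p \<subseteq> surf T \<and>
        (\<forall>(x, y)\<in>tube T p. fam T p (x, y) = (gmap T p (x, y), x)))"

definition tangency_condition :: "nat \<Rightarrow> nat \<Rightarrow> tangency_data \<Rightarrow> bool" where
  "tangency_condition d r T \<longleftrightarrow>
     (\<forall>b\<in>ivalJ T. let p = pcurve T b in
        fam T p (z1 T p) = (Vfun T p 0, 0) \<and>
        (\<exists>k. k \<noteq> 0 \<and>
          vector_derivative (\<lambda>x. fam T p (x, Hfun T p x)) (at 0) =
            k *\<^sub>R vector_derivative (\<lambda>y. (Vfun T p y, y)) (at 0))) \<and>
     (\<forall>p\<in>nbhd T.
        ((\<lambda>x. norm (fam T p (x, Hfun T p x) - (Vfun T p x, x))) has_real_derivative 0) (at 0)) \<and>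
     (\<forall>p\<in>nbhd T. \<forall>(x, y)\<in>small_box T p.
        gmap T p (x, y + Hfun T p x) - Vfun T p x =
          mu T p + x ^ 2 - fold_jac T p * y + remainder T p (x, fold_jac T p * y)) \<and>
     Ck_on d (nbhd T) (mu T) \<and> (\<forall>b\<in>ivalJ T. mu T (pcurve T b) = 0) \<and>
     Cdr_on d r (rem_domain T (nbhd T)) (remainder T) \<and>
     (\<forall>p\<in>nbhd T.
        remainder T p (0, 0) = 0 \<and>
        ddir (0, 1) (remainder T p) (0, 0) = 0 \<and>
        ddir (1, 0) (remainder T p) (0, 0) = 0 \<and>
        ddir (1, 0) (ddir (1, 0) (remainder T p)) (0, 0) = 0)"

text \<open>
  Differentiability in \<open>p\<close> is stated because it does not follow from the other hypotheses when
  \<open>d = 0\<close>. A real even root exists only for a positive determinant.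
\<close>

definition unfolding_condition :: "tangency_data \<Rightarrow> bool" where
  "unfolding_condition T \<longleftrightarrow>
     1 \<le> multM T \<and> (even (multM T) \<longrightarrow> (\<forall>p\<in>nbhd T. 0 < ret_jac T p)) \<and>
     (\<forall>b\<in>ivalJ T.
        (\<lambda>p. (mu T p, bbar T p)) differentiable (at (pcurve T b)) \<and>
        jac (\<lambda>p. (mu T p, bbar T p)) (pcurve T b) \<noteq> 0)"

definition tangency_unfolding :: "nat \<Rightarrow> nat \<Rightarrow> tangency_data \<Rightarrow> bool" where
  "tangency_unfolding d r T \<longleftrightarrow>
     piece_setting d r T \<and> curve_setting d T \<and> local_form T \<and> tangency_condition d r T \<and> unfolding_condition T"


section \<open>The renormalization\<close>

definition phi :: "tangency_data \<Rightarrow> plane \<Rightarrow> plane \<Rightarrow> plane" where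
  "phi T p = (\<lambda>(X, Y). (sigmap T p * X, Hfun T p (sigmap T p * X) + sigmap T p * lambdap T p * Y))"

definition renorm_map :: "tangency_data \<Rightarrow> plane \<Rightarrow> plane \<Rightarrow> plane" where
  "renorm_map T p = inv (phi T p) \<circ> (fam T p ^^ (ptime T + 1)) \<circ> phi T p"

text \<open>The parameter \<open>bbar\<close> may be negative when the multiplicity is odd, whence the absolute values.\<close>

definition Delta :: "tangency_data \<Rightarrow> real \<Rightarrow> plane \<Rightarrow> plane set" where
  "Delta T R p = {-R..R} \<times> {-R / \<bar>bbar T p ^ multM T\<bar>..R / \<bar>bbar T p ^ multM T\<bar>}"

definition param_domain :: "nat \<Rightarrow> tangency_data \<Rightarrow> plane set \<Rightarrow> bool" where
  "param_domain d T P \<longleftrightarrow>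
     pcurve T ` ivalJ T \<subseteq> P \<and> P \<subseteq> nbhd T \<and> Ck_diffeo_on d P (pbar T)"

text \<open>The rescaled boxes lie in the neighbourhood where the local expressions are valid.\<close>

definition boxes_in_tube :: "tangency_data \<Rightarrow> real \<Rightarrow> plane set \<Rightarrow> bool" where
  "boxes_in_tube T R P \<longleftrightarrow> (\<forall>p\<in>P. phi T p ` Delta T R p \<subseteq> tube T p)"

definition pbar_inv :: "tangency_data \<Rightarrow> plane set \<Rightarrow> plane \<Rightarrow> plane" where
  "pbar_inv T P = the_inv_into P (pbar T)"

definition renorm_family :: "tangency_data \<Rightarrow> plane set \<Rightarrow> plane \<Rightarrow> plane \<Rightarrow> plane" where
  "renorm_family T P q = renorm_map T (pbar_inv T P q)"

definition renorm_domain :: "tangency_data \<Rightarrow> real \<Rightarrow> plane set \<Rightarrow> (plane \<times> plane) set" where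
  "renorm_domain T R P =
     {(pbar T p, z) |p z. p \<in> P \<and>
        z \<in> Delta T R p \<inter> renorm_map T p -` Delta T R p \<inter> phi T p -` (surf T \<inter> fam T p -` pbox T p)}"

definition piece_distortion :: "nat \<Rightarrow> nat \<Rightarrow> tangency_data \<Rightarrow> plane set \<Rightarrow> ennreal" where
  "piece_distortion d r T P =
     distortion d r (interior {(p, z). p \<in> P \<and> z \<in> rep_domain (fam T p) (pbox T p) (ptime T)})
       (repA T) (repB T)"

definition controlled ::
  "nat \<Rightarrow> nat \<Rightarrow> real \<Rightarrow> real \<Rightarrow> real \<Rightarrow> real \<Rightarrow> tangency_data \<Rightarrow> plane set \<Rightarrow> bool" where
  "controlled d r R Kpar Krem Kdist T P \<longleftrightarrow>
     tangency_unfolding d r T \<and> param_domain d T P \<and> boxes_in_tube T R P \<and>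
     Ck_norm d (pbar T ` P) (pbar_inv T P) \<le> ennreal Kpar \<and>
     Cdr_norm d r (rem_domain T P) (remainder T) \<le> ennreal Krem \<and>
     piece_distortion d r T P \<le> ennreal Kdist"

text \<open>
  The distortion bounds all derivatives of \<open>A(x, y) - A(0, y)\<close> and \<open>B(x, y) - B(x, 0)\<close>, relative to
  \<open>\<sigma>\<close> and \<open>\<lambda>\<close>, except \<open>\<partial>\<^sub>p\<^sup>i \<partial>\<^sub>y\<^sup>r\<^sup>-\<^sup>i\<close> of the former and \<open>\<partial>\<^sub>p\<^sup>i \<partial>\<^sub>x\<^sup>r\<^sup>-\<^sup>i\<close> of the latter. For instance, with
  \<open>B = \<lambda> y\<close> and \<open>A = V + \<sigma> x (1 + \<eta>\<^sup>r\<^sup>-\<^sup>1 sin (y / \<eta>) / 2)\<close>, the distortion is bounded as \<open>\<eta> \<rightarrow> 0\<close>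
  while the renormalized map (with zero remainder) has first coordinate
  \<open>(X\<^sup>2 + a - b\<^sup>M Y) / (1 + \<eta>\<^sup>r\<^sup>-\<^sup>1 sin (\<sigma> X / \<eta>) / 2)\<close>, whose \<open>r\<close>-th derivative in \<open>X\<close> is of
  order \<open>\<sigma>\<^sup>r / \<eta>\<close>. The following norm controls these top derivatives.
\<close>

definition normalized_rep :: "tangency_data \<Rightarrow> plane \<Rightarrow> plane \<Rightarrow> plane" where
  "normalized_rep T p = (\<lambda>(x, y).
     ((repA T p (x, y) - Vfun T p y) / sigmap T p, (repB T p (x, y) - Hfun T p x) / lambdap T p))"

definition rep_norm :: "nat \<Rightarrow> nat \<Rightarrow> tangency_data \<Rightarrow> plane set \<Rightarrow> ennreal" where
  "rep_norm d r T P = Cdr_norm d r {(p, z). p \<in> P \<and> z \<in> small_box T p} (normalized_rep T)"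

end

theory Submission
  imports Defs
begin

text \<open>
  In the coordinates given by \<open>\<phi>\<^sub>p\<close>, the map \<open>f\<^sub>p\<close> near the tangency becomes
  \<open>S = X\<^sup>2 + a - b\<^sup>M Y + \<sigma>\<^sup>-\<^sup>2 r\<^sub>p(\<sigma> X, \<sigma>\<^sup>2 b\<^sup>M Y)\<close>, while the affine-like representation of the piece
  turns into \<open>A(\<sigma> u, \<sigma> X) - A(0, \<sigma> X) = \<sigma>\<^sup>2 S\<close>, where \<open>u\<close> is the first coordinate of the image of
  \<open>(X, Y)\<close>. As \<open>D log |\<partial>\<^sub>x A|\<close> is bounded, the rescaled function \<open>\<sigma>\<^sup>-\<^sup>2 (A(\<sigma> u, \<sigma> X) - A(0, \<sigma> X))\<close> is close
  to \<open>u\<close>, and the rescaled remainder is small since its derivatives of low order vanish at \<open>0\<close>. So \<open>u\<close>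
  is close to \<open>X\<^sup>2 + a - b\<^sup>M Y\<close>; the second coordinate is treated in the same way with \<open>B\<close>. Boundedness of
  the distortion loses one derivative, which a bound on the top derivatives of \<open>A\<close> and \<open>B\<close> recovers.

  Uniformity over all families with the same bounds is expressed by the filter generated by the
  conditions \<open>\<parallel>\<sigma>\<parallel> \<le> \<epsilon>\<close>. For the change of parameters, \<open>\<mu>\<close> vanishes along the curve \<open>p(b)\<close>, so the
  Jacobian condition makes \<open>b\<close>-bar strictly monotone along it; this turns local injectivity near the
  points of the curve into injectivity on a neighbourhood of the whole curve.
\<close>

section \<open>Families with bounded mixed derivatives\<close>

text \<open>The obstacle is regularity that is nowhere assumed. \<open>A\<close> and
  \<open>B\<close> are given pointwise, through the graph of \<open>f^n\<close> over a closed box;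
  their continuity in the parameter comes from compactness of the boxes, their smoothness from the
  cone condition and an inverse function argument. Likewise \<open>Cdr_on\<close> only provides
  parameter derivatives taken after the space derivatives, while chain and product rules mix the
  two; hence the recursive predicate \<open>CB\<close>, closed under both, with Schwarz's theorem as
  the entrance to it. The linear term is exact: the determinant of the return map at
  \<open>z0\<close> is \<open>fold_jac * \<lambda> / \<sigma>\<close>, so
  \<open>fold_jac * y\<close> becomes \<open>\<sigma>^2 * b^M * Y\<close> without error. Space
  derivatives of rescaled functions gain a factor \<sigma>, pure parameter derivatives do not. The
  latter are small because the functions vanish at the origin, or on an axis, for every parameter:
  integration in space trades them for derivatives containing a space direction.\<close>

lemma ddirI: "(h has_derivative h') (at x) \<Longrightarrow> ddir v h x = h' v"
  by (simp add: ddir_def frechet_derivative_at[symmetric])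

lemma has_derivative_ddir: "h differentiable (at x) \<Longrightarrow> (h has_derivative (\<lambda>v. ddir v h x)) (at x)"
  unfolding ddir_def by (simp add: frechet_derivative_works[symmetric])

lemma ddir_cong_open:
  assumes "open S" "x \<in> S" "\<And>y. y \<in> S \<Longrightarrow> f y = g y"
  shows "ddir v f x = ddir v g x" "f differentiable (at x) \<longleftrightarrow> g differentiable (at x)"
proof -
  have "(f has_derivative D) (at x) \<longleftrightarrow> (g has_derivative D) (at x)" for D
    using assms has_derivative_transform_within_open[of f D x UNIV S g]
      has_derivative_transform_within_open[of g D x UNIV S f] by auto
  then show "ddir v f x = ddir v g x" "f differentiable (at x) \<longleftrightarrow> g differentiable (at x)"
    unfolding ddir_def frechet_derivative_def differentiable_def by auto
qed

lemma open_slice_space: "open \<Omega> \<Longrightarrow> open {x. (p, x) \<in> \<Omega>}"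
  using open_vimage[of \<Omega> "\<lambda>x. (p, x)"] by (simp add: vimage_def continuous_intros)

lemma open_slice_par: "open \<Omega> \<Longrightarrow> open {p. (p, x) \<in> \<Omega>}"
  using open_vimage[of \<Omega> "\<lambda>p. (p, x)"] by (simp add: vimage_def continuous_intros)

lemma dspace_cong:
  assumes "open \<Omega>" "(p, x) \<in> \<Omega>" "\<And>p x. (p, x) \<in> \<Omega> \<Longrightarrow> f p x = g p x"
  shows "dspace v f p x = dspace v g p x" "f p differentiable (at x) \<longleftrightarrow> g p differentiable (at x)"
  unfolding dspace_def
  using ddir_cong_open[OF open_slice_space[OF assms(1), of p], of x "f p" "g p"] assms by auto

lemma dpar_cong:
  assumes "open \<Omega>" "(p, x) \<in> \<Omega>" "\<And>p x. (p, x) \<in> \<Omega> \<Longrightarrow> f p x = g p x"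
  shows "dpar u f p x = dpar u g p x"
    "(\<lambda>p. f p x) differentiable (at p) \<longleftrightarrow> (\<lambda>p. g p x) differentiable (at p)"
  unfolding dpar_def
  using ddir_cong_open[OF open_slice_par[OF assms(1), of x], of p "\<lambda>p. f p x" "\<lambda>p. g p x"] assms by auto

lemma dspaceI: "(g p has_derivative D) (at x) \<Longrightarrow> dspace v g p x = D v"
  by (simp add: dspace_def ddirI)

lemma dparI: "((\<lambda>p. g p x) has_derivative D) (at p) \<Longrightarrow> dpar u g p x = D u"
  by (simp add: dpar_def ddirI)

text \<open>
  \<open>CB r d K \<Omega> g\<close>: the set \<open>\<Omega>\<close> is open and \<open>g\<close> is of class \<open>C\<^sup>d\<^sup>,\<^sup>r\<close> on it with norm at most \<open>K\<close>, where
  moreover the differentiations may be taken in any order; \<open>K = top\<close> leaves the class only. In \<open>DB\<close>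
  the bound concerns the derivatives of positive order only.
\<close>

primrec CB ::
  "nat \<Rightarrow> nat \<Rightarrow> ennreal \<Rightarrow> ('p::real_normed_vector \<times> 'a::real_normed_vector) set
    \<Rightarrow> ('p \<Rightarrow> 'a \<Rightarrow> 'b::real_normed_vector) \<Rightarrow> bool" where
  "CB 0 d K \<Omega> g \<longleftrightarrow> open \<Omega> \<and> continuous_on \<Omega> (\<lambda>(p, x). g p x) \<and>
     (\<forall>(p, x)\<in>\<Omega>. ennreal (norm (g p x)) \<le> K)"
| "CB (Suc r) d K \<Omega> g \<longleftrightarrow> open \<Omega> \<and> continuous_on \<Omega> (\<lambda>(p, x). g p x) \<and>
     (\<forall>(p, x)\<in>\<Omega>. ennreal (norm (g p x)) \<le> K) \<and>
     (\<forall>(p, x)\<in>\<Omega>. g p differentiable (at x)) \<and>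
     (\<forall>v. CB r d (ennreal (norm v) * K) \<Omega> (dspace v g)) \<and>
     (0 < d \<longrightarrow> (\<forall>(p, x)\<in>\<Omega>. (\<lambda>p. g p x) differentiable (at p)) \<and>
        (\<forall>u. CB r (d - 1) (ennreal (norm u) * K) \<Omega> (dpar u g)))"

definition DB ::
  "nat \<Rightarrow> nat \<Rightarrow> ennreal \<Rightarrow> ('p::real_normed_vector \<times> 'a::real_normed_vector) set
    \<Rightarrow> ('p \<Rightarrow> 'a \<Rightarrow> 'b::real_normed_vector) \<Rightarrow> bool" where
  "DB r d K \<Omega> g \<longleftrightarrow> open \<Omega> \<and> continuous_on \<Omega> (\<lambda>(p, x). g p x) \<and>
     (\<forall>r'. r = Suc r' \<longrightarrow>
       (\<forall>(p, x)\<in>\<Omega>. g p differentiable (at x)) \<and>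
       (\<forall>v. CB r' d (ennreal (norm v) * K) \<Omega> (dspace v g)) \<and>
       (0 < d \<longrightarrow> (\<forall>(p, x)\<in>\<Omega>. (\<lambda>p. g p x) differentiable (at p)) \<and>
          (\<forall>u. CB r' (d - 1) (ennreal (norm u) * K) \<Omega> (dpar u g))))"

lemma CB_iff_DB: "CB r d K \<Omega> g \<longleftrightarrow> (\<forall>(p, x)\<in>\<Omega>. ennreal (norm (g p x)) \<le> K) \<and> DB r d K \<Omega> g"
  by (cases r) (auto simp: DB_def)

lemma CB_DB: "CB r d K \<Omega> g \<Longrightarrow> DB r d K \<Omega> g"
  and CB_bound: "CB r d K \<Omega> g \<Longrightarrow> (p, x) \<in> \<Omega> \<Longrightarrow> ennreal (norm (g p x)) \<le> K"
  and CB_I: "DB r d K \<Omega> g \<Longrightarrow> (\<And>p x. (p, x) \<in> \<Omega> \<Longrightarrow> ennreal (norm (g p x)) \<le> K) \<Longrightarrow> CB r d K \<Omega> g"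
  by (auto simp: CB_iff_DB)

lemma DB_open: "DB r d K \<Omega> g \<Longrightarrow> open \<Omega>"
  and DB_cont: "DB r d K \<Omega> g \<Longrightarrow> continuous_on \<Omega> (\<lambda>(p, x). g p x)"
  and DB_dspace: "DB (Suc r) d K \<Omega> g \<Longrightarrow> CB r d (ennreal (norm v) * K) \<Omega> (dspace v g)"
  and DB_dpar: "DB (Suc r) d K \<Omega> g \<Longrightarrow> 0 < d \<Longrightarrow> CB r (d - 1) (ennreal (norm u) * K) \<Omega> (dpar u g)"
  and DB_diff_space: "DB (Suc r) d K \<Omega> g \<Longrightarrow> (p, x) \<in> \<Omega> \<Longrightarrow> (g p has_derivative (\<lambda>v. dspace v g p x)) (at x)"
  and DB_diff_par: "DB (Suc r) d K \<Omega> g \<Longrightarrow> 0 < d \<Longrightarrow> (p, x) \<in> \<Omega> \<Longrightarrow>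
      ((\<lambda>p. g p x) has_derivative (\<lambda>u. dpar u g p x)) (at p)"
  by (auto simp: DB_def dspace_def dpar_def intro!: has_derivative_ddir)

lemmas CB_open = DB_open[OF CB_DB]
  and CB_cont = DB_cont[OF CB_DB]
  and CB_dspace = DB_dspace[OF CB_DB]
  and CB_dpar = DB_dpar[OF CB_DB]
  and CB_diff_space = DB_diff_space[OF CB_DB]
  and CB_diff_par = DB_diff_par[OF CB_DB]

declare CB.simps(2) [simp del]

text \<open>Slices of an open set are open, so the total functions \<open>dspace\<close> and
  \<open>dpar\<close> are determined on \<open>\<Omega>\<close> by the values of the family on
  \<open>\<Omega>\<close>.\<close>

lemma CB_cong_imp:
  assumes "\<And>p x. (p, x) \<in> \<Omega> \<Longrightarrow> f p x = g p x" "CB r d K \<Omega> f"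
  shows "CB r d K \<Omega> g"
  using assms
proof (induction r arbitrary: d K f g)
  case 0
  have "continuous_on \<Omega> (\<lambda>(p,x). g p x)"
    using CB_cont[OF 0(2)] by (rule continuous_on_eq) (use 0(1) in auto)
  then show ?case using 0 by auto
next
  case (Suc r)
  note o = CB_open[OF Suc.prems(2)]
  have c: "continuous_on \<Omega> (\<lambda>(p,x). g p x)"
    using CB_cont[OF Suc.prems(2)] by (rule continuous_on_eq) (use Suc.prems(1) in auto)
  have 1: "CB r d (ennreal (norm v) * K) \<Omega> (dspace v g)" for v
    by (rule Suc.IH[OF dspace_cong(1)[OF o _ Suc.prems(1)] CB_dspace[OF Suc.prems(2)]])
  have 2: "CB r (d - 1) (ennreal (norm u) * K) \<Omega> (dpar u g)" if "0 < d" for u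
    by (rule Suc.IH[OF dpar_cong(1)[OF o _ Suc.prems(1)] CB_dpar[OF Suc.prems(2) that]])
  have 3: "g p differentiable (at x)" if "(p, x) \<in> \<Omega>" for p x
    using dspace_cong(2)[OF o that, of f g] Suc.prems(1) differentiableI[OF CB_diff_space[OF Suc.prems(2) that]]
    by auto
  have 4: "(\<lambda>p. g p x) differentiable (at p)" if "(p, x) \<in> \<Omega>" "0 < d" for p x
    using dpar_cong(2)[OF o that(1), of f g] Suc.prems(1) differentiableI[OF CB_diff_par[OF Suc.prems(2) that(2,1)]]
    by auto
  have 5: "ennreal (norm (g p x)) \<le> K" if "(p, x) \<in> \<Omega>" for p x
    using CB_bound[OF Suc.prems(2) that] Suc.prems(1)[OF that] by simp
  show ?case unfolding CB.simps(2) using o c 1 2 3 4 5 by auto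
qed

text \<open>Lets a computation supply candidate derivatives \<open>gx\<close> and \<open>gp\<close>
  that are correct on \<open>\<Omega>\<close> only; outside, \<open>dspace\<close> and
  \<open>dpar\<close> may take arbitrary values.\<close>

lemma DB_SucI:
  assumes "open \<Omega>" "continuous_on \<Omega> (\<lambda>(p, x). g p x)"
    and x: "\<And>p x. (p, x) \<in> \<Omega> \<Longrightarrow> (g p has_derivative (\<lambda>v. gx v p x)) (at x)"
    and gx: "\<And>v. CB r d (ennreal (norm v) * K) \<Omega> (gx v)"
    and p: "\<And>p x. 0 < d \<Longrightarrow> (p, x) \<in> \<Omega> \<Longrightarrow> ((\<lambda>p. g p x) has_derivative (\<lambda>u. gp u p x)) (at p)"
    and gp: "\<And>u. 0 < d \<Longrightarrow> CB r (d - 1) (ennreal (norm u) * K) \<Omega> (gp u)"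
  shows "DB (Suc r) d K \<Omega> g"
proof -
  have "CB r d (ennreal (norm v) * K) \<Omega> (dspace v g)" for v
    using CB_cong_imp[OF _ gx[of v], of "dspace v g"] dspaceI[of g, OF x] by simp
  moreover have "CB r (d - 1) (ennreal (norm u) * K) \<Omega> (dpar u g)" if "0 < d" for u
    using CB_cong_imp[OF _ gp[OF that, of u], of "dpar u g"] dparI[of g, OF p[OF that]] by simp
  moreover have "\<forall>(p, x)\<in>\<Omega>. g p differentiable (at x)"
    using x by (auto simp: differentiable_def)
  moreover have "0 < d \<longrightarrow> (\<forall>(p, x)\<in>\<Omega>. (\<lambda>p. g p x) differentiable (at p))"
    using p by (auto simp: differentiable_def)
  ultimately show ?thesis using assms(1,2) unfolding DB_def by auto
qed

lemma CB_SucI: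
  assumes "open \<Omega>" "continuous_on \<Omega> (\<lambda>(p, x). g p x)"
    and "\<And>p x. (p, x) \<in> \<Omega> \<Longrightarrow> ennreal (norm (g p x)) \<le> K"
    and "\<And>p x. (p, x) \<in> \<Omega> \<Longrightarrow> (g p has_derivative (\<lambda>v. gx v p x)) (at x)"
    and "\<And>v. CB r d (ennreal (norm v) * K) \<Omega> (gx v)"
    and "\<And>p x. 0 < d \<Longrightarrow> (p, x) \<in> \<Omega> \<Longrightarrow> ((\<lambda>p. g p x) has_derivative (\<lambda>u. gp u p x)) (at p)"
    and "\<And>u. 0 < d \<Longrightarrow> CB r (d - 1) (ennreal (norm u) * K) \<Omega> (gp u)"
  shows "CB (Suc r) d K \<Omega> g"
  by (rule CB_I[OF DB_SucI[OF assms(1,2,4-7)] assms(3)])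

text \<open>For changes of constants, orders or domain: differentiability is inherited from the old
  data, and only the bounds on the derivatives remain to be given.\<close>

lemma DB_SucI':
  assumes "DB (Suc r0) d0 K0 \<Omega>0 g" "d \<le> d0" "open \<Omega>" "\<Omega> \<subseteq> \<Omega>0"
    and "\<And>v. CB r d (ennreal (norm v) * K) \<Omega> (dspace v g)"
    and "\<And>u. 0 < d \<Longrightarrow> CB r (d - 1) (ennreal (norm u) * K) \<Omega> (dpar u g)"
  shows "DB (Suc r) d K \<Omega> g"
proof (rule DB_SucI[where gx = "\<lambda>v. dspace v g" and gp = "\<lambda>v. dpar v g"])
  show "continuous_on \<Omega> (\<lambda>(p, x). g p x)"
    using DB_cont[OF assms(1)] assms(4) by (rule continuous_on_subset)
qed (use assms in \<open>auto intro: DB_diff_space DB_diff_par\<close>)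

lemma CB_SucI':
  assumes "DB (Suc r0) d0 K0 \<Omega>0 g" "d \<le> d0" "open \<Omega>" "\<Omega> \<subseteq> \<Omega>0"
    and "\<And>v. CB r d (ennreal (norm v) * K) \<Omega> (dspace v g)"
    and "\<And>u. 0 < d \<Longrightarrow> CB r (d - 1) (ennreal (norm u) * K) \<Omega> (dpar u g)"
    and "\<And>p x. (p, x) \<in> \<Omega> \<Longrightarrow> ennreal (norm (g p x)) \<le> K"
  shows "CB (Suc r) d K \<Omega> g"
  by (rule CB_I[OF DB_SucI'[OF assms(1-6)] assms(7)])

lemma CB_mono_K: "CB r d K \<Omega> g \<Longrightarrow> K \<le> L \<Longrightarrow> CB r d L \<Omega> g"
proof (induction r arbitrary: d K L g)
  case 0 then show ?case by (auto intro: order_trans)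
next
  case (Suc r)
  note m = mult_left_mono[OF Suc.prems(2) zero_le]
  show ?case
    by (rule CB_SucI'[OF CB_DB[OF Suc.prems(1)] order_refl CB_open[OF Suc.prems(1)] order_refl])
      (rule Suc.IH[OF CB_dspace[OF Suc.prems(1)] m] Suc.IH[OF CB_dpar[OF Suc.prems(1)] m]
        order_trans[OF CB_bound[OF Suc.prems(1)] Suc.prems(2)], assumption?)+
qed

lemma DB_mono_K: "DB r d K \<Omega> g \<Longrightarrow> K \<le> L \<Longrightarrow> DB r d L \<Omega> g"
proof (cases r)
  case 0 then show "DB r d K \<Omega> g \<Longrightarrow> K \<le> L \<Longrightarrow> ?thesis" by (auto simp: DB_def)
next
  case (Suc r')
  assume a: "DB r d K \<Omega> g" "K \<le> L"
  note g = a(1)[unfolded Suc] and m = mult_left_mono[OF a(2) zero_le]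
  show ?thesis unfolding Suc
    by (rule DB_SucI'[OF g order_refl DB_open[OF g] order_refl])
      (rule CB_mono_K[OF DB_dspace[OF g] m] CB_mono_K[OF DB_dpar[OF g] m], assumption?)+
qed

lemma CB_top: "CB r d K \<Omega> g \<Longrightarrow> CB r d top \<Omega> g"
  by (erule CB_mono_K) simp

lemma CB_SucD: "CB (Suc r) d K \<Omega> g \<Longrightarrow> CB r d K \<Omega> g"
proof (induction r arbitrary: d K g)
  case 0 then show ?case using CB_open[OF 0] CB_cont[OF 0] CB_bound[OF 0] by auto
next
  case (Suc r)
  show ?case
    by (rule CB_SucI'[OF CB_DB[OF Suc.prems] order_refl CB_open[OF Suc.prems] order_refl])
      (rule Suc.IH[OF CB_dspace[OF Suc.prems]] Suc.IH[OF CB_dpar[OF Suc.prems]] CB_bound[OF Suc.prems], assumption?)+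
qed

lemma CB_mono_r: "CB r d K \<Omega> g \<Longrightarrow> r' \<le> r \<Longrightarrow> CB r' d K \<Omega> g"
proof (induction r)
  case (Suc r) then show ?case using CB_SucD[of r d K \<Omega> g] by (cases "r' = Suc r") auto
qed simp

lemma CB_mono_d: "CB r d K \<Omega> g \<Longrightarrow> d' \<le> d \<Longrightarrow> CB r d' K \<Omega> g"
proof (induction r arbitrary: d d' K g)
  case (Suc r)
  show ?case
  proof (rule CB_SucI'[OF CB_DB[OF Suc.prems(1)] Suc.prems(2) CB_open[OF Suc.prems(1)] order_refl])
    show "CB r (d' - 1) (ennreal (norm u) * K) \<Omega> (dpar u g)" if "0 < d'" for u
      using Suc.prems(2) that by (intro Suc.IH[OF CB_dpar[OF Suc.prems(1)]]) auto
  qed (rule Suc.IH[OF CB_dspace[OF Suc.prems(1)] Suc.prems(2)] CB_bound[OF Suc.prems(1)], assumption?)+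
qed simp

lemma CB_mono:
  assumes "CB r d K \<Omega> g" "r' \<le> r" "d' \<le> d" "K \<le> L" shows "CB r' d' L \<Omega> g"
  using CB_mono_K[OF CB_mono_d[OF CB_mono_r[OF assms(1,2)] assms(3)] assms(4)] .

lemma DB_mono_rd:
  assumes "DB r d K \<Omega> g" "r' \<le> r" "d' \<le> d" shows "DB r' d' K \<Omega> g"
proof (cases r')
  case 0 then show ?thesis using assms(1) by (auto simp: DB_def)
next
  case (Suc s)
  then obtain r0 where r: "r = Suc r0" "s \<le> r0" using assms(2) by (cases r) auto
  note g = assms(1)[unfolded r]
  show ?thesis unfolding Suc
  proof (rule DB_SucI'[OF g assms(3) DB_open[OF g] order_refl])
    show "CB s d' (ennreal (norm u) * K) \<Omega> (dspace u g)" for u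
      using CB_mono[OF DB_dspace[OF g] r(2) assms(3) order_refl] .
    show "CB s (d' - 1) (ennreal (norm u) * K) \<Omega> (dpar u g)" if "0 < d'" for u
      using CB_mono[OF DB_dpar[OF g] r(2) _ order_refl, of "d' - 1" u] that assms(3) by auto
  qed
qed

lemma CB_subset: "CB r d K \<Omega> g \<Longrightarrow> open \<Omega>' \<Longrightarrow> \<Omega>' \<subseteq> \<Omega> \<Longrightarrow> CB r d K \<Omega>' g"
proof (induction r arbitrary: d K g)
  case 0 then show ?case by (auto intro: continuous_on_subset)
next
  case (Suc r)
  show ?case
    by (rule CB_SucI'[OF CB_DB[OF Suc.prems(1)] order_refl Suc.prems(2,3)])
      (rule Suc.IH[OF CB_dspace[OF Suc.prems(1)] Suc.prems(2,3)] Suc.IH[OF CB_dpar[OF Suc.prems(1)] Suc.prems(2,3)]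
        CB_bound[OF Suc.prems(1) subsetD[OF Suc.prems(3)]], assumption?)+
qed

lemma DB_subset: "DB r d K \<Omega> g \<Longrightarrow> open \<Omega>' \<Longrightarrow> \<Omega>' \<subseteq> \<Omega> \<Longrightarrow> DB r d K \<Omega>' g"
proof (cases r)
  case 0 then show "DB r d K \<Omega> g \<Longrightarrow> open \<Omega>' \<Longrightarrow> \<Omega>' \<subseteq> \<Omega> \<Longrightarrow> ?thesis"
    by (auto simp: DB_def intro: continuous_on_subset)
next
  case (Suc r')
  assume a: "DB r d K \<Omega> g" "open \<Omega>'" "\<Omega>' \<subseteq> \<Omega>"
  show ?thesis unfolding Suc
    by (rule DB_SucI'[OF a(1)[unfolded Suc] order_refl a(2,3)])
      (rule CB_subset[OF DB_dspace[OF a(1)[unfolded Suc]] a(2,3)]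
        CB_subset[OF DB_dpar[OF a(1)[unfolded Suc]] a(2,3)], assumption?)+
qed

section \<open>Algebra of bounded families: constants, linear maps, sums, products\<close>

lemma CB_const_zero: "open \<Omega> \<Longrightarrow> CB r d K \<Omega> (\<lambda>p x. 0)"
proof (induction r arbitrary: d K)
  case (Suc r)
  show ?case by (rule CB_SucI[where gx = "\<lambda>v p x. 0" and gp = "\<lambda>v p x. 0"]) (use Suc in auto)
qed (auto simp: case_prod_beta)

lemma CB_const: "open \<Omega> \<Longrightarrow> ennreal (norm c) \<le> K \<Longrightarrow> CB r d K \<Omega> (\<lambda>p x. c)"
  by (cases r) (auto intro!: CB_SucI[where gx = "\<lambda>v p x. 0" and gp = "\<lambda>v p x. 0"] CB_const_zero
      simp: case_prod_beta)

text \<open>A linear map need not be bounded on \<open>\<Omega>\<close>, whence \<open>DB\<close>: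
  its first derivative is constant and all later ones vanish.\<close>

lemma DB_linear:
  fixes L :: "'a::real_normed_vector \<Rightarrow> 'b::real_normed_vector"
  assumes "bounded_linear L" "\<And>v. norm (L v) \<le> norm v" "open \<Omega>"
  shows "DB r d 1 \<Omega> (\<lambda>(p::'p::real_normed_vector) x. L x)"
proof (cases r)
  case 0 then show ?thesis using assms
    by (auto simp: DB_def case_prod_beta intro!: bounded_linear.continuous_on[OF assms(1)] continuous_intros)
next
  case (Suc r')
  show ?thesis unfolding Suc
    by (rule DB_SucI[where gx = "\<lambda>v p x. L v" and gp = "\<lambda>u p x. 0"])
      (use assms in \<open>auto simp: case_prod_beta intro!: CB_const CB_const_zero ennreal_leI
        bounded_linear.continuous_on[OF assms(1)] continuous_intros bounded_linear.has_derivative[OF assms(1)]\<close>)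
qed

lemma DB_linear_par:
  fixes L :: "'p::real_normed_vector \<Rightarrow> 'b::real_normed_vector"
  assumes "bounded_linear L" "\<And>v. norm (L v) \<le> norm v" "open \<Omega>"
  shows "DB r d 1 \<Omega> (\<lambda>p (x::'a::real_normed_vector). L p)"
proof (cases r)
  case 0 then show ?thesis using assms
    by (auto simp: DB_def case_prod_beta intro!: bounded_linear.continuous_on[OF assms(1)] continuous_intros)
next
  case (Suc r')
  show ?thesis unfolding Suc
    by (rule DB_SucI[where gx = "\<lambda>v p x. 0" and gp = "\<lambda>u p x. L u"])
      (use assms in \<open>auto simp: case_prod_beta intro!: CB_const CB_const_zero ennreal_leI
        bounded_linear.continuous_on[OF assms(1)] continuous_intros bounded_linear.has_derivative[OF assms(1)]\<close>)
qed

lemma CB_add: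
  assumes "CB r d K \<Omega> f" "CB r d L \<Omega> g"
  shows "CB r d (K + L) \<Omega> (\<lambda>p x. f p x + g p x)"
  using assms
proof (induction r arbitrary: d K L f g)
  case 0
  have "ennreal (norm (f p x + g p x)) \<le> K + L" if "(p, x) \<in> \<Omega>" for p x
  proof -
    have "ennreal (norm (f p x + g p x)) \<le> ennreal (norm (f p x)) + ennreal (norm (g p x))"
      by (simp add: ennreal_leI norm_triangle_ineq flip: ennreal_plus)
    also have "\<dots> \<le> K + L" using 0 that by (intro add_mono) auto
    finally show ?thesis .
  qed
  moreover have "continuous_on \<Omega> (\<lambda>(p, x). f p x + g p x)"
    using 0 by (auto simp: case_prod_beta intro!: continuous_intros)
  ultimately show ?case using 0 by auto
next
  case (Suc r)
  show ?case
  proof (rule CB_SucI[where gx = "\<lambda>v p x. dspace v f p x + dspace v g p x" and gp = "\<lambda>v p x. dpar v f p x + dpar v g p x"])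
    show "continuous_on \<Omega> (\<lambda>(p, x). f p x + g p x)"
      using CB_cont[OF Suc.prems(1)] CB_cont[OF Suc.prems(2)] by (auto simp: case_prod_beta intro!: continuous_intros)
    show "ennreal (norm (f p x + g p x)) \<le> K + L" if "(p, x) \<in> \<Omega>" for p x
    proof -
      have "ennreal (norm (f p x + g p x)) \<le> ennreal (norm (f p x)) + ennreal (norm (g p x))"
        by (simp add: ennreal_leI norm_triangle_ineq flip: ennreal_plus)
      also have "\<dots> \<le> K + L"
        by (intro add_mono CB_bound[OF Suc.prems(1) that] CB_bound[OF Suc.prems(2) that])
      finally show ?thesis .
    qed
    show "CB r d (ennreal (norm v) * (K + L)) \<Omega> (\<lambda>p x. dspace v f p x + dspace v g p x)" for v
      unfolding distrib_left by (rule Suc.IH[OF CB_dspace[OF Suc.prems(1)] CB_dspace[OF Suc.prems(2)]])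
    show "CB r (d - 1) (ennreal (norm v) * (K + L)) \<Omega> (\<lambda>p x. dpar v f p x + dpar v g p x)" if "0 < d" for v
      unfolding distrib_left by (rule Suc.IH[OF CB_dpar[OF Suc.prems(1) that] CB_dpar[OF Suc.prems(2) that]])
  qed (use Suc.prems in \<open>auto intro!: CB_diff_space CB_diff_par has_derivative_add simp: CB_open\<close>)
qed

lemma CB_sum:
  assumes "finite A" "open \<Omega>" "\<And>b. b \<in> A \<Longrightarrow> CB r d (K b) \<Omega> (f b)"
  shows "CB r d (sum K A) \<Omega> (\<lambda>p x. \<Sum>b\<in>A. f b p x)"
  using assms(1,3)
proof (induction rule: finite_induct)
  case empty then show ?case using CB_const_zero[OF assms(2)] by simp
next
  case (insert b A)
  then show ?case using CB_add[of r d "K b" \<Omega> "f b" "sum K A"] by simp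
qed

lemma CB_linear:
  assumes "CB r d K \<Omega> g" "bounded_linear L" "\<And>v. norm (L v) \<le> c * norm v" "0 \<le> c"
  shows "CB r d (ennreal c * K) \<Omega> (\<lambda>p x. L (g p x))"
  using assms(1)
proof (induction r arbitrary: d K g)
  have b: "ennreal (norm (L w)) \<le> ennreal c * K" if "ennreal (norm w) \<le> K" for w K
  proof -
    have "ennreal (norm (L w)) \<le> ennreal c * ennreal (norm w)"
      using assms(3,4) by (simp add: ennreal_leI flip: ennreal_mult)
    also have "\<dots> \<le> ennreal c * K" using that by (intro mult_left_mono) auto
    finally show ?thesis .
  qed
  note co = bounded_linear.continuous_on[OF assms(2)]
  { case 0 then show ?case using b by (auto simp: case_prod_beta intro!: co) }
  { case (Suc r)
    show ?case
    proof (rule CB_SucI[where gx = "\<lambda>v p x. L (dspace v g p x)" and gp = "\<lambda>v p x. L (dpar v g p x)"])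
      show "continuous_on \<Omega> (\<lambda>(p, x). L (g p x))"
        using CB_cont[OF Suc.prems] by (auto simp: case_prod_beta intro!: co)
        show "CB r d (ennreal (norm v) * (ennreal c * K)) \<Omega> (\<lambda>p x. L (dspace v g p x))" for v
        using Suc.IH[OF CB_dspace[OF Suc.prems]] by (simp add: mult.left_commute[of _ "ennreal c"])
      show "CB r (d - 1) (ennreal (norm v) * (ennreal c * K)) \<Omega> (\<lambda>p x. L (dpar v g p x))" if "0 < d" for v
        using Suc.IH[OF CB_dpar[OF Suc.prems that]] by (simp add: mult.left_commute[of _ "ennreal c"])
    qed (use Suc.prems b in \<open>auto intro!: CB_diff_space CB_diff_par bounded_linear.has_derivative[OF assms(2)] 
      simp: CB_open CB_bound\<close>) }
qed

lemma DB_add: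
  assumes "DB r d K \<Omega> f" "DB r d L \<Omega> g"
  shows "DB r d (K + L) \<Omega> (\<lambda>p x. f p x + g p x)"
proof (cases r)
  case 0 then show ?thesis using assms by (auto simp: DB_def case_prod_beta intro!: continuous_intros)
next
  case (Suc r')
  note a = assms[unfolded Suc]
  show ?thesis unfolding Suc
  proof (rule DB_SucI[where gx = "\<lambda>v p x. dspace v f p x + dspace v g p x" and gp = "\<lambda>v p x. dpar v f p x + dpar v g p x"])
    show "continuous_on \<Omega> (\<lambda>(p, x). f p x + g p x)"
      using DB_cont[OF assms(1)] DB_cont[OF assms(2)] by (auto simp: case_prod_beta intro!: continuous_intros)
    show "CB r' d (ennreal (norm v) * (K + L)) \<Omega> (\<lambda>p x. dspace v f p x + dspace v g p x)" for v
      unfolding distrib_left by (rule CB_add[OF DB_dspace[OF a(1)] DB_dspace[OF a(2)]])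
    show "CB r' (d - 1) (ennreal (norm v) * (K + L)) \<Omega> (\<lambda>p x. dpar v f p x + dpar v g p x)" if "0 < d" for v
      unfolding distrib_left by (rule CB_add[OF DB_dpar[OF a(1) that] DB_dpar[OF a(2) that]])
  qed (use a in \<open>auto intro!: DB_diff_space DB_diff_par has_derivative_add simp: DB_open\<close>)
qed

lemma DB_linear_comp:
  assumes "DB r d K \<Omega> g" "bounded_linear L" "\<And>v. norm (L v) \<le> c * norm v" "0 \<le> c"
  shows "DB r d (ennreal c * K) \<Omega> (\<lambda>p x. L (g p x))"
proof (cases r)
  note co = bounded_linear.continuous_on[OF assms(2)]
  case 0 then show ?thesis using assms by (auto simp: DB_def case_prod_beta intro!: co)
next
  case (Suc r')
  note co = bounded_linear.continuous_on[OF assms(2)]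
  note a = assms(1)[unfolded Suc]
  show ?thesis unfolding Suc
  proof (rule DB_SucI[where gx = "\<lambda>v p x. L (dspace v g p x)" and gp = "\<lambda>v p x. L (dpar v g p x)"])
    show "continuous_on \<Omega> (\<lambda>(p, x). L (g p x))"
      using DB_cont[OF assms(1)] by (auto simp: case_prod_beta intro!: co)
    show "CB r' d (ennreal (norm v) * (ennreal c * K)) \<Omega> (\<lambda>p x. L (dspace v g p x))" for v
      using CB_linear[OF DB_dspace[OF a] assms(2-4)] by (simp add: mult.left_commute[of _ "ennreal c"])
    show "CB r' (d - 1) (ennreal (norm v) * (ennreal c * K)) \<Omega> (\<lambda>p x. L (dpar v g p x))" if "0 < d" for v
      using CB_linear[OF DB_dpar[OF a that] assms(2-4)] by (simp add: mult.left_commute[of _ "ennreal c"])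
  qed (use a in \<open>auto intro!: DB_diff_space DB_diff_par bounded_linear.has_derivative[OF assms(2)] simp: DB_open\<close>)
qed

text \<open>Every differentiation doubles the number of Leibniz terms, whence the factor
  \<open>2 ^ r\<close>.\<close>

lemma CB_scaleR:
  assumes "CB r d K \<Omega> f" "CB r d L \<Omega> g"
  shows "CB r d (2 ^ r * (K * L)) \<Omega> (\<lambda>p x. f p x *\<^sub>R g p x)"
  using assms
proof (induction r arbitrary: d K L f g)
  have b: "ennreal (norm (c *\<^sub>R w)) \<le> K * L" if "ennreal (norm c) \<le> K" "ennreal (norm w) \<le> L" for c w K L
    using mult_mono[OF that] by (simp add: ennreal_mult)
  { case 0
    have "continuous_on \<Omega> (\<lambda>(p, x). f p x *\<^sub>R g p x)"
      using 0 by (auto simp: case_prod_beta intro!: continuous_intros)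
    then show ?case using 0 b[OF CB_bound[OF 0(1)] CB_bound[OF 0(2)]] by auto }
  { case (Suc r)
    note f = Suc.prems(1) and g = Suc.prems(2)
    have e: "2 ^ r * (n * K * L) + 2 ^ r * (K * (n * L)) = n * (2 ^ Suc r * (K * L))" for n :: ennreal
      by (simp add: mult_2 distrib_left distrib_right mult_ac)
    show ?case
    proof (rule CB_SucI[where gx = "\<lambda>v p x. dspace v f p x *\<^sub>R g p x + f p x *\<^sub>R dspace v g p x"
            and gp = "\<lambda>v p x. dpar v f p x *\<^sub>R g p x + f p x *\<^sub>R dpar v g p x"])
      show "continuous_on \<Omega> (\<lambda>(p, x). f p x *\<^sub>R g p x)"
        using CB_cont[OF f] CB_cont[OF g] by (auto simp: case_prod_beta intro!: continuous_intros)
      show "CB r d (ennreal (norm v) * (2 ^ Suc r * (K * L))) \<Omega> (\<lambda>p x. dspace v f p x *\<^sub>R g p x + f p x *\<^sub>R dspace v g p x)" for v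
        unfolding e[symmetric]
        by (rule CB_add[OF Suc.IH[OF CB_dspace[OF f] CB_SucD[OF g]] Suc.IH[OF CB_SucD[OF f] CB_dspace[OF g]]])
      show "CB r (d - 1) (ennreal (norm v) * (2 ^ Suc r * (K * L))) \<Omega> (\<lambda>p x. dpar v f p x *\<^sub>R g p x + f p x *\<^sub>R dpar v g p x)"
        if "0 < d" for v
        unfolding e[symmetric]
        by (rule CB_add[OF Suc.IH[OF CB_dpar[OF f that] CB_mono_d[OF CB_SucD[OF g]]]
              Suc.IH[OF CB_mono_d[OF CB_SucD[OF f]] CB_dpar[OF g that]]]) auto
      show "ennreal (norm (f p x *\<^sub>R g p x)) \<le> 2 ^ Suc r * (K * L)" if "(p, x) \<in> \<Omega>" for p x
      proof -
        have "ennreal (norm (f p x *\<^sub>R g p x)) \<le> 1 * (K * L)"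
          using b[OF CB_bound[OF f that] CB_bound[OF g that]] by simp
        also have "\<dots> \<le> 2 ^ Suc r * (K * L)"
          by (intro mult_right_mono one_le_power) auto
        finally show ?thesis .
      qed
      show "((\<lambda>x. f p x *\<^sub>R g p x) has_derivative (\<lambda>v. dspace v f p x *\<^sub>R g p x + f p x *\<^sub>R dspace v g p x)) (at x)"
        if "(p, x) \<in> \<Omega>" for p x
        using has_derivative_scaleR[OF CB_diff_space[OF f that] CB_diff_space[OF g that]]
        by (simp add: add.commute)
      show "((\<lambda>p. f p x *\<^sub>R g p x) has_derivative (\<lambda>v. dpar v f p x *\<^sub>R g p x + f p x *\<^sub>R dpar v g p x)) (at p)"
        if "0 < d" "(p, x) \<in> \<Omega>" for p x
        using has_derivative_scaleR[OF CB_diff_par[OF f that] CB_diff_par[OF g that]]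
        by (simp add: add.commute)
    qed (rule CB_open[OF f]) }
qed

lemma CB_mult:
  fixes f g :: "'p::real_normed_vector \<Rightarrow> 'a::real_normed_vector \<Rightarrow> real"
  assumes "CB r d K \<Omega> f" "CB r d L \<Omega> g"
  shows "CB r d (2 ^ r * (K * L)) \<Omega> (\<lambda>p x. f p x * g p x)"
  using CB_scaleR[OF assms] by simp

section \<open>Symmetry of second derivatives and joint differentiability\<close>

lemma has_derivative_expand:
  fixes D :: "'a::euclidean_space \<Rightarrow> 'b::real_normed_vector"
  assumes "(f has_derivative D) F"
  shows "D v = (\<Sum>b\<in>Basis. (v \<bullet> b) *\<^sub>R D b)"
proof -
  have l: "linear D" using assms by (rule has_derivative_linear)
  have "D v = D (\<Sum>b\<in>Basis. (v \<bullet> b) *\<^sub>R b)" by (simp add: euclidean_representation)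
  also have "\<dots> = (\<Sum>b\<in>Basis. (v \<bullet> b) *\<^sub>R D b)" by (simp add: linear_sum[OF l] linear_scale[OF l])
  finally show ?thesis .
qed

lemma open_prod_ballE:
  assumes "open \<Omega>" "(p, x) \<in> \<Omega>"
  obtains e where "0 < e" "ball p e \<times> ball x e \<subseteq> \<Omega>"
proof -
  obtain e where e: "0 < e" "ball (p, x) e \<subseteq> \<Omega>" using assms by (meson open_contains_ball)
  have "ball p (e/2) \<times> ball x (e/2) \<subseteq> ball (p, x) e"
  proof
    fix z assume "z \<in> ball p (e/2) \<times> ball x (e/2)"
    then have "dist p (fst z) < e/2" "dist x (snd z) < e/2" by auto
    then have "dist (p, x) z < e"
      using sqrt_sum_squares_le_sum[of "dist p (fst z)" "dist x (snd z)"]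
      by (cases z) (auto simp: dist_Pair_Pair)
    then show "z \<in> ball (p, x) e" by simp
  qed
  then show thesis using that[of "e/2"] e by auto
qed

lemma has_derivative_line:
  assumes "(f has_derivative D) (at (p + s *\<^sub>R u))"
  shows "((\<lambda>s. f (p + s *\<^sub>R u)) has_derivative (\<lambda>h. D (h *\<^sub>R u))) (at s within S)"
proof -
  have "((\<lambda>s. p + s *\<^sub>R u) has_derivative (\<lambda>h. h *\<^sub>R u)) (at s within S)"
    using has_derivative_add[OF has_derivative_const has_derivative_scaleR_left[OF has_derivative_ident]] by simp
  then show ?thesis
    by (rule has_derivative_compose[where g = f and g' = D and f = "\<lambda>s. p + s *\<^sub>R u" and f' = "\<lambda>h. h *\<^sub>R u", OF _ assms])
qed

text \<open>Schwarz's theorem; only the mixed derivative taken in one order is assumed to exist.\<close>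

lemma has_derivative_dpar:
  fixes g :: "'p::real_normed_vector \<Rightarrow> 'a::euclidean_space \<Rightarrow> 'b::real_normed_vector"
  assumes "open \<Omega>" "(p0, x0) \<in> \<Omega>"
    and gx: "\<And>p x. (p, x) \<in> \<Omega> \<Longrightarrow> g p differentiable (at x)"
    and gp: "\<And>p x. (p, x) \<in> \<Omega> \<Longrightarrow> (\<lambda>p. g p x) differentiable (at p)"
    and gxp: "\<And>p x v. (p, x) \<in> \<Omega> \<Longrightarrow> (\<lambda>p. dspace v g p x) differentiable (at p)"
    and cont: "\<And>v. continuous_on \<Omega> (\<lambda>(p, x). dpar u (dspace v g) p x)"
  shows "((\<lambda>x. dpar u g p0 x) has_derivative (\<lambda>v. dpar u (dspace v g) p0 x0)) (at x0)"
proof -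
  define D where "D v p x = dpar u (dspace v g) p x" for v p x
  have gx': "(g p has_derivative (\<lambda>v. dspace v g p x)) (at x)" if "(p, x) \<in> \<Omega>" for p x
    using has_derivative_ddir[OF gx[OF that]] by (simp add: dspace_def)
  have gxp': "((\<lambda>p. dspace v g p x) has_derivative (\<lambda>u. dpar u (dspace v g) p x)) (at p)" if "(p, x) \<in> \<Omega>" for v p x
    using has_derivative_ddir[OF gxp[OF that]] by (simp add: dpar_def)
  have gp': "((\<lambda>p. g p x) has_derivative (\<lambda>u. dpar u g p x)) (at p)" if "(p, x) \<in> \<Omega>" for p x
    using has_derivative_ddir[OF gp[OF that]] by (simp add: dpar_def)
  \<comment> \<open>The candidate derivative is not known to be linear in \<open>v\<close>. The
    basis expansion of \<open>dspace v g\<close> provides this, since a finite sum with constant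
    coefficients can be differentiated in \<open>p\<close> termwise.\<close>
  have Dexp: "D v p x = (\<Sum>b\<in>Basis. (v \<bullet> b) *\<^sub>R D b p x)" if "(p, x) \<in> \<Omega>" for v p x
  proof -
    have "D v p x = dpar u (\<lambda>p x. \<Sum>b\<in>Basis. (v \<bullet> b) *\<^sub>R dspace b g p x) p x"
      unfolding D_def by (rule dpar_cong[OF assms(1) that]) (rule has_derivative_expand[OF gx'])
    also have "\<dots> = (\<Sum>b\<in>Basis. (v \<bullet> b) *\<^sub>R D b p x)"
      unfolding D_def
      by (rule dparI) (intro has_derivative_sum has_derivative_scaleR_right gxp' that)
    finally show ?thesis .
  qed
  have lin: "linear (\<lambda>v. D v p0 x0)"
  proof (rule linearI)
    fix a b :: 'a and c :: real
    show "D (a + b) p0 x0 = D a p0 x0 + D b p0 x0"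
      by (subst (1 2 3) Dexp[OF assms(2)]) (simp add: inner_add_left scaleR_add_left sum.distrib)
    show "D (c *\<^sub>R a) p0 x0 = c *\<^sub>R D a p0 x0"
      by (subst (1 2) Dexp[OF assms(2)]) (simp add: scaleR_sum_right)
  qed
  show ?thesis
    unfolding has_derivative_at_alt D_def[symmetric]
  proof (intro conjI allI impI)
    show "bounded_linear (\<lambda>v. D v p0 x0)" using lin by (simp add: linear_conv_bounded_linear)
    fix e :: real assume e: "0 < e"
    \<comment> \<open>An estimate uniform in \<open>v\<close> is needed: the basis expansion has
      \<open>DIM('a)\<close> terms, and their errors must add up to
      \<open>e * norm v\<close>.\<close>
    define \<eta> where "\<eta> = e / DIM('a)"
    have \<eta>: "0 < \<eta>" using e by (simp add: \<eta>_def)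
    have "\<forall>\<^sub>F z in nhds (p0, x0). \<forall>b\<in>Basis. dist (D b (fst z) (snd z)) (D b p0 x0) < \<eta>"
    proof (rule eventually_ball_finite, simp, intro ballI)
      fix b :: 'a
      have "isCont (\<lambda>(p, x). D b p x) (p0, x0)"
        using cont[of b] assms(1,2) unfolding D_def by (simp add: continuous_on_eq_continuous_at)
      then have "((\<lambda>(p, x). D b p x) \<longlongrightarrow> D b p0 x0) (nhds (p0, x0))"
        by (simp add: isCont_def tendsto_nhds_iff)
      from tendstoD[OF this \<eta>] show "\<forall>\<^sub>F z in nhds (p0, x0). dist (D b (fst z) (snd z)) (D b p0 x0) < \<eta>"
        by (simp add: case_prod_beta)
    qed
    then obtain S where S0: "open S" "(p0, x0) \<in> S"
      and S1: "\<forall>z\<in>S. \<forall>b\<in>Basis. dist (D b (fst z) (snd z)) (D b p0 x0) < \<eta>"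
      unfolding eventually_nhds by blast
    have S: "open S" "(p0, x0) \<in> S"
      "(p, x) \<in> S \<Longrightarrow> b \<in> Basis \<Longrightarrow> dist (D b p x) (D b p0 x0) < \<eta>" for p x b
      using S0 bspec[OF S1, of "(p, x)"] by auto
    obtain \<delta> where \<delta>: "0 < \<delta>" "ball p0 \<delta> \<times> ball x0 \<delta> \<subseteq> S \<inter> \<Omega>"
      by (rule open_prod_ballE[of "S \<inter> \<Omega>" p0 x0]) (use S assms in auto)
    have Dv: "norm (D v p x - D v p0 x0) \<le> e * norm v" if "p \<in> ball p0 \<delta>" "x \<in> ball x0 \<delta>" for v p x
    proof -
      have px: "(p, x) \<in> S" "(p, x) \<in> \<Omega>" using that \<delta> by auto
      have "D v p x - D v p0 x0 = (\<Sum>b\<in>Basis. (v \<bullet> b) *\<^sub>R (D b p x - D b p0 x0))"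
        by (simp add: Dexp[OF px(2), of v] Dexp[OF assms(2), of v] scaleR_diff_right sum_subtractf)
      also have "norm \<dots> \<le> (\<Sum>b\<in>(Basis::'a set). norm v * \<eta>)"
      proof (rule sum_norm_le)
        fix b :: 'a assume b: "b \<in> Basis"
        have "norm (D b p x - D b p0 x0) \<le> \<eta>" using S(3)[OF px(1) b] by (simp add: dist_norm)
        then show "norm ((v \<bullet> b) *\<^sub>R (D b p x - D b p0 x0)) \<le> norm v * \<eta>"
          using Basis_le_norm[OF b, of v] by (auto intro!: mult_mono)
      qed
      also have "\<dots> = e * norm v" by (simp add: \<eta>_def)
      finally show ?thesis .
    qed
    \<comment> \<open>Second difference, estimated by the mean value theorem twice: in the parameter
      along the segment from \<open>p0\<close>, applied to \<open>dspace v g\<close>, and then in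
      space on the ball.\<close>
    have key: "norm ((g (p0 + t *\<^sub>R u) y - g p0 y) - (g (p0 + t *\<^sub>R u) x0 - g p0 x0) - t *\<^sub>R D (y - x0) p0 x0)
        \<le> t * (e * norm (y - x0))"
      if t: "0 < t" "t * norm u < \<delta>" and y: "y \<in> ball x0 \<delta>" for t y
    proof -
      have pb: "p0 + s *\<^sub>R u \<in> ball p0 \<delta>" if "s \<in> {0..t}" for s
      proof -
        have "s * norm u \<le> t * norm u" using that by (intro mult_right_mono) auto
        then show ?thesis using t that by (simp add: dist_norm)
      qed
      have 1: "norm (dspace v g (p0 + t *\<^sub>R u) x - dspace v g p0 x - t *\<^sub>R D v p0 x0) \<le> t * e * norm v"
        if x: "x \<in> ball x0 \<delta>" for v x
      proof -
        have "norm ((dspace v g (p0 + t *\<^sub>R u) x - t *\<^sub>R D v p0 x0) - (dspace v g (p0 + 0 *\<^sub>R u) x - 0 *\<^sub>R D v p0 x0))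
            \<le> (e * norm v) * norm (t - 0)"
        proof (rule differentiable_bound[where S = "{0..t}" and f = "\<lambda>s. dspace v g (p0 + s *\<^sub>R u) x - s *\<^sub>R D v p0 x0"
              and f' = "\<lambda>s h. h *\<^sub>R (D v (p0 + s *\<^sub>R u) x - D v p0 x0)"])
          fix s assume s: "s \<in> {0..t}"
          have in\<Omega>: "(p0 + s *\<^sub>R u, x) \<in> \<Omega>" using pb[OF s] x \<delta> by auto
          have "((\<lambda>s. dspace v g (p0 + s *\<^sub>R u) x) has_derivative (\<lambda>h. dpar (h *\<^sub>R u) (dspace v g) (p0 + s *\<^sub>R u) x)) (at s within {0..t})"
            by (rule has_derivative_line[where f = "\<lambda>p. dspace v g p x", OF gxp'[OF in\<Omega>]])
          moreover have "dpar (h *\<^sub>R u) (dspace v g) (p0 + s *\<^sub>R u) x = h *\<^sub>R D v (p0 + s *\<^sub>R u) x" for h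
            unfolding D_def using linear_scale[OF has_derivative_linear[OF gxp'[OF in\<Omega>]]] .
          ultimately show "((\<lambda>s. dspace v g (p0 + s *\<^sub>R u) x - s *\<^sub>R D v p0 x0) has_derivative
              (\<lambda>h. h *\<^sub>R (D v (p0 + s *\<^sub>R u) x - D v p0 x0))) (at s within {0..t})"
            using has_derivative_diff[OF _ has_derivative_scaleR_left[OF has_derivative_ident]]
            by (simp add: scaleR_diff_right)
          show "onorm (\<lambda>h. h *\<^sub>R (D v (p0 + s *\<^sub>R u) x - D v p0 x0)) \<le> e * norm v"
            using Dv[OF pb[OF s] x, of v] by (intro onorm_le) (simp add: mult.commute mult_left_mono)
        qed (use t in auto)
        then show ?thesis using t by (simp add: algebra_simps)
      qed
      have "norm ((g (p0 + t *\<^sub>R u) y - g p0 y - t *\<^sub>R D y p0 x0) - (g (p0 + t *\<^sub>R u) x0 - g p0 x0 - t *\<^sub>R D x0 p0 x0))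
        \<le> (t * e) * norm (y - x0)"
      proof (rule differentiable_bound[where S = "ball x0 \<delta>"
            and f' = "\<lambda>x v. dspace v g (p0 + t *\<^sub>R u) x - dspace v g p0 x - t *\<^sub>R D v p0 x0"])
        fix x assume x: "x \<in> ball x0 \<delta>"
        have "(p0 + t *\<^sub>R u, x) \<in> \<Omega>" "(p0, x) \<in> \<Omega>" using pb[of t] x t \<delta> by auto
        then show "((\<lambda>x. g (p0 + t *\<^sub>R u) x - g p0 x - t *\<^sub>R D x p0 x0) has_derivative
            (\<lambda>v. dspace v g (p0 + t *\<^sub>R u) x - dspace v g p0 x - t *\<^sub>R D v p0 x0)) (at x within ball x0 \<delta>)"
          using lin
          by (intro has_derivative_diff has_derivative_scaleR_right has_derivative_at_withinI[OF gx']
              bounded_linear_imp_has_derivative) (auto simp: linear_conv_bounded_linear)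
        show "onorm (\<lambda>v. dspace v g (p0 + t *\<^sub>R u) x - dspace v g p0 x - t *\<^sub>R D v p0 x0) \<le> t * e"
          by (rule onorm_le) (use 1[OF x] in simp)
      qed (use y \<delta> in auto)
      then show ?thesis
        by (simp add: linear_diff[OF lin] algebra_simps)
    qed
    \<comment> \<open>Difference quotients in the direction \<open>u\<close>: after division by
      \<open>t\<close>, the estimate \<open>key\<close> passes to the limit, for which one side
      suffices.\<close>
    have lim: "((\<lambda>t. (g (p0 + t *\<^sub>R u) y - g p0 y) /\<^sub>R t) \<longlongrightarrow> dpar u g p0 y) (at_right 0)"
      if y: "y \<in> ball x0 \<delta>" for y
    proof -
      have "(p0, y) \<in> \<Omega>" using y \<delta> by auto
      note G = gp'[OF this]
      have "((\<lambda>t. g (p0 + t *\<^sub>R u) y) has_derivative (\<lambda>h. dpar (h *\<^sub>R u) g p0 y)) (at 0)"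
        using has_derivative_line[where f = "\<lambda>p. g p y" and p = p0 and s = 0 and u = u] G by simp
      then have "((\<lambda>t. g (p0 + t *\<^sub>R u) y) has_vector_derivative dpar u g p0 y) (at 0)"
        unfolding has_vector_derivative_def using linear_scale[OF has_derivative_linear[OF G]] by simp
      then have "((\<lambda>h. norm (g (p0 + (0 + h) *\<^sub>R u) y - g (p0 + 0 *\<^sub>R u) y - h *\<^sub>R dpar u g p0 y) / norm h) \<longlongrightarrow> 0) (at 0)"
        unfolding has_vector_derivative_def has_derivative_at by blast
      then have "((\<lambda>t. norm ((g (p0 + t *\<^sub>R u) y - g p0 y) /\<^sub>R t - dpar u g p0 y)) \<longlongrightarrow> 0) (at 0)"
      proof (rule Lim_transform_eventually)
        have "norm (g (p0 + (0 + h) *\<^sub>R u) y - g (p0 + 0 *\<^sub>R u) y - h *\<^sub>R dpar u g p0 y) / norm h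
            = norm ((g (p0 + h *\<^sub>R u) y - g p0 y) /\<^sub>R h - dpar u g p0 y)" if "h \<noteq> 0" for h
        proof -
          have "(g (p0 + h *\<^sub>R u) y - g p0 y) /\<^sub>R h - dpar u g p0 y
              = (g (p0 + h *\<^sub>R u) y - g p0 y - h *\<^sub>R dpar u g p0 y) /\<^sub>R h"
            using that by (simp add: scaleR_diff_right)
          then show ?thesis by (simp add: divide_inverse mult.commute)
        qed
        then show "\<forall>\<^sub>F h in at 0. norm (g (p0 + (0 + h) *\<^sub>R u) y - g (p0 + 0 *\<^sub>R u) y - h *\<^sub>R dpar u g p0 y) / norm h
            = norm ((g (p0 + h *\<^sub>R u) y - g p0 y) /\<^sub>R h - dpar u g p0 y)"
          by (auto simp: eventually_at_filter)
      qed
      then have "((\<lambda>t. (g (p0 + t *\<^sub>R u) y - g p0 y) /\<^sub>R t) \<longlongrightarrow> dpar u g p0 y) (at 0)"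
        by (rule LIM_zero_cancel[OF tendsto_norm_zero_cancel])
      then show ?thesis by (rule tendsto_within_subset) simp
    qed
    show "\<exists>d>0. \<forall>y. norm (y - x0) < d \<longrightarrow>
        norm (dpar u g p0 y - dpar u g p0 x0 - D (y - x0) p0 x0) \<le> e * norm (y - x0)"
    proof (intro exI[of _ \<delta>] conjI allI impI \<delta>)
      fix y assume "norm (y - x0) < \<delta>"
      then have y: "y \<in> ball x0 \<delta>" by (simp add: dist_norm norm_minus_commute)
      have x0: "x0 \<in> ball x0 \<delta>" using \<delta> by simp
      have "((\<lambda>t. norm ((g (p0 + t *\<^sub>R u) y - g p0 y) /\<^sub>R t - (g (p0 + t *\<^sub>R u) x0 - g p0 x0) /\<^sub>R t - D (y - x0) p0 x0))
          \<longlongrightarrow> norm (dpar u g p0 y - dpar u g p0 x0 - D (y - x0) p0 x0)) (at_right 0)"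
        by (intro tendsto_intros lim y x0)
      moreover have "\<forall>\<^sub>F t in at_right (0::real). t * norm u < \<delta>"
      proof -
        have "((\<lambda>t. t * norm u) \<longlongrightarrow> 0 * norm u) (at_right 0)" by (intro tendsto_intros)
        then show ?thesis using \<delta> by (auto dest: order_tendstoD)
      qed
      then have "\<forall>\<^sub>F t in at_right 0. norm ((g (p0 + t *\<^sub>R u) y - g p0 y) /\<^sub>R t - (g (p0 + t *\<^sub>R u) x0 - g p0 x0) /\<^sub>R t - D (y - x0) p0 x0)
          \<le> e * norm (y - x0)"
        using eventually_at_right_less[of 0]
      proof eventually_elim
        case (elim t)
        let ?N = "(g (p0 + t *\<^sub>R u) y - g p0 y) - (g (p0 + t *\<^sub>R u) x0 - g p0 x0) - t *\<^sub>R D (y - x0) p0 x0"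
        have "(g (p0 + t *\<^sub>R u) y - g p0 y) /\<^sub>R t - (g (p0 + t *\<^sub>R u) x0 - g p0 x0) /\<^sub>R t - D (y - x0) p0 x0 = ?N /\<^sub>R t"
          using elim by (simp add: scaleR_diff_right)
        then have "norm ((g (p0 + t *\<^sub>R u) y - g p0 y) /\<^sub>R t - (g (p0 + t *\<^sub>R u) x0 - g p0 x0) /\<^sub>R t - D (y - x0) p0 x0) = norm ?N / t"
          using elim by (simp add: divide_inverse mult.commute)
        also have "\<dots> \<le> e * norm (y - x0)"
          using key[OF elim(2,1) y] elim by (simp add: field_simps)
        finally show ?case .
      qed
      ultimately show "norm (dpar u g p0 y - dpar u g p0 x0 - D (y - x0) p0 x0) \<le> e * norm (y - x0)"
        by (intro tendsto_upperbound) auto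
    qed
  qed
qed

text \<open>Partial derivatives criterion in its asymmetric form: only the space derivative has to
  be continuous in both variables.\<close>

lemma has_derivative_joint:
  fixes g :: "'p::real_normed_vector \<Rightarrow> 'a::euclidean_space \<Rightarrow> 'b::real_normed_vector"
  assumes "open \<Omega>" "(p0, x0) \<in> \<Omega>"
    and gp: "((\<lambda>p. g p x0) has_derivative G) (at p0)"
    and gx: "\<And>p x. (p, x) \<in> \<Omega> \<Longrightarrow> (g p has_derivative (\<lambda>v. dspace v g p x)) (at x)"
    and cont: "\<And>v. continuous_on \<Omega> (\<lambda>(p, x). dspace v g p x)"
  shows "((\<lambda>z. g (fst z) (snd z)) has_derivative (\<lambda>w. G (fst w) + dspace (snd w) g p0 x0)) (at (p0, x0))"
proof -
  obtain e where e: "0 < e" "ball p0 e \<times> ball x0 e \<subseteq> \<Omega>"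
    using open_prod_ballE[OF assms(1,2)] by blast
  define fy where "fy p x = Blinfun (\<lambda>v. dspace v g p x)" for p x
  have fy: "blinfun_apply (fy p x) = (\<lambda>v. dspace v g p x)" if "(p, x) \<in> \<Omega>" for p x
    unfolding fy_def by (rule bounded_linear_Blinfun_apply) (rule has_derivative_bounded_linear[OF gx[OF that]])
  have px: "(p0, x0) \<in> ball p0 e \<times> ball x0 e" using e by simp
  have "((\<lambda>(p, x). g p x) has_derivative (\<lambda>(tx, ty). G tx + fy p0 x0 ty)) (at (p0, x0) within ball p0 e \<times> ball x0 e)"
  proof (rule has_derivative_partialsI)
    show "((\<lambda>p. g p x0) has_derivative G) (at p0 within ball p0 e)"
      using gp by (rule has_derivative_at_withinI)
    show "(g p has_derivative blinfun_apply (fy p x)) (at x within ball x0 e)" if "p \<in> ball p0 e" "x \<in> ball x0 e" for p x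
    proof -
      have "(p, x) \<in> \<Omega>" using that e by auto
      then show ?thesis using has_derivative_at_withinI[OF gx] fy by metis
    qed
    \<comment> \<open>Continuity as an operator-valued map reduces, in finite dimension, to
      continuity of the values on basis vectors.\<close>
    have "continuous_on (ball p0 e \<times> ball x0 e) (\<lambda>(p, x). fy p x)"
    proof (rule continuous_on_blinfun_componentwise)
      fix i :: 'a
      have "continuous_on (ball p0 e \<times> ball x0 e) (\<lambda>(p, x). dspace i g p x)"
        using cont[of i] e(2) by (rule continuous_on_subset)
      then show "continuous_on (ball p0 e \<times> ball x0 e) (\<lambda>z. blinfun_apply (case z of (p, x) \<Rightarrow> fy p x) i)"
        by (rule continuous_on_eq) (use fy e in auto)
    qed
    then show "continuous (at (p0, x0) within ball p0 e \<times> ball x0 e) (\<lambda>(p, x). fy p x)"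
      using px by (simp add: continuous_on_eq_continuous_within)
  qed (use e in auto)
  then have "((\<lambda>(p, x). g p x) has_derivative (\<lambda>(tx, ty). G tx + fy p0 x0 ty)) (at (p0, x0))"
    using at_within_open[OF px] by (simp add: open_Times)
  then show ?thesis using fy[OF assms(2)] by (simp add: case_prod_beta')
qed

lemma CB_has_derivative_joint:
  fixes g :: "'p::real_normed_vector \<Rightarrow> 'a::euclidean_space \<Rightarrow> 'b::real_normed_vector"
  assumes "CB (Suc r) d K \<Omega> g" "0 < d" "(p, x) \<in> \<Omega>"
  shows "((\<lambda>z. g (fst z) (snd z)) has_derivative (\<lambda>w. dpar (fst w) g p x + dspace (snd w) g p x)) (at (p, x))"
  by (rule has_derivative_joint[OF CB_open[OF assms(1)] assms(3) CB_diff_par[OF assms] CB_diff_space[OF assms(1)]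
        CB_cont[OF CB_dspace[OF assms(1)]]])

lemma CB_swap_par:
  fixes g :: "'p::real_normed_vector \<Rightarrow> 'a::euclidean_space \<Rightarrow> 'b::real_normed_vector"
  assumes g: "CB (Suc (Suc r)) d K \<Omega> g" and d: "0 < d" and px: "(p, x) \<in> \<Omega>"
  shows "dspace v (dpar u g) p x = dpar u (dspace v g) p x"
proof (rule dspaceI[where D = "\<lambda>v. dpar u (dspace v g) p x"])
  show "(dpar u g p has_derivative (\<lambda>v. dpar u (dspace v g) p x)) (at x)"
  proof (rule has_derivative_dpar[OF CB_open[OF g] px])
    show "g p differentiable (at x)" if "(p, x) \<in> \<Omega>" for p x
      using CB_diff_space[OF g that] by (auto simp: differentiable_def)
    show "(\<lambda>p. g p x) differentiable (at p)" if "(p, x) \<in> \<Omega>" for p x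
      using CB_diff_par[OF g d that] by (auto simp: differentiable_def)
    show "(\<lambda>p. dspace v g p x) differentiable (at p)" if "(p, x) \<in> \<Omega>" for p x v
      using CB_diff_par[OF CB_dspace[OF g] d that] by (auto simp: differentiable_def)
    show "continuous_on \<Omega> (\<lambda>(p, x). dpar u (dspace v g) p x)" for v
      by (rule CB_cont[OF CB_dpar[OF CB_dspace[OF g] d]])
  qed
qed

lemma has_derivative_translate:
  fixes f :: "'a::real_normed_vector \<Rightarrow> 'b::real_normed_vector"
  assumes "(f has_derivative D) (at (z + y))"
  shows "((\<lambda>z. f (z + y)) has_derivative D) (at z)" "((\<lambda>y. f (z + y)) has_derivative D) (at y)"
proof -
  have t1: "((\<lambda>z. z + y) has_derivative (\<lambda>h. h)) (at z)"
    using has_derivative_add_const[OF has_derivative_ident] by this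
  have t2: "((\<lambda>y. z + y) has_derivative (\<lambda>h. h)) (at y)"
    using has_derivative_add[OF has_derivative_const[of z] has_derivative_ident] by simp
  show "((\<lambda>z. f (z + y)) has_derivative D) (at z)"
    by (rule has_derivative_compose[where f = "\<lambda>z. z + y" and f' = "\<lambda>h. h" and g = f and g' = D, OF t1 assms])
  show "((\<lambda>y. f (z + y)) has_derivative D) (at y)"
    by (rule has_derivative_compose[where f = "\<lambda>y. z + y" and f' = "\<lambda>h. h" and g = f and g' = D, OF t2 assms])
qed

text \<open>Two space directions are reduced to one parameter and one space direction by
  translation: in \<open>g p (z + y)\<close> the shift \<open>y\<close> plays the role of the
  parameter.\<close>

lemma CB_swap_space:
  fixes g :: "'p::real_normed_vector \<Rightarrow> 'a::euclidean_space \<Rightarrow> 'b::real_normed_vector"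
  assumes g: "CB (Suc (Suc r)) d K \<Omega> g" and px: "(p, x) \<in> \<Omega>"
  shows "dspace v (dspace w g) p x = dspace w (dspace v g) p x"
proof -
  define h where "h y z = g p (z + y)" for y z
  define \<Omega>' where "\<Omega>' = {yz. (p, snd yz + fst yz) \<in> \<Omega>}"
  have o: "open \<Omega>'"
    using open_vimage[OF CB_open[OF g], of "\<lambda>yz. (p, snd yz + fst yz)"]
    by (simp add: \<Omega>'_def vimage_def case_prod_beta continuous_intros)
  have sp: "(h y has_derivative (\<lambda>v. dspace v g p (z + y))) (at z)" if "(y, z) \<in> \<Omega>'" for y z
    unfolding h_def by (rule has_derivative_translate(1)[where f = "g p", OF CB_diff_space[OF g]]) (use that in \<open>simp add: \<Omega>'_def\<close>)
  have pa: "((\<lambda>y. h y z) has_derivative (\<lambda>v. dspace v g p (z + y))) (at y)" if "(y, z) \<in> \<Omega>'" for y z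
    unfolding h_def by (rule has_derivative_translate(2)[where f = "g p", OF CB_diff_space[OF g]]) (use that in \<open>simp add: \<Omega>'_def\<close>)
  have dh: "dspace v h y z = dspace v g p (z + y)" if "(y, z) \<in> \<Omega>'" for v y z
    using dspaceI[where g = h, OF sp[OF that], of v] .
  have ph: "dpar v h y z = dspace v g p (z + y)" if "(y, z) \<in> \<Omega>'" for v y z
    using dparI[where g = h, OF pa[OF that], of v] .
  have "((\<lambda>y. dspace v g p (z + y)) has_derivative (\<lambda>w. dspace w (dspace v g) p (z + y))) (at y)" if "(y, z) \<in> \<Omega>'" for v y z
    by (rule has_derivative_translate(2)[where f = "dspace v g p", OF CB_diff_space[OF CB_dspace[OF g]]]) (use that in \<open>simp add: \<Omega>'_def\<close>)
  then have pd: "((\<lambda>y. dspace v h y z) has_derivative (\<lambda>w. dspace w (dspace v g) p (z + y))) (at y)" if "(y, z) \<in> \<Omega>'" for v y z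
    by (rule has_derivative_transform_within_open[OF _ open_slice_par[OF o, of z]]) (use that dh in auto)
  have in0: "(0, x) \<in> \<Omega>'" using px by (simp add: \<Omega>'_def)
  have "((\<lambda>z. dpar w h 0 z) has_derivative (\<lambda>v. dpar w (dspace v h) 0 x)) (at x)"
  proof (rule has_derivative_dpar[OF o in0])
    show "continuous_on \<Omega>' (\<lambda>(y, z). dpar w (dspace v h) y z)" for v
    proof (rule continuous_on_eq)
      have "continuous_on \<Omega>' (\<lambda>yz. (\<lambda>(p, x). dspace w (dspace v g) p x) (p, snd yz + fst yz))"
        by (rule continuous_on_compose2[OF CB_cont[OF CB_dspace[OF CB_dspace[OF g]]]])
          (auto simp: \<Omega>'_def intro!: continuous_intros)
      then show "continuous_on \<Omega>' (\<lambda>yz. dspace w (dspace v g) p (snd yz + fst yz))" by simp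
      fix yz assume "yz \<in> \<Omega>'"
      then show "dspace w (dspace v g) p (snd yz + fst yz) = (case yz of (y, z) \<Rightarrow> dpar w (dspace v h) y z)"
        using dparI[where g = "dspace v h", OF pd[of "fst yz" "snd yz" v], of w] by (simp add: case_prod_beta)
    qed
      show "h p differentiable (at x)" if "(p, x) \<in> \<Omega>'" for p x
      by (rule differentiableI[OF sp[OF that]])
    show "(\<lambda>p. h p x) differentiable (at p)" if "(p, x) \<in> \<Omega>'" for p x
      by (rule differentiableI[OF pa[OF that]])
    show "(\<lambda>p. dspace v h p x) differentiable (at p)" if "(p, x) \<in> \<Omega>'" for p x v
      by (rule differentiableI[OF pd[OF that]])
  qed
  then have "(dspace w g p has_derivative (\<lambda>v. dpar w (dspace v h) 0 x)) (at x)"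
    by (rule has_derivative_transform_within_open[OF _ open_slice_space[OF o, of 0]]) (use in0 ph in auto)
  from dspaceI[where g = "dspace w g", OF this, of v] dparI[where g = "dspace v h", OF pd[OF in0, of v], of w] show ?thesis by simp
qed

section \<open>Composition\<close>

primrec comp_const :: "nat \<Rightarrow> ennreal \<Rightarrow> nat \<Rightarrow> ennreal" where
  "comp_const N A 0 = 1"
| "comp_const N A (Suc r) = (1 + of_nat N * 2 ^ r * A) * comp_const N A r"

lemma comp_const_finite: "A < top \<Longrightarrow> comp_const N A r < top"
  by (induction r) (auto simp: ennreal_mult_less_top ennreal_add_less_top power_less_top_ennreal of_nat_less_top)

lemma comp_const_ge_1: "1 \<le> comp_const N A r"
proof (induction r)
  case (Suc r)
  have "1 * 1 \<le> (1 + of_nat N * 2 ^ r * A) * comp_const N A r"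
    by (intro mult_mono Suc) auto
  then show ?case by simp
qed simp

text \<open>The inner maps are only required to have bounded derivatives, since their own size never
  enters the chain rule. One derivative of the composite is a sum of at most
  \<open>DIM('a) + DIM('p)\<close> products, each with a Leibniz factor \<open>2 ^ r\<close> and an
  inner derivative bounded by \<open>L + M\<close>; the summand 1 in \<open>comp_const\<close>
  preserves the bounds of lower order.\<close>

lemma CB_compose:
  fixes F :: "'p::euclidean_space \<Rightarrow> 'a::euclidean_space \<Rightarrow> 'b::real_normed_vector"
    and \<pi> :: "'q::real_normed_vector \<Rightarrow> 'p" and h :: "'q \<Rightarrow> 'x::real_normed_vector \<Rightarrow> 'a"
  assumes "CB r d K \<Omega>' F" "DB r d L \<Omega> (\<lambda>q x. \<pi> q)" "DB r d M \<Omega> h"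
    and dom: "\<And>q x. (q, x) \<in> \<Omega> \<Longrightarrow> (\<pi> q, h q x) \<in> \<Omega>'"
  shows "CB r d (comp_const (DIM('a) + DIM('p)) (L + M) r * K) \<Omega> (\<lambda>q x. F (\<pi> q) (h q x))"
  using assms(1-3)
proof (induction r arbitrary: d K F)
  have cont: "continuous_on \<Omega> (\<lambda>(q, x). F (\<pi> q) (h q x))"
    if "CB r d K \<Omega>' F" "DB r d L \<Omega> (\<lambda>q x. \<pi> q)" "DB r d M \<Omega> h" for r d K F
  proof -
    have "continuous_on \<Omega> (\<lambda>z. (\<lambda>(p, x). F p x) (\<pi> (fst z), h (fst z) (snd z)))"
      by (rule continuous_on_compose2[OF CB_cont[OF that(1)]])
        (use DB_cont[OF that(2)] DB_cont[OF that(3)] dom in \<open>auto simp: case_prod_beta intro!: continuous_on_Pair\<close>)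
    then show ?thesis by (simp add: case_prod_beta)
  qed
  { case 0
    then show ?case using cont[OF 0] CB_bound[OF 0(1) dom] DB_open[OF 0(2)] by auto }
  { case (Suc r)
    note F = Suc.prems(1) and \<pi> = Suc.prems(2) and h = Suc.prems(3)
    define N where "N = DIM('a) + DIM('p)"
    define X where "X = comp_const N (L + M) r * K"
    have hr: "DB r d M \<Omega> h" "DB r (d - 1) M \<Omega> h" and \<pi>r: "DB r d L \<Omega> (\<lambda>q x. \<pi> q)" "DB r (d - 1) L \<Omega> (\<lambda>q x. \<pi> q)"
      by (auto intro: DB_mono_rd[OF h] DB_mono_rd[OF \<pi>])
    have I1: "CB r d X \<Omega> (\<lambda>q x. dspace b F (\<pi> q) (h q x))" if "b \<in> Basis" for b
      using Suc.IH[OF CB_dspace[OF F, of b] \<pi>r(1) hr(1)] that by (simp add: X_def N_def)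
    have I2: "CB r (d - 1) X \<Omega> (\<lambda>q x. dpar b F (\<pi> q) (h q x))" if "b \<in> Basis" "0 < d" for b
      using Suc.IH[OF CB_dpar[OF F that(2), of b] \<pi>r(2) hr(2)] that by (simp add: X_def N_def)
    have h1: "CB r d (ennreal (norm v) * M) \<Omega> (\<lambda>q x. dspace v h q x \<bullet> b)" if "b \<in> Basis" for v b
      using CB_linear[OF DB_dspace[OF h, of v], of "\<lambda>y. y \<bullet> b" 1] Basis_le_norm[OF that]
      by (simp add: bounded_linear_inner_left)
    have h2: "CB r (d - 1) (ennreal (norm v) * M) \<Omega> (\<lambda>q x. dpar v h q x \<bullet> b)" if "b \<in> Basis" "0 < d" for v b
      using CB_linear[OF DB_dpar[OF h that(2), of v], of "\<lambda>y. y \<bullet> b" 1] Basis_le_norm[OF that(1)]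
      by (simp add: bounded_linear_inner_left)
    have h3: "CB r (d - 1) (ennreal (norm v) * L) \<Omega> (\<lambda>q x. dpar v (\<lambda>q x. \<pi> q) q x \<bullet> b)" if "b \<in> Basis" "0 < d" for v b
      using CB_linear[OF DB_dpar[OF \<pi> that(2), of v], of "\<lambda>y. y \<bullet> b" 1] Basis_le_norm[OF that(1)]
      by (simp add: bounded_linear_inner_left)
    define gx where "gx v q x = (\<Sum>b\<in>Basis. (dspace v h q x \<bullet> b) *\<^sub>R dspace b F (\<pi> q) (h q x))" for v q x
    define gp where "gp v q x = (\<Sum>b\<in>Basis. (dpar v (\<lambda>q x. \<pi> q) q x \<bullet> b) *\<^sub>R dpar b F (\<pi> q) (h q x)) +
       (\<Sum>b\<in>Basis. (dpar v h q x \<bullet> b) *\<^sub>R dspace b F (\<pi> q) (h q x))" for v q x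
    have "CB r d (\<Sum>b\<in>(Basis::'a set). 2 ^ r * ((ennreal (norm v) * M) * X)) \<Omega> (gx v)" for v
      unfolding gx_def by (intro CB_sum CB_scaleR[OF h1 I1]) (auto simp: CB_open[OF F] DB_open[OF h])
    then have gx1: "CB r d (of_nat DIM('a) * (2 ^ r * ((ennreal (norm v) * M) * X))) \<Omega> (gx v)" for v
      by simp
    have gp1: "CB r (d - 1) (of_nat DIM('p) * (2 ^ r * ((ennreal (norm v) * L) * X)) + of_nat DIM('a) * (2 ^ r * ((ennreal (norm v) * M) * X))) \<Omega> (gp v)"
      if "0 < d" for v
    proof -
      have "CB r (d - 1) ((\<Sum>b\<in>(Basis::'p set). 2 ^ r * ((ennreal (norm v) * L) * X)) +
          (\<Sum>b\<in>(Basis::'a set). 2 ^ r * ((ennreal (norm v) * M) * X))) \<Omega> (gp v)"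
        unfolding gp_def
      proof (rule CB_add)
        show "CB r (d - 1) (\<Sum>b\<in>(Basis::'p set). 2 ^ r * ((ennreal (norm v) * L) * X)) \<Omega>
            (\<lambda>q x. \<Sum>b\<in>Basis. (dpar v (\<lambda>q x. \<pi> q) q x \<bullet> b) *\<^sub>R dpar b F (\<pi> q) (h q x))"
          by (rule CB_sum[OF finite_Basis DB_open[OF h]]) (rule CB_scaleR[OF h3[OF _ that] I2[OF _ that]])
        show "CB r (d - 1) (\<Sum>b\<in>(Basis::'a set). 2 ^ r * ((ennreal (norm v) * M) * X)) \<Omega>
            (\<lambda>q x. \<Sum>b\<in>Basis. (dpar v h q x \<bullet> b) *\<^sub>R dspace b F (\<pi> q) (h q x))"
          by (rule CB_sum[OF finite_Basis DB_open[OF h]]) (rule CB_scaleR[OF h2[OF _ that] CB_mono_d[OF I1 diff_le_self]])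
      qed
      then show ?thesis by simp
    qed
    \<comment> \<open>Subtraction being of little use in \<open>ennreal\<close>, the slack in the
      inequality is exhibited as an explicit summand.\<close>
    have le1: "of_nat DIM('a) * (2 ^ r * ((n * M) * X)) \<le> n * (comp_const N (L + M) (Suc r) * K)" for n
    proof -
      have "n * (comp_const N (L + M) (Suc r) * K) = of_nat DIM('a) * (2 ^ r * ((n * M) * X))
        + (n * X + n * of_nat DIM('a) * 2 ^ r * L * X + n * of_nat DIM('p) * 2 ^ r * (L + M) * X)"
        by (simp add: N_def X_def algebra_simps)
      then show ?thesis unfolding le_iff_add by blast
    qed
    have le2: "of_nat DIM('p) * (2 ^ r * ((n * L) * X)) + of_nat DIM('a) * (2 ^ r * ((n * M) * X)) \<le> n * (comp_const N (L + M) (Suc r) * K)" for n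
    proof -
      have "n * (comp_const N (L + M) (Suc r) * K) = (of_nat DIM('p) * (2 ^ r * ((n * L) * X)) + of_nat DIM('a) * (2 ^ r * ((n * M) * X)))
        + (n * X + n * of_nat DIM('a) * 2 ^ r * L * X + n * of_nat DIM('p) * 2 ^ r * M * X)"
        by (simp add: N_def X_def algebra_simps)
      then show ?thesis unfolding le_iff_add by blast
    qed
    show ?case unfolding N_def[symmetric]
    proof (rule CB_SucI[where gx = gx and gp = gp])
      show "open \<Omega>" by (rule DB_open[OF h])
      show "continuous_on \<Omega> (\<lambda>(q, x). F (\<pi> q) (h q x))" by (rule cont[OF Suc.prems])
      show "CB r d (ennreal (norm v) * (comp_const N (L + M) (Suc r) * K)) \<Omega> (gx v)" for v
        by (rule CB_mono_K[OF gx1 le1])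
      show "CB r (d - 1) (ennreal (norm v) * (comp_const N (L + M) (Suc r) * K)) \<Omega> (gp v)" if "0 < d" for v
        by (rule CB_mono_K[OF gp1[OF that] le2])
      fix q x assume qx: "(q, x) \<in> \<Omega>"
      note Dx = CB_diff_space[OF F dom[OF qx]]
      show "ennreal (norm (F (\<pi> q) (h q x))) \<le> comp_const N (L + M) (Suc r) * K"
        using mult_mono[OF comp_const_ge_1 CB_bound[OF F dom[OF qx]], of N "L + M" "Suc r"] by simp
      have "((\<lambda>x. F (\<pi> q) (h q x)) has_derivative (\<lambda>v. dspace (dspace v h q x) F (\<pi> q) (h q x))) (at x)"
        by (rule has_derivative_compose[where f = "h q" and f' = "\<lambda>v. dspace v h q x" and g = "F (\<pi> q)"
              and g' = "\<lambda>w. dspace w F (\<pi> q) (h q x)", OF DB_diff_space[OF h qx] Dx])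
      then show "((\<lambda>x. F (\<pi> q) (h q x)) has_derivative (\<lambda>v. gx v q x)) (at x)"
        unfolding gx_def has_derivative_expand[OF Dx, of "dspace v h q x" for v] .
      assume d: "0 < d"
      \<comment> \<open>In the parameter both \<open>\<pi>\<close> and \<open>h\<close> move, so the
        outer family is needed as a jointly differentiable map.\<close>
      note J = CB_has_derivative_joint[OF F d dom[OF qx]]
      have "((\<lambda>q. (\<pi> q, h q x)) has_derivative (\<lambda>u. (dpar u (\<lambda>q x. \<pi> q) q x, dpar u h q x))) (at q)"
        using has_derivative_Pair[OF DB_diff_par[OF \<pi> d qx] DB_diff_par[OF h d qx]] .
      from has_derivative_compose[where f = "\<lambda>q. (\<pi> q, h q x)" and g = "\<lambda>z. F (fst z) (snd z)"
          and g' = "\<lambda>w. dpar (fst w) F (\<pi> q) (h q x) + dspace (snd w) F (\<pi> q) (h q x)", OF this J]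
      have "((\<lambda>q. F (\<pi> q) (h q x)) has_derivative
          (\<lambda>u. dpar (dpar u (\<lambda>q x. \<pi> q) q x) F (\<pi> q) (h q x) + dspace (dpar u h q x) F (\<pi> q) (h q x))) (at q)"
        by simp
      then show "((\<lambda>q. F (\<pi> q) (h q x)) has_derivative (\<lambda>v. gp v q x)) (at q)"
        unfolding gp_def has_derivative_expand[OF Dx, of "dpar v h q x" for v]
          has_derivative_expand[OF CB_diff_par[OF F d dom[OF qx]], of "dpar v (\<lambda>q x. \<pi> q) q x" for v] .
    qed }
qed

lemma CB_scale_norm:
  assumes "CB r d K \<Omega> g"
  shows "CB r d (ennreal \<bar>c\<bar> * K) \<Omega> (\<lambda>p x. c *\<^sub>R g p x)"
  by (rule CB_linear[OF assms bounded_linear_scaleR_right]) auto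

section \<open>Equivalence with \<open>Cdr_on\<close> and \<open>Cdr_norm\<close>\<close>

lemma foldr_dpar_cong:
  "open \<Omega> \<Longrightarrow> (\<And>p x. (p, x) \<in> \<Omega> \<Longrightarrow> f p x = g p x) \<Longrightarrow> (p, x) \<in> \<Omega> \<Longrightarrow> foldr dpar us f p x = foldr dpar us g p x"
proof (induction us arbitrary: p x)
  case (Cons u us)
  have "dpar u (foldr dpar us f) p x = dpar u (foldr dpar us g) p x"
    by (rule dpar_cong(1)[OF Cons.prems(1,3)]) (rule Cons.IH[OF Cons.prems(1,2)])
  then show ?case by simp
qed simp

lemma Cdr_on_space: "Cdr_on d r \<Omega> g \<Longrightarrow> length vs < r \<Longrightarrow> (p, x) \<in> \<Omega> \<Longrightarrow> foldr dspace vs g p differentiable (at x)"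
  and Cdr_on_par: "Cdr_on d r \<Omega> g \<Longrightarrow> length us < d \<Longrightarrow> length us + length vs < r \<Longrightarrow> (p, x) \<in> \<Omega> \<Longrightarrow>
      (\<lambda>p'. mixed us vs g p' x) differentiable (at p)"
  and Cdr_on_cont: "Cdr_on d r \<Omega> g \<Longrightarrow> length us \<le> d \<Longrightarrow> length us + length vs \<le> r \<Longrightarrow>
      continuous_on \<Omega> (\<lambda>(p, x). mixed us vs g p x)"
  unfolding Cdr_on_def by (auto simp: mixed_def split: prod.splits)

text \<open>In \<open>mixed\<close>, parameter derivatives are applied last. To see that
  \<open>dpar u g\<close> is again of such a class, space derivatives must be applied after
  \<open>dpar u\<close>, which Schwarz's theorem permits one direction at a time.\<close>

lemma has_derivative_dpar_foldr:
  fixes g :: "'p::real_normed_vector \<Rightarrow> 'a::euclidean_space \<Rightarrow> 'b::real_normed_vector"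
  assumes "open \<Omega>" "Cdr_on d (Suc r) \<Omega> g" "0 < d" "(p, x) \<in> \<Omega>" "length vs < r"
  shows "((\<lambda>x. dpar u (foldr dspace vs g) p x) has_derivative (\<lambda>v. dpar u (foldr dspace (v # vs) g) p x)) (at x)"
proof -
  have "((\<lambda>x. dpar u (foldr dspace vs g) p x) has_derivative (\<lambda>v. dpar u (dspace v (foldr dspace vs g)) p x)) (at x)"
  proof (rule has_derivative_dpar[OF assms(1,4)])
    fix p x assume px: "(p, x) \<in> \<Omega>"
    show "foldr dspace vs g p differentiable at x"
      using Cdr_on_space[OF assms(2) _ px, of vs] assms(5) by simp
    show "(\<lambda>p. foldr dspace vs g p x) differentiable at p"
      using Cdr_on_par[OF assms(2) _ _ px, of "[]" vs] assms(3,5) by (simp add: mixed_def)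
    show "(\<lambda>p. dspace v (foldr dspace vs g) p x) differentiable at p" for v
      using Cdr_on_par[OF assms(2) _ _ px, of "[]" "v # vs"] assms(3,5) by (simp add: mixed_def)
  next
    show "continuous_on \<Omega> (\<lambda>(p, x). dpar u (dspace v (foldr dspace vs g)) p x)" for v
      using Cdr_on_cont[OF assms(2), of "[u]" "v # vs"] assms(3,5) by (simp add: mixed_def)
  qed
  then show ?thesis by simp
qed

lemma foldr_dspace_dpar:
  fixes g :: "'p::real_normed_vector \<Rightarrow> 'a::euclidean_space \<Rightarrow> 'b::real_normed_vector"
  assumes "open \<Omega>" "Cdr_on d (Suc r) \<Omega> g" "0 < d"
  shows "length vs \<le> r \<Longrightarrow> (p, x) \<in> \<Omega> \<Longrightarrow> foldr dspace vs (dpar u g) p x = dpar u (foldr dspace vs g) p x"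
proof (induction vs arbitrary: p x)
  case (Cons v vs)
  have "dspace v (foldr dspace vs (dpar u g)) p x = dspace v (dpar u (foldr dspace vs g)) p x"
    by (rule dspace_cong(1)[OF assms(1) Cons.prems(2)]) (use Cons in auto)
  also have "\<dots> = dpar u (foldr dspace (v # vs) g) p x"
    using dspaceI[where g = "dpar u (foldr dspace vs g)" and D = "\<lambda>v. dpar u (foldr dspace (v # vs) g) p x",
        OF has_derivative_dpar_foldr[OF assms Cons.prems(2)]] Cons.prems(1) by simp
  finally show ?case by simp
qed simp

lemma Cdr_on_dspace: "Cdr_on d (Suc r) \<Omega> g \<Longrightarrow> Cdr_on d r \<Omega> (dspace v g)"
proof -
  assume g: "Cdr_on d (Suc r) \<Omega> g"
  have e: "mixed us vs (dspace v g) = mixed us (vs @ [v]) g" for us vs by (simp add: mixed_def)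
  show ?thesis unfolding Cdr_on_def
    by (intro conjI allI impI ballI; clarsimp simp: e)
      (use Cdr_on_space[OF g, of "_ @ [v]"] Cdr_on_par[OF g, of _ "_ @ [v]"] Cdr_on_cont[OF g, of _ "_ @ [v]"]
        in \<open>auto simp: mixed_def\<close>)
qed

lemma mixed_dpar:
  fixes g :: "'p::real_normed_vector \<Rightarrow> 'a::euclidean_space \<Rightarrow> 'b::real_normed_vector"
  assumes "open \<Omega>" "Cdr_on d (Suc r) \<Omega> g" "0 < d" "length vs \<le> r" "(p, x) \<in> \<Omega>"
  shows "mixed us vs (dpar u g) p x = mixed (us @ [u]) vs g p x"
  unfolding mixed_def foldr_append
  by (rule foldr_dpar_cong[OF assms(1) _ assms(5)]) (use foldr_dspace_dpar[OF assms(1-4)] in simp)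

lemma Cdr_on_dpar:
  fixes g :: "'p::real_normed_vector \<Rightarrow> 'a::euclidean_space \<Rightarrow> 'b::real_normed_vector"
  assumes o: "open \<Omega>" and g: "Cdr_on d (Suc r) \<Omega> g" and d: "0 < d"
  shows "Cdr_on (d - 1) r \<Omega> (dpar u g)"
  unfolding Cdr_on_def
proof (intro conjI allI impI ballI)
  fix vs z assume vs: "length (vs::'a list) < r" and z: "z \<in> \<Omega>"
  obtain p x where px: "z = (p, x)" "(p, x) \<in> \<Omega>" using z by (cases z) auto
  have "foldr dspace vs (dpar u g) p differentiable (at x) \<longleftrightarrow> dpar u (foldr dspace vs g) p differentiable (at x)"
    by (rule dspace_cong(2)[OF o px(2)]) (use foldr_dspace_dpar[OF o g d] vs in auto)
  then show "case z of (p, x) \<Rightarrow> mixed [] vs (dpar u g) p differentiable at x"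
    using differentiableI[OF has_derivative_dpar_foldr[OF o g d px(2) vs]] px by (simp add: mixed_def)
next
  fix us :: "'p list" and vs :: "'a list" and z
  assume l: "length us < d - 1 \<and> length us + length vs < r" and z: "z \<in> \<Omega>"
  obtain p x where px: "z = (p, x)" "(p, x) \<in> \<Omega>" using z by (cases z) auto
  have "(\<lambda>p'. mixed us vs (dpar u g) p' x) differentiable (at p) \<longleftrightarrow> (\<lambda>p'. mixed (us @ [u]) vs g p' x) differentiable (at p)"
    by (rule dpar_cong(2)[OF o px(2)]) (use mixed_dpar[OF o g d] l in auto)
  moreover have "(\<lambda>p'. mixed (us @ [u]) vs g p' x) differentiable (at p)"
    by (rule Cdr_on_par[OF g _ _ px(2)]) (use l in auto)
  ultimately show "case z of (p, x) \<Rightarrow> (\<lambda>p'. mixed us vs (dpar u g) p' x) differentiable at p"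
    using px by simp
next
  fix us :: "'p list" and vs :: "'a list"
  assume l: "length us \<le> d - 1 \<and> length us + length vs \<le> r"
  have "continuous_on \<Omega> (\<lambda>(p, x). mixed (us @ [u]) vs g p x)"
    by (rule Cdr_on_cont[OF g]) (use l d in auto)
  then show "continuous_on \<Omega> (\<lambda>(p, x). mixed us vs (dpar u g) p x)"
    by (rule continuous_on_eq) (use mixed_dpar[OF o g d] l in auto)
qed

lemma Cdr_norm_le_iff:
  "Cdr_norm d r \<Omega> g \<le> K \<longleftrightarrow>
    (\<forall>us vs p x. length us \<le> d \<longrightarrow> length us + length vs \<le> r \<longrightarrow> (\<forall>u\<in>set us. norm u \<le> 1) \<longrightarrow> (\<forall>v\<in>set vs. norm v \<le> 1)
      \<longrightarrow> (p, x) \<in> \<Omega> \<longrightarrow> ennreal (norm (mixed us vs g p x)) \<le> K)"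
  unfolding Cdr_norm_def by (simp add: SUP_le_iff Ball_def split_paired_All) blast

text \<open>Links the two conventions: \<open>Cdr_norm\<close> takes directions in the unit ball,
  while \<open>CB\<close> admits every direction and weights the bound by its norm.\<close>

lemma scale_unit_exists: "\<exists>w. norm w \<le> 1 \<and> v = norm v *\<^sub>R w" for v :: "'a::real_normed_vector"
  by (cases "v = 0") (auto intro: exI[of _ "v /\<^sub>R norm v"])

lemma CB_of_Cdr:
  fixes g :: "'p::real_normed_vector \<Rightarrow> 'a::euclidean_space \<Rightarrow> 'b::real_normed_vector"
  assumes "open \<Omega>" "Cdr_on d r \<Omega> g" "Cdr_norm d r \<Omega> g \<le> K"
  shows "CB r d K \<Omega> g"
  using assms(2,3)
proof (induction r arbitrary: d K g)
  have b: "(p, x) \<in> \<Omega> \<Longrightarrow> ennreal (norm (g p x)) \<le> K" if "Cdr_norm d r \<Omega> g \<le> K" for p x d r K and g :: "'p \<Rightarrow> 'a \<Rightarrow> 'b"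
    using that[unfolded Cdr_norm_le_iff, rule_format, of "[]" "[]" p x] by (simp add: mixed_def)
  { case 0 then show ?case using b[OF 0(2)] Cdr_on_cont[OF 0(1), of "[]" "[]"] assms(1) by (auto simp: mixed_def) }
  { case (Suc r)
    note g = Suc.prems(1)
    have x: "(g p has_derivative (\<lambda>v. dspace v g p x)) (at x)" if "(p, x) \<in> \<Omega>" for p x
      using has_derivative_ddir[OF Cdr_on_space[OF g _ that, of "[]", simplified]] by (simp add: dspace_def)
    have y: "((\<lambda>p. g p x) has_derivative (\<lambda>u. dpar u g p x)) (at p)" if "(p, x) \<in> \<Omega>" "0 < d" for p x
      using has_derivative_ddir[OF Cdr_on_par[OF g _ _ that(1), of "[]" "[]", simplified]] that(2) by (simp add: dpar_def mixed_def)
    show ?case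
    proof (rule CB_SucI[where gx = "\<lambda>v. dspace v g" and gp = "\<lambda>v. dpar v g"])
      show "continuous_on \<Omega> (\<lambda>(p, x). g p x)"
        using Cdr_on_cont[OF g, of "[]" "[]"] by (simp add: mixed_def)
      show "CB r d (ennreal (norm v) * K) \<Omega> (dspace v g)" for v
      proof -
        obtain w :: 'a where w: "norm w \<le> 1" "v = norm v *\<^sub>R w" using scale_unit_exists by blast
        have "Cdr_norm d r \<Omega> (dspace w g) \<le> K"
          unfolding Cdr_norm_le_iff
        proof (intro allI impI)
          fix us :: "'p list" and vs :: "'a list" and p x
          assume "length us \<le> d" "length us + length vs \<le> r" "\<forall>u\<in>set us. norm u \<le> 1" "\<forall>v\<in>set vs. norm v \<le> 1" "(p, x) \<in> \<Omega>"
          then show "ennreal (norm (mixed us vs (dspace w g) p x)) \<le> K"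
            using Suc.prems(2)[unfolded Cdr_norm_le_iff, rule_format, of us "vs @ [w]" p x] w(1) by (auto simp: mixed_def)
        qed
        from CB_scale_norm[OF Suc.IH[OF Cdr_on_dspace[OF g] this], of "norm v"]
        have "CB r d (ennreal (norm v) * K) \<Omega> (\<lambda>p x. norm v *\<^sub>R dspace w g p x)" by simp
        then show ?thesis
        proof (rule CB_cong_imp[rotated])
          fix p x assume px: "(p, x) \<in> \<Omega>"
          have "dspace (norm v *\<^sub>R w) g p x = norm v *\<^sub>R dspace w g p x"
            by (rule linear_scale[OF has_derivative_linear[OF x[OF px]]])
          then show "norm v *\<^sub>R dspace w g p x = dspace v g p x" using w(2) by simp
        qed
      qed
      show "CB r (d - 1) (ennreal (norm v) * K) \<Omega> (dpar v g)" if d: "0 < d" for v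
      proof -
        obtain w :: 'p where w: "norm w \<le> 1" "v = norm v *\<^sub>R w" using scale_unit_exists by blast
        have "Cdr_norm (d - 1) r \<Omega> (dpar w g) \<le> K"
          unfolding Cdr_norm_le_iff
        proof (intro allI impI)
          fix us :: "'p list" and vs :: "'a list" and p x
          assume a: "length us \<le> d - 1" "length us + length vs \<le> r" "\<forall>u\<in>set us. norm u \<le> 1" "\<forall>v\<in>set vs. norm v \<le> 1" "(p, x) \<in> \<Omega>"
          have "length (us @ [w]) \<le> d" "length (us @ [w]) + length vs \<le> Suc r" using a d by auto
          with a show "ennreal (norm (mixed us vs (dpar w g) p x)) \<le> K"
            using Suc.prems(2)[unfolded Cdr_norm_le_iff, rule_format, of "us @ [w]" vs p x] w(1)
              mixed_dpar[OF assms(1) g d _ a(5), of vs us w] by auto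
        qed
        from CB_scale_norm[OF Suc.IH[OF Cdr_on_dpar[OF assms(1) g d] this], of "norm v"]
        have "CB r (d - 1) (ennreal (norm v) * K) \<Omega> (\<lambda>p x. norm v *\<^sub>R dpar w g p x)" by simp
        then show ?thesis
        proof (rule CB_cong_imp[rotated])
          fix p x assume px: "(p, x) \<in> \<Omega>"
          have "dpar (norm v *\<^sub>R w) g p x = norm v *\<^sub>R dpar w g p x"
            by (rule linear_scale[OF has_derivative_linear[OF y[OF px d]]])
          then show "norm v *\<^sub>R dpar w g p x = dpar v g p x" using w(2) by simp
        qed
      qed
    qed (use assms(1) b[OF Suc.prems(2)] x y in auto) }
qed

text \<open>The alternative \<open>K = top\<close> admits arbitrary directions, as needed for
  membership in the class; a finite bound is kept only along directions of norm at most 1.\<close>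

lemma CB_mixed:
  assumes "CB r d K \<Omega> g" "length us \<le> d" "length us + length vs \<le> r"
    and "K = top \<or> (\<forall>u\<in>set us. norm u \<le> 1) \<and> (\<forall>v\<in>set vs. norm v \<le> 1)"
  shows "CB (r - length us - length vs) (d - length us) K \<Omega> (mixed us vs g)"
proof -
  have le: "ennreal (norm v) * K \<le> K" if "K = top \<or> norm v \<le> 1" for v :: "'z::real_normed_vector"
    using that mult_right_mono[of "ennreal (norm v)" 1 K] by auto
  have s: "CB (r - length vs) d K \<Omega> (foldr dspace vs g)"
    using assms(3,4)
  proof (induction vs)
    case Nil then show ?case using assms(1) by simp
  next
    case (Cons v vs)
    then obtain k where k: "r - length vs = Suc k" by (cases "r - length vs") auto
    have "CB k d (ennreal (norm v) * K) \<Omega> (dspace v (foldr dspace vs g))"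
      by (rule CB_dspace) (use Cons k in auto)
    then have "CB k d K \<Omega> (dspace v (foldr dspace vs g))"
      by (rule CB_mono_K) (use Cons.prems in \<open>auto intro!: le\<close>)
    moreover have "r - length (v # vs) = k" using k by simp
    ultimately show ?case by simp
  qed
  show ?thesis
    using assms(2,3,4)
  proof (induction us)
    case Nil then show ?case using s by (simp add: mixed_def)
  next
    case (Cons u us)
    then obtain k where k: "r - length us - length vs = Suc k" by (cases "r - length us - length vs") auto
    have "CB k (d - length us - 1) (ennreal (norm u) * K) \<Omega> (dpar u (mixed us vs g))"
      by (rule CB_dpar) (use Cons k in auto)
    then have "CB k (d - length us - 1) K \<Omega> (dpar u (mixed us vs g))"
      by (rule CB_mono_K) (use Cons.prems in \<open>auto intro!: le\<close>)
    moreover have "k = r - length (u # us) - length vs" "d - length us - 1 = d - length (u # us)" using k by auto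
    ultimately show ?case by (simp add: mixed_def)
  qed
qed

lemma Cdr_of_CB:
  assumes "CB r d K \<Omega> g"
  shows "Cdr_on d r \<Omega> g" "Cdr_norm d r \<Omega> g \<le> K"
proof -
  note m = CB_mixed[OF CB_top[OF assms]]
  show "Cdr_on d r \<Omega> g"
    unfolding Cdr_on_def
  proof (intro conjI allI impI ballI)
    fix vs z assume vs: "length (vs::'b list) < r" and z: "z \<in> \<Omega>"
    then obtain k where k: "r - length vs = Suc k" by (cases "r - length vs") auto
    show "case z of (p, x) \<Rightarrow> mixed [] vs g p differentiable at x"
      using CB_diff_space[of k d top \<Omega> "mixed [] vs g"] m[of "[]" vs] vs k z
      by (cases z) (auto intro: differentiableI)
  next
    fix us :: "'a list" and vs :: "'b list" and z
    assume l: "length us < d \<and> length us + length vs < r" and z: "z \<in> \<Omega>"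
    then obtain k where k: "r - length us - length vs = Suc k" by (cases "r - length us - length vs") auto
    show "case z of (p, x) \<Rightarrow> (\<lambda>p'. mixed us vs g p' x) differentiable at p"
      using CB_diff_par[of k "d - length us" top \<Omega> "mixed us vs g"] m[of us vs] l k z
      by (cases z) (auto intro: differentiableI)
  next
    fix us :: "'a list" and vs :: "'b list"
    assume l: "length us \<le> d \<and> length us + length vs \<le> r"
    then show "continuous_on \<Omega> (\<lambda>(p, x). mixed us vs g p x)"
      using CB_cont[OF m[of us vs]] by simp
  qed
  show "Cdr_norm d r \<Omega> g \<le> K"
    unfolding Cdr_norm_le_iff
    by (intro allI impI) (rule CB_bound[OF CB_mixed[OF assms]]; simp)
qed

text \<open>The order \<open>r\<close> is free: space derivatives vanish, and \<open>CB\<close>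
  never takes more than \<open>d\<close> parameter derivatives.\<close>

lemma CB_const_of_Ck:
  fixes h :: "'p::real_normed_vector \<Rightarrow> 'b::real_normed_vector"
  assumes "open U" "Ck_on d U h" "Ck_norm d U h \<le> K"
  shows "CB r d K (U \<times> UNIV) (\<lambda>p (x::'a::real_normed_vector). h p)"
  using assms(2,3)
proof (induction r arbitrary: d K h)
  have b: "ennreal (norm (foldr ddir vs h p)) \<le> K"
    if "Ck_norm d U h \<le> K" "p \<in> U" "length vs \<le> d" "\<forall>v\<in>set vs. norm v \<le> 1" for d K p vs and h :: "'p \<Rightarrow> 'b"
    using that unfolding Ck_norm_def by (auto simp: SUP_le_iff)
  have c: "continuous_on (U \<times> UNIV) (\<lambda>(p, x::'a). h p)" if "Ck_on d U h" for d and h :: "'p \<Rightarrow> 'b"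
  proof -
    have "continuous_on U h" using that[unfolded Ck_on_def, THEN conjunct2, rule_format, of "[]"] by simp
    then have "continuous_on (U \<times> UNIV) (\<lambda>z. h (fst z))"
      by (rule continuous_on_compose2) (auto intro!: continuous_intros)
    then show ?thesis by (simp add: case_prod_beta)
  qed
  have o: "open (U \<times> (UNIV :: 'a set))" using assms(1) by (simp add: open_Times)
  { case 0 then show ?case using c[OF 0(1)] b[OF 0(2), of _ "[]"] o by auto }
  { case (Suc r)
    have hd: "h differentiable (at p)" if "p \<in> U" "0 < d" for p
      using Suc.prems(1)[unfolded Ck_on_def, THEN conjunct1, rule_format, of "[]" p] that by simp
    show ?case
    proof (rule CB_SucI[where gx = "\<lambda>v p x. 0" and gp = "\<lambda>u p x. ddir u h p"])
      show "CB r (d - 1) (ennreal (norm u) * K) (U \<times> UNIV) (\<lambda>p (x::'a). ddir u h p)" if d: "0 < d" for u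
      proof -
        obtain w :: 'p where w: "norm w \<le> 1" "u = norm u *\<^sub>R w" using scale_unit_exists by blast
        have e: "foldr ddir vs (ddir w h) = foldr ddir (vs @ [w]) h" for vs :: "'p list" by simp
        have l: "length (vs @ [w]) < d" if "length vs < d - 1" for vs :: "'p list" using that by simp
        have l': "length (vs @ [w]) \<le> d" if "length vs \<le> d - 1" for vs :: "'p list" using that d by simp
        have "Ck_on (d - 1) U (ddir w h)"
          unfolding Ck_on_def e using Suc.prems(1)[unfolded Ck_on_def] l l' by blast
        moreover have "Ck_norm (d - 1) U (ddir w h) \<le> K"
          unfolding Ck_norm_def SUP_le_iff
        proof (intro ballI)
          fix vs :: "'p list" and p assume vs: "vs \<in> {vs. length vs \<le> d - 1 \<and> (\<forall>v\<in>set vs. norm v \<le> 1)}" and p: "p \<in> U"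
          show "ennreal (norm (foldr ddir vs (ddir w h) p)) \<le> K"
            unfolding e by (rule b[OF Suc.prems(2) p]) (use vs w(1) l' in auto)
        qed
        ultimately have "CB r (d - 1) K (U \<times> UNIV) (\<lambda>p (x::'a). ddir w h p)"
          by (rule Suc.IH)
        from CB_scale_norm[OF this, of "norm u"]
        have "CB r (d - 1) (ennreal (norm u) * K) (U \<times> UNIV) (\<lambda>p (x::'a). norm u *\<^sub>R ddir w h p)" by simp
        then show ?thesis
        proof (rule CB_cong_imp[rotated])
          fix p and x :: 'a assume "(p, x) \<in> U \<times> UNIV"
          then have "(h has_derivative (\<lambda>v. ddir v h p)) (at p)" using hd d by (auto intro: has_derivative_ddir)
          from linear_scale[OF has_derivative_linear[OF this], of "norm u" w]
          show "norm u *\<^sub>R ddir w h p = ddir u h p" using w(2) by simp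
        qed
      qed
      show "((\<lambda>p. h p) has_derivative (\<lambda>u. ddir u h p)) (at p)" if "0 < d" "(p, x) \<in> U \<times> UNIV" for p and x :: 'a
        using has_derivative_ddir[OF hd] that by auto
    qed (use o c[OF Suc.prems(1)] b[OF Suc.prems(2), of _ "[]"] CB_const_zero[OF o] in auto) }
qed

lemma Ck_of_CB:
  fixes h :: "'p::real_normed_vector \<Rightarrow> 'b::real_normed_vector"
  assumes "CB d d K (U \<times> UNIV) (\<lambda>p (x::'a::real_normed_vector). h p)"
  shows "Ck_on d U h"
proof -
  note g = Cdr_of_CB(1)[OF assms]
  have e: "mixed us [] (\<lambda>p (x::'a). h p) = (\<lambda>p x. foldr ddir us h p)" for us
  proof (induction us)
    case (Cons u us) then show ?case by (simp add: mixed_def dpar_def)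
  qed (simp add: mixed_def)
  have "foldr ddir vs h differentiable (at p)" if "length vs < d" "p \<in> U" for vs p
    using Cdr_on_par[OF g that(1), of "[]" p 0] that by (simp add: e)
  moreover have "continuous_on U (foldr ddir vs h)" if "length vs \<le> d" for vs
  proof -
    have "continuous_on (U \<times> UNIV) (\<lambda>(p, x::'a). foldr ddir vs h p)"
      using Cdr_on_cont[OF g that, of "[]"] that by (simp add: e)
    then have "continuous_on U (\<lambda>p. (\<lambda>(p, x::'a). foldr ddir vs h p) (p, 0))"
      by (rule continuous_on_compose2) (auto intro!: continuous_intros)
    then show ?thesis by simp
  qed
  ultimately show ?thesis unfolding Ck_on_def by auto
qed

section \<open>Calculus of the class without bounds\<close>

abbreviation CT :: "nat \<Rightarrow> nat \<Rightarrow> ('p::real_normed_vector \<times> 'a::real_normed_vector) set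
    \<Rightarrow> ('p \<Rightarrow> 'a \<Rightarrow> 'b::real_normed_vector) \<Rightarrow> bool" where
  "CT r d \<equiv> CB r d top"

lemma CT_const: "open \<Omega> \<Longrightarrow> CT r d \<Omega> (\<lambda>p x. c)"
  by (rule CB_const) auto

lemma CT_of_DB: "DB r d K \<Omega> g \<Longrightarrow> CT r d \<Omega> g"
  by (rule CB_I[OF DB_mono_K]) auto

lemma CT_space: "open \<Omega> \<Longrightarrow> CT r d \<Omega> (\<lambda>p x. x)"
  by (rule CT_of_DB[OF DB_linear[where L = "\<lambda>x. x"]]) (auto simp: bounded_linear_ident)

lemma CT_par: "open \<Omega> \<Longrightarrow> CT r d \<Omega> (\<lambda>p x. p)"
  by (rule CT_of_DB[OF DB_linear_par[where L = "\<lambda>x. x"]]) (auto simp: bounded_linear_ident)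

lemma CT_add: "CT r d \<Omega> f \<Longrightarrow> CT r d \<Omega> g \<Longrightarrow> CT r d \<Omega> (\<lambda>p x. f p x + g p x)"
  by (drule (1) CB_add) simp

lemma CT_mult:
  fixes f g :: "'p::real_normed_vector \<Rightarrow> 'a::real_normed_vector \<Rightarrow> real"
  shows "CT r d \<Omega> f \<Longrightarrow> CT r d \<Omega> g \<Longrightarrow> CT r d \<Omega> (\<lambda>p x. f p x * g p x)"
  by (drule (1) CB_mult, erule CB_top)

lemma CT_linear: "bounded_linear L \<Longrightarrow> CT r d \<Omega> g \<Longrightarrow> CT r d \<Omega> (\<lambda>p x. L (g p x))"
proof -
  assume L: "bounded_linear L" and g: "CT r d \<Omega> g"
  obtain c where "0 \<le> c" "\<And>v. norm (L v) \<le> norm v * c" using bounded_linear.nonneg_bounded[OF L] by blast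
  then show ?thesis using CB_top[OF CB_linear[OF g L, of c]] by (simp add: mult.commute)
qed

lemma CT_uminus: "CT r d \<Omega> g \<Longrightarrow> CT r d \<Omega> (\<lambda>p x. - g p x)"
  by (rule CT_linear[OF bounded_linear_minus[OF bounded_linear_ident]])

lemma CT_diff: "CT r d \<Omega> f \<Longrightarrow> CT r d \<Omega> g \<Longrightarrow> CT r d \<Omega> (\<lambda>p x. f p x - g p x)"
  using CT_add[OF _ CT_uminus, of r d \<Omega> f g] by simp

lemma CT_fst: "CT r d \<Omega> g \<Longrightarrow> CT r d \<Omega> (\<lambda>p x. fst (g p x))"
  by (rule CT_linear[OF bounded_linear_fst])

lemma CT_snd: "CT r d \<Omega> g \<Longrightarrow> CT r d \<Omega> (\<lambda>p x. snd (g p x))"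
  by (rule CT_linear[OF bounded_linear_snd])

lemma CB_Pair:
  assumes "CB r d K \<Omega> f" "CB r d L \<Omega> g"
  shows "CB r d (K + L) \<Omega> (\<lambda>p x. (f p x, g p x))"
proof -
  have "CB r d K \<Omega> (\<lambda>p x. (f p x, 0))"
    using CB_linear[OF assms(1) bounded_linear_Pair[OF bounded_linear_ident bounded_linear_zero], of 1] by simp
  moreover have "CB r d L \<Omega> (\<lambda>p x. (0, g p x))"
    using CB_linear[OF assms(2) bounded_linear_Pair[OF bounded_linear_zero bounded_linear_ident], of 1] by simp
  ultimately show ?thesis using CB_add by fastforce
qed

lemma DB_Pair:
  assumes "DB r d K \<Omega> f" "DB r d L \<Omega> g"
  shows "DB r d (K + L) \<Omega> (\<lambda>p x. (f p x, g p x))"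
proof -
  have "DB r d K \<Omega> (\<lambda>p x. (f p x, 0))"
    using DB_linear_comp[OF assms(1) bounded_linear_Pair[OF bounded_linear_ident bounded_linear_zero], of 1] by simp
  moreover have "DB r d L \<Omega> (\<lambda>p x. (0, g p x))"
    using DB_linear_comp[OF assms(2) bounded_linear_Pair[OF bounded_linear_zero bounded_linear_ident], of 1] by simp
  ultimately show ?thesis using DB_add by fastforce
qed

lemma CT_Pair: "CT r d \<Omega> f \<Longrightarrow> CT r d \<Omega> g \<Longrightarrow> CT r d \<Omega> (\<lambda>p x. (f p x, g p x))"
  by (drule (1) CB_Pair) simp

lemma CT_compose:
  fixes F :: "'p::euclidean_space \<Rightarrow> 'a::euclidean_space \<Rightarrow> 'b::real_normed_vector"
    and \<pi> :: "'q::real_normed_vector \<Rightarrow> 'p" and h :: "'q \<Rightarrow> 'x::real_normed_vector \<Rightarrow> 'a"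
  assumes "CT r d \<Omega>' F" "CT r d \<Omega> (\<lambda>q x. \<pi> q)" "CT r d \<Omega> h" "\<And>q x. (q, x) \<in> \<Omega> \<Longrightarrow> (\<pi> q, h q x) \<in> \<Omega>'"
  shows "CT r d \<Omega> (\<lambda>q x. F (\<pi> q) (h q x))"
  by (rule CB_top[OF CB_compose[OF assms(1) CB_DB[OF assms(2)] CB_DB[OF assms(3)] assms(4)]])

text \<open>The one-variable function is viewed as a family over the same parameter space that does
  not depend on the parameter; the parameter map is then the identity, which contributes the
  \<open>1\<close> in \<open>1 + K\<close>.\<close>

lemma CB_comp_fun:
  fixes \<theta> :: "real \<Rightarrow> real" and f :: "'q::euclidean_space \<Rightarrow> 'x::real_normed_vector \<Rightarrow> real"
  assumes "CB r d C (UNIV \<times> S) (\<lambda>(p::'q) y. \<theta> y)" "DB r d K \<Omega> f" "\<And>q x. (q, x) \<in> \<Omega> \<Longrightarrow> f q x \<in> S"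
  shows "CB r d (comp_const (1 + DIM('q)) (1 + K) r * C) \<Omega> (\<lambda>q x. \<theta> (f q x))"
proof -
  have "DB r d 1 \<Omega> (\<lambda>(q::'q) (x::'x). q)"
    by (rule DB_linear_par[where L = "\<lambda>x. x"]) (auto simp: bounded_linear_ident DB_open[OF assms(2)])
  from CB_compose[OF assms(1) this assms(2)] show ?thesis using assms(3) by simp
qed

text \<open>The derivative is minus the square of the function, so the product rule closes the
  induction. The implication \<open>K < top \<longrightarrow> C < top\<close> lets one statement
  serve both the quantitative use and the complement of \<open>0\<close>.\<close>

lemma CB_inverse_fun:
  assumes "open S" "0 \<notin> S" "\<And>y. y \<in> S \<Longrightarrow> ennreal \<bar>inverse y\<bar> \<le> K"
  shows "\<exists>C. (K < top \<longrightarrow> C < top) \<and> (\<forall>d. CB r d C (UNIV \<times> S) (\<lambda>(p::'p::real_normed_vector) (y::real). inverse y))"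
proof (induction r)
  have c: "continuous_on (UNIV \<times> S) (\<lambda>(p::'p, y). inverse y)"
    using assms(2) by (auto simp: case_prod_beta intro!: continuous_intros)
  have o: "open (UNIV \<times> S :: ('p \<times> real) set)" using assms(1) by (simp add: open_Times)
  { case 0 show ?case using c o assms(3) by (auto intro!: exI[of _ K]) }
  { case (Suc r)
    then obtain C where C: "K < top \<longrightarrow> C < top" and CB: "\<And>d. CB r d C (UNIV \<times> S) (\<lambda>(p::'p) (y::real). inverse y)" by auto
    let ?C = "K + 2 ^ r * (C * C)"
    have "CB (Suc r) d ?C (UNIV \<times> S) (\<lambda>(p::'p) (y::real). inverse y)" for d
    proof (rule CB_SucI[where gx = "\<lambda>v p y. - v * (inverse y * inverse y)" and gp = "\<lambda>v p y. 0"])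
      show "CB r d (ennreal (norm v) * ?C) (UNIV \<times> S) (\<lambda>(p::'p) y. - v * (inverse y * inverse y))" for v
      proof (rule CB_mono_K)
        show "CB r d (ennreal (norm v) * (2 ^ r * (C * C))) (UNIV \<times> S) (\<lambda>(p::'p) y. - v * (inverse y * inverse y))"
          using CB_scale_norm[OF CB_mult[OF CB[of d] CB[of d]], of "- v"] by simp
        show "ennreal (norm v) * (2 ^ r * (C * C)) \<le> ennreal (norm v) * ?C" by (intro mult_left_mono) auto
      qed
      show "(inverse has_derivative (\<lambda>v. - v * (inverse y * inverse y))) (at y)" if "(p, y) \<in> UNIV \<times> S" for p :: 'p and y
        by (rule has_derivative_eq_rhs[OF DERIV_inverse[unfolded has_field_derivative_def]])
          (use that assms(2) in \<open>auto simp: fun_eq_iff\<close>)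
      show "ennreal (norm (inverse y)) \<le> ?C" if "(p, y) \<in> UNIV \<times> S" for p :: 'p and y
        using assms(3)[of y] that by (auto intro: add_increasing2)
    qed (use c o CB_const_zero[OF o] in auto)
    moreover have "K < top \<longrightarrow> ?C < top"
      using C by (auto simp: ennreal_mult_less_top ennreal_add_less_top power_less_top_ennreal)
    ultimately show ?case by blast }
qed

lemma CB_exp_fun:
  assumes "open S" "\<And>y. y \<in> S \<Longrightarrow> ennreal (exp y) \<le> K"
  shows "CB r d K (UNIV \<times> S) (\<lambda>(p::'p::real_normed_vector) (y::real). exp y)"
proof (induction r arbitrary: d)
  have c: "continuous_on (UNIV \<times> S) (\<lambda>(p::'p, y). exp y)"
    by (auto simp: case_prod_beta intro!: continuous_intros)
  have o: "open (UNIV \<times> S :: ('p \<times> real) set)" using assms(1) by (simp add: open_Times)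
  { case 0 show ?case using c o assms(2) by auto }
  { case (Suc r)
    show ?case
    proof (rule CB_SucI[where gx = "\<lambda>v p y. v * exp y" and gp = "\<lambda>v p y. 0"])
      show "CB r d (ennreal (norm v) * K) (UNIV \<times> S) (\<lambda>(p::'p) y. v * exp y)" for v
        using CB_scale_norm[OF Suc, of d v] by simp
      show "(exp has_derivative (\<lambda>v. v * exp y)) (at y)" if "(p, y) \<in> UNIV \<times> S" for p :: 'p and y
        using DERIV_exp[of y] unfolding has_field_derivative_def by (simp add: mult_commute_abs)
    qed (use c o assms(2) CB_const_zero[OF o] in auto) }
qed

lemma CT_inverse:
  fixes f :: "'q::euclidean_space \<Rightarrow> 'x::real_normed_vector \<Rightarrow> real"
  assumes "CT r d \<Omega> f" "\<And>q x. (q, x) \<in> \<Omega> \<Longrightarrow> f q x \<noteq> 0"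
  shows "CT r d \<Omega> (\<lambda>q x. inverse (f q x))"
proof -
  obtain C where "CB r d C (UNIV \<times> (- {0})) (\<lambda>(p::'q) (y::real). inverse y)"
    using CB_inverse_fun[of "- {0::real}" top] by auto
  from CB_top[OF CB_comp_fun[OF this CB_DB[OF assms(1)]]] assms(2) show ?thesis by auto
qed

lemma CT_divide:
  fixes f :: "'q::euclidean_space \<Rightarrow> 'x::real_normed_vector \<Rightarrow> real"
  assumes "CT r d \<Omega> f" "CT r d \<Omega> g" "\<And>q x. (q, x) \<in> \<Omega> \<Longrightarrow> g q x \<noteq> 0"
  shows "CT r d \<Omega> (\<lambda>q x. f q x / g q x)"
  unfolding divide_inverse by (rule CT_mult[OF assms(1) CT_inverse[OF assms(2,3)]])

text \<open>Bootstrap: if \<open>\<theta>'\<close> is at least as regular as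
  \<open>\<theta>\<close>, each order of regularity yields the next, starting from
  continuity.\<close>

lemma CT_fun_of_derivative:
  fixes \<theta> :: "real \<Rightarrow> real" and f :: "'q::euclidean_space \<Rightarrow> 'x::real_normed_vector \<Rightarrow> real"
  assumes S: "open S" and D: "\<And>y. y \<in> S \<Longrightarrow> (\<theta> has_real_derivative \<theta>' y) (at y)"
    and \<theta>': "\<And>r d. CT r d (UNIV \<times> S) (\<lambda>(p::'q) y. \<theta> y) \<Longrightarrow> CT r d (UNIV \<times> S) (\<lambda>(p::'q) y. \<theta>' y)"
    and f: "CT r d \<Omega> f" "\<And>q x. (q, x) \<in> \<Omega> \<Longrightarrow> f q x \<in> S"
  shows "CT r d \<Omega> (\<lambda>q x. \<theta> (f q x))"
proof -
  have o: "open (UNIV \<times> S :: ('q \<times> real) set)" using S by (simp add: open_Times)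
  have "continuous_on S \<theta>" using D by (auto intro!: continuous_at_imp_continuous_on DERIV_isCont)
  then have c: "continuous_on (UNIV \<times> S) (\<lambda>(p::'q, y). \<theta> y)"
    unfolding case_prod_beta by (rule continuous_on_compose2) (auto intro!: continuous_intros)
  have "CT r d (UNIV \<times> S) (\<lambda>(p::'q) y. \<theta> y)" for r d
  proof (induction r arbitrary: d)
    case 0 show ?case using c o by auto
  next
    case (Suc r)
    show ?case
    proof (rule CB_SucI[where gx = "\<lambda>v p y. v * \<theta>' y" and gp = "\<lambda>v p y. 0"])
      show "CB r d (ennreal (norm v) * top) (UNIV \<times> S) (\<lambda>(p::'q) y. v * \<theta>' y)" for v
        using CB_scale_norm[OF \<theta>'[OF Suc], of d v] by simp
      show "(\<theta> has_derivative (\<lambda>v. v * \<theta>' y)) (at y)" if "(p, y) \<in> UNIV \<times> S" for p :: 'q and y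
        using D[of y] that unfolding has_field_derivative_def by (simp add: mult_commute_abs)
    qed (use c o CB_const_zero[OF o] in auto)
  qed
  from CB_top[OF CB_comp_fun[OF this CB_DB[OF f(1)] f(2)]] show ?thesis by simp
qed

lemma CT_ln:
  fixes f :: "'q::euclidean_space \<Rightarrow> 'x::real_normed_vector \<Rightarrow> real"
  assumes f: "CT r d \<Omega> f" "\<And>q x. (q, x) \<in> \<Omega> \<Longrightarrow> 0 < f q x"
  shows "CT r d \<Omega> (\<lambda>q x. ln (f q x))"
proof (rule CT_fun_of_derivative[where S = "{0<..}" and \<theta>' = inverse, OF _ _ _ f(1)])
  show "CT r d (UNIV \<times> {0<..}) (\<lambda>(p::'q) y. inverse (y::real))" for r d
    by (rule CT_inverse[OF CT_space]) (auto simp: open_Times)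
qed (use f(2) in \<open>auto intro!: DERIV_ln\<close>)

lemma CT_exp:
  fixes f :: "'q::euclidean_space \<Rightarrow> 'x::real_normed_vector \<Rightarrow> real"
  assumes f: "CT r d \<Omega> f"
  shows "CT r d \<Omega> (\<lambda>q x. exp (f q x))"
  by (rule CT_fun_of_derivative[where S = UNIV and \<theta>' = exp, OF _ _ _ f]) auto

text \<open>The derivative is written as the root itself times a rational function, which makes the
  bootstrap applicable. For even \<open>n\<close> the argument stays positive, for odd
  \<open>n\<close> it only avoids \<open>0\<close>.\<close>

lemma CT_root:
  fixes f :: "'q::euclidean_space \<Rightarrow> 'x::real_normed_vector \<Rightarrow> real"
  assumes f: "CT r d \<Omega> f" "\<And>q x. (q, x) \<in> \<Omega> \<Longrightarrow> f q x \<noteq> 0 \<and> (even n \<longrightarrow> 0 < f q x)" and n: "0 < n"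
  shows "CT r d \<Omega> (\<lambda>q x. root n (f q x))"
proof (rule CT_fun_of_derivative[where S = "{y. y \<noteq> 0 \<and> (even n \<longrightarrow> 0 < y)}"
      and \<theta>' = "\<lambda>y. root n y * (inverse y * inverse (real n))", OF _ _ _ f(1)])
  have "{y. y \<noteq> 0 \<and> (even n \<longrightarrow> 0 < y)} = (if even n then {0<..} else - {0::real})" by auto
  then show o: "open {y. y \<noteq> 0 \<and> (even n \<longrightarrow> 0 < (y::real))}" by (simp add: open_Compl)
  show "(root n has_real_derivative root n y * (inverse y * inverse (real n))) (at y)"
    if y: "y \<in> {y. y \<noteq> 0 \<and> (even n \<longrightarrow> 0 < y)}" for y
  proof -
    have "root n y ^ n = y" using y n by (cases "even n") (auto simp: odd_real_root_pow)
    moreover have "root n y ^ n = root n y * root n y ^ (n - Suc 0)" using n by (cases n) auto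
    ultimately have "inverse (real n * root n y ^ (n - Suc 0)) = root n y * (inverse y * inverse (real n))"
      using y n by (auto simp: field_simps)
    then show ?thesis using y n by (intro DERIV_real_root_generic) auto
  qed
  show "CT r d (UNIV \<times> {y. y \<noteq> 0 \<and> (even n \<longrightarrow> 0 < y)}) (\<lambda>(p::'q) y. root n y * (inverse y * inverse (real n)))"
    if "CT r d (UNIV \<times> {y. y \<noteq> 0 \<and> (even n \<longrightarrow> 0 < y)}) (\<lambda>(p::'q) y. root n y)" for r d
    by (intro CT_mult[OF that] CT_mult CT_inverse[OF CT_space] CT_const) (use o in \<open>auto simp: open_Times\<close>)
qed (use f(2) in auto)

lemma DB_Suc_Basis:
  fixes g :: "'p::euclidean_space \<Rightarrow> 'a::euclidean_space \<Rightarrow> 'b::real_normed_vector"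
  assumes g: "DB (Suc r0) d K0 \<Omega> g"
    and x: "\<And>b. b \<in> Basis \<Longrightarrow> CB r d K \<Omega> (dspace b g)"
    and p: "\<And>b. b \<in> Basis \<Longrightarrow> 0 < d \<Longrightarrow> CB r (d - 1) K \<Omega> (dpar b g)"
  shows "DB (Suc r) d (of_nat (DIM('a) + DIM('p)) * K) \<Omega> g"
proof (rule DB_SucI'[OF g order_refl DB_open[OF g] order_refl])
  have s: "CB r e (ennreal (norm v) * K) \<Omega> (\<lambda>p x. (v \<bullet> b) *\<^sub>R f p x)" if "b \<in> Basis" "CB r e K \<Omega> f"
    for v b :: "'z::euclidean_space" and f e
    by (rule CB_mono_K[OF CB_scale_norm[OF that(2), of "v \<bullet> b"]])
      (intro mult_right_mono ennreal_leI Basis_le_norm that, simp)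
  show "CB r d (ennreal (norm v) * (of_nat (DIM('a) + DIM('p)) * K)) \<Omega> (dspace v g)" for v
  proof (rule CB_cong_imp)
    have "CB r d (\<Sum>b\<in>(Basis::'a set). ennreal (norm v) * K) \<Omega> (\<lambda>p x. \<Sum>b\<in>Basis. (v \<bullet> b) *\<^sub>R dspace b g p x)"
      by (rule CB_sum[OF finite_Basis DB_open[OF g]]) (rule s[OF _ x])
    then show "CB r d (ennreal (norm v) * (of_nat (DIM('a) + DIM('p)) * K)) \<Omega> (\<lambda>p x. \<Sum>b\<in>Basis. (v \<bullet> b) *\<^sub>R dspace b g p x)"
      by (rule CB_mono_K) (simp add: distrib_left distrib_right mult_ac)
  qed (rule has_derivative_expand[OF DB_diff_space[OF g], symmetric])
  show "CB r (d - 1) (ennreal (norm v) * (of_nat (DIM('a) + DIM('p)) * K)) \<Omega> (dpar v g)" if d: "0 < d" for v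
  proof (rule CB_cong_imp)
    have "CB r (d - 1) (\<Sum>b\<in>(Basis::'p set). ennreal (norm v) * K) \<Omega> (\<lambda>p x. \<Sum>b\<in>Basis. (v \<bullet> b) *\<^sub>R dpar b g p x)"
      by (rule CB_sum[OF finite_Basis DB_open[OF g]]) (rule s[OF _ p[OF _ d]])
    then show "CB r (d - 1) (ennreal (norm v) * (of_nat (DIM('a) + DIM('p)) * K)) \<Omega> (\<lambda>p x. \<Sum>b\<in>Basis. (v \<bullet> b) *\<^sub>R dpar b g p x)"
      by (rule CB_mono_K) (simp add: distrib_left distrib_right mult_ac)
  qed (rule has_derivative_expand[OF DB_diff_par[OF g d], symmetric])
qed

section \<open>Inverse maps and integration of derivatives\<close>

text \<open>With \<open>K = top\<close> the weight \<open>norm v * top\<close> is \<open>top\<close>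
  except for \<open>v = 0\<close>, where it is \<open>0\<close>; there the derivative vanishes by
  linearity.\<close>

lemma CT_SucI:
  assumes o: "open \<Omega>" "continuous_on \<Omega> (\<lambda>(p, x). g p x)"
    and x: "\<And>p x. (p, x) \<in> \<Omega> \<Longrightarrow> (g p has_derivative (\<lambda>v. gx v p x)) (at x)"
    and gx: "\<And>v. CT r d \<Omega> (gx v)"
    and p: "\<And>p x. 0 < d \<Longrightarrow> (p, x) \<in> \<Omega> \<Longrightarrow> ((\<lambda>p. g p x) has_derivative (\<lambda>u. gp u p x)) (at p)"
    and gp: "\<And>u. 0 < d \<Longrightarrow> CT r (d - 1) \<Omega> (gp u)"
  shows "CT (Suc r) d \<Omega> g"
proof (rule CB_SucI[OF o _ x _ p])
  show "CB r d (ennreal (norm v) * top) \<Omega> (gx v)" for v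
  proof (cases "v = 0")
    case True
    have "gx 0 p x = 0" if "(p, x) \<in> \<Omega>" for p x
      using linear_0[OF has_derivative_linear[OF x[OF that]]] .
    then show ?thesis using CB_cong_imp[OF _ CB_const_zero[OF o(1)], of "gx 0"] True by simp
  next
    case False then show ?thesis using gx by (simp add: ennreal_mult_top)
  qed
  show "CB r (d - 1) (ennreal (norm u) * top) \<Omega> (gp u)" if d: "0 < d" for u
  proof (cases "u = 0")
    case True
    have "gp 0 q x = 0" if "(q, x) \<in> \<Omega>" for q x
      using linear_0[OF has_derivative_linear[OF p[OF d that]]] .
    then show ?thesis using CB_cong_imp[OF _ CB_const_zero[OF o(1)], of "gp 0"] True by simp
  next
    case False then show ?thesis using gp[OF d] by (simp add: ennreal_mult_top)
  qed
qed auto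

lemma linear_plane_expand:
  assumes "linear (D :: real \<times> real \<Rightarrow> 'b::real_vector)"
  shows "D w = fst w *\<^sub>R D (1, 0) + snd w *\<^sub>R D (0, 1)"
proof -
  have "w = fst w *\<^sub>R (1, 0) + snd w *\<^sub>R (0, 1)" by (simp add: prod_eq_iff)
  then have "D w = D (fst w *\<^sub>R (1, 0) + snd w *\<^sub>R (0, 1))" by simp
  also have "\<dots> = fst w *\<^sub>R D (1, 0) + snd w *\<^sub>R D (0, 1)"
    by (simp only: linear_add[OF assms] linear_scale[OF assms])
  finally show ?thesis .
qed

lemma jac_dspace:
  "jac (\<Phi> p) z = fst (dspace (1, 0) \<Phi> p z) * snd (dspace (0, 1) \<Phi> p z)
     - fst (dspace (0, 1) \<Phi> p z) * snd (dspace (1, 0) \<Phi> p z)"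
  by (simp add: jac_def dspace_def)

text \<open>Inverse function theorem with parameters for an inverse already known to be continuous.
  The derivative of \<open>G\<close> is the inverse matrix of \<open>D\<Phi>\<close> evaluated at
  \<open>G\<close>, hence as regular as \<open>G\<close> is so far, and induction on the order
  concludes.\<close>

lemma CT_planar_inverse:
  fixes \<Phi> G :: "'p::euclidean_space \<Rightarrow> real \<times> real \<Rightarrow> real \<times> real"
  assumes "CT r d \<Omega>' \<Phi>" and o: "open \<Omega>" and cont: "continuous_on \<Omega> (\<lambda>(p, z). G p z)"
    and dom: "\<And>p z. (p, z) \<in> \<Omega> \<Longrightarrow> (p, G p z) \<in> \<Omega>'"
    and inv: "\<And>p z. (p, z) \<in> \<Omega> \<Longrightarrow> \<Phi> p (G p z) = z"
    and jac: "\<And>p z. (p, z) \<in> \<Omega> \<Longrightarrow> jac (\<Phi> p) (G p z) \<noteq> 0"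
  shows "CT r d \<Omega> G"
  using assms(1)
proof (induction r arbitrary: d)
  case 0 then show ?case using o cont by auto
next
  case (Suc r)
  note \<Phi> = Suc.prems
  define a where "a p z = fst (dspace (1, 0) \<Phi> p (G p z))" for p z
  define b where "b p z = fst (dspace (0, 1) \<Phi> p (G p z))" for p z
  define c where "c p z = snd (dspace (1, 0) \<Phi> p (G p z))" for p z
  define e where "e p z = snd (dspace (0, 1) \<Phi> p (G p z))" for p z
  define J where "J p z = a p z * e p z - b p z * c p z" for p z
  \<comment> \<open>Cramer's rule: \<open>N p z\<close> is the inverse of the derivative of
    \<open>\<Phi> p\<close> at \<open>G p z\<close>.\<close>
  define N where "N p z w = ((e p z * fst w - b p z * snd w) / J p z, (a p z * snd w - c p z * fst w) / J p z)" for p z and w :: "real \<times> real"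
  have J0: "J p z \<noteq> 0" if "(p, z) \<in> \<Omega>" for p z
    using jac[OF that] by (simp add: jac_dspace J_def a_def b_def c_def e_def)
  have G: "CT r d' \<Omega> G" if "d' \<le> d" for d'
    by (rule Suc.IH) (rule CB_mono_d[OF CB_SucD[OF \<Phi>] that])
  have comp: "CT r d' \<Omega> (\<lambda>p z. F p (G p z))" if "CT r d' \<Omega>' F" "d' \<le> d" for F d'
    by (rule CT_compose[OF that(1) CT_par[OF o] G[OF that(2)] dom])
  have abce: "CT r d' \<Omega> a" "CT r d' \<Omega> b" "CT r d' \<Omega> c" "CT r d' \<Omega> e" if "d' \<le> d" for d'
  proof -
    have "CT r d' \<Omega> (\<lambda>p z. dspace v \<Phi> p (G p z))" for v
      by (rule comp[OF _ that]) (rule CB_mono_d[OF CB_top[OF CB_dspace[OF \<Phi>]] that])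
    then show "CT r d' \<Omega> a" "CT r d' \<Omega> b" "CT r d' \<Omega> c" "CT r d' \<Omega> e"
      unfolding a_def b_def c_def e_def by (auto intro: CT_fst CT_snd)
  qed
  have N: "CT r d' \<Omega> (\<lambda>p z. N p z (w p z))" if "d' \<le> d" "CT r d' \<Omega> w" for w d'
    unfolding N_def J_def
    by (intro CT_Pair CT_divide CT_diff CT_mult CT_fst CT_snd abce[OF that(1)] that(2))
      (use J0 in \<open>auto simp: J_def\<close>)
  define D where "D p z w = dspace w \<Phi> p (G p z)" for p z w
  have lin: "linear (D p z)" if "(p, z) \<in> \<Omega>" for p z
    unfolding D_def using has_derivative_linear[OF CB_diff_space[OF \<Phi> dom[OF that]]] .
  have ND: "N p z (D p z w) = w" if "(p, z) \<in> \<Omega>" for p z w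
  proof -
    have "fst (D p z w) = fst w * a p z + snd w * b p z" "snd (D p z w) = fst w * c p z + snd w * e p z"
      using linear_plane_expand[OF lin[OF that], of w] unfolding a_def b_def c_def e_def D_def by simp_all
    then have "N p z (D p z w) = (fst w * J p z / J p z, snd w * J p z / J p z)"
      unfolding N_def J_def by (simp add: algebra_simps)
    then show ?thesis using J0[OF that] by simp
  qed
  have linN: "linear (N p z)" for p z
    unfolding N_def by (rule linearI) (auto simp: algebra_simps add_divide_distrib diff_divide_distrib)
  show ?case
  proof (rule CT_SucI[where gx = "\<lambda>v p z. N p z v" and gp = "\<lambda>u p z. - N p z (dpar u \<Phi> p (G p z))"])
    show "CT r d \<Omega> (\<lambda>p z. N p z v)" for v by (rule N[OF order_refl CT_const[OF o]])
    show "CT r (d - 1) \<Omega> (\<lambda>p z. - N p z (dpar u \<Phi> p (G p z)))" if "0 < d" for u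
      by (rule CT_uminus[OF N[OF diff_le_self comp[OF CB_top[OF CB_dpar[OF \<Phi> that]] diff_le_self]]])
    fix p z assume pz: "(p, z) \<in> \<Omega>"
    have cG: "isCont (\<lambda>(p, z). G p z) (p, z)" using cont o pz by (simp add: continuous_on_eq_continuous_at)
    have "isCont (\<lambda>z'. (p, z')) z" by (intro continuous_intros)
    from isCont_o2[OF this cG] have cGp: "isCont (G p) z" by simp
    show "(G p has_derivative N p z) (at z)"
    proof (rule has_derivative_inverse_basic[where f = "\<Phi> p" and f' = "D p z" and T = "{z. (p, z) \<in> \<Omega>}"])
      show "(\<Phi> p has_derivative D p z) (at (G p z))"
        unfolding D_def by (rule CB_diff_space[OF \<Phi> dom[OF pz]])
      show "bounded_linear (N p z)" using linN by (simp add: linear_conv_bounded_linear)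
      show "N p z \<circ> D p z = id" using ND[OF pz] by (auto simp: fun_eq_iff)
    qed (use cGp open_slice_space[OF o] pz inv in auto)
    assume d: "0 < d"
    \<comment> \<open>Differentiability in the parameter comes from inverting the extended map
      \<open>(p, z) \<mapsto> (p, \<Phi> p z)\<close>, whose derivative \<open>E\<close> is block
      triangular with inverse \<open>N'\<close>.\<close>
    define E where "E w = (fst w, dpar (fst w) \<Phi> p (G p z) + D p z (snd w))" for w
    define N' where "N' w = (fst w, N p z (snd w - dpar (fst w) \<Phi> p (G p z)))" for w
    have lp: "linear (\<lambda>u. dpar u \<Phi> p (G p z))"
      by (rule has_derivative_linear[OF CB_diff_par[OF \<Phi> d dom[OF pz]]])
    have "((\<lambda>w. (fst w, G (fst w) (snd w))) has_derivative N') (at (p, z))"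
    proof (rule has_derivative_inverse_basic[where f = "\<lambda>w. (fst w, \<Phi> (fst w) (snd w))" and f' = E and T = \<Omega>])
      show "((\<lambda>w. (fst w, \<Phi> (fst w) (snd w))) has_derivative E) (at (fst (p, z), G (fst (p, z)) (snd (p, z))))"
        unfolding E_def D_def fst_conv snd_conv
        by (rule has_derivative_Pair[OF has_derivative_fst[OF has_derivative_ident] CB_has_derivative_joint[OF \<Phi> d dom[OF pz]]])
      have "linear N'"
        unfolding N'_def
        by (rule linearI) (auto simp: linear_add[OF lp] linear_scale[OF lp] linear_diff[OF linN] linear_add[OF linN] linear_scale[OF linN] algebra_simps)
      then show "bounded_linear N'" by (simp add: linear_conv_bounded_linear)
      show "N' \<circ> E = id" using ND[OF pz] by (auto simp: fun_eq_iff N'_def E_def)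
      show "isCont (\<lambda>w. (fst w, G (fst w) (snd w))) (p, z)"
        using cG by (intro continuous_intros) (simp add: case_prod_beta')
    qed (use o pz inv in auto)
    from has_derivative_snd[OF this]
    have 1: "((\<lambda>w. G (fst w) (snd w)) has_derivative (\<lambda>w. snd (N' w))) (at (p, z))" by simp
    have 2: "((\<lambda>p. (p, z)) has_derivative (\<lambda>u. (u, 0))) (at p)"
      by (rule has_derivative_Pair[OF has_derivative_ident has_derivative_const])
    have "((\<lambda>p. G p z) has_derivative (\<lambda>u. snd (N' (u, 0)))) (at p)"
      using has_derivative_compose[where f = "\<lambda>p. (p, z)" and g = "\<lambda>w. G (fst w) (snd w)", OF 2 1] by simp
    then show "((\<lambda>p. G p z) has_derivative (\<lambda>u. - N p z (dpar u \<Phi> p (G p z)))) (at p)"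
      by (simp add: N'_def linear_neg[OF linN])
  qed (use o cont in auto)
qed

section \<open>Integration of space derivatives\<close>

lemma CB_swap_par_CB:
  fixes g :: "'p::real_normed_vector \<Rightarrow> 'a::euclidean_space \<Rightarrow> 'b::real_normed_vector"
  assumes g: "CT (Suc (Suc r)) d \<Omega> g" and d: "0 < d" and w: "CB (Suc m) d K \<Omega> (dspace w g)"
  shows "CB m (d - 1) (ennreal (norm u) * K) \<Omega> (dspace w (dpar u g))"
  by (rule CB_cong_imp[OF _ CB_dpar[OF w d]]) (rule CB_swap_par[OF g d, symmetric])

lemma CB_swap_space_CB:
  fixes g :: "'p::real_normed_vector \<Rightarrow> 'a::euclidean_space \<Rightarrow> 'b::real_normed_vector"
  assumes g: "CT (Suc (Suc r)) d \<Omega> g" and w: "CB (Suc m) d K \<Omega> (dspace w g)"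
  shows "CB m d (ennreal (norm v) * K) \<Omega> (dspace w (dspace v g))"
  by (rule CB_cong_imp[OF _ CB_dspace[OF w]]) (rule CB_swap_space[OF g])

text \<open>Integration from \<open>\<kappa> x\<close> to \<open>x\<close> uses derivatives along
  the kernel of the projection \<open>\<kappa>\<close> only. The directions in its range and the
  parameter directions differentiate the identity \<open>g p (\<kappa> x) = 0\<close>, so those
  derivatives vanish on the range as well and the induction applies to them.\<close>

lemma CB_vanish:
  fixes g :: "'p::real_normed_vector \<Rightarrow> 'a::euclidean_space \<Rightarrow> 'b::real_normed_vector"
  assumes \<kappa>: "bounded_linear \<kappa>" "\<And>v. \<kappa> (\<kappa> v) = \<kappa> v" "\<And>v. norm (\<kappa> v) \<le> norm v" "\<And>v. norm (v - \<kappa> v) \<le> norm v"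
    and seg: "\<And>p x t. (p, x) \<in> \<Omega> \<Longrightarrow> 0 \<le> t \<Longrightarrow> t \<le> 1 \<Longrightarrow> (p, \<kappa> x + t *\<^sub>R (x - \<kappa> x)) \<in> \<Omega>"
    and B: "0 \<le> B" "\<And>p x. (p, x) \<in> \<Omega> \<Longrightarrow> norm (x - \<kappa> x) \<le> B"
  shows "CT (Suc m) d \<Omega> g \<Longrightarrow> (\<And>p x. (p, x) \<in> \<Omega> \<Longrightarrow> g p (\<kappa> x) = 0) \<Longrightarrow>
    (\<And>w. \<kappa> w = 0 \<Longrightarrow> CB m d (ennreal (norm w) * K) \<Omega> (dspace w g)) \<Longrightarrow> CB m d (ennreal (B + 1 + real m) * K) \<Omega> g"
proof (induction m arbitrary: d K g)
  have \<kappa>lin: "\<kappa> (v - w) = \<kappa> v - \<kappa> w" for v w using \<kappa>(1) by (simp add: bounded_linear.linear linear_diff)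
  have bound: "ennreal (norm (g p x)) \<le> ennreal (B + 1 + real m) * K"
    if g: "CT (Suc m) d \<Omega> g" and z: "\<And>p x. (p, x) \<in> \<Omega> \<Longrightarrow> g p (\<kappa> x) = 0"
      and w: "\<And>w. \<kappa> w = 0 \<Longrightarrow> CB m d (ennreal (norm w) * K) \<Omega> (dspace w g)" and px: "(p, x) \<in> \<Omega>"
    for m d K p x and g :: "'p \<Rightarrow> 'a \<Rightarrow> 'b"
  proof (cases K)
    case top
    \<comment> \<open>A zero factor would turn \<open>top\<close> into \<open>0\<close>, hence the
      \<open>+ 1\<close> in the constant also for \<open>B = 0\<close>.\<close>
    have "ennreal (B + 1 + real m) \<noteq> 0" using B(1) by simp
    then show ?thesis using top by (simp add: ennreal_mult_top)
  next
    case (real k)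
    let ?w = "x - \<kappa> x"
    have kw: "\<kappa> ?w = 0" using \<kappa>lin \<kappa>(2) by simp
    \<comment> \<open>Mean value inequality on the segment from the zero \<open>\<kappa> x\<close>
      to \<open>x\<close>, whose direction lies in the kernel.\<close>
    have "norm (g p (\<kappa> x + 1 *\<^sub>R ?w) - g p (\<kappa> x + 0 *\<^sub>R ?w)) \<le> (norm ?w * k) * norm (1 - 0 :: real)"
    proof (rule differentiable_bound[where S = "{0..1}" and f = "\<lambda>t. g p (\<kappa> x + t *\<^sub>R ?w)"
          and f' = "\<lambda>t h. dspace (h *\<^sub>R ?w) g p (\<kappa> x + t *\<^sub>R ?w)"])
      fix t :: real assume t: "t \<in> {0..1}"
      then have i: "(p, \<kappa> x + t *\<^sub>R ?w) \<in> \<Omega>" using seg[OF px] by simp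
      note D = CB_diff_space[OF g i]
      show "((\<lambda>t. g p (\<kappa> x + t *\<^sub>R ?w)) has_derivative (\<lambda>h. dspace (h *\<^sub>R ?w) g p (\<kappa> x + t *\<^sub>R ?w))) (at t within {0..1})"
        by (rule has_derivative_line[where f = "g p", OF D])
      show "onorm (\<lambda>h. dspace (h *\<^sub>R ?w) g p (\<kappa> x + t *\<^sub>R ?w)) \<le> norm ?w * k"
      proof (rule onorm_le)
        fix h :: real
        have "ennreal (norm (dspace ?w g p (\<kappa> x + t *\<^sub>R ?w))) \<le> ennreal (norm ?w) * K"
          by (rule CB_bound[OF w[OF kw] i])
        then have "norm (dspace ?w g p (\<kappa> x + t *\<^sub>R ?w)) \<le> norm ?w * k"
          using real by (simp flip: ennreal_mult)
        then show "norm (dspace (h *\<^sub>R ?w) g p (\<kappa> x + t *\<^sub>R ?w)) \<le> norm ?w * k * norm h"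
          by (simp add: linear_scale[OF has_derivative_linear[OF D]] mult_left_mono mult.commute)
      qed
    qed auto
    then have "norm (g p x) \<le> norm ?w * k" using z[OF px] by simp
    also have "\<dots> \<le> (B + 1 + real m) * k" using B(2)[OF px] real by (intro mult_right_mono) auto
    finally have "ennreal (norm (g p x)) \<le> ennreal ((B + 1 + real m) * k)" by (rule ennreal_leI)
    also have "\<dots> = ennreal (B + 1 + real m) * K" using real B(1) by (simp only: ennreal_mult)
    finally show ?thesis .
  qed
  { case 0
    show ?case using bound[OF 0] CB_open[OF 0(1)] CB_cont[OF 0(1)] by auto }
  { case (Suc m)
    note g = Suc.prems(1) and z = Suc.prems(2) and w = Suc.prems(3)
    let ?C = "ennreal (B + 1 + real m)" and ?C' = "ennreal (B + 1 + real (Suc m))"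
    \<comment> \<open>One unit per order: splitting \<open>v\<close> into \<open>\<kappa> v\<close>
      and \<open>v - \<kappa> v\<close> costs the inductive constant for the first part and
      \<open>1\<close> for the second.\<close>
    have C': "?C' = ?C + 1" using B(1) by (simp add: ac_simps flip: ennreal_plus ennreal_1)
    show ?case
    proof (rule CB_SucI'[OF CB_DB[OF g] order_refl CB_open[OF g] order_refl])
      fix v :: 'a
      have 1: "CB m d (?C * (ennreal (norm v) * K)) \<Omega> (dspace (\<kappa> v) g)"
      proof (rule Suc.IH[OF CB_top[OF CB_dspace[OF g]]])
        fix p x assume px: "(p, x) \<in> \<Omega>"
        then have i: "(p, \<kappa> x) \<in> \<Omega>" using seg[OF px, of 0] by simp
        have i': "(p, \<kappa> (\<kappa> x)) \<in> \<Omega>" using i \<kappa>(2) by simp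
        have "((\<lambda>y. g p (\<kappa> y)) has_derivative (\<lambda>v. dspace (\<kappa> v) g p (\<kappa> (\<kappa> x)))) (at (\<kappa> x))"
          by (rule has_derivative_compose[where f = \<kappa> and g = "g p", OF bounded_linear_imp_has_derivative[OF \<kappa>(1)] CB_diff_space[OF g i']])
        then have "((\<lambda>y. 0) has_derivative (\<lambda>v. dspace (\<kappa> v) g p (\<kappa> (\<kappa> x)))) (at (\<kappa> x))"
          by (rule has_derivative_transform_within_open[OF _ open_slice_space[OF CB_open[OF g], of p]]) (use i z in auto)
        from has_derivative_unique[OF this has_derivative_const]
        show "dspace (\<kappa> v) g p (\<kappa> x) = 0" using \<kappa>(2) by metis
      next
        fix u assume "\<kappa> u = 0"
        from CB_swap_space_CB[OF g w[OF this], of "\<kappa> v"]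
        show "CB m d (ennreal (norm u) * (ennreal (norm v) * K)) \<Omega> (dspace u (dspace (\<kappa> v) g))"
          by (rule CB_mono_K) (use \<kappa>(3)[of v] in \<open>auto simp: mult.left_commute[of "ennreal (norm u)"] intro!: mult_right_mono ennreal_leI\<close>)
      qed
      have 2: "CB m d (ennreal (norm v) * K) \<Omega> (dspace (v - \<kappa> v) g)"
        by (rule CB_mono_K[OF CB_SucD[OF w]]) (use \<kappa>(2,4) \<kappa>lin in \<open>auto intro!: mult_right_mono ennreal_leI\<close>)
      have "CB m d (?C * (ennreal (norm v) * K) + ennreal (norm v) * K) \<Omega> (dspace v g)"
      proof (rule CB_cong_imp[OF _ CB_add[OF 1 2]])
        fix p x assume "(p, x) \<in> \<Omega>"
        from linear_add[OF has_derivative_linear[OF CB_diff_space[OF g this]], of "\<kappa> v" "v - \<kappa> v"]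
        show "dspace (\<kappa> v) g p x + dspace (v - \<kappa> v) g p x = dspace v g p x" by simp
      qed
      then show "CB m d (ennreal (norm v) * (?C' * K)) \<Omega> (dspace v g)"
        unfolding C' by (simp add: algebra_simps)
    next
      fix u :: 'p assume d: "0 < d"
      have "CB m (d - 1) (?C * (ennreal (norm u) * K)) \<Omega> (dpar u g)"
      proof (rule Suc.IH[OF CB_top[OF CB_dpar[OF g d]]])
        fix p x assume px: "(p, x) \<in> \<Omega>"
        then have i: "(p, \<kappa> x) \<in> \<Omega>" using seg[OF px, of 0] by simp
        from CB_diff_par[OF g d i]
        have "((\<lambda>p. 0) has_derivative (\<lambda>u. dpar u g p (\<kappa> x))) (at p)"
          by (rule has_derivative_transform_within_open[OF _ open_slice_par[OF CB_open[OF g], of x]]) (use px z in auto)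
        from has_derivative_unique[OF this has_derivative_const]
        show "dpar u g p (\<kappa> x) = 0" by metis
      next
        fix v assume "\<kappa> v = 0"
        from CB_swap_par_CB[OF g d w[OF this], of u]
        show "CB m (d - 1) (ennreal (norm v) * (ennreal (norm u) * K)) \<Omega> (dspace v (dpar u g))"
          by (simp add: mult.left_commute)
      qed
      then show "CB m (d - 1) (ennreal (norm u) * (?C' * K)) \<Omega> (dpar u g)"
      proof (rule CB_mono_K)
        have "?C \<le> ?C'" by (intro ennreal_leI) simp
        then show "?C * (ennreal (norm u) * K) \<le> ennreal (norm u) * (?C' * K)"
          unfolding mult.left_commute[of ?C] by (intro mult_left_mono mult_right_mono) auto
      qed
    next
      show "ennreal (norm (g p x)) \<le> ?C' * K" if "(p, x) \<in> \<Omega>" for p x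
        by (rule bound[OF g z w that])
    qed }
qed

text \<open>A derivative of order \<open>m + 1\<close> contains at most \<open>d \<le> m\<close>
  parameter directions, hence at least one space direction, which can be moved innermost. So bounds
  on the space derivatives cover all derivatives of top order.\<close>

lemma CB_raise:
  fixes g :: "'p::real_normed_vector \<Rightarrow> 'a::euclidean_space \<Rightarrow> 'b::real_normed_vector"
  shows "CT (Suc m) d \<Omega> g \<Longrightarrow> CB m d K \<Omega> g \<Longrightarrow> (\<And>v. CB m d (ennreal (norm v) * K) \<Omega> (dspace v g)) \<Longrightarrow> d \<le> m \<Longrightarrow>
    CB (Suc m) d K \<Omega> g"
proof (induction m arbitrary: d K g)
  case 0
  show ?case
    by (rule CB_SucI'[OF CB_DB[OF 0(1)] order_refl CB_open[OF 0(1)] order_refl 0(3)])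
      (use 0 CB_bound[OF 0(2)] in auto)
next
  case (Suc m)
  note g = Suc.prems(1)
  show ?case
  proof (rule CB_SucI'[OF CB_DB[OF g] order_refl CB_open[OF g] order_refl Suc.prems(3)])
    fix u :: 'p assume d: "0 < d"
    show "CB (Suc m) (d - 1) (ennreal (norm u) * K) \<Omega> (dpar u g)"
    proof (rule Suc.IH[OF CB_top[OF CB_dpar[OF g d]] CB_dpar[OF Suc.prems(2) d]])
      show "CB m (d - 1) (ennreal (norm v) * (ennreal (norm u) * K)) \<Omega> (dspace v (dpar u g))" for v
        using CB_swap_par_CB[OF g d Suc.prems(3), of u v] by (simp add: mult.left_commute)
    qed (use Suc.prems(4) in auto)
  qed (rule CB_bound[OF Suc.prems(2)])
qed

section \<open>Families indexed by a filter\<close>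

text \<open>
  In the following uniform statements, \<open>F\<close> is a filter on an arbitrary index type: along \<open>F\<close>, the
  families are bounded (\<open>BDD\<close>), have bounded derivatives of positive order (\<open>DBD\<close>), or tend to \<open>0\<close>
  (\<open>SMALL\<close>).
\<close>

definition BDD ::
  "'i filter \<Rightarrow> nat \<Rightarrow> nat \<Rightarrow> ('i \<Rightarrow> ('p::real_normed_vector \<times> 'a::real_normed_vector) set) \<Rightarrow>
    ('i \<Rightarrow> 'p \<Rightarrow> 'a \<Rightarrow> 'b::real_normed_vector) \<Rightarrow> bool" where
  "BDD F r d \<Omega> f \<longleftrightarrow> (\<exists>K<top. \<forall>\<^sub>F i in F. CB r d K (\<Omega> i) (f i))"

definition DBD ::
  "'i filter \<Rightarrow> nat \<Rightarrow> nat \<Rightarrow> ('i \<Rightarrow> ('p::real_normed_vector \<times> 'a::real_normed_vector) set) \<Rightarrow>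
    ('i \<Rightarrow> 'p \<Rightarrow> 'a \<Rightarrow> 'b::real_normed_vector) \<Rightarrow> bool" where
  "DBD F r d \<Omega> f \<longleftrightarrow> (\<exists>K<top. \<forall>\<^sub>F i in F. DB r d K (\<Omega> i) (f i))"

definition SMALL ::
  "'i filter \<Rightarrow> nat \<Rightarrow> nat \<Rightarrow> ('i \<Rightarrow> ('p::real_normed_vector \<times> 'a::real_normed_vector) set) \<Rightarrow>
    ('i \<Rightarrow> 'p \<Rightarrow> 'a \<Rightarrow> 'b::real_normed_vector) \<Rightarrow> bool" where
  "SMALL F r d \<Omega> f \<longleftrightarrow> (\<forall>\<delta>>0. \<forall>\<^sub>F i in F. CB r d (ennreal \<delta>) (\<Omega> i) (f i))"

lemma SMALL_D: "SMALL F r d \<Omega> f \<Longrightarrow> 0 < \<delta> \<Longrightarrow> \<forall>\<^sub>F i in F. CB r d (ennreal \<delta>) (\<Omega> i) (f i)"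
  by (simp add: SMALL_def)

lemma SMALL_I:
  assumes C: "C < top" and f: "\<And>\<delta>. 0 < \<delta> \<Longrightarrow> \<forall>\<^sub>F i in F. CB r d (C * ennreal \<delta>) (\<Omega> i) (f i)"
  shows "SMALL F r d \<Omega> f"
  unfolding SMALL_def
proof (intro allI impI)
  fix \<delta> :: real assume \<delta>: "0 < \<delta>"
  obtain c where c: "0 \<le> c" "C = ennreal c" using C by (cases C) auto
  have "c * (\<delta> / (c + 1)) \<le> \<delta>" using c(1) \<delta> by (simp add: field_simps)
  then have le: "C * ennreal (\<delta> / (c + 1)) \<le> ennreal \<delta>"
    using c \<delta> by (simp add: ennreal_leI flip: ennreal_mult)
  have "0 < \<delta> / (c + 1)" using c(1) \<delta> by simp
  from f[OF this] show "\<forall>\<^sub>F i in F. CB r d (ennreal \<delta>) (\<Omega> i) (f i)"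
    by eventually_elim (rule CB_mono_K[OF _ le])
qed

lemma SMALL_BDD: "SMALL F r d \<Omega> f \<Longrightarrow> BDD F r d \<Omega> f"
  unfolding BDD_def using SMALL_D[of F r d \<Omega> f 1] by (intro exI[of _ 1]) auto

lemma BDD_DBD: "BDD F r d \<Omega> f \<Longrightarrow> DBD F r d \<Omega> f"
  unfolding BDD_def DBD_def by (auto elim!: eventually_mono intro: CB_DB)

lemma DBD_I: "K < top \<Longrightarrow> \<forall>\<^sub>F i in F. DB r d K (\<Omega> i) (f i) \<Longrightarrow> DBD F r d \<Omega> f"
  unfolding DBD_def by blast

lemma BDD_I: "K < top \<Longrightarrow> \<forall>\<^sub>F i in F. CB r d K (\<Omega> i) (f i) \<Longrightarrow> BDD F r d \<Omega> f"
  unfolding BDD_def by blast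

lemma BDD_mono: "BDD F r d \<Omega> f \<Longrightarrow> r' \<le> r \<Longrightarrow> d' \<le> d \<Longrightarrow> BDD F r' d' \<Omega> f"
  unfolding BDD_def by (auto elim!: eventually_mono intro: CB_mono[OF _ _ _ order_refl])

lemma DBD_mono: "DBD F r d \<Omega> f \<Longrightarrow> r' \<le> r \<Longrightarrow> d' \<le> d \<Longrightarrow> DBD F r' d' \<Omega> f"
  unfolding DBD_def by (auto elim!: eventually_mono intro: DB_mono_rd)

lemma SMALL_mono: "SMALL F r d \<Omega> f \<Longrightarrow> r' \<le> r \<Longrightarrow> d' \<le> d \<Longrightarrow> SMALL F r' d' \<Omega> f"
  unfolding SMALL_def by (auto elim!: eventually_mono intro: CB_mono[OF _ _ _ order_refl])

lemma SMALL_cong: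
  assumes "SMALL F r d \<Omega> f" "\<forall>\<^sub>F i in F. \<forall>p x. (p, x) \<in> \<Omega> i \<longrightarrow> f i p x = g i p x"
  shows "SMALL F r d \<Omega> g"
  unfolding SMALL_def
proof (intro allI impI)
  fix \<delta> :: real assume "0 < \<delta>"
  from SMALL_D[OF assms(1) this] assms(2) show "\<forall>\<^sub>F i in F. CB r d (ennreal \<delta>) (\<Omega> i) (g i)"
    by eventually_elim (rule CB_cong_imp; auto)
qed

lemma BDD_cong:
  assumes "BDD F r d \<Omega> f" "\<forall>\<^sub>F i in F. \<forall>p x. (p, x) \<in> \<Omega> i \<longrightarrow> f i p x = g i p x"
  shows "BDD F r d \<Omega> g"
proof -
  obtain K where K: "K < top" "\<forall>\<^sub>F i in F. CB r d K (\<Omega> i) (f i)" using assms(1) unfolding BDD_def by blast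
  from K(2) assms(2) have "\<forall>\<^sub>F i in F. CB r d K (\<Omega> i) (g i)"
    by eventually_elim (rule CB_cong_imp; auto)
  then show ?thesis by (rule BDD_I[OF K(1)])
qed

lemma SMALL_subset:
  assumes "SMALL F r d \<Omega> f" "\<forall>\<^sub>F i in F. open (\<Omega>' i) \<and> \<Omega>' i \<subseteq> \<Omega> i"
  shows "SMALL F r d \<Omega>' f"
  unfolding SMALL_def
proof (intro allI impI)
  fix \<delta> :: real assume "0 < \<delta>"
  from SMALL_D[OF assms(1) this] assms(2) show "\<forall>\<^sub>F i in F. CB r d (ennreal \<delta>) (\<Omega>' i) (f i)"
    by eventually_elim (auto intro: CB_subset)
qed

lemma DBD_add:
  assumes "DBD F r d \<Omega> f" "DBD F r d \<Omega> g"
  shows "DBD F r d \<Omega> (\<lambda>i p x. f i p x + g i p x)"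
proof -
  obtain K L where K: "K < top" "L < top" and e: "\<forall>\<^sub>F i in F. DB r d K (\<Omega> i) (f i)" "\<forall>\<^sub>F i in F. DB r d L (\<Omega> i) (g i)"
    using assms unfolding DBD_def by blast
  show ?thesis
  proof (rule DBD_I)
    show "\<forall>\<^sub>F i in F. DB r d (K + L) (\<Omega> i) (\<lambda>p x. f i p x + g i p x)"
      using e by eventually_elim (rule DB_add)
  qed (use K in \<open>simp add: ennreal_add_less_top\<close>)
qed

lemma DBD_Pair:
  assumes "DBD F r d \<Omega> f" "DBD F r d \<Omega> g"
  shows "DBD F r d \<Omega> (\<lambda>i p x. (f i p x, g i p x))"
proof -
  obtain K L where K: "K < top" "L < top" and e: "\<forall>\<^sub>F i in F. DB r d K (\<Omega> i) (f i)" "\<forall>\<^sub>F i in F. DB r d L (\<Omega> i) (g i)"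
    using assms unfolding DBD_def by blast
  show ?thesis
  proof (rule DBD_I)
    show "\<forall>\<^sub>F i in F. DB r d (K + L) (\<Omega> i) (\<lambda>p x. (f i p x, g i p x))"
      using e by eventually_elim (rule DB_Pair)
  qed (use K in \<open>simp add: ennreal_add_less_top\<close>)
qed

lemma BDD_mult:
  fixes f g :: "'i \<Rightarrow> 'p::real_normed_vector \<Rightarrow> 'a::real_normed_vector \<Rightarrow> real"
  assumes "BDD F r d \<Omega> f" "BDD F r d \<Omega> g"
  shows "BDD F r d \<Omega> (\<lambda>i p x. f i p x * g i p x)"
proof -
  obtain K L where K: "K < top" "L < top" and e: "\<forall>\<^sub>F i in F. CB r d K (\<Omega> i) (f i)" "\<forall>\<^sub>F i in F. CB r d L (\<Omega> i) (g i)"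
    using assms unfolding BDD_def by blast
  show ?thesis
  proof (rule BDD_I)
    show "\<forall>\<^sub>F i in F. CB r d (2 ^ r * (K * L)) (\<Omega> i) (\<lambda>p x. f i p x * g i p x)"
      using e by eventually_elim (rule CB_mult)
  qed (use K in \<open>simp add: ennreal_mult_less_top power_less_top_ennreal\<close>)
qed

lemma SMALL_add:
  assumes "SMALL F r d \<Omega> f" "SMALL F r d \<Omega> g"
  shows "SMALL F r d \<Omega> (\<lambda>i p x. f i p x + g i p x)"
proof (rule SMALL_I)
  fix \<delta> :: real assume d: "0 < \<delta>"
  from SMALL_D[OF assms(1) d] SMALL_D[OF assms(2) d]
  show "\<forall>\<^sub>F i in F. CB r d (2 * ennreal \<delta>) (\<Omega> i) (\<lambda>p x. f i p x + g i p x)"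
    by eventually_elim (simp only: mult_2 CB_add)
qed (simp add: ennreal_numeral_less_top)

lemma SMALL_mult:
  fixes f g :: "'i \<Rightarrow> 'p::real_normed_vector \<Rightarrow> 'a::real_normed_vector \<Rightarrow> real"
  assumes "SMALL F r d \<Omega> f" "BDD F r d \<Omega> g"
  shows "SMALL F r d \<Omega> (\<lambda>i p x. f i p x * g i p x)"
proof -
  obtain K where K: "K < top" and e: "\<forall>\<^sub>F i in F. CB r d K (\<Omega> i) (g i)"
    using assms unfolding BDD_def by blast
  show ?thesis
  proof (rule SMALL_I)
    fix \<delta> :: real assume "0 < \<delta>"
    from SMALL_D[OF assms(1) this] e
    show "\<forall>\<^sub>F i in F. CB r d (2 ^ r * K * ennreal \<delta>) (\<Omega> i) (\<lambda>p x. f i p x * g i p x)"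
    proof eventually_elim
      case (elim i) then show ?case using CB_mult[of r d "ennreal \<delta>" "\<Omega> i" "f i" K "g i"] by (simp add: mult_ac)
    qed
  qed (use K in \<open>simp add: ennreal_mult_less_top power_less_top_ennreal\<close>)
qed

lemma SMALL_uminus: "SMALL F r d \<Omega> f \<Longrightarrow> SMALL F r d \<Omega> (\<lambda>i p x. - f i p x)"
  unfolding SMALL_def
proof (intro allI impI)
  fix \<delta> :: real assume f: "\<forall>\<delta>>0. \<forall>\<^sub>F i in F. CB r d (ennreal \<delta>) (\<Omega> i) (f i)" and "0 < \<delta>"
  then have "\<forall>\<^sub>F i in F. CB r d (ennreal \<delta>) (\<Omega> i) (f i)" by blast
  then show "\<forall>\<^sub>F i in F. CB r d (ennreal \<delta>) (\<Omega> i) (\<lambda>p x. - f i p x)"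
  proof eventually_elim
    case (elim i) then show ?case using CB_scale_norm[of r d "ennreal \<delta>" "\<Omega> i" "f i" "- 1"] by simp
  qed
qed

lemma BDD_const: "\<forall>\<^sub>F i in F. open (\<Omega> i) \<Longrightarrow> BDD F r d \<Omega> (\<lambda>i p x. c)"
  by (rule BDD_I[of "ennreal (norm c)"]) (auto elim!: eventually_mono intro: CB_const)

lemma DBD_par: "\<forall>\<^sub>F i in F. open (\<Omega> i) \<Longrightarrow> DBD F r d \<Omega> (\<lambda>i p x. p)"
  by (rule DBD_I[of 1]) (auto elim!: eventually_mono intro!: DB_linear_par[where L = "\<lambda>x. x"] simp: bounded_linear_ident)

lemma DBD_linear:
  assumes "bounded_linear L" "\<And>v. norm (L v) \<le> norm v" "\<forall>\<^sub>F i in F. open (\<Omega> i)"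
  shows "DBD F r d \<Omega> (\<lambda>i p x. L x)"
  by (rule DBD_I[of 1]) (use assms(3) in \<open>auto elim!: eventually_mono intro!: DB_linear assms(1,2)\<close>)

lemma DBD_linear_par:
  assumes "bounded_linear L" "\<And>v. norm (L v) \<le> norm v" "\<forall>\<^sub>F i in F. open (\<Omega> i)"
  shows "DBD F r d \<Omega> (\<lambda>i p x. L p)"
  by (rule DBD_I[of 1]) (use assms(3) in \<open>auto elim!: eventually_mono intro!: DB_linear_par assms(1,2)\<close>)

lemma BDD_linear:
  assumes "bounded_linear L" "\<And>v. norm (L v) \<le> norm v" "\<forall>\<^sub>F i in F. open (\<Omega> i)"
    and b: "\<forall>\<^sub>F i in F. \<forall>p x. (p, x) \<in> \<Omega> i \<longrightarrow> norm (L x) \<le> B"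
  shows "BDD F r d \<Omega> (\<lambda>i p x. L x)"
\<comment> \<open>\<open>B\<close> bounds the values, \<open>1\<close> the derivatives.\<close>
proof (rule BDD_I[of "ennreal (max 1 B)"])
  from assms(3) b show "\<forall>\<^sub>F i in F. CB r d (ennreal (max 1 B)) (\<Omega> i) (\<lambda>p x. L x)"
  proof eventually_elim
    case (elim i)
    have "ennreal 1 \<le> ennreal (max 1 B)" by (intro ennreal_leI) simp
    then have "DB r d (ennreal (max 1 B)) (\<Omega> i) (\<lambda>p x. L x)"
      using DB_mono_K[OF DB_linear[OF assms(1,2) elim(1)]] by simp
    then show ?case by (rule CB_I) (use elim(2) in \<open>fastforce intro!: ennreal_leI\<close>)
  qed
qed simp

lemma SMALL_compose:
  fixes G :: "'i \<Rightarrow> 'p::euclidean_space \<Rightarrow> 'a::euclidean_space \<Rightarrow> 'b::real_normed_vector"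
  assumes "SMALL F r d \<Omega>' G" "DBD F r d \<Omega> (\<lambda>i q x. \<pi> i q)" "DBD F r d \<Omega> h"
    and dom: "\<forall>\<^sub>F i in F. \<forall>q x. (q, x) \<in> \<Omega> i \<longrightarrow> (\<pi> i q, h i q x) \<in> \<Omega>' i"
  shows "SMALL F r d \<Omega> (\<lambda>i q x. G i (\<pi> i q) (h i q x))"
proof -
  obtain K L where K: "K < top" "L < top" and e: "\<forall>\<^sub>F i in F. DB r d K (\<Omega> i) (\<lambda>q x. \<pi> i q)" "\<forall>\<^sub>F i in F. DB r d L (\<Omega> i) (h i)"
    using assms(2,3) unfolding DBD_def by blast
  show ?thesis
  proof (rule SMALL_I[of "comp_const (DIM('a) + DIM('p)) (K + L) r"])
    fix \<delta> :: real assume "0 < \<delta>"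
    from SMALL_D[OF assms(1) this] e dom
    show "\<forall>\<^sub>F i in F. CB r d (comp_const (DIM('a) + DIM('p)) (K + L) r * ennreal \<delta>) (\<Omega> i) (\<lambda>q x. G i (\<pi> i q) (h i q x))"
    proof eventually_elim
      case (elim i) show ?case by (rule CB_compose[OF elim(1-3)]) (use elim(4) in blast)
    qed
  qed (use K in \<open>simp add: comp_const_finite ennreal_add_less_top\<close>)
qed

lemma BDD_compose:
  fixes G :: "'i \<Rightarrow> 'p::euclidean_space \<Rightarrow> 'a::euclidean_space \<Rightarrow> 'b::real_normed_vector"
  assumes "BDD F r d \<Omega>' G" "DBD F r d \<Omega> (\<lambda>i q x. \<pi> i q)" "DBD F r d \<Omega> h"
    and dom: "\<forall>\<^sub>F i in F. \<forall>q x. (q, x) \<in> \<Omega> i \<longrightarrow> (\<pi> i q, h i q x) \<in> \<Omega>' i"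
  shows "BDD F r d \<Omega> (\<lambda>i q x. G i (\<pi> i q) (h i q x))"
proof -
  obtain K L N where K: "K < top" "L < top" "N < top" and e: "\<forall>\<^sub>F i in F. DB r d K (\<Omega> i) (\<lambda>q x. \<pi> i q)"
      "\<forall>\<^sub>F i in F. DB r d L (\<Omega> i) (h i)" "\<forall>\<^sub>F i in F. CB r d N (\<Omega>' i) (G i)"
    using assms(1-3) unfolding DBD_def BDD_def by blast
  show ?thesis
  proof (rule BDD_I[of "comp_const (DIM('a) + DIM('p)) (K + L) r * N"])
    from e dom
    show "\<forall>\<^sub>F i in F. CB r d (comp_const (DIM('a) + DIM('p)) (K + L) r * N) (\<Omega> i) (\<lambda>q x. G i (\<pi> i q) (h i q x))"
    proof eventually_elim
      case (elim i) show ?case by (rule CB_compose[OF elim(3,1,2)]) (use elim(4) in blast)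
    qed
  qed (use K in \<open>simp add: comp_const_finite ennreal_add_less_top ennreal_mult_less_top\<close>)
qed

lemma BDD_comp_fun:
  fixes \<theta> :: "real \<Rightarrow> real" and f :: "'i \<Rightarrow> 'q::euclidean_space \<Rightarrow> 'x::real_normed_vector \<Rightarrow> real"
  assumes "C < top" "CB r d C (UNIV \<times> S) (\<lambda>(p::'q) y. \<theta> y)" "DBD F r d \<Omega> f"
    and "\<forall>\<^sub>F i in F. \<forall>q x. (q, x) \<in> \<Omega> i \<longrightarrow> f i q x \<in> S"
  shows "BDD F r d \<Omega> (\<lambda>i q x. \<theta> (f i q x))"
proof -
  obtain K where K: "K < top" and e: "\<forall>\<^sub>F i in F. DB r d K (\<Omega> i) (f i)"
    using assms(3) unfolding DBD_def by blast
  show ?thesis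
  proof (rule BDD_I[of "comp_const (1 + DIM('q)) (1 + K) r * C"])
    from e assms(4)
    show "\<forall>\<^sub>F i in F. CB r d (comp_const (1 + DIM('q)) (1 + K) r * C) (\<Omega> i) (\<lambda>q x. \<theta> (f i q x))"
      by eventually_elim (rule CB_comp_fun[OF assms(2)]; blast)
    have "1 + K < top" using K by (simp add: ennreal_add_less_top)
    then show "comp_const (1 + DIM('q)) (1 + K) r * C < top"
      using assms(1) by (simp only: ennreal_mult_less_top comp_const_finite) simp
  qed
qed

lemma SMALL_bound: "SMALL F r d \<Omega> f \<Longrightarrow> 0 < \<delta> \<Longrightarrow> \<forall>\<^sub>F i in F. \<forall>p x. (p, x) \<in> \<Omega> i \<longrightarrow> norm (f i p x) \<le> \<delta>"
  by (drule (1) SMALL_D, erule eventually_mono) (auto dest!: CB_bound simp: ennreal_le_iff)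

text \<open>Smallness confines the argument to a half line on which \<open>exp\<close>, and thus
  each of its derivatives, is bounded.\<close>

lemma BDD_exp:
  fixes f :: "'i \<Rightarrow> 'q::euclidean_space \<Rightarrow> 'x::real_normed_vector \<Rightarrow> real"
  assumes "SMALL F r d \<Omega> f"
  shows "BDD F r d \<Omega> (\<lambda>i q x. exp (f i q x))"
proof (rule BDD_comp_fun[where S = "{..<1}" and C = "ennreal (exp 1)" and \<theta> = exp and f = f])
  show "CB r d (ennreal (exp 1)) (UNIV \<times> {..<1}) (\<lambda>(p::'q) (y::real). exp y)"
    by (rule CB_exp_fun) (auto intro!: ennreal_leI)
  show "\<forall>\<^sub>F i in F. \<forall>q x. (q, x) \<in> \<Omega> i \<longrightarrow> f i q x \<in> {..<1}"
    using SMALL_bound[OF assms, of "1/2"] by (auto elim!: eventually_mono) fastforce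
qed (use assms in \<open>auto intro: BDD_DBD SMALL_BDD\<close>)

text \<open>Eventually \<open>1 + f\<close> is at least \<open>1/2\<close>; the half line above
  \<open>1/4\<close> is an open set containing these values on which the inverse and its derivatives
  are bounded.\<close>

lemma BDD_inverse:
  fixes f :: "'i \<Rightarrow> 'q::euclidean_space \<Rightarrow> 'x::real_normed_vector \<Rightarrow> real"
  assumes "SMALL F r d \<Omega> f"
  shows "BDD F r d \<Omega> (\<lambda>i q x. inverse (1 + f i q x))"
proof -
  have inv: "ennreal \<bar>inverse y\<bar> \<le> ennreal 4" if "y \<in> {1/4<..}" for y :: real
    using that by (intro ennreal_leI) (auto simp: field_simps)
  have ev: "\<forall>\<^sub>F i in F. open (\<Omega> i)" using SMALL_D[OF assms, of 1] by (auto elim!: eventually_mono intro: CB_open)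
  obtain C where C: "ennreal 4 < top \<longrightarrow> C < top" "\<And>d. CB r d C (UNIV \<times> {1/4<..}) (\<lambda>(p::'q) (y::real). inverse y)"
    using CB_inverse_fun[where S = "{1/4<..}" and K = "ennreal 4" and r = r, OF _ _ inv] by auto
  show ?thesis
  proof (rule BDD_comp_fun[where \<theta> = inverse and f = "\<lambda>i q x. 1 + f i q x", OF _ C(2)])
    show "DBD F r d \<Omega> (\<lambda>i q x. 1 + f i q x)"
      by (rule DBD_add[OF BDD_DBD[OF BDD_const[OF ev]] BDD_DBD[OF SMALL_BDD[OF assms]]])
    show "\<forall>\<^sub>F i in F. \<forall>q x. (q, x) \<in> \<Omega> i \<longrightarrow> 1 + f i q x \<in> {1/4<..}"
      using SMALL_bound[OF assms, of "1/2"] by (auto elim!: eventually_mono) fastforce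
  qed (use C(1) in simp)
qed

lemma CB_dir_plane:
  fixes g :: "'p::real_normed_vector \<Rightarrow> real \<times> real \<Rightarrow> 'b::real_normed_vector"
  assumes g: "DB (Suc m) d L \<Omega> g" and 1: "CB r d K \<Omega> (dspace (1, 0) g)" and 2: "CB r d K \<Omega> (dspace (0, 1) g)"
  shows "CB r d (ennreal (norm v) * (2 * K)) \<Omega> (dspace v g)"
proof (rule CB_cong_imp)
  have "\<bar>fst v\<bar> \<le> norm v" "\<bar>snd v\<bar> \<le> norm v" using norm_fst_le[of "fst v" "snd v"] norm_snd_le[of "snd v" "fst v"] by auto
  then have "ennreal \<bar>fst v\<bar> * K \<le> ennreal (norm v) * K" "ennreal \<bar>snd v\<bar> * K \<le> ennreal (norm v) * K"
    by (auto intro!: mult_right_mono ennreal_leI)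
  from add_mono[OF this] show "CB r d (ennreal (norm v) * (2 * K)) \<Omega> (\<lambda>p x. fst v *\<^sub>R dspace (1, 0) g p x + snd v *\<^sub>R dspace (0, 1) g p x)"
    by (intro CB_mono_K[OF CB_add[OF CB_scale_norm[OF 1] CB_scale_norm[OF 2]]]) (simp add: mult_2 distrib_left)
  show "fst v *\<^sub>R dspace (1, 0) g p x + snd v *\<^sub>R dspace (0, 1) g p x = dspace v g p x" if "(p, x) \<in> \<Omega>" for p x
    using linear_plane_expand[OF has_derivative_linear[OF DB_diff_space[OF g that]], of v] by simp
qed

lemma SMALL_dspace:
  assumes "SMALL F (Suc r) d \<Omega> f" shows "SMALL F r d \<Omega> (\<lambda>i. dspace v (f i))"
proof (rule SMALL_I[of "ennreal (norm v)"])
  fix \<delta> :: real assume "0 < \<delta>"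
  from SMALL_D[OF assms this] show "\<forall>\<^sub>F i in F. CB r d (ennreal (norm v) * ennreal \<delta>) (\<Omega> i) (dspace v (f i))"
    by eventually_elim (rule CB_dspace)
qed simp

lemma SMALL_dpar:
  assumes "SMALL F (Suc r) d \<Omega> f" "0 < d" shows "SMALL F r (d - 1) \<Omega> (\<lambda>i. dpar v (f i))"
proof (rule SMALL_I[of "ennreal (norm v)"])
  fix \<delta> :: real assume "0 < \<delta>"
  from SMALL_D[OF assms(1) this] show "\<forall>\<^sub>F i in F. CB r (d - 1) (ennreal (norm v) * ennreal \<delta>) (\<Omega> i) (dpar v (f i))"
    by eventually_elim (rule CB_dpar[OF _ assms(2)])
qed simp

lemma DBD_dspace:
  assumes "DBD F (Suc r) d \<Omega> f" shows "BDD F r d \<Omega> (\<lambda>i. dspace v (f i))"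
proof -
  obtain K where K: "K < top" "\<forall>\<^sub>F i in F. DB (Suc r) d K (\<Omega> i) (f i)" using assms unfolding DBD_def by blast
  show ?thesis
  proof (rule BDD_I)
    show "ennreal (norm v) * K < top" using K(1) by (simp add: ennreal_mult_less_top)
    show "\<forall>\<^sub>F i in F. CB r d (ennreal (norm v) * K) (\<Omega> i) (dspace v (f i))"
      using K(2) by eventually_elim (rule DB_dspace)
  qed
qed

lemma DBD_dpar:
  assumes "DBD F (Suc r) d \<Omega> f" "0 < d" shows "BDD F r (d - 1) \<Omega> (\<lambda>i. dpar v (f i))"
proof -
  obtain K where K: "K < top" "\<forall>\<^sub>F i in F. DB (Suc r) d K (\<Omega> i) (f i)" using assms unfolding DBD_def by blast
  show ?thesis
  proof (rule BDD_I)
    show "ennreal (norm v) * K < top" using K(1) by (simp add: ennreal_mult_less_top)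
    show "\<forall>\<^sub>F i in F. CB r (d - 1) (ennreal (norm v) * K) (\<Omega> i) (dpar v (f i))"
      using K(2) by eventually_elim (rule DB_dpar[OF _ assms(2)])
  qed
qed

lemma SMALL_Suc_Basis:
  fixes g :: "'i \<Rightarrow> 'p::euclidean_space \<Rightarrow> 'a::euclidean_space \<Rightarrow> 'b::real_normed_vector"
  assumes g: "\<forall>\<^sub>F i in F. CT (Suc r0) d (\<Omega> i) (g i)" and b: "SMALL F r d \<Omega> g"
    and x: "\<And>b. b \<in> Basis \<Longrightarrow> SMALL F r d \<Omega> (\<lambda>i. dspace b (g i))"
    and p: "\<And>b. b \<in> Basis \<Longrightarrow> 0 < d \<Longrightarrow> SMALL F r (d - 1) \<Omega> (\<lambda>i. dpar b (g i))"
  shows "SMALL F (Suc r) d \<Omega> g"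
proof (rule SMALL_I[of "of_nat (DIM('a) + DIM('p))"])
  fix \<delta> :: real assume \<delta>: "0 < \<delta>"
  have 1: "\<forall>\<^sub>F i in F. \<forall>b\<in>Basis. CB r d (ennreal \<delta>) (\<Omega> i) (dspace b (g i))"
    by (rule eventually_ball_finite[OF finite_Basis]) (use SMALL_D[OF x \<delta>] in blast)
  have 2: "\<forall>\<^sub>F i in F. \<forall>b\<in>Basis. 0 < d \<longrightarrow> CB r (d - 1) (ennreal \<delta>) (\<Omega> i) (dpar b (g i))"
  proof (rule eventually_ball_finite[OF finite_Basis], intro ballI)
    fix b :: 'p assume "b \<in> Basis"
    then show "\<forall>\<^sub>F i in F. 0 < d \<longrightarrow> CB r (d - 1) (ennreal \<delta>) (\<Omega> i) (dpar b (g i))"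
      using SMALL_D[OF p \<delta>] by (cases "0 < d") auto
  qed
  from g SMALL_D[OF b \<delta>] 1 2 show "\<forall>\<^sub>F i in F. CB (Suc r) d (of_nat (DIM('a) + DIM('p)) * ennreal \<delta>) (\<Omega> i) (g i)"
  proof eventually_elim
    case (elim i)
    have "DB (Suc r) d (of_nat (DIM('a) + DIM('p)) * ennreal \<delta>) (\<Omega> i) (g i)"
      by (rule DB_Suc_Basis[OF CB_DB[OF elim(1)]]) (use elim(3,4) in auto)
    then show ?case
    proof (rule CB_I)
      fix p x assume "(p, x) \<in> \<Omega> i"
      then have "ennreal (norm (g i p x)) \<le> 1 * ennreal \<delta>" using CB_bound[OF elim(2)] by simp
      also have "\<dots> \<le> of_nat (DIM('a) + DIM('p)) * ennreal \<delta>"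
        using of_nat_mono[of 1 "DIM('a) + DIM('p)"] by (intro mult_right_mono) (auto simp: Suc_le_eq)
      finally show "ennreal (norm (g i p x)) \<le> of_nat (DIM('a) + DIM('p)) * ennreal \<delta>" .
    qed
  qed
qed (simp add: of_nat_less_top)

lemma SMALL_raise:
  fixes g :: "'i \<Rightarrow> 'p::real_normed_vector \<Rightarrow> real \<times> real \<Rightarrow> 'b::real_normed_vector"
  assumes g: "\<forall>\<^sub>F i in F. CT (Suc m) d (\<Omega> i) (g i)" and b: "SMALL F m d \<Omega> g"
    and x: "SMALL F m d \<Omega> (\<lambda>i. dspace (1, 0) (g i))" "SMALL F m d \<Omega> (\<lambda>i. dspace (0, 1) (g i))"
    and d: "d \<le> m"
  shows "SMALL F (Suc m) d \<Omega> g"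
proof (rule SMALL_I[of 2])
  fix \<delta> :: real assume \<delta>: "0 < \<delta>"
  from g SMALL_D[OF b \<delta>] SMALL_D[OF x(1) \<delta>] SMALL_D[OF x(2) \<delta>]
  show "\<forall>\<^sub>F i in F. CB (Suc m) d (2 * ennreal \<delta>) (\<Omega> i) (g i)"
  proof eventually_elim
    case (elim i)
    have "ennreal \<delta> \<le> 2 * ennreal \<delta>" by (simp add: mult_2)
    then show ?case
      by (intro CB_raise[OF elim(1)] CB_mono_K[OF elim(2)] CB_dir_plane[OF CB_DB[OF elim(1)] elim(3,4)] d)
  qed
qed (simp add: ennreal_numeral_less_top)

text \<open>The vectors \<open>e\<close> and \<open>e'\<close> span the kernel of
  \<open>\<kappa>\<close> with controlled coefficients; a one-dimensional kernel is covered by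
  \<open>e' = e\<close>.\<close>

lemma SMALL_vanish:
  fixes g :: "'i \<Rightarrow> 'p::real_normed_vector \<Rightarrow> real \<times> real \<Rightarrow> 'b::real_normed_vector"
  assumes \<kappa>: "bounded_linear \<kappa>" "\<And>v. \<kappa> (\<kappa> v) = \<kappa> v" "\<And>v. norm (\<kappa> v) \<le> norm v" "\<And>v. norm (v - \<kappa> v) \<le> norm v"
    and e: "\<And>w. \<kappa> w = 0 \<Longrightarrow> \<exists>c c'. w = c *\<^sub>R e + c' *\<^sub>R e' \<and> \<bar>c\<bar> \<le> norm w \<and> \<bar>c'\<bar> \<le> norm w"
    and seg: "\<forall>\<^sub>F i in F. \<forall>p x t. (p, x) \<in> \<Omega> i \<longrightarrow> 0 \<le> t \<longrightarrow> t \<le> 1 \<longrightarrow> (p, \<kappa> x + t *\<^sub>R (x - \<kappa> x)) \<in> \<Omega> i"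
    and B: "0 \<le> B" "\<forall>\<^sub>F i in F. \<forall>p x. (p, x) \<in> \<Omega> i \<longrightarrow> norm (x - \<kappa> x) \<le> B"
    and g: "\<forall>\<^sub>F i in F. CT (Suc m) d (\<Omega> i) (g i)"
    and z: "\<forall>\<^sub>F i in F. \<forall>p x. (p, x) \<in> \<Omega> i \<longrightarrow> g i p (\<kappa> x) = 0"
    and x: "SMALL F m d \<Omega> (\<lambda>i. dspace e (g i))" "SMALL F m d \<Omega> (\<lambda>i. dspace e' (g i))"
  shows "SMALL F m d \<Omega> g"
proof (rule SMALL_I[of "ennreal (B + 1 + real m) * 2"])
  fix \<delta> :: real assume \<delta>: "0 < \<delta>"
  from seg B(2) g z SMALL_D[OF x(1) \<delta>] SMALL_D[OF x(2) \<delta>]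
  show "\<forall>\<^sub>F i in F. CB m d (ennreal (B + 1 + real m) * 2 * ennreal \<delta>) (\<Omega> i) (g i)"
  proof eventually_elim
    case (elim i)
    have "CB m d (ennreal (B + 1 + real m) * (2 * ennreal \<delta>)) (\<Omega> i) (g i)"
    proof (rule CB_vanish[OF \<kappa> _ B(1) _ elim(3)])
      fix w assume "\<kappa> w = 0"
      then obtain c c' where w: "w = c *\<^sub>R e + c' *\<^sub>R e'" "\<bar>c\<bar> \<le> norm w" "\<bar>c'\<bar> \<le> norm w" using e by blast
      have "CB m d (ennreal \<bar>c\<bar> * ennreal \<delta> + ennreal \<bar>c'\<bar> * ennreal \<delta>) (\<Omega> i)
          (\<lambda>p x. c *\<^sub>R dspace e (g i) p x + c' *\<^sub>R dspace e' (g i) p x)"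
        by (rule CB_add[OF CB_scale_norm[OF elim(5)] CB_scale_norm[OF elim(6)]])
      then have "CB m d (ennreal \<bar>c\<bar> * ennreal \<delta> + ennreal \<bar>c'\<bar> * ennreal \<delta>) (\<Omega> i) (dspace w (g i))"
      proof (rule CB_cong_imp[rotated])
        fix p x assume "(p, x) \<in> \<Omega> i"
        then have l: "linear (\<lambda>v. dspace v (g i) p x)" by (rule has_derivative_linear[OF CB_diff_space[OF elim(3)]])
        show "c *\<^sub>R dspace e (g i) p x + c' *\<^sub>R dspace e' (g i) p x = dspace w (g i) p x"
          unfolding w(1) by (simp add: linear_add[OF l] linear_scale[OF l])
      qed
      then show "CB m d (ennreal (norm w) * (2 * ennreal \<delta>)) (\<Omega> i) (dspace w (g i))"
      proof (rule CB_mono_K)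
        have "ennreal \<bar>c\<bar> * ennreal \<delta> + ennreal \<bar>c'\<bar> * ennreal \<delta> \<le> ennreal (norm w) * ennreal \<delta> + ennreal (norm w) * ennreal \<delta>"
          by (intro add_mono mult_right_mono ennreal_leI w) auto
        then show "ennreal \<bar>c\<bar> * ennreal \<delta> + ennreal \<bar>c'\<bar> * ennreal \<delta> \<le> ennreal (norm w) * (2 * ennreal \<delta>)"
          by (simp add: mult_2 distrib_left)
      qed
    qed (use elim in auto)
    then show ?case by (simp add: mult.assoc)
  qed
qed (simp add: ennreal_mult_less_top ennreal_numeral_less_top)

section \<open>Rescaled families\<close>

declare split_paired_All [simp del] split_paired_Ex [simp del]

lemma plane_bounds: "\<bar>fst (v::real \<times> real)\<bar> \<le> norm v" "\<bar>snd v\<bar> \<le> norm v"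
  using norm_fst_le[of "fst v" "snd v"] norm_snd_le[of "snd v" "fst v"] by auto

lemma norm_le_sum: "norm (v::real \<times> real) \<le> \<bar>fst v\<bar> + \<bar>snd v\<bar>"
  using norm_Pair_le[of "fst v" "snd v"] by simp

text \<open>For \<open>\<kappa> = 0\<close> the kernel is the whole plane: all space derivatives are
  controlled, and \<open>SMALL_raise\<close> gains the extra order.\<close>

lemma SMALL_vanish_origin:
  fixes g :: "'i \<Rightarrow> 'p::real_normed_vector \<Rightarrow> real \<times> real \<Rightarrow> 'b::real_normed_vector"
  assumes seg: "\<forall>\<^sub>F i in F. \<forall>p x t. (p, x) \<in> \<Omega> i \<longrightarrow> 0 \<le> t \<longrightarrow> t \<le> 1 \<longrightarrow> (p, t *\<^sub>R x) \<in> \<Omega> i"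
    and B: "0 \<le> B" "\<forall>\<^sub>F i in F. \<forall>p x. (p, x) \<in> \<Omega> i \<longrightarrow> norm x \<le> B"
    and g: "\<forall>\<^sub>F i in F. CT (Suc m) d (\<Omega> i) (g i)"
    and z: "\<forall>\<^sub>F i in F. \<forall>p x. (p, x) \<in> \<Omega> i \<longrightarrow> g i p 0 = 0"
    and x: "SMALL F m d \<Omega> (\<lambda>i. dspace (1, 0) (g i))" "SMALL F m d \<Omega> (\<lambda>i. dspace (0, 1) (g i))"
    and d: "d \<le> m"
  shows "SMALL F (Suc m) d \<Omega> g"
proof (rule SMALL_raise[OF g _ x d])
  show "SMALL F m d \<Omega> g"
  proof (rule SMALL_vanish[where \<kappa> = "\<lambda>x. 0" and e = "(1, 0)" and e' = "(0, 1)", OF _ _ _ _ _ _ B(1) _ g _ x])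
    fix w :: "real \<times> real"
    show "\<exists>c c'. w = c *\<^sub>R (1, 0) + c' *\<^sub>R (0, 1) \<and> \<bar>c\<bar> \<le> norm w \<and> \<bar>c'\<bar> \<le> norm w"
      by (intro exI[of _ "fst w"] exI[of _ "snd w"]) (simp add: prod_eq_iff plane_bounds)
  qed (use seg B(2) z in auto)
qed

text \<open>Integration in the first variable alone. Nothing is known about the vertical derivative
  at the top order, so no order is gained; this is the derivative lost in the statement with bounded
  distortion only.\<close>

lemma SMALL_vanish_axis:
  fixes g :: "'i \<Rightarrow> 'p::real_normed_vector \<Rightarrow> real \<times> real \<Rightarrow> 'b::real_normed_vector"
  assumes seg: "\<forall>\<^sub>F i in F. \<forall>p x y t. (p, (x, y)) \<in> \<Omega> i \<longrightarrow> 0 \<le> t \<longrightarrow> t \<le> 1 \<longrightarrow> (p, (t * x, y)) \<in> \<Omega> i"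
    and B: "0 \<le> B" "\<forall>\<^sub>F i in F. \<forall>p x. (p, x) \<in> \<Omega> i \<longrightarrow> norm x \<le> B"
    and g: "\<forall>\<^sub>F i in F. CT (Suc m) d (\<Omega> i) (g i)"
    and z: "\<forall>\<^sub>F i in F. \<forall>p x y. (p, (x, y)) \<in> \<Omega> i \<longrightarrow> g i p (0, y) = 0"
    and x: "SMALL F m d \<Omega> (\<lambda>i. dspace (1, 0) (g i))"
  shows "SMALL F m d \<Omega> g"
proof (rule SMALL_vanish[where \<kappa> = "\<lambda>v. (0, snd v)" and e = "(1, 0)" and e' = "(1, 0)", OF _ _ _ _ _ _ B(1) _ g _ x x])
  show "bounded_linear (\<lambda>v::real \<times> real. (0::real, snd v))"
    by (intro bounded_linear_Pair bounded_linear_zero bounded_linear_snd)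
  fix w :: "real \<times> real"
  show "norm (0::real, snd w) \<le> norm w" using plane_bounds[of w] by simp
  have e: "w - (0, snd w) = (fst w, 0)" for w :: "real \<times> real" by (simp add: prod_eq_iff)
  show "norm (w - (0, snd w)) \<le> norm w" unfolding e using plane_bounds[of w] by simp
  show "\<exists>c c'. w = c *\<^sub>R (1, 0) + c' *\<^sub>R (1, 0) \<and> \<bar>c\<bar> \<le> norm w \<and> \<bar>c'\<bar> \<le> norm w" if "(0::real, snd w) = 0"
    using that by (intro exI[of _ "fst w"] exI[of _ 0]) (simp add: prod_eq_iff plane_bounds)
next
  have e: "(0, snd x) + t *\<^sub>R (x - (0, snd x)) = (t * fst x, snd x)" for x :: "real \<times> real" and t by (simp add: prod_eq_iff)
  show "\<forall>\<^sub>F i in F. \<forall>p x t. (p, x) \<in> \<Omega> i \<longrightarrow> 0 \<le> t \<longrightarrow> t \<le> 1 \<longrightarrow> (p, (0, snd x) + t *\<^sub>R (x - (0, snd x))) \<in> \<Omega> i"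
    using seg by (rule eventually_mono) (simp add: e)
  have n: "norm (x - (0, snd x)) \<le> norm x" for x :: "real \<times> real"
  proof -
    have "x - (0, snd x) = (fst x, 0)" by (simp add: prod_eq_iff)
    then show ?thesis using plane_bounds[of x] by simp
  qed
  show "\<forall>\<^sub>F i in F. \<forall>p x. (p, x) \<in> \<Omega> i \<longrightarrow> norm (x - (0, snd x)) \<le> B"
    using B(2) by (rule eventually_mono) (meson n order_trans)
  show "\<forall>\<^sub>F i in F. \<forall>p x. (p, x) \<in> \<Omega> i \<longrightarrow> g i p (0, snd x) = 0"
    using z by (rule eventually_mono) auto
qed auto

lemma dspace_scaled:
  fixes G :: "'p::real_normed_vector \<Rightarrow> real \<times> real \<Rightarrow> 'b::real_normed_vector"
  assumes G: "DB (Suc m) d K \<Omega>' G" and i: "(p, (a * fst z, b * snd z)) \<in> \<Omega>'"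
  shows "((\<lambda>z. G p (a * fst z, b * snd z)) has_derivative (\<lambda>v. dspace (a * fst v, b * snd v) G p (a * fst z, b * snd z))) (at z)"
proof (rule has_derivative_compose[where f = "\<lambda>z. (a * fst z, b * snd z)" and g = "G p" and f' = "\<lambda>v. (a * fst v, b * snd v)"
      and g' = "\<lambda>w. dspace w G p (a * fst z, b * snd z)", OF _ DB_diff_space[OF G i]])
  show "((\<lambda>z. (a * fst z, b * snd z)) has_derivative (\<lambda>v. (a * fst v, b * snd v))) (at z)"
    by (intro has_derivative_Pair has_derivative_mult_right has_derivative_fst has_derivative_snd has_derivative_ident)
qed

lemma dspace_rescale:
  fixes G :: "'p::real_normed_vector \<Rightarrow> real \<times> real \<Rightarrow> 'b::real_normed_vector"
  assumes G: "DB (Suc m) d K \<Omega>' G" and i: "(\<pi> q, (s q * fst z, s' q * snd z)) \<in> \<Omega>'"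
  shows "dspace (1, 0) (\<lambda>q z. G (\<pi> q) (s q * fst z, s' q * snd z)) q z
      = s q *\<^sub>R dspace (1, 0) G (\<pi> q) (s q * fst z, s' q * snd z)"
    and "dspace (0, 1) (\<lambda>q z. G (\<pi> q) (s q * fst z, s' q * snd z)) q z
      = s' q *\<^sub>R dspace (0, 1) G (\<pi> q) (s q * fst z, s' q * snd z)"
proof -
  have l: "linear (\<lambda>w. dspace w G (\<pi> q) (s q * fst z, s' q * snd z))"
    by (rule has_derivative_linear[OF DB_diff_space[OF G i]])
  have e: "(s q, 0) = s q *\<^sub>R (1, 0::real)" "(0, s' q) = s' q *\<^sub>R (0::real, 1)" by simp_all
  note D = dspaceI[where g = "\<lambda>q z. G (\<pi> q) (s q * fst z, s' q * snd z)" and p = q, OF dspace_scaled[OF G i]]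
  show "dspace (1, 0) (\<lambda>q z. G (\<pi> q) (s q * fst z, s' q * snd z)) q z
      = s q *\<^sub>R dspace (1, 0) G (\<pi> q) (s q * fst z, s' q * snd z)"
    using D[of "(1, 0)"] linear_scale[OF l, of "s q" "(1, 0)"] by simp
  show "dspace (0, 1) (\<lambda>q z. G (\<pi> q) (s q * fst z, s' q * snd z)) q z
      = s' q *\<^sub>R dspace (0, 1) G (\<pi> q) (s q * fst z, s' q * snd z)"
    using D[of "(0, 1)"] linear_scale[OF l, of "s' q" "(0, 1)"] by simp
qed

text \<open>Used twice: with \<open>s' = s\<close> for the affine-like representation and with
  \<open>s' = s^2\<close> for the remainder. The condition \<open>box\<close> makes the domain
  star-shaped about the origin and about the axes, as integration requires.\<close>

locale rescaling =
  fixes F :: "'i filter" and d r :: nat and \<Omega> \<Omega>' :: "'i \<Rightarrow> (plane \<times> plane) set"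
    and \<pi> :: "'i \<Rightarrow> plane \<Rightarrow> plane" and s s' :: "'i \<Rightarrow> plane \<Rightarrow> real" and B :: real
  assumes dr: "d + 3 \<le> r"
    and open_dom: "\<forall>\<^sub>F i in F. open (\<Omega> i)"
    and into: "\<forall>\<^sub>F i in F. \<forall>q z. (q, z) \<in> \<Omega> i \<longrightarrow> (\<pi> i q, (s i q * fst z, s' i q * snd z)) \<in> \<Omega>' i"
    and B: "0 \<le> B" "\<forall>\<^sub>F i in F. \<forall>q z. (q, z) \<in> \<Omega> i \<longrightarrow> norm z \<le> B"
    and box: "\<forall>\<^sub>F i in F. \<forall>q x y t t'. (q, (x, y)) \<in> \<Omega> i \<longrightarrow> \<bar>t\<bar> \<le> 1 \<longrightarrow> \<bar>t'\<bar> \<le> 1 \<longrightarrow> (q, (t * x, t' * y)) \<in> \<Omega> i"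
    and par: "DBD F r d \<Omega> (\<lambda>i q z. \<pi> i q)"
    and s_small: "SMALL F r d \<Omega> (\<lambda>i q z. s i q)" "SMALL F r d \<Omega> (\<lambda>i q z. s' i q)"
begin

abbreviation rsc :: "('i \<Rightarrow> plane \<Rightarrow> plane \<Rightarrow> real) \<Rightarrow> 'i \<Rightarrow> plane \<Rightarrow> plane \<Rightarrow> real" where
  "rsc G \<equiv> \<lambda>i q z. G i (\<pi> i q) (s i q * fst z, s' i q * snd z)"

lemma seg: "\<forall>\<^sub>F i in F. \<forall>q z t. (q, z) \<in> \<Omega> i \<longrightarrow> 0 \<le> t \<longrightarrow> t \<le> 1 \<longrightarrow> (q, t *\<^sub>R z) \<in> \<Omega> i"
  using box by (rule eventually_mono) auto

lemma seg_axis: "\<forall>\<^sub>F i in F. \<forall>q x y t. (q, (x, y)) \<in> \<Omega> i \<longrightarrow> 0 \<le> t \<longrightarrow> t \<le> 1 \<longrightarrow> (q, (t * x, y)) \<in> \<Omega> i"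
  using box
proof (rule eventually_mono)
  fix i assume a: "\<forall>q x y t t'. (q, (x, y)) \<in> \<Omega> i \<longrightarrow> \<bar>t\<bar> \<le> 1 \<longrightarrow> \<bar>t'\<bar> \<le> 1 \<longrightarrow> (q, (t * x, t' * y)) \<in> \<Omega> i"
  show "\<forall>q x y t. (q, (x, y)) \<in> \<Omega> i \<longrightarrow> 0 \<le> t \<longrightarrow> t \<le> 1 \<longrightarrow> (q, (t * x, y)) \<in> \<Omega> i"
  proof (intro allI impI)
    fix q and x y t :: real assume "(q, (x, y)) \<in> \<Omega> i" "0 \<le> t" "t \<le> 1"
    then show "(q, (t * x, y)) \<in> \<Omega> i" using a[rule_format, of q x y t 1] by simp
  qed
qed

lemma BDD_coord: "BDD F m d \<Omega> (\<lambda>i q z. fst z)" "BDD F m d \<Omega> (\<lambda>i q z. snd z)"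
proof -
  have "\<forall>\<^sub>F i in F. \<forall>q z. (q, z) \<in> \<Omega> i \<longrightarrow> norm (fst z) \<le> B"
    using B(2)
  proof (rule eventually_mono, intro allI impI)
    fix i q and z :: plane assume "\<forall>q z. (q, z) \<in> \<Omega> i \<longrightarrow> norm z \<le> B" "(q, z) \<in> \<Omega> i"
    then have "norm z \<le> B" by blast
    then show "norm (fst z) \<le> B" using plane_bounds(1)[of z] by simp
  qed
  moreover have "\<forall>\<^sub>F i in F. \<forall>q z. (q, z) \<in> \<Omega> i \<longrightarrow> norm (snd z) \<le> B"
    using B(2)
  proof (rule eventually_mono, intro allI impI)
    fix i q and z :: plane assume "\<forall>q z. (q, z) \<in> \<Omega> i \<longrightarrow> norm z \<le> B" "(q, z) \<in> \<Omega> i"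
    then have "norm z \<le> B" by blast
    then show "norm (snd z) \<le> B" using plane_bounds(2)[of z] by simp
  qed
  ultimately show "BDD F m d \<Omega> (\<lambda>i q z. fst z)" "BDD F m d \<Omega> (\<lambda>i q z. snd z)"
    using BDD_linear[where L = fst and F = F and \<Omega> = \<Omega> and B = B and r = m and d = d, OF bounded_linear_fst _ open_dom]
      BDD_linear[where L = snd and F = F and \<Omega> = \<Omega> and B = B and r = m and d = d, OF bounded_linear_snd _ open_dom] plane_bounds
    by auto
qed

lemma DBD_arg: "m \<le> r \<Longrightarrow> DBD F m d \<Omega> (\<lambda>i q z. (s i q * fst z, s' i q * snd z))"
  by (intro DBD_Pair BDD_DBD BDD_mult BDD_coord BDD_mono[OF SMALL_BDD[OF s_small(1)]] BDD_mono[OF SMALL_BDD[OF s_small(2)]] order_refl)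

lemma BDD_rsc:
  assumes "BDD F m d \<Omega>' G" "m \<le> r" shows "BDD F m d \<Omega> (rsc G)"
  by (rule BDD_compose[OF assms(1) DBD_mono[OF par assms(2) order_refl] DBD_arg[OF assms(2)] into])

lemma CT_rsc:
  assumes G: "\<forall>\<^sub>F i in F. CT m d (\<Omega>' i) (G i)" and m: "m \<le> r"
  shows "\<forall>\<^sub>F i in F. CT m d (\<Omega> i) (rsc G i)"
proof -
  obtain K L where "\<forall>\<^sub>F i in F. DB m d K (\<Omega> i) (\<lambda>q z. \<pi> i q)" "\<forall>\<^sub>F i in F. DB m d L (\<Omega> i) (\<lambda>q z. (s i q * fst z, s' i q * snd z))"
    using DBD_mono[OF par m order_refl] DBD_arg[OF m] unfolding DBD_def by blast
  with G into show ?thesis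
  proof eventually_elim
    case (elim i)
    show ?case by (rule CT_compose[OF elim(1) CT_of_DB[OF elim(3)] CT_of_DB[OF elim(4)]]) (use elim(2) in blast)
  qed
qed

lemma rsc_dspace:
  assumes G: "\<forall>\<^sub>F i in F. CT (Suc m) d (\<Omega>' i) (G i)"
  shows "\<forall>\<^sub>F i in F. \<forall>q z. (q, z) \<in> \<Omega> i \<longrightarrow> dspace (1, 0) (rsc G i) q z = s i q * rsc (\<lambda>i. dspace (1, 0) (G i)) i q z"
    and "\<forall>\<^sub>F i in F. \<forall>q z. (q, z) \<in> \<Omega> i \<longrightarrow> dspace (0, 1) (rsc G i) q z = s' i q * rsc (\<lambda>i. dspace (0, 1) (G i)) i q z"
proof -
  show "\<forall>\<^sub>F i in F. \<forall>q z. (q, z) \<in> \<Omega> i \<longrightarrow> dspace (1, 0) (rsc G i) q z = s i q * rsc (\<lambda>i. dspace (1, 0) (G i)) i q z"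
    using G into
  proof eventually_elim
    case (elim i) then show ?case using dspace_rescale(1)[OF CB_DB[OF elim(1)], of "\<pi> i" _ "s i" _ "s' i"] by simp
  qed
  show "\<forall>\<^sub>F i in F. \<forall>q z. (q, z) \<in> \<Omega> i \<longrightarrow> dspace (0, 1) (rsc G i) q z = s' i q * rsc (\<lambda>i. dspace (0, 1) (G i)) i q z"
    using G into
  proof eventually_elim
    case (elim i) then show ?case using dspace_rescale(2)[OF CB_DB[OF elim(1)], of "\<pi> i" _ "s i" _ "s' i"] by simp
  qed
qed

lemma eventually_sym_eq:
  "\<forall>\<^sub>F i in F. \<forall>q z. (q, z) \<in> \<Omega> i \<longrightarrow> f i q z = g i q z \<Longrightarrow> \<forall>\<^sub>F i in F. \<forall>q z. (q, z) \<in> \<Omega> i \<longrightarrow> g i q z = f i q z"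
  by (erule eventually_mono) auto

text \<open>By the chain rule a space derivative of a rescaled function carries the factor
  \<open>s\<close> or \<open>s'\<close>, which is small in the parameter as well.\<close>

lemma SMALL_rsc_dspace:
  assumes G: "\<forall>\<^sub>F i in F. CT (Suc n) d (\<Omega>' i) (G i)" and m: "m \<le> r"
  shows "BDD F m d \<Omega>' (\<lambda>i. dspace (1, 0) (G i)) \<Longrightarrow> SMALL F m d \<Omega> (\<lambda>i. dspace (1, 0) (rsc G i))"
    and "BDD F m d \<Omega>' (\<lambda>i. dspace (0, 1) (G i)) \<Longrightarrow> SMALL F m d \<Omega> (\<lambda>i. dspace (0, 1) (rsc G i))"
  using SMALL_cong[OF SMALL_mult[OF SMALL_mono[OF s_small(1) m order_refl] BDD_rsc[OF _ m]] eventually_sym_eq[OF rsc_dspace(1)[OF G]]]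
    SMALL_cong[OF SMALL_mult[OF SMALL_mono[OF s_small(2) m order_refl] BDD_rsc[OF _ m]] eventually_sym_eq[OF rsc_dspace(2)[OF G]]]
  by auto

text \<open>Values and parameter derivatives carry no factor \<open>s\<close>; since
  \<open>G\<close> vanishes at the origin for every parameter, they are integrals of small space
  derivatives.\<close>

lemma SMALL_rsc:
  assumes G: "\<forall>\<^sub>F i in F. CT (Suc m) d (\<Omega>' i) (G i)" and m: "d \<le> m" "Suc m \<le> r"
    and z: "\<forall>\<^sub>F i in F. \<forall>q z. (q, z) \<in> \<Omega> i \<longrightarrow> G i (\<pi> i q) 0 = 0"
    and b: "BDD F m d \<Omega>' (\<lambda>i. dspace (1, 0) (G i))" "BDD F m d \<Omega>' (\<lambda>i. dspace (0, 1) (G i))"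
  shows "SMALL F (Suc m) d \<Omega> (rsc G)"
proof (rule SMALL_vanish_origin[OF seg B CT_rsc[OF G m(2)] _ _ _ m(1)])
  show "\<forall>\<^sub>F i in F. \<forall>q z. (q, z) \<in> \<Omega> i \<longrightarrow> rsc G i q 0 = 0"
    using z by (rule eventually_mono) (simp add: zero_prod_def)
qed (use SMALL_rsc_dspace[OF G _ ] m b in auto)

text \<open>
  Distortion: \<open>D log \<partial>\<^sub>x a\<close> is bounded, so after rescaling \<open>log \<partial>\<^sub>x a\<close> is small, and integrating
  \<open>\<partial>\<^sub>x a - 1\<close> in the direction \<open>x\<close> shows that the rescaled \<open>a\<close> is close to the first coordinate.
\<close>

lemma SMALL_gamma:
  assumes ss': "\<And>i. s' i = s i" and s0: "\<forall>\<^sub>F i in F. \<forall>q z. (q, z) \<in> \<Omega> i \<longrightarrow> s i q \<noteq> 0"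
    and a: "\<forall>\<^sub>F i in F. CT r d (\<Omega>' i) (a i)"
    and a0: "\<forall>\<^sub>F i in F. \<forall>q x y. (q, (x, y)) \<in> \<Omega> i \<longrightarrow> a i (\<pi> i q) (0, s i q * y) = 0"
    and a1: "\<forall>\<^sub>F i in F. \<forall>q z. (q, z) \<in> \<Omega> i \<longrightarrow> dspace (1, 0) (a i) (\<pi> i q) 0 = 1"
    and pos: "\<forall>\<^sub>F i in F. \<forall>p z. (p, z) \<in> \<Omega>' i \<longrightarrow> 0 < dspace (1, 0) (a i) p z"
    and dist: "BDD F (r - 2) d \<Omega>' (\<lambda>i. dspace (1, 0) (\<lambda>p z. ln (dspace (1, 0) (a i) p z)))"
      "BDD F (r - 2) d \<Omega>' (\<lambda>i. dspace (0, 1) (\<lambda>p z. ln (dspace (1, 0) (a i) p z)))"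
  defines "\<gamma> \<equiv> \<lambda>i q z. rsc a i q z / s i q - fst z"
  shows "\<forall>\<^sub>F i in F. CT r d (\<Omega> i) (\<gamma> i)" "SMALL F (r - 1) d \<Omega> \<gamma>" "BDD F r d \<Omega>' a \<Longrightarrow> SMALL F r d \<Omega> \<gamma>"
proof -
  define m where "m = r - 2"
  have r: "r = Suc (Suc m)" "r - 1 = Suc m" "d \<le> m" using dr by (auto simp: m_def)
  then have le: "Suc m \<le> r" by auto
  define L where "L i p z = ln (dspace (1, 0) (a i) p z)" for i p z
  have aS: "\<forall>\<^sub>F i in F. CT (Suc (Suc m)) d (\<Omega>' i) (a i)" using a unfolding r .
  have L: "\<forall>\<^sub>F i in F. CT (Suc m) d (\<Omega>' i) (L i)"
    using aS pos
  proof eventually_elim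
    case (elim i) show ?case unfolding L_def
      by (rule CT_ln[OF CB_top[OF CB_dspace[OF elim(1)]]]) (use elim(2) in blast)
  qed
  have E: "SMALL F (Suc m) d \<Omega> (rsc L)"
  proof (rule SMALL_rsc[OF L r(3) le _ dist[folded L_def m_def]])
    show "\<forall>\<^sub>F i in F. \<forall>q z. (q, z) \<in> \<Omega> i \<longrightarrow> L i (\<pi> i q) 0 = 0"
      using a1 by (rule eventually_mono) (simp add: L_def)
  qed
  \<comment> \<open>This is the rescaled \<open>\<partial>\<^sub>x a - 1\<close>: exponentiating the
    small function \<open>rsc L\<close> avoids any lower bound on
    \<open>\<partial>\<^sub>x a\<close>.\<close>
  define e where "e i q z = exp (rsc L i q z) - 1" for i q z
  have Ed: "\<forall>\<^sub>F i in F. CT (Suc m) d (\<Omega> i) (rsc L i)" by (rule CT_rsc[OF L le])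
  have ed: "\<forall>\<^sub>F i in F. \<forall>q z. (q, z) \<in> \<Omega> i \<longrightarrow> dspace v (rsc L i) q z * exp (rsc L i q z) = dspace v (e i) q z" for v
    using Ed
  proof eventually_elim
    case (elim i)
    show ?case
    proof (intro allI impI)
      fix q z assume "(q, z) \<in> \<Omega> i"
      note D = CB_diff_space[OF elim this]
      have "(e i q has_derivative (\<lambda>v. dspace v (rsc L i) q z * exp (rsc L i q z))) (at z)"
        unfolding e_def using has_derivative_diff[OF has_derivative_exp[OF D] has_derivative_const[of 1]]
        by (simp add: mult.commute)
      then show "dspace v (rsc L i) q z * exp (rsc L i q z) = dspace v (e i) q z"
        by (rule dspaceI[where D = "\<lambda>v. dspace v (rsc L i) q z * exp (rsc L i q z)", symmetric])
    qed
  qed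
  have e: "SMALL F (Suc m) d \<Omega> e"
  proof (rule SMALL_vanish_origin[OF seg B _ _ _ _ r(3)])
    show "\<forall>\<^sub>F i in F. CT (Suc m) d (\<Omega> i) (e i)"
      using Ed open_dom unfolding e_def by eventually_elim (intro CT_diff CT_exp CT_const)
    have "\<forall>\<^sub>F i in F. \<forall>q z. (q, z) \<in> \<Omega> i \<longrightarrow> rsc L i q 0 = 0"
      using a1 by (rule eventually_mono) (simp add: L_def zero_prod_def)
    then show "\<forall>\<^sub>F i in F. \<forall>q z. (q, z) \<in> \<Omega> i \<longrightarrow> e i q 0 = 0"
      by (rule eventually_mono) (simp add: e_def)
    have "SMALL F m d \<Omega> (\<lambda>i. dspace v (e i))" for v
      by (rule SMALL_cong[OF SMALL_mult[OF SMALL_dspace[OF E, of v] BDD_exp[OF SMALL_mono[OF E]]] ed]) auto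
    then show "SMALL F m d \<Omega> (\<lambda>i. dspace (1, 0) (e i))" "SMALL F m d \<Omega> (\<lambda>i. dspace (0, 1) (e i))" by blast+
  qed
  show \<gamma>C: "\<forall>\<^sub>F i in F. CT r d (\<Omega> i) (\<gamma> i)"
    using CT_rsc[OF a order_refl] SMALL_D[OF s_small(1) zero_less_one] open_dom s0
  proof eventually_elim
    case (elim i) show ?case unfolding \<gamma>_def
      by (intro CT_diff CT_divide CT_fst CT_space elim(1,3) CB_top[OF elim(2)]) (use elim(4) in blast)
  qed
  then have \<gamma>C': "\<forall>\<^sub>F i in F. CT (Suc (Suc m)) d (\<Omega> i) (\<gamma> i)" unfolding r .
  \<comment> \<open>The factor \<open>s\<close> produced by differentiating the rescaled function
    cancels the division by \<open>s\<close>.\<close>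
  have \<gamma>d: "\<forall>\<^sub>F i in F. \<forall>q z. (q, z) \<in> \<Omega> i \<longrightarrow> dspace (1, 0) (\<gamma> i) q z = rsc (\<lambda>i. dspace (1, 0) (a i)) i q z - 1 \<and>
      dspace (0, 1) (\<gamma> i) q z = rsc (\<lambda>i. dspace (0, 1) (a i)) i q z"
    using CT_rsc[OF a order_refl] rsc_dspace[OF aS] s0
  proof eventually_elim
    case (elim i)
    show ?case
    proof (intro allI impI)
      fix q z assume i: "(q, z) \<in> \<Omega> i"
      have "(\<gamma> i q has_derivative (\<lambda>v. dspace v (rsc a i) q z / s i q - fst v)) (at z)"
        unfolding \<gamma>_def divide_inverse
        by (intro has_derivative_diff has_derivative_mult_left CB_diff_space[OF elim(1)[unfolded r] i] has_derivative_fst has_derivative_ident)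
      from dspaceI[where g = "\<gamma> i" and D = "\<lambda>v. dspace v (rsc a i) q z / s i q - fst v", OF this]
      show "dspace (1, 0) (\<gamma> i) q z = rsc (\<lambda>i. dspace (1, 0) (a i)) i q z - 1 \<and>
          dspace (0, 1) (\<gamma> i) q z = rsc (\<lambda>i. dspace (0, 1) (a i)) i q z"
        using elim(2)[rule_format, OF i] elim(3)[rule_format, OF i] elim(4)[rule_format, OF i] by (simp add: ss')
    qed
  qed
  have \<gamma>1: "SMALL F (Suc m) d \<Omega> (\<lambda>i. dspace (1, 0) (\<gamma> i))"
  proof (rule SMALL_cong[OF e])
    from \<gamma>d pos into show "\<forall>\<^sub>F i in F. \<forall>q z. (q, z) \<in> \<Omega> i \<longrightarrow> e i q z = dspace (1, 0) (\<gamma> i) q z"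
      by eventually_elim (simp add: e_def L_def)
  qed
  \<comment> \<open>Vanishing on the axis \<open>x = 0\<close> leaves only
    \<open>\<partial>\<^sub>x \<gamma>\<close> to integrate, which is known to be small up to order
    \<open>r - 1\<close>.\<close>
  show \<gamma>2: "SMALL F (r - 1) d \<Omega> \<gamma>"
    unfolding r(2)
  proof (rule SMALL_vanish_axis[OF seg_axis B \<gamma>C' _ \<gamma>1])
    show "\<forall>\<^sub>F i in F. \<forall>q x y. (q, (x, y)) \<in> \<Omega> i \<longrightarrow> \<gamma> i q (0, y) = 0"
      using a0 by (rule eventually_mono) (simp add: \<gamma>_def ss')
  qed
  assume b: "BDD F r d \<Omega>' a"
  \<comment> \<open>First derivatives of \<open>\<gamma>\<close> have used up the division by
    \<open>s\<close>; second derivatives carry a free factor \<open>s\<close>. A bound on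
    \<open>a\<close> at order \<open>r\<close> therefore makes them small at order
    \<open>r - 2\<close>, and two applications of \<open>SMALL_raise\<close> reach order
    \<open>r\<close>.\<close>
  have sm: "SMALL F m d \<Omega> (\<lambda>i. dspace v (dspace w (\<gamma> i)))"
    if vw: "v \<in> {(1, 0), (0, 1)}" "w \<in> {(1, 0), (0, 1)}" for v w
  proof -
    have dw: "\<forall>\<^sub>F i in F. CT (Suc m) d (\<Omega>' i) (dspace w (a i))"
      using aS by (rule eventually_mono) (rule CB_top[OF CB_dspace])
    have bw: "BDD F (Suc m) d \<Omega>' (\<lambda>i. dspace w (a i))" using DBD_dspace[OF BDD_DBD[OF b[unfolded r(1)]]] .
    have "SMALL F m d \<Omega> (\<lambda>i. dspace v (rsc (\<lambda>i. dspace w (a i)) i))"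
      using SMALL_rsc_dspace[OF dw, of m] DBD_dspace[OF BDD_DBD[OF bw]] vw(1) r(1) by auto
    then show ?thesis
    proof (rule SMALL_cong)
      show "\<forall>\<^sub>F i in F. \<forall>q z. (q, z) \<in> \<Omega> i \<longrightarrow> dspace v (rsc (\<lambda>i. dspace w (a i)) i) q z = dspace v (dspace w (\<gamma> i)) q z"
        using \<gamma>d open_dom CT_rsc[OF dw le]
      proof eventually_elim
        case (elim i)
        have "dspace v (dspace w (\<gamma> i)) q z = dspace v (\<lambda>q z. rsc (\<lambda>i. dspace w (a i)) i q z - fst w) q z" if "(q, z) \<in> \<Omega> i" for q z
          by (rule dspace_cong(1)[OF elim(2) that]) (use elim(1) vw(2) in auto)
        moreover have "dspace v (\<lambda>q z. rsc (\<lambda>i. dspace w (a i)) i q z - fst w) q z = dspace v (rsc (\<lambda>i. dspace w (a i)) i) q z" if "(q, z) \<in> \<Omega> i" for q z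
        proof -
          note D = elim(3)
          show ?thesis
            by (rule dspaceI[where D = "\<lambda>v. dspace v (rsc (\<lambda>i. dspace w (a i)) i) q z"])
              (use has_derivative_diff[OF CB_diff_space[OF D that] has_derivative_const[of "fst w"]] in simp)
        qed
        ultimately show ?case by simp
      qed
    qed
  qed
  have dC: "\<forall>\<^sub>F i in F. CT (Suc m) d (\<Omega> i) (dspace w (\<gamma> i))" for w
    using \<gamma>C' by (rule eventually_mono) (rule CB_top[OF CB_dspace])
  have "SMALL F (Suc m) d \<Omega> (\<lambda>i. dspace w (\<gamma> i))" if "w \<in> {(1, 0), (0, 1)}" for w
    by (rule SMALL_raise[OF dC SMALL_dspace[OF \<gamma>2[unfolded r(2)]] sm sm r(3)]) (use that in auto)
  then show "SMALL F r d \<Omega> \<gamma>"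
    unfolding r(1) using \<gamma>2 r(2,3) by (intro SMALL_raise[OF \<gamma>C']) auto
qed

text \<open>
  The anisotropic rescaling \<open>(s, s\<^sup>2)\<close> divided by \<open>s\<^sup>2\<close> makes every derivative of the remainder small
  except those which vanish at the origin; the latter are recovered by integration, which uses
  derivatives of order \<open>3\<close> in space and \<open>d\<close> in the parameter, whence \<open>d \<le> r - 3\<close>.
\<close>

lemma SMALL_remainder:
  assumes ss': "\<And>i q. s' i q = s i q ^ 2" and s0: "\<forall>\<^sub>F i in F. \<forall>q z. (q, z) \<in> \<Omega> i \<longrightarrow> s i q \<noteq> 0"
    and f: "\<forall>\<^sub>F i in F. CT r d (\<Omega>' i) (f i)" "BDD F r d \<Omega>' f"
    and f0: "\<forall>\<^sub>F i in F. \<forall>q z. (q, z) \<in> \<Omega> i \<longrightarrow> f i (\<pi> i q) 0 = 0 \<and> dspace (1, 0) (f i) (\<pi> i q) 0 = 0 \<and>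
      dspace (0, 1) (f i) (\<pi> i q) 0 = 0 \<and> dspace (1, 0) (dspace (1, 0) (f i)) (\<pi> i q) 0 = 0"
  defines "\<rho> \<equiv> \<lambda>i q z. rsc f i q z / s i q ^ 2"
  shows "\<forall>\<^sub>F i in F. CT r d (\<Omega> i) (\<rho> i)" "SMALL F r d \<Omega> \<rho>"
proof -
  define m where "m = r - 3"
  have r: "r = Suc (Suc (Suc m))" "d \<le> m" using dr by (auto simp: m_def)
  then have le: "Suc m \<le> r" "Suc (Suc m) \<le> r" "Suc (Suc (Suc m)) \<le> r" by auto
  have sC: "\<forall>\<^sub>F i in F. CT n d (\<Omega> i) (\<lambda>q z. s i q)" if "n \<le> r" for n
    using SMALL_D[OF SMALL_mono[OF s_small(1) that order_refl] zero_less_one] by (rule eventually_mono) (rule CB_top)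
  have fC: "\<forall>\<^sub>F i in F. CT (Suc (Suc (Suc m))) d (\<Omega>' i) (f i)" using f(1) unfolding r(1) .
  have fC1: "\<forall>\<^sub>F i in F. CT (Suc (Suc m)) d (\<Omega>' i) (dspace v (f i))" for v
    using fC by (rule eventually_mono) (rule CB_top[OF CB_dspace])
  have fC2: "\<forall>\<^sub>F i in F. CT (Suc m) d (\<Omega>' i) (dspace w (dspace v (f i)))" for v w
    using fC1 by (rule eventually_mono) (rule CB_top[OF CB_dspace])
  have b1: "BDD F (Suc (Suc m)) d \<Omega>' (\<lambda>i. dspace v (f i))" for v
    by (rule DBD_dspace[OF BDD_DBD[OF f(2)[unfolded r(1)]]])
  have b2: "BDD F (Suc m) d \<Omega>' (\<lambda>i. dspace w (dspace v (f i)))" for v w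
    by (rule DBD_dspace[OF BDD_DBD[OF b1]])
  have b3: "BDD F m d \<Omega>' (\<lambda>i. dspace u (dspace w (dspace v (f i))))" for u v w
    by (rule DBD_dspace[OF BDD_DBD[OF b2]])
  have z1: "\<forall>\<^sub>F i in F. \<forall>q z. (q, z) \<in> \<Omega> i \<longrightarrow> f i (\<pi> i q) 0 = 0"
    and z2: "\<forall>\<^sub>F i in F. \<forall>q z. (q, z) \<in> \<Omega> i \<longrightarrow> dspace (1, 0) (f i) (\<pi> i q) 0 = 0"
    and z3: "\<forall>\<^sub>F i in F. \<forall>q z. (q, z) \<in> \<Omega> i \<longrightarrow> dspace (0, 1) (f i) (\<pi> i q) 0 = 0"
    and z4: "\<forall>\<^sub>F i in F. \<forall>q z. (q, z) \<in> \<Omega> i \<longrightarrow> dspace (1, 0) (dspace (1, 0) (f i)) (\<pi> i q) 0 = 0"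
    using f0 by (rule eventually_mono, blast)+
  \<comment> \<open>\<open>\<partial>\<^sub>x\<partial>\<^sub>x f\<close> and, below,
    \<open>\<partial>\<^sub>y f\<close> are exactly the derivatives whose rescaling factor cancels
    \<open>s^2\<close>; both vanish at the origin, so \<open>SMALL_rsc\<close> applies to
    them.\<close>
  have xx: "SMALL F (Suc m) d \<Omega> (rsc (\<lambda>i. dspace (1, 0) (dspace (1, 0) (f i))))"
    by (rule SMALL_rsc[OF fC2 r(2) le(1) z4 b3 b3])
  have y: "SMALL F (Suc (Suc m)) d \<Omega> (rsc (\<lambda>i. dspace (0, 1) (f i)))"
    by (rule SMALL_rsc[OF fC1 _ le(2) z3 b2 b2]) (use r in simp)
  \<comment> \<open>\<open>f1\<close> is \<open>\<partial>\<^sub>x \<rho>\<close>. Its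
    \<open>x\<close>-derivative is the rescaled
    \<open>\<partial>\<^sub>x\<partial>\<^sub>x f\<close>, and its \<open>y\<close>-derivative keeps
    a factor \<open>s^2 / s = s\<close>, so the mixed second derivative of \<open>f\<close> may be
    nonzero at the origin.\<close>
  define f1 where "f1 i q z = rsc (\<lambda>i. dspace (1, 0) (f i)) i q z / s i q" for i q z
  have f1C: "\<forall>\<^sub>F i in F. CT (Suc (Suc m)) d (\<Omega> i) (f1 i)"
    using CT_rsc[OF fC1[of "(1, 0)"] le(2)] sC[OF le(2)] s0
  proof eventually_elim
    case (elim i) show ?case unfolding f1_def
      by (intro CT_divide elim(1,2)) (use elim(3) in blast)
  qed
  have f1d: "\<forall>\<^sub>F i in F. \<forall>q z. (q, z) \<in> \<Omega> i \<longrightarrow> dspace (1, 0) (f1 i) q z = rsc (\<lambda>i. dspace (1, 0) (dspace (1, 0) (f i))) i q z \<and>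
     dspace (0, 1) (f1 i) q z = s i q * rsc (\<lambda>i. dspace (0, 1) (dspace (1, 0) (f i))) i q z"
    using CT_rsc[OF fC1[of "(1, 0)"] le(2)] rsc_dspace[OF fC1[of "(1, 0)"]] s0
  proof eventually_elim
    case (elim i)
    show ?case
    proof (intro allI impI)
      fix q z assume i: "(q, z) \<in> \<Omega> i"
      have "(f1 i q has_derivative (\<lambda>v. dspace v (rsc (\<lambda>i. dspace (1, 0) (f i)) i) q z / s i q)) (at z)"
        unfolding f1_def divide_inverse
        by (intro has_derivative_mult_left CB_diff_space[OF elim(1) i])
      from dspaceI[where g = "f1 i" and D = "\<lambda>v. dspace v (rsc (\<lambda>i. dspace (1, 0) (f i)) i) q z / s i q", OF this]
      show "dspace (1, 0) (f1 i) q z = rsc (\<lambda>i. dspace (1, 0) (dspace (1, 0) (f i))) i q z \<and>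
         dspace (0, 1) (f1 i) q z = s i q * rsc (\<lambda>i. dspace (0, 1) (dspace (1, 0) (f i))) i q z"
        using elim(2)[rule_format, OF i] elim(3)[rule_format, OF i] elim(4)[rule_format, OF i]
        by (simp add: ss' power2_eq_square)
    qed
  qed
  have f1: "SMALL F (Suc (Suc m)) d \<Omega> f1"
  proof (rule SMALL_vanish_origin[OF seg B f1C])
    show "\<forall>\<^sub>F i in F. \<forall>q z. (q, z) \<in> \<Omega> i \<longrightarrow> f1 i q 0 = 0"
      using z2 by (rule eventually_mono) (auto simp: f1_def zero_prod_def)
    show "SMALL F (Suc m) d \<Omega> (\<lambda>i. dspace (1, 0) (f1 i))"
      by (rule SMALL_cong[OF xx]) (use f1d in \<open>auto elim: eventually_mono\<close>)
    show "SMALL F (Suc m) d \<Omega> (\<lambda>i. dspace (0, 1) (f1 i))"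
      by (rule SMALL_cong[OF SMALL_mult[OF SMALL_mono[OF s_small(1)] BDD_rsc[OF b2]]])
        (use f1d r in \<open>auto elim: eventually_mono\<close>)
  qed (use r in auto)
  show \<rho>C: "\<forall>\<^sub>F i in F. CT r d (\<Omega> i) (\<rho> i)"
    using CT_rsc[OF f(1) order_refl] sC[OF order_refl] s0
  proof eventually_elim
    case (elim i) show ?case unfolding \<rho>_def power2_eq_square
      by (intro CT_divide CT_mult elim(1,2)) (use elim(3) in auto)
  qed
  have \<rho>d: "\<forall>\<^sub>F i in F. \<forall>q z. (q, z) \<in> \<Omega> i \<longrightarrow> dspace (1, 0) (\<rho> i) q z = f1 i q z \<and>
     dspace (0, 1) (\<rho> i) q z = rsc (\<lambda>i. dspace (0, 1) (f i)) i q z"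
    using CT_rsc[OF fC le(3)] rsc_dspace[OF fC] s0
  proof eventually_elim
    case (elim i)
    show ?case
    proof (intro allI impI)
      fix q z assume i: "(q, z) \<in> \<Omega> i"
      have "(\<rho> i q has_derivative (\<lambda>v. dspace v (rsc f i) q z / s i q ^ 2)) (at z)"
        unfolding \<rho>_def divide_inverse
        by (intro has_derivative_mult_left CB_diff_space[OF elim(1) i])
      from dspaceI[where g = "\<rho> i" and D = "\<lambda>v. dspace v (rsc f i) q z / s i q ^ 2", OF this]
      show "dspace (1, 0) (\<rho> i) q z = f1 i q z \<and> dspace (0, 1) (\<rho> i) q z = rsc (\<lambda>i. dspace (0, 1) (f i)) i q z"
        using elim(2)[rule_format, OF i] elim(3)[rule_format, OF i] elim(4)[rule_format, OF i]
        by (simp add: ss' f1_def power2_eq_square)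
    qed
  qed
  show "SMALL F r d \<Omega> \<rho>"
    unfolding r(1)
  proof (rule SMALL_vanish_origin[OF seg B \<rho>C[unfolded r(1)]])
    show "\<forall>\<^sub>F i in F. \<forall>q z. (q, z) \<in> \<Omega> i \<longrightarrow> \<rho> i q 0 = 0"
      using z1 by (rule eventually_mono) (auto simp: \<rho>_def zero_prod_def)
    show "SMALL F (Suc (Suc m)) d \<Omega> (\<lambda>i. dspace (1, 0) (\<rho> i))"
      by (rule SMALL_cong[OF f1]) (use \<rho>d in \<open>auto elim: eventually_mono\<close>)
    show "SMALL F (Suc (Suc m)) d \<Omega> (\<lambda>i. dspace (0, 1) (\<rho> i))"
      by (rule SMALL_cong[OF y]) (use \<rho>d in \<open>auto elim: eventually_mono\<close>)
  qed (use r in auto)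
qed

end

text \<open>
  If \<open>u\<close> solves \<open>u + \<gamma>(u, x) = S\<close> with \<open>\<gamma>\<close> small, then \<open>w = u - S\<close> satisfies
  \<open>(1 + \<partial>\<^sub>1\<gamma>) Dw = - (\<partial>\<^sub>1\<gamma> DS + \<partial>\<^sub>2\<gamma> dx)\<close>, which bounds \<open>w\<close> inductively on the order.
\<close>

lemma SMALL_implicit:
  fixes \<gamma> u S :: "'i \<Rightarrow> plane \<Rightarrow> plane \<Rightarrow> real"
  assumes \<gamma>: "SMALL F m d \<Omega> \<gamma>" and uC: "\<forall>\<^sub>F i in F. CT m d (W i) (u i)" and S: "DBD F m d W S"
    and into: "\<forall>\<^sub>F i in F. \<forall>q z. (q, z) \<in> W i \<longrightarrow> (q, (u i q z, fst z)) \<in> \<Omega> i"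
    and eq: "\<forall>\<^sub>F i in F. \<forall>q z. (q, z) \<in> W i \<longrightarrow> u i q z + \<gamma> i q (u i q z, fst z) = S i q z"
  shows "SMALL F m d W (\<lambda>i q z. u i q z - S i q z)" "DBD F m d W u"
proof -
  have oW: "\<forall>\<^sub>F i in F. open (W i)" using uC by (rule eventually_mono) (rule CB_open)
  have \<gamma>C: "\<forall>\<^sub>F i in F. CT m d (\<Omega> i) (\<gamma> i)"
    using SMALL_D[OF \<gamma> zero_less_one] by (rule eventually_mono) (rule CB_top)
  have SC: "\<forall>\<^sub>F i in F. CT m d (W i) (S i)"
    using S unfolding DBD_def by (auto elim!: eventually_mono intro: CT_of_DB)
  define w where "w i q z = u i q z - S i q z" for i q z
  have wC: "\<forall>\<^sub>F i in F. CT m d (W i) (w i)"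
    using uC SC unfolding w_def by eventually_elim (rule CT_diff)
  \<comment> \<open>Smallness of \<open>w\<close> at order \<open>n\<close> bounds the derivatives
    of \<open>u = w + S\<close> at that order, which is what the next order needs inside the
    composition.\<close>
  have uw: "DBD F n d W u" if "SMALL F n d W w" "n \<le> m" for n
    using DBD_add[OF BDD_DBD[OF SMALL_BDD[OF that(1)]] DBD_mono[OF S that(2) order_refl]] by (simp add: w_def)
  have "n \<le> m \<longrightarrow> SMALL F n d W w" for n
  proof (induction n)
    \<comment> \<open>At order \<open>0\<close> the equation reads
      \<open>w = - \<gamma>(u, X)\<close>, so the bound on \<open>\<gamma>\<close> is a bound on
      \<open>w\<close>.\<close>
    case 0
    have "SMALL F 0 d W w" unfolding SMALL_def
    proof (intro allI impI)
      fix \<delta> :: real assume "0 < \<delta>"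
      from SMALL_bound[OF \<gamma> this] into eq wC show "\<forall>\<^sub>F i in F. CB 0 d (ennreal \<delta>) (W i) (w i)"
      proof eventually_elim
        case (elim i)
        have "ennreal (norm (w i q z)) \<le> ennreal \<delta>" if "(q, z) \<in> W i" for q z
        proof -
          have "w i q z = - \<gamma> i q (u i q z, fst z)" using elim(3) that by (simp add: w_def algebra_simps)
          then show ?thesis using elim(1,2) that by (auto intro!: ennreal_leI)
        qed
        then show ?case using CB_open[OF elim(4)] CB_cont[OF elim(4)] by auto
      qed
    qed
    then show ?case by simp
  next
    case (Suc n)
    show ?case
    proof
      assume n: "Suc n \<le> m"
      then obtain m' where m: "m = Suc m'" "n \<le> m'" by (cases m) auto
      have w: "SMALL F n d W w" using Suc n by simp
      \<comment> \<open>The formulas for the first derivatives of \<open>w\<close> contain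
        \<open>u\<close> only through the inner map \<open>(u, X)\<close>, so its order
        \<open>n\<close> yields \<open>w\<close> at order \<open>n + 1\<close>.\<close>
      have \<eta>: "DBD F n d W (\<lambda>i q z. (u i q z, fst z))"
        by (rule DBD_Pair[OF uw[OF w Suc_leD[OF n]] DBD_linear[where L = fst, OF bounded_linear_fst _ oW]])
          (simp only: real_norm_def plane_bounds)
      have comp: "SMALL F n d' W (\<lambda>i q z. f i q (u i q z, fst z))" if "SMALL F n d' \<Omega> f" "d' \<le> d" for f :: "'i \<Rightarrow> plane \<Rightarrow> plane \<Rightarrow> real" and d'
        by (rule SMALL_compose[where \<pi> = "\<lambda>i q. q" and h = "\<lambda>i q z. (u i q z, fst z)", OF that(1) DBD_par[OF oW] DBD_mono[OF \<eta> order_refl that(2)] into])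
      define g where "g v i q z = dspace v (\<gamma> i) q (u i q z, fst z)" for v i q z
      have g: "SMALL F n d W (g v)" for v
        unfolding g_def by (rule comp[OF SMALL_dspace[OF SMALL_mono[OF \<gamma> n order_refl]] order_refl])
      define J where "J i q z = inverse (1 + g (1, 0) i q z)" for i q z
      have J: "BDD F n d W J" unfolding J_def by (rule BDD_inverse[OF g])
      \<comment> \<open>The bound \<open>1/2\<close> on \<open>\<partial>\<^sub>1\<gamma>\<close>
        makes the linear equation for the derivatives of \<open>w\<close> solvable, with a bounded
        factor \<open>J\<close>.\<close>
      have ineq: "\<forall>\<^sub>F i in F. \<forall>q z. (q, z) \<in> W i \<longrightarrow> 1 + g (1, 0) i q z \<noteq> 0"
        using SMALL_bound[OF g[of "(1, 0)"], of "1/2"]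
      proof (simp, elim eventually_mono, intro allI impI)
        fix i q z assume "\<forall>q z. (q, z) \<in> W i \<longrightarrow> \<bar>g (1, 0) i q z\<bar> * 2 \<le> 1" "(q, z) \<in> W i"
        then have "\<bar>g (1, 0) i q z\<bar> * 2 \<le> 1" by blast
        then show "1 + g (1, 0) i q z \<noteq> 0" by auto
      qed
      have dS: "\<forall>\<^sub>F i in F. \<forall>q z. (q, z) \<in> W i \<longrightarrow>
          (g (1, 0) i q z * dspace v (S i) q z + g (0, 1) i q z * fst v) * J i q z = - dspace v (w i) q z" for v
        using \<gamma>C uC SC into eq ineq
      proof eventually_elim
        case (elim i)
        show ?case
        proof (intro allI impI)
          fix q z assume i: "(q, z) \<in> W i"
          have i': "(q, (u i q z, fst z)) \<in> \<Omega> i" using elim(4) i by blast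
          note Du = CB_diff_space[OF elim(2)[unfolded m(1)] i] and DS = CB_diff_space[OF elim(3)[unfolded m(1)] i]
            and D\<gamma> = CB_diff_space[OF elim(1)[unfolded m(1)] i']
          have "((\<lambda>z. (u i q z, fst z)) has_derivative (\<lambda>v. (dspace v (u i) q z, fst v))) (at z)"
            by (intro has_derivative_Pair Du has_derivative_fst has_derivative_ident)
          from has_derivative_add[OF Du has_derivative_compose[where g = "\<gamma> i q" and f = "\<lambda>z. (u i q z, fst z)", OF this D\<gamma>]]
          have "(S i q has_derivative (\<lambda>v. dspace v (u i) q z + dspace (dspace v (u i) q z, fst v) (\<gamma> i) q (u i q z, fst z))) (at z)"
            by (rule has_derivative_transform_within_open[OF _ open_slice_space[OF CB_open[OF elim(2)], of q]]) (use i elim(5) in auto)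
          from dspaceI[where g = "S i" and D = "\<lambda>v. dspace v (u i) q z + dspace (dspace v (u i) q z, fst v) (\<gamma> i) q (u i q z, fst z)", OF this, of v]
          have 1: "dspace v (S i) q z = dspace v (u i) q z + dspace (dspace v (u i) q z, fst v) (\<gamma> i) q (u i q z, fst z)" .
          have 2: "dspace (a, b) (\<gamma> i) q (u i q z, fst z) = a * g (1, 0) i q z + b * g (0, 1) i q z" for a b
            using linear_plane_expand[OF has_derivative_linear[OF D\<gamma>], of "(a, b)"] by (simp add: g_def)
          have 3: "dspace v (w i) q z = dspace v (u i) q z - dspace v (S i) q z"
            by (rule dspaceI[where g = "w i" and D = "\<lambda>v. dspace v (u i) q z - dspace v (S i) q z"])
              (use has_derivative_diff[OF Du DS] in \<open>simp add: w_def[abs_def]\<close>)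
          have "(1 + g (1, 0) i q z) * dspace v (w i) q z = - (g (1, 0) i q z * dspace v (S i) q z + g (0, 1) i q z * fst v)"
            unfolding 3 using 1 2 by (simp add: algebra_simps)
          moreover have "1 + g (1, 0) i q z \<noteq> 0" using elim(6) i by blast
          ultimately show "(g (1, 0) i q z * dspace v (S i) q z + g (0, 1) i q z * fst v) * J i q z = - dspace v (w i) q z"
            unfolding J_def by (simp add: field_simps)
        qed
      qed
      have dP: "\<forall>\<^sub>F i in F. \<forall>q z. (q, z) \<in> W i \<longrightarrow>
          (g (1, 0) i q z * dpar v (S i) q z + dpar v (\<gamma> i) q (u i q z, fst z)) * J i q z = - dpar v (w i) q z" if d: "0 < d" for v
        using \<gamma>C uC SC into eq ineq
      proof eventually_elim
        case (elim i)
        show ?case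
        proof (intro allI impI)
          fix q z assume i: "(q, z) \<in> W i"
          have i': "(q, (u i q z, fst z)) \<in> \<Omega> i" using elim(4) i by blast
          note Du = CB_diff_par[OF elim(2)[unfolded m(1)] d i] and DS = CB_diff_par[OF elim(3)[unfolded m(1)] d i]
            and D\<gamma>x = CB_diff_space[OF elim(1)[unfolded m(1)] i']
            and D\<gamma> = CB_has_derivative_joint[OF elim(1)[unfolded m(1)] d i']
          have "((\<lambda>q. (q, (u i q z, fst z))) has_derivative (\<lambda>v. (v, (dpar v (u i) q z, 0)))) (at q)"
            by (intro has_derivative_Pair Du has_derivative_const has_derivative_ident)
          from has_derivative_add[OF Du has_derivative_compose[where g = "\<lambda>z. \<gamma> i (fst z) (snd z)" and f = "\<lambda>q. (q, (u i q z, fst z))", OF this D\<gamma>]]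
          have "((\<lambda>q. u i q z + \<gamma> i q (u i q z, fst z)) has_derivative (\<lambda>v. dpar v (u i) q z + (dpar v (\<gamma> i) q (u i q z, fst z) + dspace (dpar v (u i) q z, 0) (\<gamma> i) q (u i q z, fst z)))) (at q)"
            by simp
          then have "((\<lambda>q. S i q z) has_derivative (\<lambda>v. dpar v (u i) q z + (dpar v (\<gamma> i) q (u i q z, fst z) + dspace (dpar v (u i) q z, 0) (\<gamma> i) q (u i q z, fst z)))) (at q)"
            by (rule has_derivative_transform_within_open[OF _ open_slice_par[OF CB_open[OF elim(2)], of z]]) (use i elim(5) in auto)
          from dparI[where g = "S i" and D = "\<lambda>v. dpar v (u i) q z + (dpar v (\<gamma> i) q (u i q z, fst z) + dspace (dpar v (u i) q z, 0) (\<gamma> i) q (u i q z, fst z))", OF this, of v]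
          have 1: "dpar v (S i) q z = dpar v (u i) q z + (dpar v (\<gamma> i) q (u i q z, fst z) + dspace (dpar v (u i) q z, 0) (\<gamma> i) q (u i q z, fst z))" .
          have 2: "dspace (a, 0) (\<gamma> i) q (u i q z, fst z) = a * g (1, 0) i q z" for a
            using linear_plane_expand[OF has_derivative_linear[OF D\<gamma>x], of "(a, 0)"] by (simp add: g_def)
          have 3: "dpar v (w i) q z = dpar v (u i) q z - dpar v (S i) q z"
            by (rule dparI[where g = "w i" and D = "\<lambda>v. dpar v (u i) q z - dpar v (S i) q z"])
              (use has_derivative_diff[OF Du DS] in \<open>simp add: w_def[abs_def]\<close>)
          have "(1 + g (1, 0) i q z) * dpar v (w i) q z = - (g (1, 0) i q z * dpar v (S i) q z + dpar v (\<gamma> i) q (u i q z, fst z))"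
            unfolding 3 using 1 2 by (simp add: algebra_simps)
          moreover have "1 + g (1, 0) i q z \<noteq> 0" using elim(6) i by blast
          ultimately show "(g (1, 0) i q z * dpar v (S i) q z + dpar v (\<gamma> i) q (u i q z, fst z)) * J i q z = - dpar v (w i) q z"
            unfolding J_def by (simp add: field_simps)
        qed
      qed
      have neg: "SMALL F n d' W f" if "SMALL F n d' W h" "\<forall>\<^sub>F i in F. \<forall>q z. (q, z) \<in> W i \<longrightarrow> h i q z = - f i q z"
        for h f :: "'i \<Rightarrow> plane \<Rightarrow> plane \<Rightarrow> real" and d'
        by (rule SMALL_cong[OF SMALL_uminus[OF that(1)]]) (use that(2) in \<open>auto elim: eventually_mono\<close>)
      have wC': "\<forall>\<^sub>F i in F. CT (Suc m') d (W i) (w i)" using wC unfolding m(1) .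
      have Sn: "DBD F (Suc n) d W S" by (rule DBD_mono[OF S n order_refl])
      show "SMALL F (Suc n) d W w"
      proof (rule SMALL_Suc_Basis[OF wC' w])
        fix v :: plane
        show "SMALL F n d W (\<lambda>i. dspace v (w i))"
          by (rule neg[OF SMALL_mult[OF SMALL_add[OF SMALL_mult[OF g DBD_dspace[OF Sn, of v]] SMALL_mult[OF g BDD_const[OF oW, of _ _ "fst v"]]] J] dS])
        assume d: "0 < d"
        have "SMALL F n (d - 1) W (\<lambda>i q z. dpar v (\<gamma> i) q (u i q z, fst z))"
          by (rule comp[OF SMALL_dpar[OF SMALL_mono[OF \<gamma> n order_refl] d] diff_le_self])
        from neg[OF SMALL_mult[OF SMALL_add[OF SMALL_mult[OF SMALL_mono[OF g order_refl diff_le_self] DBD_dpar[OF Sn d]] this] BDD_mono[OF J order_refl diff_le_self]] dP[OF d]]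
        show "SMALL F n (d - 1) W (\<lambda>i. dpar v (w i))" .
      qed
    qed
  qed
  then have "SMALL F m d W w" by simp
  then show "SMALL F m d W (\<lambda>i q z. u i q z - S i q z)" "DBD F m d W u"
    using uw by (auto simp: w_def[abs_def])
qed

section \<open>Jacobians of planar maps and elementary topology\<close>

lemma jac_has_derivative:
  assumes "(h has_derivative D) (at z)"
  shows "jac h z = fst (D (1, 0)) * snd (D (0, 1)) - fst (D (0, 1)) * snd (D (1, 0))"
  by (simp add: jac_def ddirI[OF assms])

lemma jac_compose:
  assumes "h differentiable (at z)" "k differentiable (at (h z))"
  shows "jac (\<lambda>z. k (h z)) z = jac k (h z) * jac h z"
proof -
  obtain D E where D: "(h has_derivative D) (at z)" and E: "(k has_derivative E) (at (h z))"
    using assms by (auto simp: differentiable_def)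
  have "((\<lambda>z. k (h z)) has_derivative (\<lambda>v. E (D v))) (at z)"
    by (rule has_derivative_compose[where f = h and g = k, OF D E])
  note jac_has_derivative[OF this]
  moreover have "E w = fst w *\<^sub>R E (1, 0) + snd w *\<^sub>R E (0, 1)" for w
    by (rule linear_plane_expand[OF has_derivative_linear[OF E]])
  note this[of "D (1, 0)"] this[of "D (0, 1)"]
  ultimately show ?thesis
    unfolding jac_has_derivative[OF D] jac_has_derivative[OF E] by (simp add: algebra_simps)
qed

lemma jac_ident: "jac (\<lambda>z. z) z = 1"
  by (simp add: jac_has_derivative[OF has_derivative_ident])

lemma jac_cong_open:
  assumes "open S" "z \<in> S" "\<And>y. y \<in> S \<Longrightarrow> f y = g y"
  shows "jac f z = jac g z"
  unfolding jac_def using ddir_cong_open(1)[OF assms] by simp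

lemma Ck_on_differentiable: "Ck_on k U h \<Longrightarrow> 0 < k \<Longrightarrow> x \<in> U \<Longrightarrow> h differentiable (at x)"
  unfolding Ck_on_def by (metis foldr_Nil id_apply list.size(3))

lemma Ck_on_continuous: "Ck_on k U h \<Longrightarrow> continuous_on U h"
  unfolding Ck_on_def by (metis foldr_Nil id_apply le0 list.size(3))

text \<open>The chain rule for \<open>h\<close> followed by its inverse gives determinant
  \<open>1\<close>.\<close>

lemma jac_diffeo_nonzero:
  assumes h: "Ck_diffeo_on k U h" and k: "0 < k" and z: "z \<in> U"
  shows "jac h z \<noteq> 0"
proof
  assume 0: "jac h z = 0"
  have U: "open U" "inj_on h U" and d: "h differentiable (at z)" "the_inv_into U h differentiable (at (h z))"
    using h Ck_on_differentiable[OF _ k] z by (auto simp: Ck_diffeo_on_def)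
  have "jac (\<lambda>z. the_inv_into U h (h z)) z = jac (\<lambda>z. z) z"
    by (rule jac_cong_open[OF U(1) z]) (use U(2) in \<open>simp add: the_inv_into_f_f\<close>)
  then show False using jac_compose[OF d] 0 jac_ident by simp
qed

lemma open_Collect_less_on:
  fixes f g :: "'a::topological_space \<Rightarrow> real"
  assumes "open S" "continuous_on S f" "continuous_on S g"
  shows "open {x \<in> S. f x < g x}"
proof -
  obtain A where "open A" "A \<inter> S = {x \<in> S. f x < g x}"
    using open_Collect_less_Int[OF assms(2,3)] by blast
  then show ?thesis using assms(1) by (metis open_Int)
qed

lemma closedin_Collect_le:
  fixes f g :: "'a::topological_space \<Rightarrow> real"
  assumes "continuous_on S f" "continuous_on S g"
  shows "closedin (top_of_set S) {x \<in> S. f x \<le> g x}"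
proof -
  have "closedin (top_of_set S) (S \<inter> (\<lambda>x. g x - f x) -` {0..})"
    by (rule continuous_closedin_preimage) (auto intro!: continuous_intros assms)
  moreover have "S \<inter> (\<lambda>x. g x - f x) -` {0..} = {x \<in> S. f x \<le> g x}" by auto
  ultimately show ?thesis by simp
qed

section \<open>The affine-like representation\<close>

locale tangency =
  fixes d r :: nat and T :: tangency_data
  assumes dr: "d + 3 \<le> r" and tu: "tangency_unfolding d r T"
begin

definition "IJ = ivalI T \<times> ivalJ T"
abbreviation "N \<equiv> nbhd T"
abbreviation "f \<equiv> fam T"
abbreviation "n \<equiv> ptime T"
abbreviation "A \<equiv> repA T"
abbreviation "B \<equiv> repB T"
abbreviation "Y \<equiv> pbox T"
abbreviation "S \<equiv> surf T"

definition boxes :: "plane set \<Rightarrow> (plane \<times> plane) set" where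
  "boxes P = {(p, z). p \<in> P \<and> z \<in> small_box T p}"

lemma ps: "piece_setting d r T" and cs: "curve_setting d T" and lf: "local_form T"
  and tc: "tangency_condition d r T" and uc: "unfolding_condition T"
  using tu by (auto simp: tangency_unfolding_def)

lemma open_S: "open S" and open_IJ: "open IJ" and open_N: "open N" and N_IJ: "p \<in> N \<Longrightarrow> p \<in> IJ"
  and rad_cont: "continuous_on N (rad T)" and rad_pos: "p \<in> N \<Longrightarrow> 0 < rad T p"
  and box_rep: "p \<in> N \<Longrightarrow> small_box T p \<subseteq> rep_domain (f p) (Y p) n"
  using ps cs unfolding piece_setting_def curve_setting_def IJ_def by (blast intro: open_Times)+

lemma f_diffeo: "p \<in> IJ \<Longrightarrow> Ck_diffeo_on r S (f p)" and f_S: "p \<in> IJ \<Longrightarrow> f p ` S = S"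
  using ps unfolding piece_setting_def IJ_def by blast+

lemma f_C: "CT r d (IJ \<times> S) f"
  by (rule CB_of_Cdr) (use ps open_S open_IJ in \<open>auto simp: piece_setting_def IJ_def open_Times\<close>)

lemma iter_S: "p \<in> IJ \<Longrightarrow> z \<in> S \<Longrightarrow> (f p ^^ k) z \<in> S"
  using f_S[of p] by (induction k) auto

lemma iter_C: "CT r d (IJ \<times> S) (\<lambda>p. f p ^^ k)"
proof (induction k)
  have o: "open (IJ \<times> S)" by (rule CB_open[OF f_C])
  { case 0 show ?case using CT_space[OF o] by (simp add: id_def) }
  { case (Suc k)
    have "CT r d (IJ \<times> S) (\<lambda>p z. f p ((f p ^^ k) z))"
      by (rule CT_compose[OF f_C CT_par[OF o] Suc]) (use iter_S in auto)
    then show ?case by (simp add: comp_def) }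
qed

lemma r_pos: "0 < r" "Suc (r - 1) = r" "d \<le> r - 1"
  using dr by auto

lemma iter_deriv: "p \<in> IJ \<Longrightarrow> z \<in> S \<Longrightarrow> ((f p ^^ k) has_derivative (\<lambda>v. dspace v (\<lambda>p. f p ^^ k) p z)) (at z)"
  using CB_diff_space[of "r - 1" d top "IJ \<times> S" "\<lambda>p. f p ^^ k" p z] iter_C[of k] r_pos by simp

lemma iter_diff: "p \<in> IJ \<Longrightarrow> z \<in> S \<Longrightarrow> (f p ^^ k) differentiable (at z)"
  by (rule differentiableI[OF iter_deriv])

lemma f_diff: "p \<in> IJ \<Longrightarrow> z \<in> S \<Longrightarrow> f p differentiable (at z)"
  using iter_diff[of p z 1] by simp

lemma f_jac: "p \<in> IJ \<Longrightarrow> z \<in> S \<Longrightarrow> jac (f p) z \<noteq> 0"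
  by (rule jac_diffeo_nonzero[OF f_diffeo r_pos(1)])

lemma iter_jac: "p \<in> IJ \<Longrightarrow> z \<in> S \<Longrightarrow> jac (f p ^^ k) z \<noteq> 0"
proof (induction k)
  case 0 then show ?case using jac_ident by (simp add: id_def)
next
  case (Suc k)
  have "jac (\<lambda>z. f p ((f p ^^ k) z)) z = jac (f p) ((f p ^^ k) z) * jac (f p ^^ k) z"
    by (rule jac_compose[OF iter_diff f_diff]) (use Suc iter_S in auto)
  then show ?case using Suc f_jac iter_S by (simp add: comp_def)
qed

lemma Y_S: "p \<in> IJ \<Longrightarrow> Y p \<subseteq> S"
  and cone: "p \<in> IJ \<Longrightarrow> z \<in> Y p \<Longrightarrow> u \<notin> cone_v (vslope T) \<Longrightarrow> ddir u (f p ^^ n) z \<in> cone_h (hslope T)"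
  using ps unfolding piece_setting_def persistent_piece_def piece_def IJ_def by blast+

lemma rep_conv:
  assumes "p \<in> IJ" "(x0, y0) \<in> Y p" "(f p ^^ n) (x0, y0) = (x1, y1)"
  shows "x0 = A p (x1, y0)" "y1 = B p (x1, y0)"
proof -
  have "affine_like_rep (f p) (Y p) n (A p) (B p)"
    using ps assms(1) unfolding piece_setting_def IJ_def by blast
  moreover have "(x1, y1) \<in> (f p ^^ n) ` Y p" using assms(2,3) by (metis imageI)
  ultimately show "x0 = A p (x1, y0)" "y1 = B p (x1, y0)"
    using assms(2,3) unfolding affine_like_rep_def by blast+
qed

lemma rep:
  assumes "(p, (x1, y0)) \<in> boxes N"
  shows "(A p (x1, y0), y0) \<in> Y p" "(f p ^^ n) (A p (x1, y0), y0) = (x1, B p (x1, y0))"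
proof -
  have p: "p \<in> N" using assms by (simp add: boxes_def)
  have "(x1, y0) \<in> rep_domain (f p) (Y p) n"
    by (rule subsetD[OF box_rep[OF p]]) (use assms in \<open>simp add: boxes_def\<close>)
  then obtain x0 y1 where "(x0, y0) \<in> Y p" "(f p ^^ n) (x0, y0) = (x1, y1)" by (auto simp: rep_domain_def)
  with rep_conv[OF N_IJ[OF p] this] show "(A p (x1, y0), y0) \<in> Y p" "(f p ^^ n) (A p (x1, y0), y0) = (x1, B p (x1, y0))"
    by auto
qed

lemma open_boxes:
  assumes "open P" "P \<subseteq> N" shows "open (boxes P)"
proof -
  have c: "continuous_on (P \<times> UNIV) (\<lambda>w::plane \<times> plane. rad T (fst w))"
    by (rule continuous_on_compose2[OF rad_cont]) (use assms(2) in \<open>auto intro!: continuous_intros\<close>)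
  have o: "open (P \<times> (UNIV :: plane set))" using assms(1) by (simp add: open_Times)
  have "open {w \<in> P \<times> (UNIV :: plane set). \<bar>fst (snd w)\<bar> < rad T (fst w)}"
    by (rule open_Collect_less_on[OF o _ c]) (intro continuous_intros)
  moreover have "open {w \<in> P \<times> (UNIV :: plane set). \<bar>snd (snd w)\<bar> < rad T (fst w)}"
    by (rule open_Collect_less_on[OF o _ c]) (intro continuous_intros)
  ultimately have "open ({w \<in> P \<times> (UNIV :: plane set). \<bar>fst (snd w)\<bar> < rad T (fst w)} \<inter> {w \<in> P \<times> (UNIV :: plane set). \<bar>snd (snd w)\<bar> < rad T (fst w)})"
    by (rule open_Int)
  moreover have "boxes P = {w \<in> P \<times> (UNIV :: plane set). \<bar>fst (snd w)\<bar> < rad T (fst w)} \<inter> {w \<in> P \<times> (UNIV :: plane set). \<bar>snd (snd w)\<bar> < rad T (fst w)}"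
    by (auto simp: boxes_def small_box_def)
  ultimately show ?thesis by simp
qed

lemma zero_box: "p \<in> N \<Longrightarrow> (p, (0, 0)) \<in> boxes N"
  using rad_pos by (auto simp: boxes_def small_box_def)

text \<open>The four inequalities are continuous in the parameter but say nothing about the shape of
  the set. Compactness, connectedness and an interior point come from the diffeomorphism with the
  square, the last by invariance of domain.\<close>

lemma pbox_structure:
  obtains \<psi>m \<psi>p \<phi>m \<phi>p :: "plane \<Rightarrow> real \<Rightarrow> real" where
    "\<And>p. p \<in> IJ \<Longrightarrow> Y p = {(x, y). \<psi>m p x \<le> y \<and> y \<le> \<psi>p p x \<and> \<phi>m p y \<le> x \<and> x \<le> \<phi>p p y}"
    "continuous_on (IJ \<times> UNIV) (\<lambda>(p, t). \<psi>m p t)" "continuous_on (IJ \<times> UNIV) (\<lambda>(p, t). \<psi>p p t)"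
    "continuous_on (IJ \<times> UNIV) (\<lambda>(p, t). \<phi>m p t)" "continuous_on (IJ \<times> UNIV) (\<lambda>(p, t). \<phi>p p t)"
    "\<And>p. p \<in> IJ \<Longrightarrow> compact (Y p) \<and> connected (Y p) \<and> interior (Y p) \<noteq> {}"
proof -
  have pp: "persistent_piece r (hslope T) (vslope T) IJ S f Y n"
    using ps unfolding piece_setting_def IJ_def by (elim conjE)
  define Q where "Q \<psi>m \<psi>p \<phi>m \<phi>p \<longleftrightarrow> (\<forall>p\<in>IJ. tame_box_with r (hslope T) (vslope T) (\<psi>m p) (\<psi>p p) (\<phi>m p) (\<phi>p p) (Y p)) \<and>
      (\<forall>c\<in>{\<psi>m, \<psi>p, \<phi>m, \<phi>p}. continuous_on (IJ \<times> UNIV) (\<lambda>(p, t). c p t))"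
    for \<psi>m \<psi>p \<phi>m \<phi>p :: "plane \<Rightarrow> real \<Rightarrow> real"
  have "\<exists>\<psi>m \<psi>p \<phi>m \<phi>p. Q \<psi>m \<psi>p \<phi>m \<phi>p"
    unfolding Q_def by (rule pp[unfolded persistent_piece_def, THEN conjunct2])
  then obtain \<psi>m \<psi>p \<phi>m \<phi>p where "Q \<psi>m \<psi>p \<phi>m \<phi>p" by blast
  note tc = this[unfolded Q_def]
  note t = tc[THEN conjunct1] and c = tc[THEN conjunct2]
  have "compact (Y p) \<and> connected (Y p) \<and> interior (Y p) \<noteq> {}" if p: "p \<in> IJ" for p
  proof -
    let ?Q = "{-1..1} \<times> {-1..1} :: plane set" and ?V = "{-1<..<1} \<times> {-1<..<1} :: plane set"
    obtain U and h :: "plane \<Rightarrow> plane" where h: "?Q \<subseteq> U" "Ck_diffeo_on r U h" "h ` ?Q = Y p"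
      using bspec[OF t p] unfolding tame_box_with_def by (elim conjE exE) blast
    have hc: "continuous_on U h" and inj: "inj_on h U"
      using h(2) by (auto simp: Ck_diffeo_on_def dest: Ck_on_continuous)
    have cQ: "continuous_on ?Q h" using hc h(1) by (rule continuous_on_subset)
    have "compact (Y p)" unfolding h(3)[symmetric] by (rule compact_continuous_image[OF cQ]) (intro compact_Times compact_Icc)
    moreover have "connected (Y p)" unfolding h(3)[symmetric] by (rule connected_continuous_image[OF cQ]) (intro connected_Times connected_Icc)
    moreover have "open (h ` ?V)"
    proof (rule invariance_of_domain)
      have "?V \<subseteq> U" using h(1) by force
      then show "continuous_on ?V h" "inj_on h ?V" using hc inj by (auto intro: continuous_on_subset inj_on_subset)
    qed (simp add: open_Times)
    then have "h ` ?V \<subseteq> interior (Y p)" unfolding h(3)[symmetric] by (intro interior_maximal image_mono) auto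
    then have "interior (Y p) \<noteq> {}" by force
    ultimately show ?thesis by blast
  qed
  moreover have "Y p = {(x, y). \<psi>m p x \<le> y \<and> y \<le> \<psi>p p x \<and> \<phi>m p y \<le> x \<and> x \<le> \<phi>p p y}" if "p \<in> IJ" for p
    using bspec[OF t that] unfolding tame_box_with_def by (elim conjE)
  moreover have "continuous_on (IJ \<times> UNIV) (\<lambda>(p, t). \<psi>m p t)" "continuous_on (IJ \<times> UNIV) (\<lambda>(p, t). \<psi>p p t)"
    "continuous_on (IJ \<times> UNIV) (\<lambda>(p, t). \<phi>m p t)" "continuous_on (IJ \<times> UNIV) (\<lambda>(p, t). \<phi>p p t)"
    using c by simp_all
  ultimately show thesis by (intro that)
qed

text \<open>Joint continuity of the four boundary curves in the parameter and the point makes the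
  moving box a closed condition.\<close>

lemma pbox_closed:
  assumes "continuous_on D P" "continuous_on D Z" "P ` D \<subseteq> IJ"
  shows "closedin (top_of_set D) {w \<in> D. Z w \<in> Y (P w)}"
proof -
  obtain \<psi>m \<psi>p \<phi>m \<phi>p :: "plane \<Rightarrow> real \<Rightarrow> real" where
    Y: "\<And>p. p \<in> IJ \<Longrightarrow> Y p = {(x, y). \<psi>m p x \<le> y \<and> y \<le> \<psi>p p x \<and> \<phi>m p y \<le> x \<and> x \<le> \<phi>p p y}" and
    c: "continuous_on (IJ \<times> UNIV) (\<lambda>(p, t). \<psi>m p t)" "continuous_on (IJ \<times> UNIV) (\<lambda>(p, t). \<psi>p p t)"
    "continuous_on (IJ \<times> UNIV) (\<lambda>(p, t). \<phi>m p t)" "continuous_on (IJ \<times> UNIV) (\<lambda>(p, t). \<phi>p p t)" and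
    "\<And>p. p \<in> IJ \<Longrightarrow> compact (Y p) \<and> connected (Y p) \<and> interior (Y p) \<noteq> {}"
    by (rule pbox_structure) blast
  have cc: "continuous_on D (\<lambda>w. c (P w) (g w))" if "continuous_on (IJ \<times> UNIV) (\<lambda>(p, t). c p t)" "continuous_on D g"
    for c :: "plane \<Rightarrow> real \<Rightarrow> real" and g
  proof -
    have "continuous_on D (\<lambda>w. (\<lambda>(p, t). c p t) (P w, g w))"
      by (rule continuous_on_compose2[OF that(1)]) (use assms that(2) in \<open>auto intro!: continuous_intros\<close>)
    then show ?thesis by simp
  qed
  have Z: "continuous_on D (\<lambda>w. fst (Z w))" "continuous_on D (\<lambda>w. snd (Z w))"
    using assms(2) by (auto intro!: continuous_intros)
  have "closedin (top_of_set D) ({w \<in> D. \<psi>m (P w) (fst (Z w)) \<le> snd (Z w)} \<inter> {w \<in> D. snd (Z w) \<le> \<psi>p (P w) (fst (Z w))}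
      \<inter> ({w \<in> D. \<phi>m (P w) (snd (Z w)) \<le> fst (Z w)} \<inter> {w \<in> D. fst (Z w) \<le> \<phi>p (P w) (snd (Z w))}))"
    by (intro closedin_Int closedin_Collect_le[OF cc[OF c(1) Z(1)] Z(2)] closedin_Collect_le[OF Z(2) cc[OF c(2) Z(1)]]
        closedin_Collect_le[OF cc[OF c(3) Z(2)] Z(1)] closedin_Collect_le[OF Z(1) cc[OF c(4) Z(2)]])
  moreover have "{w \<in> D. Z w \<in> Y (P w)} = {w \<in> D. \<psi>m (P w) (fst (Z w)) \<le> snd (Z w)} \<inter> {w \<in> D. snd (Z w) \<le> \<psi>p (P w) (fst (Z w))}
      \<inter> ({w \<in> D. \<phi>m (P w) (snd (Z w)) \<le> fst (Z w)} \<inter> {w \<in> D. fst (Z w) \<le> \<phi>p (P w) (snd (Z w))})"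
  proof -
    have "Z w \<in> Y (P w) \<longleftrightarrow> \<psi>m (P w) (fst (Z w)) \<le> snd (Z w) \<and> snd (Z w) \<le> \<psi>p (P w) (fst (Z w)) \<and>
        \<phi>m (P w) (snd (Z w)) \<le> fst (Z w) \<and> fst (Z w) \<le> \<phi>p (P w) (snd (Z w))" if "w \<in> D" for w
      using Y[of "P w"] assms(3) that by (auto simp: case_prod_beta)
    then show ?thesis by auto
  qed
  ultimately show ?thesis by simp
qed

text \<open>
  The sets \<open>Y p\<close> are connected, keep an interior point and avoid a large circle as \<open>p\<close> varies.
\<close>

lemma pbox_locally_bounded:
  assumes p0: "p0 \<in> IJ"
  obtains U K where "open U" "p0 \<in> U" "U \<subseteq> IJ" "\<And>p. p \<in> U \<Longrightarrow> Y p \<subseteq> ball 0 K"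
proof -
  obtain \<psi>m \<psi>p \<phi>m \<phi>p :: "plane \<Rightarrow> real \<Rightarrow> real" where
    Y: "\<And>p. p \<in> IJ \<Longrightarrow> Y p = {(x, y). \<psi>m p x \<le> y \<and> y \<le> \<psi>p p x \<and> \<phi>m p y \<le> x \<and> x \<le> \<phi>p p y}" and
    c: "continuous_on (IJ \<times> UNIV) (\<lambda>(p, t). \<psi>m p t)" "continuous_on (IJ \<times> UNIV) (\<lambda>(p, t). \<psi>p p t)"
    "continuous_on (IJ \<times> UNIV) (\<lambda>(p, t). \<phi>m p t)" "continuous_on (IJ \<times> UNIV) (\<lambda>(p, t). \<phi>p p t)" and
    top: "\<And>p. p \<in> IJ \<Longrightarrow> compact (Y p) \<and> connected (Y p) \<and> interior (Y p) \<noteq> {}"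
    by (rule pbox_structure) blast
  obtain x y where "(x, y) \<in> interior (Y p0)" using top[OF p0] by auto
  then obtain e where e: "0 < e" "ball (x, y) e \<subseteq> Y p0" by (metis mem_interior)
  define \<epsilon> where "\<epsilon> = e / 2"
  have \<epsilon>: "0 < \<epsilon>" "\<epsilon> < e" using e by (auto simp: \<epsilon>_def)
  have in1: "(x + s, y) \<in> Y p0" "(x, y + s) \<in> Y p0" if "\<bar>s\<bar> \<le> \<epsilon>" for s
    using that \<epsilon> by (auto intro!: subsetD[OF e(2)] simp: dist_Pair_Pair dist_real_def)
  have Yx: "(x', y') \<in> Y p0 \<Longrightarrow> \<psi>m p0 x' \<le> y' \<and> y' \<le> \<psi>p p0 x' \<and> \<phi>m p0 y' \<le> x' \<and> x' \<le> \<phi>p p0 y'" for x' y'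
    using Y[OF p0] by simp
  \<comment> \<open>A small cross around an interior point lies in the box, which makes the four
    inequalities strict at its centre; strict inequalities persist for nearby parameters.\<close>
  have s: "\<psi>m p0 x < y" "y < \<psi>p p0 x" "\<phi>m p0 y < x" "x < \<phi>p p0 y"
    using Yx[OF in1(1)[of \<epsilon>]] Yx[OF in1(1)[of "- \<epsilon>"]] Yx[OF in1(2)[of \<epsilon>]] Yx[OF in1(2)[of "- \<epsilon>"]] \<epsilon> by auto
  have cc: "continuous_on IJ (\<lambda>p. c p t)" if "continuous_on (IJ \<times> UNIV) (\<lambda>(p, t). c p t)" for c :: "plane \<Rightarrow> real \<Rightarrow> real" and t
  proof -
    have "continuous_on IJ (\<lambda>w. (\<lambda>(p, t). c p t) (w, t))"
      by (rule continuous_on_compose2[OF that]) (auto intro!: continuous_intros)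
    then show ?thesis by simp
  qed
  define U1 where "U1 = {p \<in> IJ. \<psi>m p x < y} \<inter> {p \<in> IJ. y < \<psi>p p x} \<inter> ({p \<in> IJ. \<phi>m p y < x} \<inter> {p \<in> IJ. x < \<phi>p p y})"
  have U1: "open U1" "p0 \<in> U1"
    unfolding U1_def using s p0
    by (simp_all add: open_Int open_Collect_less_on[OF open_IJ cc[OF c(1)] continuous_on_const]
        open_Collect_less_on[OF open_IJ continuous_on_const cc[OF c(2)]]
        open_Collect_less_on[OF open_IJ cc[OF c(3)] continuous_on_const]
        open_Collect_less_on[OF open_IJ continuous_on_const cc[OF c(4)]])
  have xy: "(x, y) \<in> Y p" if "p \<in> U1" for p
    using that Y[of p] unfolding U1_def by auto
  obtain K where K: "Y p0 \<subseteq> ball 0 K" using compact_imp_bounded top[OF p0] by (metis bounded_subset_ballD)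
  \<comment> \<open>Parameters whose box meets the circle of radius \<open>K\<close>: a projection
    of a closed set along a compact factor, hence closed. Outside of it a connected box containing a
    point inside the circle cannot leave the disc.\<close>
  define C where "C = {p. \<exists>z. z \<in> sphere 0 K \<and> (z, p) \<in> {w \<in> sphere 0 K \<times> IJ. fst w \<in> Y (snd w)}}"
  have "closedin (top_of_set IJ) C"
    unfolding C_def by (rule closedin_compact_projection[OF compact_sphere pbox_closed]) (auto intro!: continuous_intros)
  then have "openin (top_of_set IJ) (IJ - C)" by (simp add: openin_diff)
  then have oC: "open (IJ - C)" using open_IJ by (simp add: openin_open_eq)
  have "p0 \<notin> C" using K by (auto simp: C_def)
  show thesis
  proof (rule that[of "U1 \<inter> (IJ - C)" K])
    show "open (U1 \<inter> (IJ - C))" using U1(1) oC by (rule open_Int)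
    show "p0 \<in> U1 \<inter> (IJ - C)" using U1(2) p0 \<open>p0 \<notin> C\<close> by simp
    fix p assume p: "p \<in> U1 \<inter> (IJ - C)"
    show "Y p \<subseteq> ball 0 K"
    proof (rule ccontr)
      assume "\<not> Y p \<subseteq> ball 0 K"
      moreover have "Y p \<inter> ball 0 K \<noteq> {}" using xy xy[OF U1(2)] K p by blast
      moreover have "connected (Y p)" using top p by blast
      ultimately have "Y p \<inter> frontier (ball 0 K) \<noteq> {}" by (intro connected_Int_frontier) auto
      then obtain z where z: "z \<in> Y p" "z \<in> frontier (ball 0 K)" by blast
      have "(x, y) \<in> ball 0 K" using xy[OF U1(2)] K by blast
      then have "0 < K" using le_less_trans[OF norm_ge_zero] by simp
      then have "z \<in> sphere 0 K" using z(2) by (simp add: frontier_ball)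
      then show False using z(1) p by (auto simp: C_def)
    qed
  qed blast
qed

text \<open>Closed graph theorem for a map into a compact set. The value \<open>A p (x1, y0)\<close>
  is the only \<open>t\<close> with \<open>(t, y0)\<close> in the box and first image coordinate
  \<open>x1\<close>, a closed condition, and local boundedness of the boxes confines it to a fixed
  ball.\<close>

lemma A_cont: "continuous_on (boxes N) (\<lambda>(p, z). A p z)"
proof (rule continuous_at_imp_continuous_on, intro ballI)
  fix w0 assume w0: "w0 \<in> boxes N"
  then have "fst w0 \<in> IJ" using N_IJ by (auto simp: boxes_def)
  then obtain U K where U: "open U" "fst w0 \<in> U" "U \<subseteq> IJ" "\<And>p. p \<in> U \<Longrightarrow> Y p \<subseteq> ball 0 K"
    by (rule pbox_locally_bounded) blast
  define D0 where "D0 = boxes N \<inter> (U \<times> UNIV)"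
  have oD0: "open D0" unfolding D0_def using open_boxes[OF open_N order_refl] U(1) by (intro open_Int open_Times) auto
  define D where "D = D0 \<times> cball (0::real) K"
  define P where "P v = fst (fst v)" for v :: "(plane \<times> plane) \<times> real"
  define Z where "Z v = (snd v, snd (snd (fst v)))" for v :: "(plane \<times> plane) \<times> real"
  define C1 where "C1 = {v \<in> D. Z v \<in> Y (P v)}"
  have PD: "P ` D \<subseteq> IJ" using U(3) by (auto simp: P_def D_def D0_def)
  have cP: "continuous_on D' P" and cZ: "continuous_on D' Z" for D'
    unfolding P_def Z_def by (intro continuous_intros)+
  have C1: "closedin (top_of_set D) C1" unfolding C1_def by (rule pbox_closed[OF cP cZ PD])
  have "continuous_on C1 (\<lambda>v. (\<lambda>(p, z). (f p ^^ n) z) (P v, Z v))"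
  proof (rule continuous_on_compose2[OF CB_cont[OF iter_C]])
    show "(\<lambda>v. (P v, Z v)) ` C1 \<subseteq> IJ \<times> S"
    proof (rule image_subsetI)
      fix v assume v: "v \<in> C1"
      then have "P v \<in> IJ" using PD by (auto simp: C1_def)
      moreover from Y_S[OF this] have "Z v \<in> S" using v by (auto simp: C1_def)
      ultimately show "(P v, Z v) \<in> IJ \<times> S" by simp
    qed
  qed (intro continuous_on_Pair cP cZ)
  then have c: "continuous_on C1 (\<lambda>v. fst ((f (P v) ^^ n) (Z v)) - fst (snd (fst v)))"
    by (auto intro!: continuous_intros)
  define C2 where "C2 = C1 \<inter> (\<lambda>v. fst ((f (P v) ^^ n) (Z v)) - fst (snd (fst v))) -` {0}"
  have "closedin (top_of_set C1) C2" unfolding C2_def by (rule continuous_closedin_preimage[OF c]) simp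
  then have C2: "closedin (top_of_set D) C2" using C1 by (rule closedin_trans)
  \<comment> \<open>\<open>C2\<close> is cut out by closed conditions; uniqueness in
    \<open>rep_conv\<close> and existence in \<open>rep\<close> identify it with the graph of
    \<open>A\<close> over \<open>D0\<close>.\<close>
  have e: "C2 = (\<lambda>w. (w, (\<lambda>(p, z). A p z) w)) ` D0"
  proof (intro equalityI subsetI)
    fix v assume "v \<in> C2"
    then have v: "v \<in> D" "Z v \<in> Y (P v)" "fst ((f (P v) ^^ n) (Z v)) = fst (snd (fst v))" by (auto simp: C2_def C1_def)
    obtain p x1 y0 t where vv: "v = ((p, (x1, y0)), t)" by (metis surj_pair)
    have "t = A p (x1, y0)"
      using rep_conv(1)[of p t y0 x1 "snd ((f p ^^ n) (t, y0))"] v PD by (auto simp: vv P_def Z_def prod_eq_iff)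
    then show "v \<in> (\<lambda>w. (w, (\<lambda>(p, z). A p z) w)) ` D0" using v(1) by (auto simp: vv D_def image_iff)
  next
    fix v assume "v \<in> (\<lambda>w. (w, (\<lambda>(p, z). A p z) w)) ` D0"
    then obtain p x1 y0 where w: "(p, (x1, y0)) \<in> D0" and vv: "v = ((p, (x1, y0)), A p (x1, y0))" by auto
    have "(p, (x1, y0)) \<in> boxes N" "p \<in> U" using w by (auto simp: D0_def)
    note R = rep[OF this(1)] and K = U(4)[OF this(2)]
    have "norm (A p (x1, y0), y0) < K" using R(1) K by auto
    then have "\<bar>A p (x1, y0)\<bar> \<le> K" using plane_bounds(1)[of "(A p (x1, y0), y0)"] by simp
    then have "v \<in> D" using w by (simp add: vv D_def)
    then show "v \<in> C2" using R by (auto simp: vv C2_def C1_def P_def Z_def)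
  qed
  have "C2 \<subseteq> D" by (auto simp: C2_def C1_def)
  then have im: "(\<lambda>(p, z). A p z) \<in> D0 \<rightarrow> cball 0 K" unfolding e by (auto simp: D_def)
  have "continuous_on D0 (\<lambda>(p, z). A p z)"
    unfolding continuous_closed_graph_eq[OF compact_cball im] using C2 unfolding e D_def .
  then show "isCont (\<lambda>(p, z). A p z) w0"
    using oD0 w0 U(2) by (simp add: continuous_on_eq_continuous_at D0_def mem_Times_iff)
qed

section \<open>Smoothness and partial derivatives of the representation\<close>

lemma A_S: "(p, z) \<in> boxes N \<Longrightarrow> (p, (A p z, snd z)) \<in> IJ \<times> S"
proof -
  assume pz: "(p, z) \<in> boxes N"
  then have p: "p \<in> N" by (simp add: boxes_def)
  have "(A p z, snd z) \<in> Y p" using rep(1)[of p "fst z" "snd z"] pz by simp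
  then show ?thesis using Y_S[OF N_IJ[OF p]] N_IJ[OF p] by blast
qed

text \<open>The map \<open>\<Phi>\<close>, made of the first coordinate of \<open>f^n\<close> and of
  \<open>y\<close>, has \<open>(x1, y0) \<mapsto> (A, y0)\<close> as a continuous inverse; its
  Jacobian is nonzero by the cone condition.\<close>

lemma A_C: "CT r d (boxes N) A"
proof -
  define \<Phi> where "\<Phi> p z = (fst ((f p ^^ n) z), snd z)" for p z
  have "CT r d (boxes N) (\<lambda>p z. (A p z, snd z))"
  proof (rule CT_planar_inverse)
    show "CT r d (IJ \<times> S) \<Phi>" unfolding \<Phi>_def
      by (intro CT_Pair CT_fst CT_snd iter_C CT_space CB_open[OF f_C])
    show "open (boxes N)" by (rule open_boxes[OF open_N order_refl])
    show "continuous_on (boxes N) (\<lambda>(p, z). (A p z, snd z))"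
      using A_cont by (auto simp: case_prod_beta intro!: continuous_intros)
    fix p z assume pz: "(p, z) \<in> boxes N"
    show "(p, (A p z, snd z)) \<in> IJ \<times> S" by (rule A_S[OF pz])
    have R: "(A p z, snd z) \<in> Y p" "(f p ^^ n) (A p z, snd z) = (fst z, B p z)"
      using rep[of p "fst z" "snd z"] pz by auto
    show "\<Phi> p (A p z, snd z) = z" using R(2) by (simp add: \<Phi>_def)
    have p: "p \<in> IJ" and zS: "(A p z, snd z) \<in> S" using A_S[OF pz] by auto
    define D where "D v = dspace v (\<lambda>p. f p ^^ n) p (A p z, snd z)" for v
    have D: "((f p ^^ n) has_derivative D) (at (A p z, snd z))" unfolding D_def by (rule iter_deriv[OF p zS])
    have "(\<Phi> p has_derivative (\<lambda>v. (fst (D v), snd v))) (at (A p z, snd z))"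
      unfolding \<Phi>_def by (intro has_derivative_Pair has_derivative_fst[OF D] has_derivative_snd has_derivative_ident)
    from jac_has_derivative[OF this] have j: "jac (\<Phi> p) (A p z, snd z) = fst (D (1, 0))" by simp
    \<comment> \<open>If the first component of \<open>D (1, 0)\<close> vanished, the horizontal
      cone would force \<open>D (1, 0) = 0\<close>, contradicting the invertibility of the
      derivative of \<open>f^n\<close>.\<close>
    have "(1, 0) \<notin> cone_v (vslope T)" by (simp add: cone_v_def)
    from cone[OF p R(1) this] have "\<bar>snd (D (1, 0))\<bar> \<le> hslope T * \<bar>fst (D (1, 0))\<bar>"
      unfolding ddirI[OF D] cone_h_def by (simp add: case_prod_beta)
    moreover have "jac (f p ^^ n) (A p z, snd z) \<noteq> 0" by (rule iter_jac[OF p zS])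
    ultimately show "jac (\<Phi> p) (A p z, snd z) \<noteq> 0"
      unfolding j jac_has_derivative[OF D] by auto
  qed
  from CT_fst[OF this] show ?thesis by simp
qed

lemma B_C: "CT r d (boxes N) B"
proof (rule CB_cong_imp)
  have o: "open (boxes N)" by (rule CB_open[OF A_C])
  show "CT r d (boxes N) (\<lambda>p z. snd ((f p ^^ n) (A p z, snd z)))"
    by (intro CT_snd CT_compose[OF iter_C CT_par[OF o] CT_Pair[OF A_C CT_snd[OF CT_space[OF o]]] A_S])
  show "snd ((f p ^^ n) (A p z, snd z)) = B p z" if "(p, z) \<in> boxes N" for p z
    using rep(2)[of p "fst z" "snd z"] that by simp
qed

lemma A_deriv: "(p, z) \<in> boxes N \<Longrightarrow> (A p has_derivative (\<lambda>v. dspace v A p z)) (at z)"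
  and B_deriv: "(p, z) \<in> boxes N \<Longrightarrow> (B p has_derivative (\<lambda>v. dspace v B p z)) (at z)"
  using CB_diff_space[of "r - 1" d top "boxes N" A p z] CB_diff_space[of "r - 1" d top "boxes N" B p z] A_C B_C r_pos by simp_all

text \<open>Both statements come from differentiating \<open>f^n (A z, y) = (x, B z)\<close>: the
  determinants of the two sides give the formula for \<open>\<partial>\<^sub>y B\<close>, and the
  image of \<open>(1, 0)\<close> has first coordinate \<open>1\<close>, which excludes
  \<open>\<partial>\<^sub>x A = 0\<close>.\<close>

lemma A_x_nonzero: "(p, z) \<in> boxes N \<Longrightarrow> dspace (1, 0) A p z \<noteq> 0"
  and B_y_eq: "(p, z) \<in> boxes N \<Longrightarrow> dspace (0, 1) B p z = jac (f p ^^ n) (A p z, snd z) * dspace (1, 0) A p z"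
proof -
  assume pz: "(p, z) \<in> boxes N"
  have p: "p \<in> IJ" and zS: "(A p z, snd z) \<in> S" using A_S[OF pz] by auto
  note D = iter_deriv[OF p zS, of n]
  have \<psi>: "((\<lambda>z. (A p z, snd z)) has_derivative (\<lambda>v. (dspace v A p z, snd v))) (at z)"
    by (intro has_derivative_Pair A_deriv[OF pz] has_derivative_snd has_derivative_ident)
  have k: "((\<lambda>z. (fst z, B p z)) has_derivative (\<lambda>v. (fst v, dspace v B p z))) (at z)"
    by (intro has_derivative_Pair B_deriv[OF pz] has_derivative_fst has_derivative_ident)
  have eq: "(f p ^^ n) (A p z, snd z) = (fst z, B p z)" if "z \<in> {z. (p, z) \<in> boxes N}" for z
    using rep(2)[of p "fst z" "snd z"] that by simp
  have o: "open {z. (p, z) \<in> boxes N}" by (rule open_slice_space[OF CB_open[OF A_C]])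
  have "jac (\<lambda>z. (f p ^^ n) (A p z, snd z)) z = jac (\<lambda>z. (fst z, B p z)) z"
    by (rule jac_cong_open[OF o _ eq]) (use pz in auto)
  then have "dspace (0, 1) B p z = jac (f p ^^ n) (A p z, snd z) * jac (\<lambda>z. (A p z, snd z)) z"
    using jac_compose[where h = "\<lambda>z. (A p z, snd z)" and k = "f p ^^ n", OF differentiableI[OF \<psi>] iter_diff[OF p zS]]
    unfolding jac_has_derivative[OF k] by simp
  then show "dspace (0, 1) B p z = jac (f p ^^ n) (A p z, snd z) * dspace (1, 0) A p z"
    unfolding jac_has_derivative[OF \<psi>] by simp
  have "((\<lambda>z. (f p ^^ n) (A p z, snd z)) has_derivative (\<lambda>v. dspace (dspace v A p z, snd v) (\<lambda>p. f p ^^ n) p (A p z, snd z))) (at z)"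
    by (rule has_derivative_compose[where f = "\<lambda>z. (A p z, snd z)" and g = "f p ^^ n", OF \<psi> D])
  then have "((\<lambda>z. (fst z, B p z)) has_derivative (\<lambda>v. dspace (dspace v A p z, snd v) (\<lambda>p. f p ^^ n) p (A p z, snd z))) (at z)"
    by (rule has_derivative_transform_within_open[OF _ o]) (use pz eq in auto)
  from fun_cong[OF has_derivative_unique[OF this k], of "(1, 0)"]
  have "dspace (dspace (1, 0) A p z, 0) (\<lambda>p. f p ^^ n) p (A p z, snd z) = (1, dspace (1, 0) B p z)"
    by simp
  then show "dspace (1, 0) A p z \<noteq> 0"
    using linear_0[OF has_derivative_linear[OF D]] by (auto simp: zero_prod_def)
qed

lemma B_y_nonzero: "(p, z) \<in> boxes N \<Longrightarrow> dspace (0, 1) B p z \<noteq> 0"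
  using A_x_nonzero[of p z] iter_jac[of p "(A p z, snd z)" n] A_S[of p z] by (simp add: B_y_eq)

section \<open>The determinant of the return map\<close>

lemma sigma_eq: "sigmap T p = dspace (1, 0) A p (0, 0)" and lambda_eq: "lambdap T p = dspace (0, 1) B p (0, 0)"
  by (simp_all add: sigmap_def lambdap_def dspace_def)

lemma sigma_nonzero: "p \<in> N \<Longrightarrow> sigmap T p \<noteq> 0" and lambda_nonzero: "p \<in> N \<Longrightarrow> lambdap T p \<noteq> 0"
  using A_x_nonzero B_y_nonzero zero_box by (auto simp: sigma_eq lambda_eq)

lemma z1_S: "p \<in> N \<Longrightarrow> z1 T p \<in> S"
proof -
  assume p: "p \<in> N"
  have "z1 T p \<in> tube T p"
    using rad_pos[OF p] unfolding tube_def by (intro CollectI exI[of _ 0] exI[of _ 0]) (auto simp: small_box_def z1_def Hfun_def)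
  then show ?thesis using lf p by (auto simp: local_form_def)
qed

lemma fold_jac_nonzero: "p \<in> N \<Longrightarrow> fold_jac T p \<noteq> 0"
  unfolding fold_jac_def by (rule f_jac[OF N_IJ z1_S])

text \<open>Chain rule along the orbit of \<open>z0\<close>: \<open>f^n\<close> sends it to
  \<open>z1\<close> with determinant \<open>\<lambda> / \<sigma>\<close>, and one more iterate
  contributes \<open>fold_jac\<close>.\<close>

lemma ret_jac_eq: "p \<in> N \<Longrightarrow> ret_jac T p = fold_jac T p * lambdap T p / sigmap T p"
proof -
  assume p: "p \<in> N"
  have b: "(p, (0, 0)) \<in> boxes N" by (rule zero_box[OF p])
  have "z0 T p \<in> S" using A_S[OF b] by (simp add: z0_def)
  moreover have "(f p ^^ n) (z0 T p) = z1 T p" using rep(2)[OF b] by (simp add: z0_def z1_def)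
  ultimately have "jac (\<lambda>z. f p ((f p ^^ n) z)) (z0 T p) = jac (f p) (z1 T p) * jac (f p ^^ n) (z0 T p)"
    using jac_compose[OF iter_diff f_diff, of p "z0 T p" p n] N_IJ[OF p] z1_S[OF p] by simp
  moreover have "lambdap T p = jac (f p ^^ n) (z0 T p) * sigmap T p"
    using B_y_eq[OF b] by (simp add: lambda_eq sigma_eq z0_def)
  ultimately show ?thesis
    using sigma_nonzero[OF p] by (simp add: ret_jac_def fold_jac_def comp_def)
qed

lemma ret_jac_nonzero: "p \<in> N \<Longrightarrow> ret_jac T p \<noteq> 0"
  using sigma_nonzero lambda_nonzero fold_jac_nonzero by (simp add: ret_jac_eq)

lemma multM_pos: "0 < multM T" and ret_jac_pos: "even (multM T) \<Longrightarrow> p \<in> N \<Longrightarrow> 0 < ret_jac T p"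
  using uc by (auto simp: unfolding_condition_def)

text \<open>The real root is inverted by the power for odd \<open>M\<close>, and for even
  \<open>M\<close> because the determinant is positive. This identity makes the coefficient of
  \<open>Y\<close> exactly \<open>b^M\<close>.\<close>

lemma bbar_power: "p \<in> N \<Longrightarrow> bbar T p ^ multM T = fold_jac T p * lambdap T p / sigmap T p"
  using multM_pos ret_jac_pos[of p] unfolding ret_jac_eq[symmetric] bbar_def
  by (cases "even (multM T)") (auto simp: odd_real_root_pow)

end

section \<open>The renormalized map\<close>

text \<open>
  Everything is now indexed by \<open>q = (a, b)\<close>, the new parameter, and the points are \<open>z = (X, b\<^sup>M Y)\<close>.
  The first coordinate \<open>u\<close> of the renormalized map is \<open>sol\<close>, the solution of \<open>u + gamA (u, X) = tgt\<close>, and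
  its second coordinate is \<open>X + gamB (X, u)\<close>. The function \<open>norB\<close> has its variables exchanged, so that
  it has the same properties as \<open>norA\<close>. The set \<open>dom_W\<close> is the domain of \<open>sol\<close>; it is open because
  \<open>imgA\<close> is, by invariance of domain.
\<close>

definition sg :: "tangency_data \<Rightarrow> plane set \<Rightarrow> plane \<Rightarrow> real" where
  "sg T P q = sigmap T (pbar_inv T P q)"

definition norA :: "tangency_data \<Rightarrow> plane \<Rightarrow> plane \<Rightarrow> real" where
  "norA T p z = fst (normalized_rep T p z)"

definition norB :: "tangency_data \<Rightarrow> plane \<Rightarrow> plane \<Rightarrow> real" where
  "norB T p z = snd (normalized_rep T p (snd z, fst z))"

text \<open>\<open>R + 1\<close> leaves an open margin around the closed box of size
  \<open>R\<close>; the two other inequalities keep the rescaled point inside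
  \<open>small_box\<close>.\<close>

definition dom_box :: "tangency_data \<Rightarrow> plane set \<Rightarrow> real \<Rightarrow> (plane \<times> plane) set" where
  "dom_box T P R = {(q, z). q \<in> pbar T ` P \<and> \<bar>fst z\<bar> < R + 1 \<and> \<bar>snd z\<bar> < R + 1 \<and>
     \<bar>sg T P q * fst z\<bar> < rad T (pbar_inv T P q) \<and> \<bar>sg T P q * snd z\<bar> < rad T (pbar_inv T P q)}"

definition dom_rem :: "tangency_data \<Rightarrow> plane set \<Rightarrow> real \<Rightarrow> (plane \<times> plane) set" where
  "dom_rem T P R = {(q, z). q \<in> pbar T ` P \<and> \<bar>fst z\<bar> < R + 1 \<and> \<bar>snd z\<bar> < R + 1 \<and>
     \<bar>sg T P q * fst z\<bar> < rad T (pbar_inv T P q) \<and>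
     \<bar>sg T P q ^ 2 * snd z\<bar> < \<bar>fold_jac T (pbar_inv T P q)\<bar> * rad T (pbar_inv T P q)}"

definition gamA :: "tangency_data \<Rightarrow> plane set \<Rightarrow> plane \<Rightarrow> plane \<Rightarrow> real" where
  "gamA T P q z = norA T (pbar_inv T P q) (sg T P q * fst z, sg T P q * snd z) / sg T P q - fst z"

definition gamB :: "tangency_data \<Rightarrow> plane set \<Rightarrow> plane \<Rightarrow> plane \<Rightarrow> real" where
  "gamB T P q z = norB T (pbar_inv T P q) (sg T P q * fst z, sg T P q * snd z) / sg T P q - fst z"

definition rho :: "tangency_data \<Rightarrow> plane set \<Rightarrow> plane \<Rightarrow> plane \<Rightarrow> real" where
  "rho T P q z = remainder T (pbar_inv T P q) (sg T P q * fst z, sg T P q ^ 2 * snd z) / sg T P q ^ 2"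

definition tgt :: "tangency_data \<Rightarrow> plane set \<Rightarrow> plane \<Rightarrow> plane \<Rightarrow> real" where
  "tgt T P q z = fst q + fst z * fst z - snd z + rho T P q z"

definition farg :: "tangency_data \<Rightarrow> plane set \<Rightarrow> plane \<Rightarrow> plane \<Rightarrow> plane" where
  "farg T P q z = (Vfun T (pbar_inv T P q) (sg T P q * fst z) + sg T P q * sg T P q * tgt T P q z, sg T P q * fst z)"

text \<open>An open substitute for the box \<open>Y p\<close>, which is closed: by
  \<open>rep\<close> its fibres are parts of \<open>Y p\<close>, namely those on which
  \<open>A\<close> can be evaluated within the rescaled size.\<close>

definition imgA :: "tangency_data \<Rightarrow> plane set \<Rightarrow> real \<Rightarrow> (plane \<times> plane) set" where
  "imgA T P R = (\<lambda>(p, z). (p, (repA T p z, snd z))) ` {(p, z). p \<in> P \<and> z \<in> small_box T p \<and>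
     \<bar>fst z\<bar> < (R + 1) * \<bar>sigmap T p\<bar> \<and> \<bar>snd z\<bar> < (R + 1) * \<bar>sigmap T p\<bar>}"

definition dom_W :: "tangency_data \<Rightarrow> plane set \<Rightarrow> real \<Rightarrow> (plane \<times> plane) set" where
  "dom_W T P R = {(q, z). (q, z) \<in> dom_rem T P R \<and> (pbar_inv T P q, farg T P q z) \<in> imgA T P R}"

text \<open>Solving the equation for \<open>u\<close> amounts to applying \<open>f^n\<close>. This
  explicit formula gives the regularity of \<open>u\<close> directly; the implicit equation is kept
  for the estimates.\<close>

definition sol :: "tangency_data \<Rightarrow> plane set \<Rightarrow> plane \<Rightarrow> plane \<Rightarrow> real" where
  "sol T P q z = fst ((fam T (pbar_inv T P q) ^^ ptime T) (farg T P q z)) / sg T P q"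

definition henZ :: "tangency_data \<Rightarrow> plane set \<Rightarrow> plane \<Rightarrow> plane \<Rightarrow> real" where
  "henZ T P q z = (sol T P q z - tgt T P q z) + rho T P q z"

definition henX :: "tangency_data \<Rightarrow> plane set \<Rightarrow> plane \<Rightarrow> plane \<Rightarrow> real" where
  "henX T P q z = gamB T P q (fst z, sol T P q z)"

lemma CT_const_extend:
  fixes h :: "'p::real_normed_vector \<Rightarrow> 'b::real_normed_vector"
  assumes "open U" "CT m d (U \<times> UNIV) (\<lambda>p (x::'a::real_normed_vector). h p)" "d \<le> m"
  shows "CT m' d (U \<times> UNIV) (\<lambda>p (x::'c::real_normed_vector). h p)"
  by (rule CB_const_of_Ck[OF assms(1) Ck_of_CB[OF CB_mono_r[OF assms(2,3)]]]) simp

context tangency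
begin

section \<open>Regularity of the data in the original parameter\<close>

lemma open_N_univ: "open (N \<times> (UNIV :: plane set))"
  using open_N by (simp add: open_Times)

lemma box_zero_par: "CT r d (N \<times> (UNIV :: plane set)) (\<lambda>p z. repA T p (0, 0))" "CT r d (N \<times> (UNIV :: plane set)) (\<lambda>p z. repB T p (0, 0))"
  by (rule CT_compose[OF A_C CT_par[OF open_N_univ] CT_const[OF open_N_univ]], use zero_box in blast)
    (rule CT_compose[OF B_C CT_par[OF open_N_univ] CT_const[OF open_N_univ]], use zero_box in blast)

text \<open>As first derivatives, \<sigma> and \<lambda> are known at order \<open>r - 1\<close>
  only. They depend on the parameter alone and \<open>d \<le> r - 1\<close>, so the order can be
  raised at will.\<close>

lemma sigma_CT: "CT m d (N \<times> (UNIV :: 'a::real_normed_vector set)) (\<lambda>p z. sigmap T p)"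
  and lambda_CT: "CT m d (N \<times> (UNIV :: 'a set)) (\<lambda>p z. lambdap T p)"
proof -
  have A: "CT (r - 1) d (boxes N) (dspace (1, 0) A)" and B: "CT (r - 1) d (boxes N) (dspace (0, 1) B)"
    by (rule CB_top[OF CB_dspace], use A_C B_C r_pos in simp)+
  have "CT (r - 1) d (N \<times> (UNIV :: plane set)) (\<lambda>p z. dspace (1, 0) A p (0, 0))"
    by (rule CT_compose[OF A CT_par[OF open_N_univ] CT_const[OF open_N_univ]]) (use zero_box in blast)
  from CT_const_extend[OF open_N this r_pos(3)] show "CT m d (N \<times> (UNIV :: 'a set)) (\<lambda>p z. sigmap T p)"
    by (simp add: sigma_eq)
  have "CT (r - 1) d (N \<times> (UNIV :: plane set)) (\<lambda>p z. dspace (0, 1) B p (0, 0))"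
    by (rule CT_compose[OF B CT_par[OF open_N_univ] CT_const[OF open_N_univ]]) (use zero_box in blast)
  from CT_const_extend[OF open_N this r_pos(3)] show "CT m d (N \<times> (UNIV :: 'a set)) (\<lambda>p z. lambdap T p)"
    by (simp add: lambda_eq)
qed

lemma fold_jac_CT: "CT m d (N \<times> (UNIV :: 'a::real_normed_vector set)) (\<lambda>p z. fold_jac T p)"
proof -
  have F: "CT (r - 1) d (IJ \<times> S) (dspace v f)" for v
    by (rule CB_top[OF CB_dspace], use f_C r_pos in simp)
  have "CT (r - 1) d (N \<times> (UNIV :: plane set)) (\<lambda>p z. dspace v f p (0, repB T p (0, 0)))" for v
  proof (rule CT_compose[OF F CT_par[OF open_N_univ] CT_Pair[OF CT_const[OF open_N_univ] CB_mono_r[OF box_zero_par(2) diff_le_self]]])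
    fix p and z :: plane assume "(p, z) \<in> N \<times> UNIV"
    then show "(p, (0, repB T p (0, 0))) \<in> IJ \<times> S" using z1_S[of p] N_IJ[of p] by (simp add: z1_def)
  qed
  then have "CT (r - 1) d (N \<times> (UNIV :: plane set)) (\<lambda>p z. fold_jac T p)"
    unfolding fold_jac_def jac_dspace z1_def by (intro CT_diff CT_mult CT_fst CT_snd)
  from CT_const_extend[OF open_N this r_pos(3)] show ?thesis .
qed

lemma mu_CT: "CT m d (N \<times> (UNIV :: 'a::real_normed_vector set)) (\<lambda>p z. mu T p)"
  by (rule CB_const_of_Ck[OF open_N]) (use tc in \<open>auto simp: tangency_condition_def\<close>)

lemma boxes_iff: "(p, z) \<in> boxes P \<longleftrightarrow> p \<in> P \<and> \<bar>fst z\<bar> < rad T p \<and> \<bar>snd z\<bar> < rad T p"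
  by (cases z) (auto simp: boxes_def small_box_def)

lemma norA_CT: "CT r d (boxes N) (norA T)"
proof -
  have o: "open (boxes N)" by (rule CB_open[OF A_C])
  have s: "CT r d (boxes N) (\<lambda>p z. sigmap T p)"
    by (rule CB_subset[OF sigma_CT o]) (auto simp: boxes_def)
  have "CT r d (boxes N) (\<lambda>p z. (A p z - A p (0, snd z)) / sigmap T p)"
  proof (intro CT_divide CT_diff A_C s CT_compose[OF A_C CT_par[OF o] CT_Pair[OF CT_const[OF o] CT_snd[OF CT_space[OF o]]]])
    show "(p, (0, snd z)) \<in> boxes N" if "(p, z) \<in> boxes N" for p z
      using that rad_pos[of p] by (auto simp: boxes_iff)
    show "sigmap T p \<noteq> 0" if "(p, z) \<in> boxes N" for p z using sigma_nonzero[of p] that by (auto simp: boxes_def)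
  qed
  moreover have "norA T = (\<lambda>p z. (A p z - A p (0, snd z)) / sigmap T p)"
    by (auto simp: fun_eq_iff norA_def normalized_rep_def Vfun_def)
  ultimately show ?thesis by simp
qed

lemma norB_CT: "CT r d (boxes N) (norB T)"
proof -
  have o: "open (boxes N)" by (rule CB_open[OF A_C])
  have s: "CT r d (boxes N) (\<lambda>p z. lambdap T p)"
    by (rule CB_subset[OF lambda_CT o]) (auto simp: boxes_def)
  note fs = CT_fst[OF CT_space[OF o]] CT_snd[OF CT_space[OF o]]
  have "CT r d (boxes N) (\<lambda>p z. (B p (snd z, fst z) - B p (snd z, 0)) / lambdap T p)"
  proof (intro CT_divide CT_diff s CT_compose[OF B_C CT_par[OF o] CT_Pair[OF fs(2) fs(1)]] CT_compose[OF B_C CT_par[OF o] CT_Pair[OF fs(2) CT_const[OF o]]])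
    show "(p, (snd z, 0)) \<in> boxes N" "(p, (snd z, fst z)) \<in> boxes N" if "(p, z) \<in> boxes N" for p z
      using that rad_pos[of p] by (auto simp: boxes_iff)
    show "lambdap T p \<noteq> 0" if "(p, z) \<in> boxes N" for p z using lambda_nonzero[of p] that by (auto simp: boxes_def)
  qed
  moreover have "norB T = (\<lambda>p z. (B p (snd z, fst z) - B p (snd z, 0)) / lambdap T p)"
    by (auto simp: fun_eq_iff norB_def normalized_rep_def Hfun_def)
  ultimately show ?thesis by simp
qed

lemma remainder_CT: "CT r d (rem_domain T P) (remainder T)" if P: "P \<subseteq> N" "open P"
proof -
  have o: "open (rem_domain T P')" if P': "P' \<subseteq> N" "open P'" for P'
  proof -
    have oP: "open (P' \<times> (UNIV :: plane set))" using P' by (simp add: open_Times)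
    have c1: "continuous_on (P' \<times> UNIV) (\<lambda>w::plane \<times> plane. rad T (fst w))"
      by (rule continuous_on_compose2[OF rad_cont]) (use P' in \<open>auto intro!: continuous_intros\<close>)
    have "continuous_on (N \<times> UNIV) (\<lambda>(p, z::plane). fold_jac T p)" by (rule CB_cont[OF fold_jac_CT])
    moreover have "P' \<times> UNIV \<subseteq> N \<times> (UNIV :: plane set)" using P' by blast
    ultimately have "continuous_on (P' \<times> UNIV) (\<lambda>(p, z::plane). fold_jac T p)" by (rule continuous_on_subset)
    then have c2: "continuous_on (P' \<times> UNIV) (\<lambda>w::plane \<times> plane. fold_jac T (fst w))"
      by (simp add: case_prod_beta')
    have "open {w \<in> P' \<times> (UNIV :: plane set). \<bar>fst (snd w)\<bar> < rad T (fst w)}"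
      by (rule open_Collect_less_on[OF oP _ c1]) (intro continuous_intros)
    moreover have "open {w \<in> P' \<times> (UNIV :: plane set). \<bar>snd (snd w)\<bar> < \<bar>fold_jac T (fst w)\<bar> * rad T (fst w)}"
      by (rule open_Collect_less_on[OF oP]) (intro continuous_intros c1 c2)+
    ultimately have "open ({w \<in> P' \<times> (UNIV :: plane set). \<bar>fst (snd w)\<bar> < rad T (fst w)} \<inter> {w \<in> P' \<times> (UNIV :: plane set). \<bar>snd (snd w)\<bar> < \<bar>fold_jac T (fst w)\<bar> * rad T (fst w)})"
      by (rule open_Int)
    moreover have "rem_domain T P' = {w \<in> P' \<times> (UNIV :: plane set). \<bar>fst (snd w)\<bar> < rad T (fst w)} \<inter> {w \<in> P' \<times> (UNIV :: plane set). \<bar>snd (snd w)\<bar> < \<bar>fold_jac T (fst w)\<bar> * rad T (fst w)}"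
      by (auto simp: rem_domain_def)
    ultimately show ?thesis by simp
  qed
  have "CT r d (rem_domain T N) (remainder T)"
    by (rule CB_of_Cdr[OF o]) (use tc open_N in \<open>auto simp: tangency_condition_def\<close>)
  then show ?thesis by (rule CB_subset[OF _ o[OF P]]) (use P(1) in \<open>auto simp: rem_domain_def\<close>)
qed

end

locale renorm = tangency +
  fixes P :: "plane set" and R :: real
  assumes pd: "param_domain d T P" and bt: "boxes_in_tube T R P" and R: "0 < R"
begin

abbreviation "Q \<equiv> pbar T ` P"
abbreviation "pq \<equiv> pbar_inv T P"
abbreviation "s \<equiv> sg T P"

section \<open>Regularity in the new parameter and openness of the domains\<close>

lemma P_N: "p \<in> P \<Longrightarrow> p \<in> N" and open_P: "open P" and open_Q: "open Q" and inj: "inj_on (pbar T) P"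
  and pq_Ck: "Ck_on d Q pq"
  using pd by (auto simp: param_domain_def Ck_diffeo_on_def pbar_inv_def[abs_def])

lemma pq_P: "q \<in> Q \<Longrightarrow> pq q \<in> P" and pq_inv: "q \<in> Q \<Longrightarrow> pbar T (pq q) = q"
  and pq_left: "p \<in> P \<Longrightarrow> pq (pbar T p) = p"
  unfolding pbar_inv_def using inj
  by (auto simp: the_inv_into_f_f f_the_inv_into_f)

lemma pq_CT: "CT m d (Q \<times> (UNIV :: 'a::real_normed_vector set)) (\<lambda>q z. pq q)"
  by (rule CB_const_of_Ck[OF open_Q pq_Ck]) simp

lemma comp_CT:
  assumes "\<And>m. CT m d (N \<times> (UNIV :: plane set)) (\<lambda>p z. h p)"
  shows "CT m d (Q \<times> (UNIV :: plane set)) (\<lambda>q z. h (pq q))"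
proof (rule CT_compose[OF assms[of m] pq_CT[of m] CT_space[OF CB_open[OF pq_CT[of m]]]])
  show "(pq q, z) \<in> N \<times> UNIV" if "(q, z) \<in> Q \<times> (UNIV :: plane set)" for q z
    using P_N[OF pq_P[of q]] that by blast
qed

lemma s_CT: "CT m d (Q \<times> (UNIV :: plane set)) (\<lambda>q z. s q)"
  unfolding sg_def by (rule comp_CT[OF sigma_CT])

lemma s_nonzero: "q \<in> Q \<Longrightarrow> s q \<noteq> 0"
  unfolding sg_def by (rule sigma_nonzero[OF P_N[OF pq_P]])

lemma cont_Q:
  "continuous_on (Q \<times> UNIV) (\<lambda>w::plane \<times> plane. rad T (pq (fst w)))"
  "continuous_on (Q \<times> UNIV) (\<lambda>w::plane \<times> plane. s (fst w))"
  "continuous_on (Q \<times> UNIV) (\<lambda>w::plane \<times> plane. fold_jac T (pq (fst w)))"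
proof -
  have "continuous_on (Q \<times> UNIV) (\<lambda>w::plane \<times> plane. pq (fst w))"
    using CB_cont[OF pq_CT[of 0]] by (simp add: case_prod_beta')
  then show "continuous_on (Q \<times> UNIV) (\<lambda>w::plane \<times> plane. rad T (pq (fst w)))"
  proof (rule continuous_on_compose2[OF rad_cont], intro image_subsetI)
    fix w assume "w \<in> Q \<times> (UNIV :: plane set)"
    then have "fst w \<in> Q" by (simp add: mem_Times_iff)
    then show "pq (fst w) \<in> N" by (rule P_N[OF pq_P])
  qed
  show "continuous_on (Q \<times> UNIV) (\<lambda>w::plane \<times> plane. s (fst w))"
    using CB_cont[OF s_CT[of 0]] by (simp add: case_prod_beta')
  show "continuous_on (Q \<times> UNIV) (\<lambda>w::plane \<times> plane. fold_jac T (pq (fst w)))"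
    using CB_cont[OF comp_CT[OF fold_jac_CT, of 0]] by (simp add: case_prod_beta')
qed

lemma open_Q_univ: "open (Q \<times> (UNIV :: plane set))"
  using open_Q by (simp add: open_Times)

lemma open_dom_box: "open (dom_box T P R)"
proof -
  have "open ({w \<in> Q \<times> (UNIV :: plane set). \<bar>fst (snd w)\<bar> < R + 1} \<inter> {w \<in> Q \<times> (UNIV :: plane set). \<bar>snd (snd w)\<bar> < R + 1}
      \<inter> ({w \<in> Q \<times> (UNIV :: plane set). \<bar>s (fst w) * fst (snd w)\<bar> < rad T (pq (fst w))}
      \<inter> {w \<in> Q \<times> (UNIV :: plane set). \<bar>s (fst w) * snd (snd w)\<bar> < rad T (pq (fst w))}))"
    by (intro open_Int open_Collect_less_on[OF open_Q_univ] continuous_intros cont_Q)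
  moreover have "dom_box T P R = {w \<in> Q \<times> (UNIV :: plane set). \<bar>fst (snd w)\<bar> < R + 1} \<inter> {w \<in> Q \<times> (UNIV :: plane set). \<bar>snd (snd w)\<bar> < R + 1}
      \<inter> ({w \<in> Q \<times> (UNIV :: plane set). \<bar>s (fst w) * fst (snd w)\<bar> < rad T (pq (fst w))}
      \<inter> {w \<in> Q \<times> (UNIV :: plane set). \<bar>s (fst w) * snd (snd w)\<bar> < rad T (pq (fst w))})"
    unfolding dom_box_def by auto
  ultimately show ?thesis by simp
qed

lemma open_dom_rem: "open (dom_rem T P R)"
proof -
  have "open ({w \<in> Q \<times> (UNIV :: plane set). \<bar>fst (snd w)\<bar> < R + 1} \<inter> {w \<in> Q \<times> (UNIV :: plane set). \<bar>snd (snd w)\<bar> < R + 1}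
      \<inter> ({w \<in> Q \<times> (UNIV :: plane set). \<bar>s (fst w) * fst (snd w)\<bar> < rad T (pq (fst w))}
      \<inter> {w \<in> Q \<times> (UNIV :: plane set). \<bar>s (fst w) ^ 2 * snd (snd w)\<bar> < \<bar>fold_jac T (pq (fst w))\<bar> * rad T (pq (fst w))}))"
    by (intro open_Int open_Collect_less_on[OF open_Q_univ] continuous_intros cont_Q)
  moreover have "dom_rem T P R = {w \<in> Q \<times> (UNIV :: plane set). \<bar>fst (snd w)\<bar> < R + 1} \<inter> {w \<in> Q \<times> (UNIV :: plane set). \<bar>snd (snd w)\<bar> < R + 1}
      \<inter> ({w \<in> Q \<times> (UNIV :: plane set). \<bar>s (fst w) * fst (snd w)\<bar> < rad T (pq (fst w))}
      \<inter> {w \<in> Q \<times> (UNIV :: plane set). \<bar>s (fst w) ^ 2 * snd (snd w)\<bar> < \<bar>fold_jac T (pq (fst w))\<bar> * rad T (pq (fst w))})"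
    unfolding dom_rem_def by auto
  ultimately show ?thesis by simp
qed

lemma dom_boxD: "(q, z) \<in> dom_box T P R \<Longrightarrow> q \<in> Q"
    "(q, z) \<in> dom_box T P R \<Longrightarrow> (pq q, (s q * fst z, s q * snd z)) \<in> boxes P"
  and dom_remD: "(q, z) \<in> dom_rem T P R \<Longrightarrow> q \<in> Q"
    "(q, z) \<in> dom_rem T P R \<Longrightarrow> (pq q, (s q * fst z, s q ^ 2 * snd z)) \<in> rem_domain T P"
    "(q, z) \<in> dom_rem T P R \<Longrightarrow> (pq q, (0, s q * fst z)) \<in> boxes P"
  using pq_P[of q] rad_pos[OF P_N[OF pq_P[of q]]]
  by (auto simp: dom_box_def dom_rem_def boxes_iff rem_domain_def)

lemma boxes_mono: "boxes P \<subseteq> boxes N"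
  using P_N by (auto simp: boxes_def)

lemma on_rem:
  "CT m d (dom_rem T P R) (\<lambda>q z. pq q)" "CT m d (dom_rem T P R) (\<lambda>q z. s q)"
  "CT m d (dom_rem T P R) (\<lambda>q z. fst z)" "CT m d (dom_rem T P R) (\<lambda>q z. snd z)" "CT m d (dom_rem T P R) (\<lambda>q z. fst q)"
  using open_dom_rem
  by (auto intro!: CB_subset[OF pq_CT] CB_subset[OF s_CT] CT_fst CT_snd CT_space CT_par dest: dom_remD)

lemma rho_CT: "CT r d (dom_rem T P R) (rho T P)"
proof -
  have "P \<subseteq> N" using P_N by blast
  note rem = remainder_CT[OF this open_P]
  have c: "CT r d (dom_rem T P R) (\<lambda>q z. remainder T (pq q) (s q * fst z, s q * s q * snd z))"
    by (rule CT_compose[OF rem on_rem(1) CT_Pair[OF CT_mult[OF on_rem(2,3)] CT_mult[OF CT_mult[OF on_rem(2,2)] on_rem(4)]]])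
      (use dom_remD(2) in \<open>simp add: power2_eq_square\<close>)
  show ?thesis
    unfolding rho_def[abs_def] power2_eq_square
    by (rule CT_divide[OF c CT_mult[OF on_rem(2,2)]]) (use s_nonzero dom_remD(1) in simp)
qed

lemma tgt_CT: "CT r d (dom_rem T P R) (tgt T P)"
  unfolding tgt_def[abs_def] by (intro CT_diff CT_add CT_mult on_rem rho_CT)

lemma farg_CT: "CT r d (dom_rem T P R) (farg T P)"
  unfolding farg_def[abs_def] Vfun_def
  by (intro CT_Pair CT_add CT_mult on_rem tgt_CT
      CT_compose[OF A_C on_rem(1) CT_Pair[OF CT_const[OF open_dom_rem] CT_mult[OF on_rem(2,3)]]])
    (use dom_remD(3) boxes_mono in blast)

lemma open_imgA: "open (imgA T P R)"
proof -
  let ?D = "{(p, z). p \<in> P \<and> z \<in> small_box T p \<and> \<bar>fst z\<bar> < (R + 1) * \<bar>sigmap T p\<bar> \<and> \<bar>snd z\<bar> < (R + 1) * \<bar>sigmap T p\<bar>}"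
  have oP: "open (boxes P)" by (rule open_boxes[OF open_P]) (use P_N in blast)
  have "continuous_on (N \<times> UNIV) (\<lambda>(p, z::plane). sigmap T p)" by (rule CB_cont[OF sigma_CT])
  moreover have "boxes P \<subseteq> N \<times> (UNIV :: plane set)" unfolding boxes_def using P_N by blast
  ultimately have "continuous_on (boxes P) (\<lambda>(p, z::plane). sigmap T p)" by (rule continuous_on_subset)
  then have c: "continuous_on (boxes P) (\<lambda>w. sigmap T (fst w))" by (simp add: case_prod_beta')
  have D: "?D = {w \<in> boxes P. \<bar>fst (snd w)\<bar> < (R + 1) * \<bar>sigmap T (fst w)\<bar>} \<inter> {w \<in> boxes P. \<bar>snd (snd w)\<bar> < (R + 1) * \<bar>sigmap T (fst w)\<bar>}"
    by (auto simp: boxes_def)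
  have "open ?D" unfolding D
    by (intro open_Int open_Collect_less_on[OF oP] continuous_intros c)
  moreover have sub: "?D \<subseteq> boxes N" using boxes_mono by (auto simp: boxes_def)
  have "continuous_on ?D (\<lambda>(p, z). A p z)" by (rule continuous_on_subset[OF CB_cont[OF A_C] sub])
  then have "continuous_on ?D (\<lambda>(p, z). (p, (A p z, snd z)))"
    by (auto simp: case_prod_beta' intro!: continuous_intros)
  \<comment> \<open>The point is recovered from its image since \<open>x\<close> is the first
    coordinate of \<open>f^n (A (x, y), y)\<close>; invariance of domain then applies.\<close>
  moreover have "inj_on (\<lambda>(p, z). (p, (A p z, snd z))) ?D"
  proof (rule inj_onI)
    fix w w' assume w: "w \<in> ?D" "w' \<in> ?D" and e: "(\<lambda>(p, z). (p, (A p z, snd z))) w = (\<lambda>(p, z). (p, (A p z, snd z))) w'"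
    obtain p x y p' x' y' where ww: "w = (p, (x, y))" "w' = (p', (x', y'))" by (metis surj_pair)
    have "(p, (x, y)) \<in> boxes N" "(p', (x', y')) \<in> boxes N" using w sub unfolding ww by blast+
    from rep(2)[OF this(1)] rep(2)[OF this(2)]
    have x: "x = fst ((f p ^^ n) (A p (x, y), y))" "x' = fst ((f p' ^^ n) (A p' (x', y'), y'))" by simp_all
    have e: "p = p'" "A p (x, y) = A p' (x', y')" "y = y'" using e unfolding ww by auto
    have "(A p (x, y), y) = (A p' (x', y'), y')" using e(2,3) by simp
    from arg_cong2[where f = "\<lambda>p w. fst ((f p ^^ n) w)", OF e(1) this]
    have "x = x'" by (simp only: x[symmetric])
    then show "w = w'" using e unfolding ww by simp
  qed
  ultimately show ?thesis unfolding imgA_def by (intro invariance_of_domain)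
qed

lemma open_dom_W: "open (dom_W T P R)"
proof -
  have "continuous_on (dom_rem T P R) (\<lambda>w. (pq (fst w), farg T P (fst w) (snd w)))"
    using CB_cont[OF CT_Pair[OF on_rem(1) farg_CT]] by (simp add: case_prod_beta')
  from continuous_open_preimage[OF this open_dom_rem open_imgA]
  have "open (dom_rem T P R \<inter> (\<lambda>w. (pq (fst w), farg T P (fst w) (snd w))) -` imgA T P R)" .
  moreover have "w \<in> dom_W T P R \<longleftrightarrow> w \<in> dom_rem T P R \<inter> (\<lambda>w. (pq (fst w), farg T P (fst w) (snd w))) -` imgA T P R" for w
    by (cases w) (simp add: dom_W_def)
  then have "dom_W T P R = dom_rem T P R \<inter> (\<lambda>w. (pq (fst w), farg T P (fst w) (snd w))) -` imgA T P R" by (rule set_eqI)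
  ultimately show ?thesis by simp
qed

lemma dom_W_rem: "dom_W T P R \<subseteq> dom_rem T P R"
  by (auto simp: dom_W_def)

text \<open>Membership in \<open>imgA\<close> writes \<open>farg\<close> as
  \<open>(A (x, y), y)\<close>; applying \<open>f^n\<close> returns \<open>x\<close>, so
  \<open>x = s * sol\<close>, and comparing first coordinates gives the equation.\<close>

lemma sol_props:
  assumes qz: "(q, z) \<in> dom_W T P R"
  shows "(q, (sol T P q z, fst z)) \<in> dom_box T P R"
    and "farg T P q z = (A (pq q) (s q * sol T P q z, s q * fst z), s q * fst z)"
    and "sol T P q z + gamA T P q (sol T P q z, fst z) = tgt T P q z"
proof -
  let ?p = "pq q"
  have rem: "(q, z) \<in> dom_rem T P R" using qz dom_W_rem by blast
  have q: "q \<in> Q" by (rule dom_remD(1)[OF rem])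
  have s0: "s q \<noteq> 0" by (rule s_nonzero[OF q])
  obtain x y where xy: "(x, y) \<in> small_box T ?p" "\<bar>x\<bar> < (R + 1) * \<bar>s q\<bar>" "\<bar>y\<bar> < (R + 1) * \<bar>s q\<bar>"
    "farg T P q z = (A ?p (x, y), y)" "?p \<in> P"
    using qz by (auto simp: dom_W_def imgA_def sg_def)
  have y: "y = s q * fst z" using xy(4) by (simp add: farg_def)
  have "(?p, (x, y)) \<in> boxes N" using xy P_N by (auto simp: boxes_def)
  from rep(2)[OF this] have u: "sol T P q z = x / s q" unfolding sol_def xy(4) by simp
  then have x: "x = s q * sol T P q z" using s0 by simp
  have "\<bar>x\<bar> < rad T ?p" "\<bar>y\<bar> < rad T ?p" using xy(1) by (auto simp: small_box_def)
  moreover have "\<bar>sol T P q z\<bar> < R + 1" using xy(2) s0 unfolding u by (simp add: abs_divide pos_divide_less_eq)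
  moreover have "\<bar>fst z\<bar> < R + 1" using rem by (simp add: dom_rem_def)
  ultimately show "(q, (sol T P q z, fst z)) \<in> dom_box T P R"
    using q by (simp add: dom_box_def x[symmetric] y[symmetric])
  show fa: "farg T P q z = (A ?p (s q * sol T P q z, s q * fst z), s q * fst z)"
    using xy(4) x y by simp
  then have "A ?p (s q * sol T P q z, s q * fst z) - Vfun T ?p (s q * fst z) = s q * s q * tgt T P q z"
    by (simp add: farg_def)
  then have "norA T ?p (s q * sol T P q z, s q * fst z) = s q * tgt T P q z"
    using s0 by (simp add: norA_def normalized_rep_def sg_def)
  then show "sol T P q z + gamA T P q (sol T P q z, fst z) = tgt T P q z"
    using s0 by (simp add: gamA_def)
qed

lemma sol_CT: "CT r d (dom_W T P R) (sol T P)"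
proof -
  note sub = CB_subset[OF _ open_dom_W dom_W_rem]
  have i: "(pq q, farg T P q z) \<in> IJ \<times> S" if "(q, z) \<in> dom_W T P R" for q z
  proof -
    have "(pq q, (s q * sol T P q z, s q * fst z)) \<in> boxes N"
      using dom_boxD(2)[OF sol_props(1)[OF that]] boxes_mono by auto
    from A_S[OF this] show ?thesis unfolding sol_props(2)[OF that] by simp
  qed
  have c: "CT r d (dom_W T P R) (\<lambda>q z. (f (pq q) ^^ n) (farg T P q z))"
    by (rule CT_compose[OF iter_C sub[OF on_rem(1)] sub[OF farg_CT] i])
  have "s q \<noteq> 0" if "(q, z) \<in> dom_W T P R" for q z
    by (rule s_nonzero[OF dom_remD(1)[OF subsetD[OF dom_W_rem that]]])
  then show ?thesis unfolding sol_def[abs_def]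
    by (rule CT_divide[OF CT_fst[OF c] sub[OF on_rem(2)]])
qed

lemma henZ_CT: "CT r d (dom_W T P R) (henZ T P)"
  unfolding henZ_def[abs_def]
  by (intro CT_add CT_diff sol_CT CB_subset[OF tgt_CT open_dom_W dom_W_rem] CB_subset[OF rho_CT open_dom_W dom_W_rem])

lemma henX_CT: "CT r d (dom_W T P R) (henX T P)"
proof -
  have o: "open (dom_W T P R)" by (rule open_dom_W)
  show ?thesis unfolding henX_def[abs_def]
  proof (rule CB_cong_imp)
    have sw: "CT r d (dom_W T P R) (\<lambda>q z. norB T (pq q) (s q * fst z, s q * sol T P q z))"
    proof (rule CT_compose[OF norB_CT CB_subset[OF on_rem(1) o dom_W_rem] CT_Pair[OF CT_mult CT_mult]])
      show "(pq q, (s q * fst z, s q * sol T P q z)) \<in> boxes N" if "(q, z) \<in> dom_W T P R" for q z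
        using dom_boxD(2)[OF sol_props(1)[OF that]] P_N by (simp add: boxes_iff)
    qed (intro CB_subset[OF on_rem(2) o dom_W_rem] CB_subset[OF on_rem(3) o dom_W_rem] sol_CT)+
    show "CT r d (dom_W T P R) (\<lambda>q z. norB T (pq q) (s q * fst z, s q * sol T P q z) / s q - fst z)"
      by (rule CT_diff[OF CT_divide[OF sw CB_subset[OF on_rem(2) o dom_W_rem]] CB_subset[OF on_rem(3) o dom_W_rem]])
        (rule s_nonzero[OF dom_remD(1)[OF subsetD[OF dom_W_rem]]])
  qed (simp add: gamB_def)
qed

end

context renorm
begin

lemma pbar_pq: "q \<in> Q \<Longrightarrow> fst q * (s q * s q) = mu T (pq q)"
  "q \<in> Q \<Longrightarrow> snd q ^ multM T * s q = fold_jac T (pq q) * lambdap T (pq q)"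
proof -
  assume q: "q \<in> Q"
  have e: "pbar T (pq q) = q" and N: "pq q \<in> N" using pq_inv[OF q] P_N[OF pq_P[OF q]] by auto
  have "fst q = abar T (pq q)" "snd q = bbar T (pq q)" using e by (auto simp: pbar_def prod_eq_iff)
  then show "fst q * (s q * s q) = mu T (pq q)" "snd q ^ multM T * s q = fold_jac T (pq q) * lambdap T (pq q)"
    using bbar_power[OF N] s_nonzero[OF q] by (simp_all add: abar_def sg_def power2_eq_square)
qed

text \<open>Through \<open>bbar_power\<close> the vertical scale \<open>\<sigma>\<lambda>\<close> of
  \<open>phi\<close>, multiplied by the determinant of the fold, becomes
  \<open>\<sigma>^2 * b^M\<close>: the second argument of the remainder is quadratic in
  \<sigma>.\<close>

lemma pbar_scale: "q \<in> Q \<Longrightarrow> s q ^ 2 * (snd q ^ multM T * y) = fold_jac T (pq q) * (s q * lambdap T (pq q) * y)"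
proof -
  assume q: "q \<in> Q"
  have "s q ^ 2 * (snd q ^ multM T * y) = (snd q ^ multM T * s q) * (s q * y)" by (simp add: power2_eq_square)
  then show ?thesis unfolding pbar_pq(2)[OF q] by (simp only: mult_ac)
qed

lemma f_phi:
  assumes q: "q \<in> Q" and b: "(s q * X, s q * lambdap T (pq q) * Y') \<in> small_box T (pq q)"
  shows "f (pq q) (phi T (pq q) (X, Y')) = farg T P q (X, snd q ^ multM T * Y')"
proof -
  let ?p = "pq q"
  let ?x = "s q * X" and ?y = "s q * lambdap T (pq q) * Y'"
  have p: "?p \<in> N" by (rule P_N[OF pq_P[OF q]])
  have ph: "phi T ?p (X, Y') = (?x, Hfun T ?p ?x + ?y)" by (simp add: phi_def sg_def)
  have "(?x, Hfun T ?p ?x + ?y) \<in> tube T ?p" using b unfolding tube_def by blast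
  then have 1: "f ?p (phi T ?p (X, Y')) = (gmap T ?p (?x, ?y + Hfun T ?p ?x), ?x)"
    using lf p unfolding local_form_def ph by (auto simp: add.commute)
  have "gmap T ?p (?x, ?y + Hfun T ?p ?x) - Vfun T ?p ?x
      = mu T ?p + ?x ^ 2 - fold_jac T ?p * ?y + remainder T ?p (?x, fold_jac T ?p * ?y)"
    using tc p b unfolding tangency_condition_def by blast
  then have 2: "gmap T ?p (?x, ?y + Hfun T ?p ?x) = Vfun T ?p ?x + (mu T ?p + ?x ^ 2
      - s q ^ 2 * (snd q ^ multM T * Y') + remainder T ?p (?x, s q ^ 2 * (snd q ^ multM T * Y')))"
    unfolding pbar_scale[OF q] by simp
  have "s q * s q * tgt T P q (X, snd q ^ multM T * Y') = fst q * (s q * s q) + ?x ^ 2 - s q ^ 2 * (snd q ^ multM T * Y')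
      + s q ^ 2 * (remainder T ?p (?x, s q ^ 2 * (snd q ^ multM T * Y')) / s q ^ 2)"
    unfolding tgt_def rho_def power2_eq_square fst_conv snd_conv by (simp only: distrib_left right_diff_distrib mult_ac)
  then have "s q * s q * tgt T P q (X, snd q ^ multM T * Y') = mu T ?p + ?x ^ 2 - s q ^ 2 * (snd q ^ multM T * Y')
      + remainder T ?p (?x, s q ^ 2 * (snd q ^ multM T * Y'))"
    using s_nonzero[OF q] pbar_pq(1)[OF q] by simp
  then show ?thesis unfolding 1 2 farg_def by simp
qed

lemma phi_inj: "q \<in> Q \<Longrightarrow> inj (phi T (pq q))"
proof (rule injI)
  fix z w assume q: "q \<in> Q" and e: "phi T (pq q) z = phi T (pq q) w"
  have "s q \<noteq> 0" "lambdap T (pq q) \<noteq> 0" using s_nonzero[OF q] lambda_nonzero[OF P_N[OF pq_P[OF q]]] by auto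
  then show "z = w" using e by (cases z; cases w) (auto simp: phi_def sg_def)
qed

text \<open>Conjugation by \<open>phi\<close> sends the fold to \<open>farg\<close> and the
  transition through the piece to \<open>sol\<close>. The second coordinate divides
  \<open>B - H\<close> by \<open>\<sigma>\<lambda>\<close>, which is \<open>X\<close> up to
  \<open>gamB\<close>.\<close>

lemma renorm_on_W:
  assumes qz: "(q, (X, snd q ^ multM T * Y')) \<in> dom_W T P R"
  shows "renorm_family T P q (X, Y') = (X ^ 2 + fst q - snd q ^ multM T * Y' + henZ T P q (X, snd q ^ multM T * Y'),
    X + henX T P q (X, snd q ^ multM T * Y'))"
proof -
  let ?p = "pq q" and ?w = "snd q ^ multM T * Y'"
  let ?u = "sol T P q (X, ?w)"
  have rem: "(q, (X, ?w)) \<in> dom_rem T P R" using qz dom_W_rem by blast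
  have q: "q \<in> Q" by (rule dom_remD(1)[OF rem])
  have p: "?p \<in> N" by (rule P_N[OF pq_P[OF q]])
  have s0: "s q \<noteq> 0" and l0: "lambdap T ?p \<noteq> 0" and d0: "fold_jac T ?p \<noteq> 0"
    using s_nonzero[OF q] lambda_nonzero[OF p] fold_jac_nonzero[OF p] by simp_all
  have "\<bar>s q ^ 2 * ?w\<bar> < \<bar>fold_jac T ?p\<bar> * rad T ?p" and X: "\<bar>s q * X\<bar> < rad T ?p"
    using rem by (auto simp: dom_rem_def)
  then have "\<bar>fold_jac T ?p\<bar> * \<bar>s q * lambdap T ?p * Y'\<bar> < \<bar>fold_jac T ?p\<bar> * rad T ?p"
    unfolding pbar_scale[OF q] abs_mult[of "fold_jac T ?p"] by simp
  then have "(s q * X, s q * lambdap T ?p * Y') \<in> small_box T ?p"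
    using d0 X by (simp add: small_box_def)
  from f_phi[OF q this] have 1: "f ?p (phi T ?p (X, Y')) = (A ?p (s q * ?u, s q * X), s q * X)"
    using sol_props(2)[OF qz] by simp
  have "(?p, (s q * ?u, s q * X)) \<in> boxes N"
    using dom_boxD(2)[OF sol_props(1)[OF qz]] boxes_mono by auto
  from rep(2)[OF this] have 2: "(f ?p ^^ (n + 1)) (phi T ?p (X, Y')) = (s q * ?u, B ?p (s q * ?u, s q * X))"
    using 1 by (simp add: funpow_swap1)
  \<comment> \<open>\<open>inv\<close> of an injective map is evaluated by exhibiting the
    preimage.\<close>
  have "phi T ?p (?u, (B ?p (s q * ?u, s q * X) - Hfun T ?p (s q * ?u)) / (s q * lambdap T ?p)) = (s q * ?u, B ?p (s q * ?u, s q * X))"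
    using s0 l0 by (simp add: phi_def sg_def)
  from inv_f_eq[OF phi_inj[OF q] this]
  have 3: "renorm_family T P q (X, Y') = (?u, (B ?p (s q * ?u, s q * X) - Hfun T ?p (s q * ?u)) / (s q * lambdap T ?p))"
    using 2 by (simp add: renorm_family_def renorm_map_def)
  have "?u = X ^ 2 + fst q - ?w + henZ T P q (X, ?w)"
    by (simp add: henZ_def tgt_def power2_eq_square)
  moreover have "(B ?p (s q * ?u, s q * X) - Hfun T ?p (s q * ?u)) / (s q * lambdap T ?p) = X + henX T P q (X, ?w)"
    by (simp add: henX_def gamB_def norB_def normalized_rep_def mult.commute)
  ultimately show ?thesis unfolding 3 by simp
qed

text \<open>The starting point in \<open>Delta\<close> bounds \<open>X\<close> and
  \<open>b^M Y\<close>; the return to \<open>Delta\<close> bounds the first coordinate of the image.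
  Together with membership in the piece they give a point of \<open>imgA\<close>.\<close>

lemma domain_in_W:
  assumes "(q, (X, Y')) \<in> renorm_domain T R P"
  shows "(q, (X, snd q ^ multM T * Y')) \<in> dom_W T P R"
proof -
  obtain p where p: "p \<in> P" "q = pbar T p" "(X, Y') \<in> Delta T R p" "renorm_map T p (X, Y') \<in> Delta T R p"
      "f p (phi T p (X, Y')) \<in> Y p"
    using assms by (auto simp: renorm_domain_def)
  let ?w = "snd q ^ multM T * Y'"
  have q: "q \<in> Q" and pp: "pq q = p" using p(1,2) pq_left by auto
  have N: "p \<in> N" by (rule P_N[OF p(1)])
  have s0: "s q \<noteq> 0" and l0: "lambdap T p \<noteq> 0" and d0: "fold_jac T p \<noteq> 0"
    using s_nonzero[OF q] lambda_nonzero[OF N] fold_jac_nonzero[OF N] by simp_all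
  \<comment> \<open>Used for the starting point and again for its image.\<close>
  have box: "(s q * X1, s q * lambdap T p * Y1) \<in> small_box T p" if "(X1, Y1) \<in> Delta T R p" for X1 Y1
  proof -
    have "phi T p (X1, Y1) \<in> tube T p" using bt p(1) that unfolding boxes_in_tube_def by blast
    moreover have "phi T p (X1, Y1) = (s q * X1, Hfun T p (s q * X1) + s q * lambdap T p * Y1)" by (simp add: phi_def sg_def pp)
    ultimately show ?thesis unfolding tube_def by auto
  qed
  have fa: "f p (phi T p (X, Y')) = farg T P q (X, ?w)"
    using f_phi[OF q, of X Y'] box[OF p(3)] by (simp add: pp)
  have X: "\<bar>X\<bar> \<le> R" using p(3) by (auto simp: Delta_def)
  have bq: "snd q = bbar T p" by (simp add: p(2) pbar_def)
  have "\<bar>Y'\<bar> \<le> R / \<bar>bbar T p ^ multM T\<bar>" using p(3) by (auto simp: Delta_def)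
  moreover have "bbar T p ^ multM T \<noteq> 0" using bbar_power[OF N] l0 d0 sigma_nonzero[OF N] by simp
  ultimately have w: "\<bar>?w\<bar> \<le> R" by (simp add: bq abs_mult field_simps)
  have sb: "\<bar>s q * X\<bar> < rad T p" "\<bar>s q * lambdap T p * Y'\<bar> < rad T p" using box[OF p(3)] by (auto simp: small_box_def)
  have "\<bar>fold_jac T p\<bar> * \<bar>s q * lambdap T p * Y'\<bar> < \<bar>fold_jac T p\<bar> * rad T p"
    using mult_strict_left_mono[OF sb(2), of "\<bar>fold_jac T p\<bar>"] d0 by simp
  then have "\<bar>s q ^ 2 * ?w\<bar> < \<bar>fold_jac T p\<bar> * rad T p"
    unfolding pbar_scale[OF q] pp abs_mult[of "fold_jac T p"] by simp
  then have rem: "(q, (X, ?w)) \<in> dom_rem T P R"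
    using q X w sb(1) by (simp add: dom_rem_def pp)
  obtain x1 y1 where xy: "(f p ^^ n) (f p (phi T p (X, Y'))) = (x1, y1)" by (metis surj_pair)
  have "phi T p (x1 / s q, (y1 - Hfun T p x1) / (s q * lambdap T p)) = (x1, y1)"
    using s0 l0 by (simp add: phi_def sg_def pp)
  from inv_f_eq[OF phi_inj[OF q, unfolded pp] this]
  have "renorm_map T p (X, Y') = (x1 / s q, (y1 - Hfun T p x1) / (s q * lambdap T p))"
    using xy by (simp add: renorm_map_def funpow_swap1)
  \<comment> \<open>This bounds \<open>x1\<close> by the radius of the box and by
    \<open>R * \<bar>s q\<bar>\<close>, which the closed set \<open>Y p\<close> alone would not
    provide.\<close>
  then have D: "(x1 / s q, (y1 - Hfun T p x1) / (s q * lambdap T p)) \<in> Delta T R p" using p(4) by simp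
  have x1: "\<bar>x1\<bar> < rad T p" using box[OF D] s0 by (simp add: small_box_def)
  have "\<bar>x1 / s q\<bar> \<le> R" using D by (auto simp: Delta_def)
  then have "\<bar>x1\<bar> \<le> R * \<bar>s q\<bar>" using s0 by (simp add: abs_divide pos_divide_le_eq)
  moreover have "\<bar>s q * X\<bar> \<le> R * \<bar>s q\<bar>" using X by (simp add: abs_mult mult.commute mult_right_mono)
  moreover have "R * \<bar>s q\<bar> < (R + 1) * \<bar>s q\<bar>" using s0 by (simp add: algebra_simps)
  ultimately have small: "\<bar>x1\<bar> < (R + 1) * \<bar>sigmap T p\<bar>" "\<bar>s q * X\<bar> < (R + 1) * \<bar>sigmap T p\<bar>" by (auto simp: sg_def pp)
  have f2: "snd (farg T P q (X, ?w)) = s q * X" by (simp add: farg_def)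
  have yp: "(fst (farg T P q (X, ?w)), s q * X) \<in> Y p" using p(5) unfolding fa by (metis f2 prod.collapse)
  have "fst (farg T P q (X, ?w)) = A p (x1, s q * X)"
    by (rule rep_conv(1)[OF N_IJ[OF N] yp, where ?y1.0 = y1]) (use xy fa f2 in \<open>metis prod.collapse\<close>)
  then have "farg T P q (X, ?w) = (A p (x1, s q * X), s q * X)" using f2 by (metis prod.collapse)
  moreover have "(x1, s q * X) \<in> small_box T p" using x1 sb(1) by (simp add: small_box_def)
  ultimately have "(p, farg T P q (X, ?w)) \<in> imgA T P R"
    unfolding imgA_def using p(1) small by (intro image_eqI[of _ _ "(p, (x1, s q * X))"]) auto
  then show ?thesis using rem by (simp add: dom_W_def pp)
qed

text \<open>The norms are taken on \<open>dom_W\<close>, in the variables \<open>(X, b^M Y)\<close>;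
  the open set of pairs \<open>(q, (X, Y))\<close> is its preimage under the rescaling
  \<open>h\<close> of the last variable.\<close>

lemma henon_like_of_bounds:
  assumes "CB m d K (dom_W T P R) (henZ T P)" "CB m d K (dom_W T P R) (henX T P)"
  shows "henon_like_restricted d r m K (multM T) (renorm_domain T R P) (renorm_family T P)"
proof -
  define h where "h w = (fst w, (fst (snd w), snd (fst w) ^ multM T * snd (snd w)))" for w :: "plane \<times> plane"
  define \<Omega> where "\<Omega> = h -` dom_W T P R"
  have "continuous_on UNIV h" unfolding h_def by (intro continuous_intros)
  then have "open \<Omega>" unfolding \<Omega>_def by (rule open_vimage[OF open_dom_W])
  moreover have "renorm_domain T R P \<subseteq> \<Omega>"
  proof
    fix w assume w: "w \<in> renorm_domain T R P"
    obtain q X Y' where "w = (q, (X, Y'))" by (metis surj_pair)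
    then show "w \<in> \<Omega>" using domain_in_W[of q X Y'] w by (simp add: \<Omega>_def h_def)
  qed
  moreover have "henon_like d r m K (multM T) \<Omega> (renorm_family T P)"
    unfolding henon_like_def
  proof (rule exI[of _ "dom_W T P R"], rule exI[of _ "henZ T P"], rule exI[of _ "henX T P"], intro conjI)
    show "open (dom_W T P R)" by (rule open_dom_W)
    show "Cdr_on d r (dom_W T P R) (henZ T P)" "Cdr_on d r (dom_W T P R) (henX T P)"
      by (rule Cdr_of_CB(1)[OF henZ_CT], rule Cdr_of_CB(1)[OF henX_CT])
    show "Cdr_norm d m (dom_W T P R) (henZ T P) \<le> K" "Cdr_norm d m (dom_W T P R) (henX T P) \<le> K"
      by (rule Cdr_of_CB(2)[OF assms(1)], rule Cdr_of_CB(2)[OF assms(2)])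
    have "((a, b), (X, b ^ multM T * Y')) \<in> dom_W T P R \<and> renorm_family T P (a, b) (X, Y') =
        (X ^ 2 + a - b ^ multM T * Y' + henZ T P (a, b) (X, b ^ multM T * Y'), X + henX T P (a, b) (X, b ^ multM T * Y'))"
      if "((a, b), (X, Y')) \<in> \<Omega>" for a b X Y'
    proof -
      have "((a, b), (X, snd (a, b) ^ multM T * Y')) \<in> dom_W T P R" using that by (simp add: \<Omega>_def h_def)
      with renorm_on_W[OF this] show ?thesis by simp
    qed
    then show "\<forall>((a, b), (X, Y))\<in>\<Omega>. ((a, b), (X, b ^ multM T * Y)) \<in> dom_W T P R \<and> renorm_family T P (a, b) (X, Y) =
        (X ^ 2 + a - b ^ multM T * Y + henZ T P (a, b) (X, b ^ multM T * Y), X + henX T P (a, b) (X, b ^ multM T * Y))"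
      by blast
  qed
  ultimately show ?thesis unfolding henon_like_restricted_def by blast
qed

end

context tangency
begin

text \<open>Normalization divides the derivative by its value at the origin, so the logarithm
  changes by a constant in space and the distortion is the same. Stated for a general
  \<open>G\<close> to cover both \<open>A\<close> and \<open>B\<close>.\<close>

lemma normalized_facts:
  assumes G: "CT r d (boxes N) G" and nz: "\<And>p z. (p, z) \<in> boxes N \<Longrightarrow> dspace (1, 0) G p z \<noteq> (0::real)"
    and a: "\<And>p z. a p z = (G p z - G p (0, snd z)) / dspace (1, 0) G p (0, 0)"
    and pz: "(p, z) \<in> boxes N"
  shows "dspace (1, 0) a p z = dspace (1, 0) G p z / dspace (1, 0) G p (0, 0)"
    and "dspace (1, 0) a p 0 = 1" and "0 < dspace (1, 0) a p z"
    and "dspace e (\<lambda>p z. ln (dspace (1, 0) a p z)) p z = dspace e (\<lambda>p z. ln \<bar>dspace (1, 0) G p z\<bar>) p z"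
proof -
  let ?c = "dspace (1, 0) G p (0, 0)"
  have p: "p \<in> N" using pz by (simp add: boxes_def)
  have c: "?c \<noteq> 0" by (rule nz[OF zero_box[OF p]])
  have G': "CT (Suc (r - 1)) d (boxes N) G" using G r_pos by simp
  have ax: "dspace (1, 0) a p z = dspace (1, 0) G p z / ?c" if "(p, z) \<in> boxes N" for z
  proof -
    have b: "(p, (0, snd z)) \<in> boxes N" using that rad_pos[OF p] by (auto simp: boxes_iff)
    have "((\<lambda>z::plane. (0::real, snd z)) has_derivative (\<lambda>v. (0, snd v))) (at z)"
      by (intro has_derivative_Pair has_derivative_const has_derivative_snd has_derivative_ident)
    from has_derivative_diff[OF CB_diff_space[OF G' that] has_derivative_compose[where g = "G p", OF this CB_diff_space[OF G' b]]]
    have "(a p has_derivative (\<lambda>v. (dspace v G p z - dspace (0, snd v) G p (0, snd z)) / ?c)) (at z)"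
      unfolding a[abs_def] divide_inverse by (rule has_derivative_mult_left)
    from dspaceI[where g = a and D = "\<lambda>v. (dspace v G p z - dspace (0, snd v) G p (0, snd z)) / ?c", OF this, of "(1, 0)"]
    show ?thesis using linear_0[OF has_derivative_linear[OF CB_diff_space[OF G' b]]] by (simp add: zero_prod_def)
  qed
  show "dspace (1, 0) a p z = dspace (1, 0) G p z / ?c" by (rule ax[OF pz])
  show "dspace (1, 0) a p 0 = 1" using ax[OF zero_box[OF p]] c by (simp add: zero_prod_def)
  have seg: "(p, t *\<^sub>R w) \<in> boxes N" if "0 \<le> t" "t \<le> 1" "(p, w) \<in> boxes N" for t w
  proof -
    have "t * \<bar>fst w\<bar> \<le> \<bar>fst w\<bar>" "t * \<bar>snd w\<bar> \<le> \<bar>snd w\<bar>" using that by (auto intro: mult_left_le_one_le)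
    then show ?thesis using that by (auto simp: boxes_iff abs_mult)
  qed
  \<comment> \<open>Along the segment to the origin the derivative does not vanish, so by the
    intermediate value theorem it keeps the sign of its value there.\<close>
  have pos: "0 < dspace (1, 0) G p w / ?c" if w: "(p, w) \<in> boxes N" for w
  proof (rule ccontr)
    assume "\<not> 0 < dspace (1, 0) G p w / ?c"
    then have le: "dspace (1, 0) G p (1 *\<^sub>R w) / ?c \<le> 0" by simp
    have ge: "0 \<le> dspace (1, 0) G p (0 *\<^sub>R w) / ?c" using c by (simp add: zero_prod_def)
    have "continuous_on {0..1} (\<lambda>t. (\<lambda>(p, z). dspace (1, 0) G p z) (p, t *\<^sub>R w))"
    proof (rule continuous_on_compose2[OF CB_cont[OF CB_dspace[OF G']]], goal_cases)
      case 1 show ?case by (intro continuous_intros)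
    next
      case 2 show ?case by (rule image_subsetI) (use seg w in simp)
    qed
    then have "continuous_on {0..1} (\<lambda>t. dspace (1, 0) G p (t *\<^sub>R w) / ?c)"
      using c by (auto intro!: continuous_intros)
    from IVT2'[OF le ge _ this] obtain t where "0 \<le> t" "t \<le> 1" "dspace (1, 0) G p (t *\<^sub>R w) / ?c = 0" by auto
    then show False using nz[OF seg[OF _ _ w]] c by simp
  qed
  show "0 < dspace (1, 0) a p z" using pos[OF pz] ax[OF pz] by simp
  have o: "open {z. (p, z) \<in> boxes N}" by (rule open_slice_space[OF CB_open[OF G]])
  define L where "L w = ln \<bar>dspace (1, 0) G p w\<bar>" for w
  have eq: "ln (dspace (1, 0) a p w) = L w - ln \<bar>?c\<bar>" if "w \<in> {z. (p, z) \<in> boxes N}" for w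
  proof -
    have w: "(p, w) \<in> boxes N" using that by simp
    have "dspace (1, 0) a p w = \<bar>dspace (1, 0) G p w\<bar> / \<bar>?c\<bar>"
      using ax[OF w] pos[OF w] by (metis abs_divide abs_of_pos)
    then show ?thesis using c nz[OF w] by (simp add: L_def ln_div)
  qed
  \<comment> \<open>Writing \<open>ln \<bar>g\<bar>\<close> as half of \<open>ln (g * g)\<close>
    gives differentiability without a distinction of signs.\<close>
  have "CT (Suc (r - 2)) d (boxes N) (\<lambda>p z. ln (dspace (1, 0) G p z * dspace (1, 0) G p z))"
  proof (rule CT_ln[OF CT_mult])
    have "CT (r - 1) d (boxes N) (dspace (1, 0) G)" by (rule CB_top[OF CB_dspace[OF G']])
    moreover have "Suc (r - 2) = r - 1" using dr by simp
    ultimately show "CT (Suc (r - 2)) d (boxes N) (dspace (1, 0) G)" "CT (Suc (r - 2)) d (boxes N) (dspace (1, 0) G)" by simp_all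
  qed (use nz in \<open>metis mult_pos_pos mult_neg_neg linorder_neqE_linordered_idom\<close>)
  from CB_diff_space[OF this pz] obtain D where "((\<lambda>z. ln (dspace (1, 0) G p z * dspace (1, 0) G p z)) has_derivative D) (at z)" by blast
  from has_derivative_mult_left[OF this, of "1/2"]
  have "(L has_derivative (\<lambda>v. D v * (1 / 2))) (at z)"
  proof (rule has_derivative_transform_within_open[OF _ o])
    fix w assume "w \<in> {z. (p, z) \<in> boxes N}"
    then have "dspace (1, 0) G p w \<noteq> 0" using nz by simp
    then have "ln (\<bar>dspace (1, 0) G p w\<bar> * \<bar>dspace (1, 0) G p w\<bar>) = L w + L w" unfolding L_def by (intro ln_mult_pos) auto
    then show "ln (dspace (1, 0) G p w * dspace (1, 0) G p w) * (1 / 2) = L w" by simp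
  qed (use pz in simp)
  then have LD: "L differentiable (at z)" by (rule differentiableI)
  have "ddir e (\<lambda>w. ln (dspace (1, 0) a p w)) z = ddir e (\<lambda>w. L w - ln \<bar>?c\<bar>) z"
    by (rule ddir_cong_open(1)[OF o _ eq]) (use pz in auto)
  also have "\<dots> = ddir e L z"
    using has_derivative_diff[OF has_derivative_ddir[OF LD] has_derivative_const[of "ln \<bar>?c\<bar>"]]
    by (intro ddirI[where h' = "\<lambda>v. ddir v L z"]) simp
  finally show "dspace e (\<lambda>p z. ln (dspace (1, 0) a p z)) p z = dspace e (\<lambda>p z. ln \<bar>dspace (1, 0) G p z\<bar>) p z"
    by (simp add: dspace_def L_def[abs_def])
qed

end

section \<open>The change of parameters\<close>

lemma mixed_space_only: "mixed [] vs (\<lambda>_. h) (p :: 'p::real_normed_vector) = foldr ddir vs h"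
proof -
  have "foldr dspace vs (\<lambda>_ :: 'p. h) = (\<lambda>_. foldr ddir vs h)"
    by (induction vs) (simp_all add: dspace_def)
  then show ?thesis by (simp add: mixed_def)
qed

text \<open>A single map is a family with a dummy parameter and \<open>d = 0\<close>, which makes
  the parametrized inverse function theorem available for it.\<close>

lemma CT_space_only_iff:
  fixes h :: "'a::euclidean_space \<Rightarrow> 'b::real_normed_vector"
  assumes "open U"
  shows "CT k 0 ((UNIV :: 'p::euclidean_space set) \<times> U) (\<lambda>_. h) \<longleftrightarrow> Ck_on k U h"
proof
  assume C: "CT k 0 ((UNIV :: 'p set) \<times> U) (\<lambda>_. h)"
  note D = Cdr_of_CB(1)[OF C]
  show "Ck_on k U h"
    unfolding Ck_on_def
  proof (intro conjI allI impI ballI)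
    fix vs x assume "length (vs :: 'a list) < k" "x \<in> U"
    then show "foldr ddir vs h differentiable (at x)"
      using D[unfolded Cdr_on_def, THEN conjunct1, rule_format, of vs "(0, x)"] by (simp add: mixed_space_only)
  next
    fix vs assume "length (vs :: 'a list) \<le> k"
    then have "continuous_on ((UNIV :: 'p set) \<times> U) (\<lambda>(p, x). foldr ddir vs h x)"
      using Cdr_on_cont[OF D, of "[]" vs] by (simp add: mixed_space_only)
    then have "continuous_on U (\<lambda>x. (\<lambda>(p, x). foldr ddir vs h x) (0 :: 'p, x))"
      by (rule continuous_on_compose2) (auto intro!: continuous_intros)
    then show "continuous_on U (foldr ddir vs h)" by simp
  qed
next
  assume C: "Ck_on k U h"
  show "CT k 0 ((UNIV :: 'p set) \<times> U) (\<lambda>_. h)"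
  proof (rule CB_of_Cdr)
    show "open ((UNIV :: 'p set) \<times> U)" using assms by (simp add: open_Times)
    have "continuous_on ((UNIV :: 'p set) \<times> U) (\<lambda>(p, x). foldr ddir vs h x)" if "length vs \<le> k" for vs
    proof -
      have "continuous_on U (foldr ddir vs h)" using C that by (simp add: Ck_on_def)
      then have "continuous_on ((UNIV :: 'p set) \<times> U) (\<lambda>w. foldr ddir vs h (snd w))"
        by (rule continuous_on_compose2) (auto intro!: continuous_intros)
      then show ?thesis by (simp add: case_prod_beta')
    qed
    then show "Cdr_on 0 k ((UNIV :: 'p set) \<times> U) (\<lambda>_. h)"
      using C by (auto simp: Cdr_on_def mixed_space_only Ck_on_def)
  qed simp
qed

lemma Ck_on_subset: "Ck_on k U h \<Longrightarrow> V \<subseteq> U \<Longrightarrow> Ck_on k V h"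
  unfolding Ck_on_def by (meson continuous_on_subset subsetD)

lemma Ck_on_ddir: "Ck_on k U h \<Longrightarrow> 0 < k \<Longrightarrow> continuous_on U (ddir v h)"
proof -
  assume C: "Ck_on k U h" and k: "0 < k"
  have "length [v] \<le> k" using k by simp
  then have "continuous_on U (foldr ddir [v] h)" using C unfolding Ck_on_def by blast
  then show ?thesis by simp
qed

text \<open>Invariance of domain gives an open image and, applied to open subsets of
  \<open>P\<close>, a continuous inverse; smoothness then follows from
  \<open>CT_planar_inverse\<close>.\<close>

lemma planar_diffeo_of_inj:
  fixes h :: "plane \<Rightarrow> plane"
  assumes P: "open P" and h: "Ck_on k P h" and inj: "inj_on h P" and jac: "\<And>x. x \<in> P \<Longrightarrow> jac h x \<noteq> 0"
  shows "Ck_diffeo_on k P h"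
proof -
  have c: "continuous_on P h" by (rule Ck_on_continuous[OF h])
  have o: "open (h ` P)" by (rule invariance_of_domain[OF c P inj])
  have gc: "continuous_on (h ` P) (the_inv_into P h)"
  proof (rule continuous_on_open_vimage[OF o, THEN iffD2], intro allI impI)
    fix B :: "plane set" assume B: "open B"
    have "the_inv_into P h -` B \<inter> h ` P = h ` (P \<inter> B)"
      using inj by (auto simp: the_inv_into_f_f)
    moreover have "open (h ` (P \<inter> B))"
      by (rule invariance_of_domain[OF continuous_on_subset[OF c] open_Int[OF P B] inj_on_subset[OF inj]]) auto
    ultimately show "open (the_inv_into P h -` B \<inter> h ` P)" by simp
  qed
  have "CT k 0 ((UNIV :: real set) \<times> h ` P) (\<lambda>_. the_inv_into P h)"
  proof (rule CT_planar_inverse)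
    show "CT k 0 ((UNIV :: real set) \<times> P) (\<lambda>_. h)" using h by (simp add: CT_space_only_iff P)
    show "open ((UNIV :: real set) \<times> h ` P)" using o by (simp add: open_Times)
    have "continuous_on ((UNIV :: real set) \<times> h ` P) (\<lambda>w. the_inv_into P h (snd w))"
      by (rule continuous_on_compose2[OF gc]) (auto intro!: continuous_intros)
    then show "continuous_on ((UNIV :: real set) \<times> h ` P) (\<lambda>(p, z). the_inv_into P h z)"
      by (simp add: case_prod_beta')
    fix p :: real and z assume z: "(p, z) \<in> UNIV \<times> h ` P"
    then have i: "the_inv_into P h z \<in> P" using the_inv_into_into[OF inj, of z P] by auto
    then show "(p, the_inv_into P h z) \<in> UNIV \<times> P" by simp
    show "h (the_inv_into P h z) = z" using f_the_inv_into_f[OF inj] z by auto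
    show "jac h (the_inv_into P h z) \<noteq> 0" by (rule jac[OF i])
  qed
  then show ?thesis
    using P h inj o by (simp add: Ck_diffeo_on_def CT_space_only_iff)
qed

lemma planar_locally_injective:
  fixes h :: "plane \<Rightarrow> plane"
  assumes N: "open N" and h: "Ck_on k N h" "0 < k" and a: "a \<in> N" and jac: "jac h a \<noteq> 0"
  obtains e where "0 < e" "ball a e \<subseteq> N" "inj_on h (ball a e)"
proof -
  define D where "D x v = fst v *\<^sub>R ddir (1, 0) h x + snd v *\<^sub>R ddir (0, 1) h x" for x v
  have D: "(h has_derivative D x) (at x)" if "x \<in> N" for x
  proof -
    have d: "(h has_derivative (\<lambda>v. ddir v h x)) (at x)"
      by (rule has_derivative_ddir[OF Ck_on_differentiable[OF h that]])
    have "ddir v h x = D x v" for v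
      unfolding D_def by (rule linear_plane_expand[OF has_derivative_linear[OF d]])
    with d show ?thesis by (simp add: fun_eq_iff)
  qed
  \<comment> \<open>Inverse of the derivative at \<open>a\<close>, again by Cramer's rule.\<close>
  define g where "g w = ((snd (ddir (0, 1) h a) * fst w - fst (ddir (0, 1) h a) * snd w) / jac h a,
      (fst (ddir (1, 0) h a) * snd w - snd (ddir (1, 0) h a) * fst w) / jac h a)" for w :: plane
  have "linear g" unfolding g_def by (rule linearI) (auto simp: algebra_simps add_divide_distrib diff_divide_distrib)
  then have bl: "bounded_linear g" by (simp add: linear_conv_bounded_linear)
  have "g (D a w) = w" for w
  proof -
    have "g (D a w) = (fst w * jac h a / jac h a, snd w * jac h a / jac h a)"
      unfolding g_def D_def jac_def by (simp add: algebra_simps)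
    then show ?thesis using jac by simp
  qed
  then have gD: "g \<circ> D a = id" by (simp add: fun_eq_iff)
  \<comment> \<open>The derivative is determined by two columns, each within \<open>e / 3\<close>;
    the total \<open>2 * e / 3\<close> leaves the strict inequality.\<close>
  have on: "\<exists>\<delta>>0. \<forall>x. dist a x < \<delta> \<longrightarrow> onorm (\<lambda>v. D x v - D a v) < e" if e: "0 < e" for e
  proof -
    have c: "isCont (ddir v h) a" for v
      using Ck_on_ddir[OF h, of v] N a by (simp add: continuous_on_eq_continuous_at)
    have e3: "0 < e / 3" using e by simp
    obtain \<delta>1 where \<delta>1: "\<delta>1 > 0" "\<And>x. dist x a < \<delta>1 \<Longrightarrow> dist (ddir (1, 0) h x) (ddir (1, 0) h a) < e / 3"
      using c[of "(1, 0)"] e3 unfolding continuous_at_eps_delta by blast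
    obtain \<delta>2 where \<delta>2: "\<delta>2 > 0" "\<And>x. dist x a < \<delta>2 \<Longrightarrow> dist (ddir (0, 1) h x) (ddir (0, 1) h a) < e / 3"
      using c[of "(0, 1)"] e3 unfolding continuous_at_eps_delta by blast
    show ?thesis
    proof (intro exI[of _ "min \<delta>1 \<delta>2"] conjI allI impI)
      show "0 < min \<delta>1 \<delta>2" using \<delta>1(1) \<delta>2(1) by simp
      fix x assume "dist a x < min \<delta>1 \<delta>2"
      then have "dist x a < \<delta>1" "dist x a < \<delta>2" by (simp_all add: dist_commute)
      then have l: "norm (ddir (1, 0) h x - ddir (1, 0) h a) \<le> e / 3" "norm (ddir (0, 1) h x - ddir (0, 1) h a) \<le> e / 3"
        using \<delta>1(2)[of x] \<delta>2(2)[of x] by (simp_all add: dist_norm)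
      have "norm (D x v - D a v) \<le> (2 * e / 3) * norm v" for v
      proof -
        have "D x v - D a v = fst v *\<^sub>R (ddir (1, 0) h x - ddir (1, 0) h a) + snd v *\<^sub>R (ddir (0, 1) h x - ddir (0, 1) h a)"
          by (simp add: D_def algebra_simps)
        also have "norm \<dots> \<le> \<bar>fst v\<bar> * norm (ddir (1, 0) h x - ddir (1, 0) h a) + \<bar>snd v\<bar> * norm (ddir (0, 1) h x - ddir (0, 1) h a)"
          by (rule order_trans[OF norm_triangle_ineq]) simp
        also have "\<dots> \<le> norm v * (e / 3) + norm v * (e / 3)"
          using norm_fst_le[of "fst v" "snd v"] norm_snd_le[of "snd v" "fst v"] l by (intro add_mono mult_mono) auto
        finally show ?thesis by simp
      qed
      then have "onorm (\<lambda>v. D x v - D a v) \<le> 2 * e / 3" by (rule onorm_bound[rotated]) (use e in simp)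
      then show "onorm (\<lambda>v. D x v - D a v) < e" using e by simp
    qed
  qed
  from has_derivative_locally_injective[OF a N bl gD D on] that show ?thesis by blast
qed

text \<open>The values of \<open>snd \<circ> h\<close> along the curve locate the point of the curve near which a point lies,
  so the local injectivity of \<open>h\<close> is enough.\<close>

lemma planar_diffeo_near_curve:
  fixes h :: "plane \<Rightarrow> plane" and c :: "real \<Rightarrow> plane"
  assumes N: "open N" and h: "Ck_on k N h" "0 < k"
    and J: "is_interval J" and c: "continuous_on J c" "c ` J \<subseteq> N"
    and jac: "\<And>b. b \<in> J \<Longrightarrow> jac h (c b) \<noteq> 0" and inj: "inj_on (\<lambda>b. snd (h (c b))) J"
  obtains P where "c ` J \<subseteq> P" "P \<subseteq> N" "Ck_diffeo_on k P h"
proof -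
  have hc: "continuous_on N h" by (rule Ck_on_continuous[OF h(1)])
  define N' where "N' = {x \<in> N. jac h x \<noteq> 0}"
  have "continuous_on N (jac h)"
    unfolding jac_def by (intro continuous_intros Ck_on_ddir[OF h])
  then have oN': "open N'"
    using continuous_open_preimage[OF _ N, of "jac h" "- {0}"] by (simp add: N'_def open_Compl Collect_conj_eq vimage_def)
  have hN': "Ck_on k N' h" by (rule Ck_on_subset[OF h(1)]) (auto simp: N'_def)
  define \<beta> where "\<beta> b = snd (h (c b))" for b
  have \<beta>c: "continuous_on J \<beta>"
    unfolding \<beta>_def by (intro continuous_on_snd continuous_on_compose2[OF hc c])
  have inj\<beta>: "inj_on \<beta> J" using inj by (simp add: \<beta>_def[abs_def])
  \<comment> \<open>A continuous injection of an interval is a homeomorphism onto its image, so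
    \<open>c\<close> is a continuous function of the value \<open>\<beta> b\<close>.\<close>
  obtain g where g: "homeomorphism J (\<beta> ` J) \<beta> g"
    using homeomorphism_into_1d[OF _ \<beta>c refl inj\<beta>] J by (auto simp: is_interval_path_connected_1)
  have gb: "g (\<beta> b) = b" if "b \<in> J" for b using g that by (simp add: homeomorphism_def)
  have cg: "continuous_on (\<beta> ` J) (\<lambda>y. c (g y))"
    by (rule continuous_on_compose2[OF c(1)]) (use g in \<open>auto simp: homeomorphism_def\<close>)
  have ex: "\<exists>e \<eta>. 0 < \<eta> \<and> \<eta> \<le> e / 2 \<and> ball (c b) e \<subseteq> N' \<and> inj_on h (ball (c b) e) \<and>
      (\<forall>b'\<in>J. \<bar>\<beta> b' - \<beta> b\<bar> < 2 * \<eta> \<longrightarrow> dist (c b') (c b) < e / 2)" if b: "b \<in> J" for b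
  proof -
    have "c b \<in> N'" using b c(2) jac by (auto simp: N'_def)
    then obtain e where e: "0 < e" "ball (c b) e \<subseteq> N'" "inj_on h (ball (c b) e)"
      using planar_locally_injective[OF oN' hN' h(2), of "c b"] jac[OF b] by blast
    obtain \<tau> where \<tau>: "0 < \<tau>" "\<And>y. y \<in> \<beta> ` J \<Longrightarrow> dist y (\<beta> b) < \<tau> \<Longrightarrow> dist (c (g y)) (c (g (\<beta> b))) < e / 2"
      using cg[unfolded continuous_on_iff] b e(1) by (metis half_gt_zero imageI)
    have "dist (c b') (c b) < e / 2" if "b' \<in> J" "\<bar>\<beta> b' - \<beta> b\<bar> < \<tau>" for b'
      using \<tau>(2)[of "\<beta> b'"] that b by (simp add: gb dist_real_def)
    then show ?thesis
      using e \<tau>(1) by (intro exI[of _ e] exI[of _ "min (e / 2) (\<tau> / 2)"]) auto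
  qed
  have "\<forall>b\<in>J. \<exists>w. 0 < snd w \<and> snd w \<le> fst w / 2 \<and> ball (c b) (fst w) \<subseteq> N' \<and> inj_on h (ball (c b) (fst w)) \<and>
      (\<forall>b'\<in>J. \<bar>\<beta> b' - \<beta> b\<bar> < 2 * snd w \<longrightarrow> dist (c b') (c b) < fst w / 2)"
    using ex by (metis fst_conv snd_conv)
  from bchoice[OF this] obtain w where
    w: "\<forall>b\<in>J. 0 < snd (w b) \<and> snd (w b) \<le> fst (w b) / 2 \<and> ball (c b) (fst (w b)) \<subseteq> N' \<and> inj_on h (ball (c b) (fst (w b))) \<and>
      (\<forall>b'\<in>J. \<bar>\<beta> b' - \<beta> b\<bar> < 2 * snd (w b) \<longrightarrow> dist (c b') (c b) < fst (w b) / 2)" ..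
  obtain e \<eta> where \<eta>: "\<And>b. b \<in> J \<Longrightarrow> 0 < \<eta> b" "\<And>b. b \<in> J \<Longrightarrow> \<eta> b \<le> e b / 2" "\<And>b. b \<in> J \<Longrightarrow> ball (c b) (e b) \<subseteq> N'"
      "\<And>b. b \<in> J \<Longrightarrow> inj_on h (ball (c b) (e b))"
      "\<And>b b'. b \<in> J \<Longrightarrow> b' \<in> J \<Longrightarrow> \<bar>\<beta> b' - \<beta> b\<bar> < 2 * \<eta> b \<Longrightarrow> dist (c b') (c b) < e b / 2"
    by (rule that[of "\<lambda>b. snd (w b)" "\<lambda>b. fst (w b)"]) (use w in blast)+
  define V where "V b = ball (c b) (\<eta> b) \<inter> {x \<in> N. \<bar>snd (h x) - \<beta> b\<bar> < \<eta> b}" for b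
  define P where "P = (\<Union>b\<in>J. V b)"
  have oP: "open P"
    unfolding P_def V_def
    by (intro open_UN ballI open_Int open_ball open_Collect_less_on[OF N]) (intro continuous_intros hc)+
  have PN': "P \<subseteq> N'"
  proof
    fix x assume "x \<in> P"
    then obtain b where b: "b \<in> J" "dist (c b) x < \<eta> b" by (auto simp: P_def V_def)
    then have "x \<in> ball (c b) (e b)" using \<eta>(1)[OF b(1)] \<eta>(2)[OF b(1)] by simp
    then show "x \<in> N'" using \<eta>(3)[OF b(1)] by blast
  qed
  \<comment> \<open>Equal values of \<open>h\<close> place \<open>\<beta> b\<close> and
    \<open>\<beta> b'\<close> within \<open>2 * \<eta> b\<close>, hence \<open>c b'\<close> within
    \<open>e b / 2\<close> of \<open>c b\<close>. Both points then lie in the single ball about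
    \<open>c b\<close> on which \<open>h\<close> is injective; taking the larger
    \<open>\<eta>\<close> as reference makes this work.\<close>
  have key: "x = y" if b: "b \<in> J" "b' \<in> J" and le: "\<eta> b' \<le> \<eta> b" and xy: "x \<in> V b" "y \<in> V b'" and eq: "h x = h y" for b b' x y
  proof -
    have "\<bar>\<beta> b' - \<beta> b\<bar> < 2 * \<eta> b" using xy eq le by (auto simp: V_def)
    from \<eta>(5)[OF b this] have d: "dist (c b') (c b) < e b / 2" .
    have "dist (c b') y < e b / 2" using xy(2) le \<eta>(2)[OF b(1)] by (auto simp: V_def)
    then have "dist (c b) y < e b" using d dist_triangle[of "c b" y "c b'"] by (simp add: dist_commute)
    moreover have "dist (c b) x < e b" using xy(1) \<eta>(1,2)[OF b(1)] by (auto simp: V_def)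
    ultimately show ?thesis using \<eta>(4)[OF b(1)] eq by (auto simp: inj_on_def)
  qed
  have injP: "inj_on h P"
  proof (rule inj_onI)
    fix x y assume "x \<in> P" "y \<in> P" and eq: "h x = h y"
    then obtain b b' where b: "b \<in> J" "x \<in> V b" "b' \<in> J" "y \<in> V b'" by (auto simp: P_def)
    show "x = y"
      using key[OF b(1,3) _ b(2,4) eq] key[OF b(3,1) _ b(4,2) eq[symmetric]] by (cases "\<eta> b' \<le> \<eta> b") auto
  qed
  have "c ` J \<subseteq> P"
  proof
    fix x assume "x \<in> c ` J"
    then obtain b where b: "b \<in> J" "x = c b" by blast
    then have "x \<in> V b" using \<eta>(1) c(2) by (auto simp: V_def \<beta>_def)
    then show "x \<in> P" using b by (auto simp: P_def)
  qed
  moreover have "P \<subseteq> N" using PN' by (auto simp: N'_def)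
  moreover have "Ck_diffeo_on k P h"
    by (rule planar_diffeo_of_inj[OF oP Ck_on_subset[OF hN' PN'] injP]) (use PN' in \<open>auto simp: N'_def\<close>)
  ultimately show ?thesis using that by blast
qed

section \<open>The new parameter along the curve of tangencies\<close>

context tangency
begin

lemma bbar_CT: "CT m d (N \<times> (UNIV :: plane set)) (\<lambda>p z. bbar T p)"
proof (rule CB_cong_imp)
  show "CT m d (N \<times> (UNIV :: plane set)) (\<lambda>p z. root (multM T) (fold_jac T p * lambdap T p / sigmap T p))"
  proof (rule CT_root[OF CT_divide[OF CT_mult[OF fold_jac_CT lambda_CT] sigma_CT]])
    show "sigmap T p \<noteq> 0" if "(p, z) \<in> N \<times> (UNIV :: plane set)" for p z
      using that sigma_nonzero by simp
    show "fold_jac T p * lambdap T p / sigmap T p \<noteq> 0 \<and> (even (multM T) \<longrightarrow> 0 < fold_jac T p * lambdap T p / sigmap T p)"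
      if "(p, z) \<in> N \<times> (UNIV :: plane set)" for p z
      using ret_jac_pos[of p] ret_jac_nonzero[of p] that by (simp add: ret_jac_eq)
  qed (rule multM_pos)
  show "root (multM T) (fold_jac T p * lambdap T p / sigmap T p) = bbar T p" if "(p, z) \<in> N \<times> (UNIV :: plane set)" for p z
    using that by (simp add: bbar_def ret_jac_eq)
qed

lemma pbar_Ck: "Ck_on d N (pbar T)"
proof (rule Ck_of_CB)
  show "CT d d (N \<times> (UNIV :: plane set)) (\<lambda>p z. pbar T p)"
    unfolding pbar_def abar_def power2_eq_square
    by (intro CT_Pair CT_divide CT_mult mu_CT sigma_CT bbar_CT) (use sigma_nonzero in auto)
qed

lemma pcurve_N: "b \<in> ivalJ T \<Longrightarrow> pcurve T b \<in> N" and mu_pcurve: "b \<in> ivalJ T \<Longrightarrow> mu T (pcurve T b) = 0"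
  using cs tc by (auto simp: curve_setting_def tangency_condition_def)

lemma sigma_Ck: "Ck_on d N (sigmap T)"
  by (rule Ck_of_CB[OF sigma_CT[where 'a = plane]])

lemma unfolding_derivatives:
  assumes b: "b \<in> ivalJ T"
  obtains Dm Db where "(mu T has_derivative Dm) (at (pcurve T b))" "(bbar T has_derivative Db) (at (pcurve T b))"
    "Dm (1, 0) * Db (0, 1) - Dm (0, 1) * Db (1, 0) \<noteq> 0"
proof -
  let ?p = "pcurve T b"
  obtain D where D: "((\<lambda>p. (mu T p, bbar T p)) has_derivative D) (at ?p)"
    using uc b by (auto simp: unfolding_condition_def differentiable_def)
  have "jac (\<lambda>p. (mu T p, bbar T p)) ?p \<noteq> 0" using uc b by (auto simp: unfolding_condition_def)
  then have "fst (D (1, 0)) * snd (D (0, 1)) - fst (D (0, 1)) * snd (D (1, 0)) \<noteq> 0"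
    by (simp add: jac_has_derivative[OF D])
  then show ?thesis using that[OF has_derivative_fst[OF D, simplified] has_derivative_snd[OF D, simplified]] by simp
qed

text \<open>Since \<open>\<mu>\<close> vanishes on the curve, the derivative of
  \<open>1 / \<sigma>^2\<close> contributes nothing there, and the Jacobian is that of the unfolding
  condition divided by \<open>\<sigma>^2\<close>.\<close>

lemma jac_pbar_pcurve:
  assumes d: "0 < d" and b: "b \<in> ivalJ T"
  shows "jac (pbar T) (pcurve T b) \<noteq> 0"
proof -
  let ?p = "pcurve T b"
  obtain Dm Db where D: "(mu T has_derivative Dm) (at ?p)" "(bbar T has_derivative Db) (at ?p)"
    "Dm (1, 0) * Db (0, 1) - Dm (0, 1) * Db (1, 0) \<noteq> 0" by (rule unfolding_derivatives[OF b])
  have s: "sigmap T ?p \<noteq> 0" by (rule sigma_nonzero[OF pcurve_N[OF b]])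
  have "(\<lambda>p. inverse (sigmap T p ^ 2)) differentiable (at ?p)"
    using Ck_on_differentiable[OF sigma_Ck d pcurve_N[OF b]] s by (intro differentiable_inverse differentiable_power) auto
  then obtain E where E: "((\<lambda>p. inverse (sigmap T p ^ 2)) has_derivative E) (at ?p)" by (auto simp: differentiable_def)
  have "((\<lambda>p. mu T p * inverse (sigmap T p ^ 2)) has_derivative (\<lambda>v. Dm v / sigmap T ?p ^ 2)) (at ?p)"
    using has_derivative_mult[OF D(1) E] mu_pcurve[OF b] by (simp add: divide_inverse)
  then have "((\<lambda>p. (mu T p * inverse (sigmap T p ^ 2), bbar T p)) has_derivative (\<lambda>v. (Dm v / sigmap T ?p ^ 2, Db v))) (at ?p)"
    by (rule has_derivative_Pair[OF _ D(2)])
  moreover have "pbar T = (\<lambda>p. (mu T p * inverse (sigmap T p ^ 2), bbar T p))"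
    by (simp add: fun_eq_iff pbar_def abar_def divide_inverse)
  ultimately have "jac (pbar T) ?p = Dm (1, 0) / sigmap T ?p ^ 2 * Db (0, 1) - Dm (0, 1) / sigmap T ?p ^ 2 * Db (1, 0)"
    using jac_has_derivative by fastforce
  also have "\<dots> = (Dm (1, 0) * Db (0, 1) - Dm (0, 1) * Db (1, 0)) / sigmap T ?p ^ 2"
    by (simp add: diff_divide_distrib)
  finally show ?thesis using D(3) s by simp
qed

lemma J_facts: "open (ivalJ T)" "is_interval (ivalJ T)"
  using ps by (auto simp: piece_setting_def)

lemma pcurve_deriv:
  assumes d: "0 < d" and b: "b \<in> ivalJ T"
  obtains a' where "(pcurve T has_derivative (\<lambda>t. (t * a', t))) (at b)"
proof -
  have "Ck_on d (ivalJ T) (curve T)" using cs by (simp add: curve_setting_def)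
  from has_derivative_ddir[OF Ck_on_differentiable[OF this d b]]
  have D: "(curve T has_derivative (\<lambda>t. ddir t (curve T) b)) (at b)" .
  define k where "k = ddir 1 (curve T) b"
  have "ddir t (curve T) b = t * k" for t
    using linear_cmul[OF has_derivative_linear[OF D], of t 1] by (simp add: k_def)
  with D have "(curve T has_derivative (\<lambda>t. t * k)) (at b)" by simp
  from has_derivative_Pair[OF this has_derivative_ident] show ?thesis
    using that[of k] by (simp add: pcurve_def[abs_def])
qed

text \<open>The tangent \<open>(a', 1)\<close> of the curve lies in the kernel of
  \<open>D\<mu>\<close>; if the derivative of \<open>bbar\<close> vanished on it too, the two
  differentials would be dependent.\<close>

lemma bbar_pcurve_deriv:
  assumes d: "0 < d" and b: "b \<in> ivalJ T"
  obtains k where "((\<lambda>b. bbar T (pcurve T b)) has_real_derivative k) (at b)" "k \<noteq> 0"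
proof -
  obtain Dm Db where D: "(mu T has_derivative Dm) (at (pcurve T b))" "(bbar T has_derivative Db) (at (pcurve T b))"
    "Dm (1, 0) * Db (0, 1) - Dm (0, 1) * Db (1, 0) \<noteq> 0" by (rule unfolding_derivatives[OF b])
  obtain a' where a': "(pcurve T has_derivative (\<lambda>t. (t * a', t))) (at b)" by (rule pcurve_deriv[OF d b])
  have lm: "Dm v = fst v * Dm (1, 0) + snd v * Dm (0, 1)" and lb: "Db v = fst v * Db (1, 0) + snd v * Db (0, 1)" for v
    using linear_plane_expand[OF has_derivative_linear[OF D(1)], of v]
      linear_plane_expand[OF has_derivative_linear[OF D(2)], of v] by simp_all
  have "((\<lambda>b. mu T (pcurve T b)) has_derivative (\<lambda>t. Dm (t * a', t))) (at b)"
    by (rule has_derivative_compose[where g = "mu T", OF a' D(1)])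
  moreover have "((\<lambda>b. mu T (pcurve T b)) has_derivative (\<lambda>t. 0)) (at b)"
    using has_derivative_transform_within_open[OF has_derivative_const J_facts(1) b, of 0 "\<lambda>b. mu T (pcurve T b)"] mu_pcurve by simp
  ultimately have "(\<lambda>t. Dm (t * a', t)) = (\<lambda>t. 0)" by (rule has_derivative_unique)
  then have "Dm (a', 1) = 0" by (metis mult_1)
  then have m0: "a' * Dm (1, 0) + Dm (0, 1) = 0" using lm[of "(a', 1)"] by simp
  have "((\<lambda>b. bbar T (pcurve T b)) has_derivative (\<lambda>t. Db (t * a', t))) (at b)"
    by (rule has_derivative_compose[where g = "bbar T", OF a' D(2)])
  moreover have "(\<lambda>t. Db (t * a', t)) = times (Db (a', 1))"
    by (rule ext) (subst (1 2) lb, simp add: algebra_simps)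
  ultimately have "((\<lambda>b. bbar T (pcurve T b)) has_real_derivative Db (a', 1)) (at b)"
    by (simp add: has_field_derivative_def)
  moreover have "Db (a', 1) \<noteq> 0"
  proof
    assume "Db (a', 1) = 0"
    then have "a' * Db (1, 0) + Db (0, 1) = 0" using lb[of "(a', 1)"] by simp
    then have "Db (0, 1) = - (a' * Db (1, 0))" "Dm (0, 1) = - (a' * Dm (1, 0))" using m0 by linarith+
    then have "Dm (1, 0) * Db (0, 1) - Dm (0, 1) * Db (1, 0) = 0" by simp
    then show False using D(3) by simp
  qed
  ultimately show ?thesis by (rule that)
qed

text \<open>Rolle's argument: two equal values would produce a zero of the derivative in
  between.\<close>

lemma bbar_pcurve_inj:
  assumes d: "0 < d"
  shows "inj_on (\<lambda>b. bbar T (pcurve T b)) (ivalJ T)"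
proof -
  let ?g = "\<lambda>b. bbar T (pcurve T b)"
  have ne: "?g x \<noteq> ?g y" if xy: "x \<in> ivalJ T" "y \<in> ivalJ T" "x < y" for x y
  proof
    assume eq: "?g x = ?g y"
    have sub: "z \<in> ivalJ T" if "x \<le> z" "z \<le> y" for z
      using J_facts(2) xy that unfolding is_interval_1 by blast
    have "\<forall>z\<in>ivalJ T. \<exists>k. (?g has_real_derivative k) (at z) \<and> k \<noteq> 0"
    proof
      fix z assume "z \<in> ivalJ T"
      from bbar_pcurve_deriv[OF d this] show "\<exists>k. (?g has_real_derivative k) (at z) \<and> k \<noteq> 0" by blast
    qed
    from bchoice[OF this] obtain k where k: "\<forall>z\<in>ivalJ T. (?g has_real_derivative k z) (at z) \<and> k z \<noteq> 0" ..
    have "(?g has_real_derivative k z) (at z)" if "x \<le> z" "z \<le> y" for z using k sub[OF that] by blast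
    from MVT2[OF xy(3) this] obtain z where z: "x < z" "z < y" "?g y - ?g x = (y - x) * k z" by blast
    then have "k z \<noteq> 0" using k sub[of z] by simp
    then show False using eq xy(3) z(3) by simp
  qed
  then show ?thesis by (intro linorder_inj_onI) auto
qed

theorem param_domain_exists:
  assumes d: "0 < d"
  shows "\<exists>P. param_domain d T P"
proof -
  have "pcurve T differentiable (at b)" if "b \<in> ivalJ T" for b
    using pcurve_deriv[OF d that] unfolding differentiable_def by metis
  then have c: "continuous_on (ivalJ T) (pcurve T)"
    by (intro continuous_at_imp_continuous_on ballI differentiable_imp_continuous_within)
  have sub: "pcurve T ` ivalJ T \<subseteq> N" using pcurve_N by blast
  have inj: "inj_on (\<lambda>b. snd (pbar T (pcurve T b))) (ivalJ T)" using bbar_pcurve_inj[OF d] by (simp add: pbar_def)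
  from planar_diffeo_near_curve[OF open_N pbar_Ck d J_facts(2) c sub jac_pbar_pcurve[OF d] inj]
  show ?thesis by (metis param_domain_def)
qed

end

section \<open>Quantitative estimates\<close>

definition lnA :: "tangency_data \<Rightarrow> plane \<Rightarrow> plane \<Rightarrow> real" where
  "lnA T p z = ln \<bar>dspace (1, 0) (repA T) p z\<bar>"

definition lnB :: "tangency_data \<Rightarrow> plane \<Rightarrow> plane \<Rightarrow> real" where
  "lnB T p z = ln \<bar>dspace (0, 1) (repB T) p z\<bar>"

lemma log_distortion_eq:
  "log_distortion (repA T) (repB T) p z =
    ((dspace (1, 0) (lnA T) p z, dspace (0, 1) (lnA T) p z), (dspace (1, 0) (lnB T) p z, dspace (0, 1) (lnB T) p z))"
  by (simp add: log_distortion_def Let_def dspace_def lnA_def[abs_def] lnB_def[abs_def])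

lemma CT_ln_abs:
  fixes g :: "'q::euclidean_space \<Rightarrow> 'x::real_normed_vector \<Rightarrow> real"
  assumes g: "CT m d \<Omega> g" and nz: "\<And>p z. (p, z) \<in> \<Omega> \<Longrightarrow> g p z \<noteq> 0"
  shows "CT m d \<Omega> (\<lambda>p z. ln \<bar>g p z\<bar>)"
proof (rule CB_cong_imp)
  show "CT m d \<Omega> (\<lambda>p z. ln (g p z * g p z) / 2)"
  proof (rule CT_divide[OF CT_ln[OF CT_mult[OF g g]] CT_const[OF CB_open[OF g]]])
    show "0 < g p z * g p z" if "(p, z) \<in> \<Omega>" for p z
      using nz[OF that] by (metis mult_pos_pos mult_neg_neg linorder_neqE_linordered_idom)
  qed simp
  show "ln (g p z * g p z) / 2 = ln \<bar>g p z\<bar>" if "(p, z) \<in> \<Omega>" for p z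
    using ln_mult_pos[of "\<bar>g p z\<bar>" "\<bar>g p z\<bar>"] nz[OF that] by simp
qed

lemma dspace_swap:
  fixes G :: "plane \<Rightarrow> plane \<Rightarrow> 'b::real_normed_vector"
  assumes "(G p has_derivative D) (at (snd z, fst z))"
  shows "((\<lambda>z. G p (snd z, fst z)) has_derivative (\<lambda>v. D (snd v, fst v))) (at z)"
proof -
  have "((\<lambda>z::plane. (snd z, fst z)) has_derivative (\<lambda>v. (snd v, fst v))) (at z)"
    by (intro has_derivative_Pair has_derivative_fst has_derivative_snd has_derivative_ident)
  from has_derivative_compose[where g = "G p" and f = "\<lambda>z. (snd z, fst z)", OF this assms] show ?thesis .
qed

context tangency
begin

lemma A_x_CT: "CT (r - 1) d (boxes N) (dspace (1, 0) A)" and B_y_CT: "CT (r - 1) d (boxes N) (dspace (0, 1) B)"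
  by (rule CB_top[OF CB_dspace], use A_C B_C r_pos in simp)+

lemma lnA_CT: "CT (r - 1) d (boxes N) (lnA T)" and lnB_CT: "CT (r - 1) d (boxes N) (lnB T)"
  unfolding lnA_def[abs_def] lnB_def[abs_def]
  by (rule CT_ln_abs[OF A_x_CT A_x_nonzero], assumption) (rule CT_ln_abs[OF B_y_CT B_y_nonzero], assumption)

lemma r2: "Suc (r - 2) = r - 1" "d \<le> r - 2"
  using dr by auto

lemma box_swap: "(p, z) \<in> boxes P \<Longrightarrow> (p, (snd z, fst z)) \<in> boxes P"
  by (simp add: boxes_iff)

lemma swapB_CT: "CT r d (boxes N) (\<lambda>p z. B p (snd z, fst z))"
proof -
  have o: "open (boxes N)" by (rule CB_open[OF A_C])
  show ?thesis
    by (rule CT_compose[OF B_C CT_par[OF o] CT_Pair[OF CT_snd[OF CT_space[OF o]] CT_fst[OF CT_space[OF o]]] box_swap])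
qed

lemma swapB_x:
  assumes "(p, z) \<in> boxes N"
  shows "dspace (1, 0) (\<lambda>p z. B p (snd z, fst z)) p z = dspace (0, 1) B p (snd z, fst z)"
  using dspaceI[where g = "\<lambda>p z. B p (snd z, fst z)" and D = "\<lambda>v. dspace (snd v, fst v) B p (snd z, fst z)" and v = "(1, 0)" and p = p and x = z,
      OF dspace_swap[where G = B and p = p and z = z, OF B_deriv[OF box_swap[OF assms]]]] by simp

lemma norA_facts:
  assumes "(p, z) \<in> boxes N"
  shows "dspace (1, 0) (norA T) p 0 = 1" "0 < dspace (1, 0) (norA T) p z"
    "dspace e (\<lambda>p z. ln (dspace (1, 0) (norA T) p z)) p z = dspace e (lnA T) p z"
proof -
  have e: "norA T p z = (A p z - A p (0, snd z)) / dspace (1, 0) A p (0, 0)" for p z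
    by (cases z) (simp add: norA_def normalized_rep_def Vfun_def sigma_eq)
  note F = normalized_facts[OF A_C A_x_nonzero e assms]
  show "dspace (1, 0) (norA T) p 0 = 1" "0 < dspace (1, 0) (norA T) p z"
    "dspace e (\<lambda>p z. ln (dspace (1, 0) (norA T) p z)) p z = dspace e (lnA T) p z"
    using F(2,3,4) by (simp_all add: lnA_def[abs_def])
qed

text \<open>\<open>B\<close> with exchanged arguments contracts in its first variable as
  \<open>A\<close> does, so \<open>normalized_facts\<close> applies; the price is that
  \<open>lnB\<close> appears with both its point and its direction exchanged.\<close>

lemma norB_facts:
  assumes pz: "(p, z) \<in> boxes N"
  shows "dspace (1, 0) (norB T) p 0 = 1" "0 < dspace (1, 0) (norB T) p z"
    "dspace e (\<lambda>p z. ln (dspace (1, 0) (norB T) p z)) p z = dspace (snd e, fst e) (lnB T) p (snd z, fst z)"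
proof -
  let ?G = "\<lambda>p z. B p (snd z, fst z)"
  have e: "norB T p z = (B p (snd z, fst z) - B p (snd (0::real, snd z), fst (0::real, snd z))) / dspace (1, 0) ?G p (0, 0)"
    if "p \<in> N" for p z
    using swapB_x[OF zero_box[OF that]] by (cases z) (simp add: norB_def normalized_rep_def Hfun_def lambda_eq)
  define a where "a p z = (B p (snd z, fst z) - B p (snd (0::real, snd z), fst (0::real, snd z))) / dspace (1, 0) ?G p (0, 0)" for p z
  have nz: "dspace (1, 0) ?G p z \<noteq> 0" if "(p, z) \<in> boxes N" for p z
    using B_y_nonzero[OF box_swap[OF that]] swapB_x[OF that] by simp
  note F = normalized_facts[where G = ?G and a = a, OF swapB_CT nz a_def pz]
  have ae: "a p = norB T p" if "p \<in> N" for p using e[OF that] by (simp add: fun_eq_iff a_def)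
  have p: "p \<in> N" using pz by (simp add: boxes_def)
  have da: "dspace v a p = dspace v (norB T) p" for v by (simp add: dspace_def ae[OF p])
  show "dspace (1, 0) (norB T) p 0 = 1" "0 < dspace (1, 0) (norB T) p z"
    using F(2,3) by (simp_all add: da)
  have "dspace e (\<lambda>p z. ln (dspace (1, 0) (norB T) p z)) p z = dspace e (\<lambda>p z. ln (dspace (1, 0) a p z)) p z"
    by (simp add: dspace_def[of e] da)
  also have "\<dots> = dspace e (\<lambda>p z. ln \<bar>dspace (1, 0) ?G p z\<bar>) p z" by (rule F(4))
  also have "\<dots> = dspace e (\<lambda>p z. lnB T p (snd z, fst z)) p z"
    by (rule dspace_cong(1)[OF CB_open[OF A_C] pz]) (simp add: swapB_x lnB_def)
  also have "\<dots> = dspace (snd e, fst e) (lnB T) p (snd z, fst z)"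
  proof -
    have "CT (Suc (r - 2)) d (boxes N) (lnB T)" using lnB_CT r2 by simp
    from dspace_swap[where G = "lnB T", OF CB_diff_space[OF this box_swap[OF pz]]]
    show ?thesis by (intro dspaceI[where D = "\<lambda>v. dspace (snd v, fst v) (lnB T) p (snd z, fst z)"])
  qed
  finally show "dspace e (\<lambda>p z. ln (dspace (1, 0) (norB T) p z)) p z = dspace (snd e, fst e) (lnB T) p (snd z, fst z)" .
qed

end

section \<open>From the prescribed norms to bounded families\<close>

context renorm
begin

lemma P_sub: "P \<subseteq> N"
  using P_N by blast

lemma open_bP: "open (boxes P)"
  by (rule open_boxes[OF open_P P_sub])

lemma CB_pq: "Ck_norm d Q pq \<le> K \<Longrightarrow> CB m d K (Q \<times> (UNIV :: plane set)) (\<lambda>q z. pq q)"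
  by (rule CB_const_of_Ck[OF open_Q pq_Ck])

lemma CB_sigma: "Ck_norm d P (sigmap T) \<le> K \<Longrightarrow> CB m d K (P \<times> (UNIV :: plane set)) (\<lambda>p z. sigmap T p)"
proof (rule CB_const_of_Ck[OF open_P Ck_of_CB])
  show "CT d d (P \<times> (UNIV :: plane set)) (\<lambda>p z. sigmap T p)"
    by (rule CB_subset[OF sigma_CT]) (use open_P P_sub in \<open>auto simp: open_Times\<close>)
qed

lemma CB_remainder: "Cdr_norm d r (rem_domain T P) (remainder T) \<le> K \<Longrightarrow> CB r d K (rem_domain T P) (remainder T)"
  by (rule CB_of_Cdr[OF CB_open Cdr_of_CB(1)]) (rule remainder_CT[OF P_sub open_P])+

text \<open>The distortion is measured on the interior of the whole domain of the representation,
  which contains the open boxes used here.\<close>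

lemma CB_distortion:
  assumes "piece_distortion d r T P \<le> K"
  shows "CB (r - 2) d K (boxes P) (log_distortion A B)"
proof (rule CB_of_Cdr[OF open_bP])
  let ?D = "{(p, z). p \<in> P \<and> z \<in> rep_domain (f p) (Y p) n}"
  have "CT (r - 2) d (boxes P) (dspace v (lnA T))" "CT (r - 2) d (boxes P) (dspace v (lnB T))" for v
    using CB_subset[OF CB_top[OF CB_dspace] open_bP boxes_mono] lnA_CT lnB_CT r2 by metis+
  then have "CT (r - 2) d (boxes P) (log_distortion A B)"
    unfolding log_distortion_eq[abs_def] by (intro CT_Pair)
  then show "Cdr_on d (r - 2) (boxes P) (log_distortion A B)" by (rule Cdr_of_CB(1))
  have sub: "boxes P \<subseteq> interior ?D"
    by (rule interior_maximal[OF _ open_bP]) (use box_rep P_N in \<open>unfold boxes_def, blast\<close>)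
  \<comment> \<open>The minimum in the distortion does not cut the parameter order, because
    \<open>d + 3 \<le> r\<close>.\<close>
  have "min d (r - 2) = d" using r2 by simp
  with assms have le: "Cdr_norm d (r - 2) (interior ?D) (log_distortion A B) \<le> K"
    by (simp add: piece_distortion_def distortion_def)
  show "Cdr_norm d (r - 2) (boxes P) (log_distortion A B) \<le> K"
    unfolding Cdr_norm_le_iff
  proof (intro allI impI)
    fix us vs p z
    assume "length (us::plane list) \<le> d" "length us + length (vs::plane list) \<le> r - 2" "\<forall>u\<in>set us. norm u \<le> 1" "\<forall>v\<in>set vs. norm v \<le> 1" "(p, z) \<in> boxes P"
    then show "ennreal (norm (mixed us vs (log_distortion A B) p z)) \<le> K"
      using le[unfolded Cdr_norm_le_iff] sub by blast
  qed
qed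

lemma CB_rep:
  assumes "rep_norm d r T P \<le> K"
  shows "CB r d K (boxes P) (normalized_rep T)"
proof (rule CB_of_Cdr[OF open_bP])
  have e: "normalized_rep T = (\<lambda>p z. (norA T p z, norB T p (snd z, fst z)))"
    by (simp add: fun_eq_iff norA_def norB_def)
  have "CT r d (boxes P) (\<lambda>p z. norB T p (snd z, fst z))"
    by (rule CT_compose[OF norB_CT CT_par[OF open_bP] CT_Pair[OF CT_snd[OF CT_space[OF open_bP]] CT_fst[OF CT_space[OF open_bP]]]])
      (use box_swap boxes_mono in blast)
  then have "CT r d (boxes P) (normalized_rep T)"
    unfolding e by (intro CT_Pair CB_subset[OF norA_CT open_bP boxes_mono])
  then show "Cdr_on d r (boxes P) (normalized_rep T)" by (rule Cdr_of_CB(1))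
  show "Cdr_norm d r (boxes P) (normalized_rep T) \<le> K"
    using assms by (simp add: rep_norm_def boxes_def)
qed

lemma dom_box_scale: "(q, (x, y)) \<in> dom_box T P R \<Longrightarrow> \<bar>t\<bar> \<le> 1 \<Longrightarrow> \<bar>t'\<bar> \<le> 1 \<Longrightarrow> (q, (t * x, t' * y)) \<in> dom_box T P R"
  and dom_rem_scale: "(q, (x, y)) \<in> dom_rem T P R \<Longrightarrow> \<bar>t\<bar> \<le> 1 \<Longrightarrow> \<bar>t'\<bar> \<le> 1 \<Longrightarrow> (q, (t * x, t' * y)) \<in> dom_rem T P R"
proof -
  have m: "\<bar>c * (t * x)\<bar> < b" if "\<bar>c * x\<bar> < b" "\<bar>t\<bar> \<le> 1" for b c t x :: real
  proof -
    have "\<bar>c * (t * x)\<bar> = \<bar>t\<bar> * \<bar>c * x\<bar>" by (simp add: abs_mult)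
    also have "\<dots> \<le> 1 * \<bar>c * x\<bar>" using that(2) by (intro mult_right_mono) auto
    finally show ?thesis using that(1) by simp
  qed
  have m1: "\<bar>t * x\<bar> < b" if "\<bar>x\<bar> < b" "\<bar>t\<bar> \<le> 1" for b t x :: real
    using m[of 1 x b t] that by simp
  show "(q, (x, y)) \<in> dom_box T P R \<Longrightarrow> \<bar>t\<bar> \<le> 1 \<Longrightarrow> \<bar>t'\<bar> \<le> 1 \<Longrightarrow> (q, (t * x, t' * y)) \<in> dom_box T P R"
    unfolding dom_box_def by (simp add: m m1)
  show "(q, (x, y)) \<in> dom_rem T P R \<Longrightarrow> \<bar>t\<bar> \<le> 1 \<Longrightarrow> \<bar>t'\<bar> \<le> 1 \<Longrightarrow> (q, (t * x, t' * y)) \<in> dom_rem T P R"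
    unfolding dom_rem_def by (simp add: m m1)
qed

lemma dom_box_norm: "(q, z) \<in> dom_box T P R \<Longrightarrow> norm z \<le> 2 * R + 2"
  and dom_rem_norm: "(q, z) \<in> dom_rem T P R \<Longrightarrow> norm z \<le> 2 * R + 2"
  using norm_le_sum[of z] by (auto simp: dom_box_def dom_rem_def)

lemma remainder_zero:
  assumes "p \<in> N"
  shows "remainder T p 0 = 0 \<and> dspace (1, 0) (remainder T) p 0 = 0 \<and> dspace (0, 1) (remainder T) p 0 = 0 \<and>
    dspace (1, 0) (dspace (1, 0) (remainder T)) p 0 = 0"
  using tc assms unfolding tangency_condition_def dspace_def zero_prod_def by blast

end

section \<open>Uniform smallness over all controlled unfoldings\<close>

lemma tangency_renorm_of_controlled:
  assumes "d + 3 \<le> r" "0 < R" "controlled d r R Kpar Krem Kdist T P"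
  shows "renorm d r T P R"
  using assms by (auto simp: controlled_def renorm_def tangency_def renorm_axioms_def)

lemma BDD_bounded_linear:
  assumes f: "BDD F m d \<Omega> f" and L: "bounded_linear L" "\<And>v. norm (L v) \<le> norm v"
  shows "BDD F m d \<Omega> (\<lambda>i p z. L (f i p z))"
proof -
  obtain K where K: "K < top" "\<forall>\<^sub>F i in F. CB m d K (\<Omega> i) (f i)" using f unfolding BDD_def by blast
  from K(2) have "\<forall>\<^sub>F i in F. CB m d (ennreal 1 * K) (\<Omega> i) (\<lambda>p z. L (f i p z))"
    by eventually_elim (erule CB_linear[OF _ L(1)], use L(2) in simp_all)
  then show ?thesis using K(1) by (intro BDD_I[of "ennreal 1 * K"]) simp_all
qed

lemma norm_fst_le': "norm (fst w) \<le> norm w" and norm_snd_le': "norm (snd w) \<le> norm w"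
  using norm_fst_le[of "fst w" "snd w"] norm_snd_le[of "snd w" "fst w"] by simp_all

lemma DBD_subset:
  assumes "DBD F m d \<Omega> f" "\<forall>\<^sub>F i in F. open (\<Omega>' i) \<and> \<Omega>' i \<subseteq> \<Omega> i"
  shows "DBD F m d \<Omega>' f"
proof -
  obtain K where K: "K < top" "\<forall>\<^sub>F i in F. DB m d K (\<Omega> i) (f i)" using assms(1) unfolding DBD_def by blast
  from K(2) assms(2) have "\<forall>\<^sub>F i in F. DB m d K (\<Omega>' i) (f i)"
    by eventually_elim (auto intro: DB_subset)
  then show ?thesis by (rule DBD_I[OF K(1)])
qed

locale renorm_filter =
  fixes F :: "(tangency_data \<times> plane set) filter" and d r :: nat and R Kpar Krem Kdist :: real
  assumes dr: "d + 3 \<le> r" and R: "0 < R"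
    and ctl: "\<forall>\<^sub>F i in F. controlled d r R Kpar Krem Kdist (fst i) (snd i)"
    and small: "\<And>\<epsilon>. 0 < \<epsilon> \<Longrightarrow> \<forall>\<^sub>F i in F. Ck_norm d (snd i) (sigmap (fst i)) \<le> ennreal \<epsilon>"
begin

lemma ren: "\<forall>\<^sub>F i in F. renorm d r (fst i) (snd i) R"
  using ctl by eventually_elim (rule tangency_renorm_of_controlled[OF dr R])

lemma tan: "\<forall>\<^sub>F i in F. tangency d r (fst i)"
  using ren by eventually_elim (simp add: renorm_def)

abbreviation "Qs \<equiv> \<lambda>i. (pbar (fst i) ` snd i) \<times> (UNIV :: plane set)"
abbreviation "pqs \<equiv> \<lambda>i. pbar_inv (fst i) (snd i)"
abbreviation "ss \<equiv> \<lambda>i. sg (fst i) (snd i)"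
abbreviation "bx \<equiv> \<lambda>i. dom_box (fst i) (snd i) R"
abbreviation "rm \<equiv> \<lambda>i. dom_rem (fst i) (snd i) R"
abbreviation "dW \<equiv> \<lambda>i. dom_W (fst i) (snd i) R"

lemma pqs_DBD: "DBD F m d Qs (\<lambda>i q z. pqs i q)"
proof (rule BDD_DBD, rule BDD_I)
  show "ennreal Kpar < top" by simp
  from ren ctl show "\<forall>\<^sub>F i in F. CB m d (ennreal Kpar) (Qs i) (\<lambda>q z. pqs i q)"
    by eventually_elim (rule renorm.CB_pq, auto simp: controlled_def)
qed

lemma open_Qs: "\<forall>\<^sub>F i in F. open (Qs i)"
  using ren by eventually_elim (simp add: renorm.open_Q open_Times)

text \<open>\<sigma> is small as a function of \<open>p\<close>, but the family is indexed by
  \<open>q\<close>; the bound \<open>Kpar\<close> on \<open>q \<mapsto> p\<close> transports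
  smallness of the parameter derivatives.\<close>

lemma ss_small: "SMALL F m d Qs (\<lambda>i q z. ss i q)"
proof -
  have "SMALL F m d (\<lambda>i. snd i \<times> (UNIV :: plane set)) (\<lambda>i p z. sigmap (fst i) p)"
    unfolding SMALL_def
  proof (intro allI impI)
    fix \<delta> :: real assume "0 < \<delta>"
    from ren small[OF this]
    show "\<forall>\<^sub>F i in F. CB m d (ennreal \<delta>) (snd i \<times> (UNIV :: plane set)) (\<lambda>p z. sigmap (fst i) p)"
      by eventually_elim (rule renorm.CB_sigma)
  qed
  note S = SMALL_compose[OF this pqs_DBD[of m] DBD_linear[OF bounded_linear_ident order_refl open_Qs]]
  have "\<forall>\<^sub>F i in F. \<forall>q x. (q, x) \<in> Qs i \<longrightarrow> (pqs i q, x) \<in> snd i \<times> (UNIV :: plane set)"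
    using ren by eventually_elim (intro allI impI SigmaI UNIV_I renorm.pq_P, assumption, erule SigmaD1)
  from S[OF this] show ?thesis unfolding sg_def .
qed

lemma dom_sub: "dom_box T P R \<subseteq> (pbar T ` P) \<times> (UNIV :: plane set)" "dom_rem T P R \<subseteq> (pbar T ` P) \<times> (UNIV :: plane set)"
    "dom_W T P R \<subseteq> dom_rem T P R"
  unfolding dom_box_def dom_rem_def dom_W_def by blast+

lemma box_Qs: "\<forall>\<^sub>F i in F. open (bx i) \<and> bx i \<subseteq> Qs i"
  using ren by eventually_elim (intro conjI renorm.open_dom_box dom_sub)

lemma rem_Qs: "\<forall>\<^sub>F i in F. open (rm i) \<and> rm i \<subseteq> Qs i"
  using ren by eventually_elim (intro conjI renorm.open_dom_rem dom_sub)

lemma dW_rem: "\<forall>\<^sub>F i in F. open (dW i) \<and> dW i \<subseteq> rm i"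
  using ren by eventually_elim (intro conjI renorm.open_dom_W dom_sub)

lemma open_box: "\<forall>\<^sub>F i in F. open (bx i)" and open_rem: "\<forall>\<^sub>F i in F. open (rm i)" and open_dW: "\<forall>\<^sub>F i in F. open (dW i)"
  using box_Qs rem_Qs dW_rem by (auto elim: eventually_mono)

lemma box_norm: "\<forall>\<^sub>F i in F. \<forall>q z. (q, z) \<in> bx i \<longrightarrow> norm z \<le> 2 * R + 2"
  using ren by eventually_elim (blast dest: renorm.dom_box_norm)

lemma rem_norm: "\<forall>\<^sub>F i in F. \<forall>q z. (q, z) \<in> rm i \<longrightarrow> norm z \<le> 2 * R + 2"
  using ren by eventually_elim (blast dest: renorm.dom_rem_norm)

sublocale gam: rescaling F d r bx "\<lambda>i. tangency.boxes (fst i) (snd i)" pqs ss ss "2 * R + 2"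
proof
  show "d + 3 \<le> r" by (rule dr)
  show "0 \<le> 2 * R + 2" using R by simp
  show "\<forall>\<^sub>F i in F. open (bx i)" by (rule open_box)
  show "\<forall>\<^sub>F i in F. \<forall>q z. (q, z) \<in> bx i \<longrightarrow> norm z \<le> 2 * R + 2" by (rule box_norm)
  show "\<forall>\<^sub>F i in F. \<forall>q z. (q, z) \<in> bx i \<longrightarrow> (pqs i q, (ss i q * fst z, ss i q * snd z)) \<in> tangency.boxes (fst i) (snd i)"
    using ren by eventually_elim (blast dest: renorm.dom_boxD(2))
  show "\<forall>\<^sub>F i in F. \<forall>q x y t t'. (q, (x, y)) \<in> bx i \<longrightarrow> \<bar>t\<bar> \<le> 1 \<longrightarrow> \<bar>t'\<bar> \<le> 1 \<longrightarrow> (q, (t * x, t' * y)) \<in> bx i"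
    using ren by eventually_elim (blast intro: renorm.dom_box_scale)
  show "DBD F r d bx (\<lambda>i q z. pqs i q)" by (rule DBD_subset[OF pqs_DBD box_Qs])
  show "SMALL F r d bx (\<lambda>i q z. ss i q)" by (rule SMALL_subset[OF ss_small box_Qs])
qed

sublocale rema: rescaling F d r rm "\<lambda>i. rem_domain (fst i) (snd i)" pqs ss "\<lambda>i q. ss i q ^ 2" "2 * R + 2"
proof
  show "d + 3 \<le> r" by (rule dr)
  show "0 \<le> 2 * R + 2" using R by simp
  show "\<forall>\<^sub>F i in F. open (rm i)" by (rule open_rem)
  show "\<forall>\<^sub>F i in F. \<forall>q z. (q, z) \<in> rm i \<longrightarrow> norm z \<le> 2 * R + 2" by (rule rem_norm)
  show "\<forall>\<^sub>F i in F. \<forall>q z. (q, z) \<in> rm i \<longrightarrow> (pqs i q, (ss i q * fst z, ss i q ^ 2 * snd z)) \<in> rem_domain (fst i) (snd i)"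
    using ren by eventually_elim (blast dest: renorm.dom_remD(2))
  show "\<forall>\<^sub>F i in F. \<forall>q x y t t'. (q, (x, y)) \<in> rm i \<longrightarrow> \<bar>t\<bar> \<le> 1 \<longrightarrow> \<bar>t'\<bar> \<le> 1 \<longrightarrow> (q, (t * x, t' * y)) \<in> rm i"
    using ren by eventually_elim (blast intro: renorm.dom_rem_scale)
  show "DBD F r d rm (\<lambda>i q z. pqs i q)" by (rule DBD_subset[OF pqs_DBD rem_Qs])
  show s: "SMALL F r d rm (\<lambda>i q z. ss i q)" by (rule SMALL_subset[OF ss_small rem_Qs])
  show "SMALL F r d rm (\<lambda>i q z. ss i q ^ 2)"
    unfolding power2_eq_square by (rule SMALL_mult[OF s SMALL_BDD[OF s]])
qed

lemma rho_small: "SMALL F r d rm (\<lambda>i. rho (fst i) (snd i))"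
  unfolding rho_def[abs_def]
proof (rule rema.SMALL_remainder(2))
  show "ss i q ^ 2 = ss i q ^ 2" for i q ..
  show "\<forall>\<^sub>F i in F. \<forall>q z. (q, z) \<in> rm i \<longrightarrow> ss i q \<noteq> 0"
    using ren by eventually_elim (blast dest: renorm.dom_remD(1) renorm.s_nonzero)
  have b: "\<forall>\<^sub>F i in F. CB r d (ennreal Krem) (rem_domain (fst i) (snd i)) (remainder (fst i))"
    using ren ctl by eventually_elim (rule renorm.CB_remainder, auto simp: controlled_def)
  then show "BDD F r d (\<lambda>i. rem_domain (fst i) (snd i)) (\<lambda>i. remainder (fst i))" by (intro BDD_I[of "ennreal Krem"]) auto
  from b show "\<forall>\<^sub>F i in F. CT r d (rem_domain (fst i) (snd i)) (remainder (fst i))"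
    by eventually_elim (rule CB_top)
  show "\<forall>\<^sub>F i in F. \<forall>q z. (q, z) \<in> rm i \<longrightarrow> remainder (fst i) (pqs i q) 0 = 0 \<and> dspace (1, 0) (remainder (fst i)) (pqs i q) 0 = 0 \<and>
      dspace (0, 1) (remainder (fst i)) (pqs i q) 0 = 0 \<and> dspace (1, 0) (dspace (1, 0) (remainder (fst i))) (pqs i q) 0 = 0"
    using ren
  proof eventually_elim
    case (elim i)
    show ?case
      by (intro allI impI renorm.remainder_zero[OF elim] renorm.P_N[OF elim] renorm.pq_P[OF elim] renorm.dom_remD(1)[OF elim])
  qed
qed

lemma dist_BDD:
  "BDD F (r - 2) d (\<lambda>i. tangency.boxes (fst i) (snd i)) (\<lambda>i. dspace (1, 0) (lnA (fst i)))"
  "BDD F (r - 2) d (\<lambda>i. tangency.boxes (fst i) (snd i)) (\<lambda>i. dspace (0, 1) (lnA (fst i)))"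
  "BDD F (r - 2) d (\<lambda>i. tangency.boxes (fst i) (snd i)) (\<lambda>i. dspace (1, 0) (lnB (fst i)))"
  "BDD F (r - 2) d (\<lambda>i. tangency.boxes (fst i) (snd i)) (\<lambda>i. dspace (0, 1) (lnB (fst i)))"
proof -
  let ?D = "\<lambda>i p z. log_distortion (repA (fst i)) (repB (fst i)) p z"
  let ?K = "ennreal Kdist"
  have b: "\<forall>\<^sub>F i in F. CB (r - 2) d ?K (tangency.boxes (fst i) (snd i)) (?D i)"
    using ren ctl by eventually_elim (rule renorm.CB_distortion, auto simp: controlled_def)
  have lin: "BDD F (r - 2) d (\<lambda>i. tangency.boxes (fst i) (snd i)) (\<lambda>i p z. L (?D i p z))"
    if L: "bounded_linear L" "\<And>v. norm (L v) \<le> norm v" for L :: "plane \<times> plane \<Rightarrow> real"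
    using BDD_bounded_linear[OF BDD_I[OF _ b] L] by simp
  have n: "norm (fst (fst v)) \<le> norm v" "norm (snd (fst v)) \<le> norm v" "norm (fst (snd v)) \<le> norm v" "norm (snd (snd v)) \<le> norm v"
    for v :: "plane \<times> plane"
    by (rule order_trans[OF norm_fst_le' norm_fst_le'] order_trans[OF norm_snd_le' norm_fst_le']
        order_trans[OF norm_fst_le' norm_snd_le'] order_trans[OF norm_snd_le' norm_snd_le'])+
  show "BDD F (r - 2) d (\<lambda>i. tangency.boxes (fst i) (snd i)) (\<lambda>i. dspace (1, 0) (lnA (fst i)))"
    using lin[OF bounded_linear_compose[OF bounded_linear_fst bounded_linear_fst] n(1)] by (simp add: log_distortion_eq)
  show "BDD F (r - 2) d (\<lambda>i. tangency.boxes (fst i) (snd i)) (\<lambda>i. dspace (0, 1) (lnA (fst i)))"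
    using lin[OF bounded_linear_compose[OF bounded_linear_snd bounded_linear_fst] n(2)] by (simp add: log_distortion_eq)
  show "BDD F (r - 2) d (\<lambda>i. tangency.boxes (fst i) (snd i)) (\<lambda>i. dspace (1, 0) (lnB (fst i)))"
    using lin[OF bounded_linear_compose[OF bounded_linear_fst bounded_linear_snd] n(3)] by (simp add: log_distortion_eq)
  show "BDD F (r - 2) d (\<lambda>i. tangency.boxes (fst i) (snd i)) (\<lambda>i. dspace (0, 1) (lnB (fst i)))"
    using lin[OF bounded_linear_compose[OF bounded_linear_snd bounded_linear_snd] n(4)] by (simp add: log_distortion_eq)
qed

lemma open_bs: "\<forall>\<^sub>F i in F. open (tangency.boxes (fst i) (snd i))"
  using ren by eventually_elim (rule renorm.open_bP)

lemma swap_BDD: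
  fixes G :: "tangency_data \<times> plane set \<Rightarrow> plane \<Rightarrow> plane \<Rightarrow> real"
  assumes "BDD F m d (\<lambda>i. tangency.boxes (fst i) (snd i)) G"
  shows "BDD F m d (\<lambda>i. tangency.boxes (fst i) (snd i)) (\<lambda>i p z. G i p (snd z, fst z))"
proof (rule BDD_compose[OF assms DBD_par[OF open_bs] DBD_linear[OF _ _ open_bs]])
  show "bounded_linear (\<lambda>z::plane. (snd z, fst z))"
    by (intro bounded_linear_Pair bounded_linear_fst bounded_linear_snd)
  show "norm (snd v, fst v) \<le> norm v" for v :: plane by (cases v) (simp add: norm_Pair add.commute)
  show "\<forall>\<^sub>F i in F. \<forall>q x. (q, x) \<in> tangency.boxes (fst i) (snd i) \<longrightarrow> (q, (snd x, fst x)) \<in> tangency.boxes (fst i) (snd i)"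
    using tan by eventually_elim (blast intro: tangency.box_swap)
qed

lemma box_nonzero: "\<forall>\<^sub>F i in F. \<forall>q z. (q, z) \<in> bx i \<longrightarrow> ss i q \<noteq> 0"
  using ren by eventually_elim (blast dest: renorm.dom_boxD(1) renorm.s_nonzero)

lemma gamA_small:
  "SMALL F (r - 1) d bx (\<lambda>i. gamA (fst i) (snd i))"
  "BDD F r d (\<lambda>i. tangency.boxes (fst i) (snd i)) (\<lambda>i. norA (fst i)) \<Longrightarrow> SMALL F r d bx (\<lambda>i. gamA (fst i) (snd i))"
proof -
  let ?bs = "\<lambda>i. tangency.boxes (fst i) (snd i)" and ?a = "\<lambda>i. norA (fst i)"
  have a: "\<forall>\<^sub>F i in F. CT r d (?bs i) (?a i)"
    using ren by eventually_elim (rule CB_subset[OF tangency.norA_CT renorm.open_bP renorm.boxes_mono], simp_all add: renorm_def)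
  have a0: "\<forall>\<^sub>F i in F. \<forall>q x y. (q, (x, y)) \<in> bx i \<longrightarrow> ?a i (pqs i q) (0, ss i q * y) = 0"
    by (rule always_eventually) (simp add: norA_def normalized_rep_def Vfun_def)
  have a1: "\<forall>\<^sub>F i in F. \<forall>q z. (q, z) \<in> bx i \<longrightarrow> dspace (1, 0) (?a i) (pqs i q) 0 = 1"
    using ren
  proof eventually_elim
    case (elim i)
    then have t: "tangency d r (fst i)" by (simp add: renorm_def)
    show ?case
      using tangency.norA_facts(1)[OF t set_mp[OF renorm.boxes_mono[OF elim] renorm.dom_boxD(2)[OF elim]]] by blast
  qed
  have f: "\<forall>\<^sub>F i in F. \<forall>p z. (p, z) \<in> ?bs i \<longrightarrow> 0 < dspace (1, 0) (?a i) p z \<and>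
     (\<forall>e. dspace e (\<lambda>p z. ln (dspace (1, 0) (?a i) p z)) p z = dspace e (lnA (fst i)) p z)"
    using ren
  proof eventually_elim
    case (elim i)
    then have t: "tangency d r (fst i)" by (simp add: renorm_def)
    show ?case
      by (intro allI impI conjI tangency.norA_facts(2,3)[OF t] set_mp[OF renorm.boxes_mono[OF elim]])
  qed
  have pos: "\<forall>\<^sub>F i in F. \<forall>p z. (p, z) \<in> ?bs i \<longrightarrow> 0 < dspace (1, 0) (?a i) p z"
    using f by eventually_elim blast
  have l: "\<forall>\<^sub>F i in F. \<forall>p z. (p, z) \<in> ?bs i \<longrightarrow> dspace e (lnA (fst i)) p z = dspace e (\<lambda>p z. ln (dspace (1, 0) (?a i) p z)) p z" for e
    using f by eventually_elim metis
  note G = gam.SMALL_gamma[OF refl box_nonzero a a0 a1 pos BDD_cong[OF dist_BDD(1) l] BDD_cong[OF dist_BDD(2) l]]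
  show "SMALL F (r - 1) d bx (\<lambda>i. gamA (fst i) (snd i))" using G(2) by (simp add: gamA_def[abs_def])
  show "BDD F r d ?bs ?a \<Longrightarrow> SMALL F r d bx (\<lambda>i. gamA (fst i) (snd i))" using G(3) by (simp add: gamA_def[abs_def])
qed

lemma gamB_small:
  "SMALL F (r - 1) d bx (\<lambda>i. gamB (fst i) (snd i))"
  "BDD F r d (\<lambda>i. tangency.boxes (fst i) (snd i)) (\<lambda>i. norB (fst i)) \<Longrightarrow> SMALL F r d bx (\<lambda>i. gamB (fst i) (snd i))"
proof -
  let ?bs = "\<lambda>i. tangency.boxes (fst i) (snd i)" and ?a = "\<lambda>i. norB (fst i)"
  have a: "\<forall>\<^sub>F i in F. CT r d (?bs i) (?a i)"
    using ren by eventually_elim (rule CB_subset[OF tangency.norB_CT renorm.open_bP renorm.boxes_mono], simp_all add: renorm_def)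
  have a0: "\<forall>\<^sub>F i in F. \<forall>q x y. (q, (x, y)) \<in> bx i \<longrightarrow> ?a i (pqs i q) (0, ss i q * y) = 0"
    by (rule always_eventually) (simp add: norB_def normalized_rep_def Hfun_def)
  have a1: "\<forall>\<^sub>F i in F. \<forall>q z. (q, z) \<in> bx i \<longrightarrow> dspace (1, 0) (?a i) (pqs i q) 0 = 1"
    using ren
  proof eventually_elim
    case (elim i)
    then have t: "tangency d r (fst i)" by (simp add: renorm_def)
    show ?case
      using tangency.norB_facts(1)[OF t set_mp[OF renorm.boxes_mono[OF elim] renorm.dom_boxD(2)[OF elim]]] by blast
  qed
  have f: "\<forall>\<^sub>F i in F. \<forall>p z. (p, z) \<in> ?bs i \<longrightarrow> 0 < dspace (1, 0) (?a i) p z \<and>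
     (\<forall>e. dspace e (\<lambda>p z. ln (dspace (1, 0) (?a i) p z)) p z = dspace (snd e, fst e) (lnB (fst i)) p (snd z, fst z))"
    using ren
  proof eventually_elim
    case (elim i)
    then have t: "tangency d r (fst i)" by (simp add: renorm_def)
    show ?case
      by (intro allI impI conjI tangency.norB_facts(2,3)[OF t] set_mp[OF renorm.boxes_mono[OF elim]])
  qed
  have pos: "\<forall>\<^sub>F i in F. \<forall>p z. (p, z) \<in> ?bs i \<longrightarrow> 0 < dspace (1, 0) (?a i) p z"
    using f by eventually_elim blast
  have l: "\<forall>\<^sub>F i in F. \<forall>p z. (p, z) \<in> ?bs i \<longrightarrow>
      dspace (snd e, fst e) (lnB (fst i)) p (snd z, fst z) = dspace e (\<lambda>p z. ln (dspace (1, 0) (?a i) p z)) p z" for e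
    using f by eventually_elim metis
  \<comment> \<open>The vertical distortion of \<open>B\<close> comes first, since
    \<open>norB\<close> has its variables exchanged.\<close>
  note G = gam.SMALL_gamma[OF refl box_nonzero a a0 a1 pos BDD_cong[OF swap_BDD[OF dist_BDD(4)] l[of "(1, 0)", simplified]]
    BDD_cong[OF swap_BDD[OF dist_BDD(3)] l[of "(0, 1)", simplified]]]
  show "SMALL F (r - 1) d bx (\<lambda>i. gamB (fst i) (snd i))" using G(2) by (simp add: gamB_def[abs_def])
  show "BDD F r d ?bs ?a \<Longrightarrow> SMALL F r d bx (\<lambda>i. gamB (fst i) (snd i))" using G(3) by (simp add: gamB_def[abs_def])
qed

lemma tgt_DBD: "DBD F r d dW (\<lambda>i. tgt (fst i) (snd i))"
proof -
  have b: "\<forall>\<^sub>F i in F. \<forall>q z. (q, z) \<in> dW i \<longrightarrow> norm (fst z) \<le> 2 * R + 2"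
    using dW_rem rem_norm by eventually_elim (blast intro: order_trans[OF norm_fst_le'])
  have ns: "norm (- snd z) \<le> norm z" for z :: plane using norm_snd_le'[of z] by simp
  have x: "BDD F r d dW (\<lambda>i q z. fst z)"
    by (rule BDD_linear[OF bounded_linear_fst norm_fst_le' open_dW b])
  have "DBD F r d dW (\<lambda>i q z. fst q + fst z * fst z + - snd z + rho (fst i) (snd i) q z)"
    by (intro DBD_add DBD_linear_par DBD_linear BDD_DBD BDD_mult x bounded_linear_fst bounded_linear_minus bounded_linear_snd norm_fst_le' ns open_dW
        SMALL_BDD SMALL_subset[OF rho_small dW_rem])
  then show ?thesis by (simp add: tgt_def[abs_def])
qed

text \<open>The order \<open>m\<close> is left open: \<open>r - 1\<close> when only the distortion
  is bounded, \<open>r\<close> when the normalized representation is bounded as well.\<close>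

lemma hen_small:
  assumes m: "m \<le> r" and A: "SMALL F m d bx (\<lambda>i. gamA (fst i) (snd i))" and B: "SMALL F m d bx (\<lambda>i. gamB (fst i) (snd i))"
  shows "SMALL F m d dW (\<lambda>i. henZ (fst i) (snd i))" "SMALL F m d dW (\<lambda>i. henX (fst i) (snd i))"
proof -
  have u: "\<forall>\<^sub>F i in F. CT m d (dW i) (sol (fst i) (snd i))"
    using ren by eventually_elim (rule CB_mono_r[OF renorm.sol_CT m])
  have into: "\<forall>\<^sub>F i in F. \<forall>q z. (q, z) \<in> dW i \<longrightarrow> (q, (sol (fst i) (snd i) q z, fst z)) \<in> bx i"
    using ren by eventually_elim (blast dest: renorm.sol_props(1))
  have eq: "\<forall>\<^sub>F i in F. \<forall>q z. (q, z) \<in> dW i \<longrightarrow>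
      sol (fst i) (snd i) q z + gamA (fst i) (snd i) q (sol (fst i) (snd i) q z, fst z) = tgt (fst i) (snd i) q z"
    using ren by eventually_elim (blast dest: renorm.sol_props(3))
  note I = SMALL_implicit[OF A u DBD_mono[OF tgt_DBD m order_refl] into eq]
  show "SMALL F m d dW (\<lambda>i. henZ (fst i) (snd i))"
    unfolding henZ_def[abs_def] by (rule SMALL_add[OF I(1) SMALL_mono[OF SMALL_subset[OF rho_small dW_rem] m order_refl]])
  \<comment> \<open>\<open>dom_box\<close> is symmetric in its two space variables, so the pair
    \<open>(X, u)\<close> required by \<open>gamB\<close> is admissible too.\<close>
  have into': "\<forall>\<^sub>F i in F. \<forall>q z. (q, z) \<in> dW i \<longrightarrow> (q, (fst z, sol (fst i) (snd i) q z)) \<in> bx i"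
    using into by eventually_elim (simp add: dom_box_def)
  show "SMALL F m d dW (\<lambda>i. henX (fst i) (snd i))"
    unfolding henX_def[abs_def]
    by (rule SMALL_compose[OF B DBD_par[OF open_dW] DBD_Pair[OF DBD_linear[OF bounded_linear_fst norm_fst_le' open_dW] I(2)] into'])
qed

lemma henon_like_eventually:
  assumes "m \<le> r" "SMALL F m d bx (\<lambda>i. gamA (fst i) (snd i))" "SMALL F m d bx (\<lambda>i. gamB (fst i) (snd i))" "0 < \<delta>"
  shows "\<forall>\<^sub>F i in F. henon_like_restricted d r m (ennreal \<delta>) (multM (fst i)) (renorm_domain (fst i) R (snd i)) (renorm_family (fst i) (snd i))"
  using ren SMALL_D[OF hen_small(1)[OF assms(1-3)] assms(4)] SMALL_D[OF hen_small(2)[OF assms(1-3)] assms(4)]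
  by eventually_elim (rule renorm.henon_like_of_bounds)

lemma rep_BDD:
  assumes "\<forall>\<^sub>F i in F. rep_norm d r (fst i) (snd i) \<le> ennreal Krep"
  shows "BDD F r d (\<lambda>i. tangency.boxes (fst i) (snd i)) (\<lambda>i. norA (fst i))"
    "BDD F r d (\<lambda>i. tangency.boxes (fst i) (snd i)) (\<lambda>i. norB (fst i))"
proof -
  have b: "\<forall>\<^sub>F i in F. CB r d (ennreal Krep) (tangency.boxes (fst i) (snd i)) (normalized_rep (fst i))"
    using ren assms by eventually_elim (rule renorm.CB_rep)
  have lin: "BDD F r d (\<lambda>i. tangency.boxes (fst i) (snd i)) (\<lambda>i p z. L (normalized_rep (fst i) p z))"
    if L: "bounded_linear L" "\<And>v. norm (L v) \<le> norm v" for L :: "plane \<Rightarrow> real"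
    using BDD_bounded_linear[OF BDD_I[OF _ b] L] by simp
  have n: "norm (fst v) \<le> norm v" "norm (snd v) \<le> norm v" for v :: plane
    by (rule norm_fst_le' norm_snd_le')+
  show "BDD F r d (\<lambda>i. tangency.boxes (fst i) (snd i)) (\<lambda>i. norA (fst i))"
    unfolding norA_def[abs_def] by (rule lin[OF bounded_linear_fst n(1)])
  from swap_BDD[OF lin[OF bounded_linear_snd n(2)]]
  show "BDD F r d (\<lambda>i. tangency.boxes (fst i) (snd i)) (\<lambda>i. norB (fst i))"
    by (simp add: norB_def[abs_def])
qed

end

text \<open>The sets for different \<open>\<epsilon>\<close> are nested, so they form a filter base,
  and a statement proved eventually yields one \<open>\<epsilon>\<close> valid for all indices at
  once.\<close>

lemma eventually_small_filter:
  fixes C :: "'i \<Rightarrow> bool" and N :: "'i \<Rightarrow> ennreal"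
  defines "F \<equiv> INF \<epsilon>\<in>{0<..}. principal {i. C i \<and> N i \<le> ennreal \<epsilon>}"
  shows "eventually X F \<longleftrightarrow> (\<exists>\<epsilon>>0. \<forall>i. C i \<and> N i \<le> ennreal \<epsilon> \<longrightarrow> X i)"
  unfolding F_def
proof (subst eventually_INF_base)
  show "{0<..} \<noteq> ({} :: real set)" by auto
  show "\<exists>\<epsilon>\<in>{0<..}. principal {i. C i \<and> N i \<le> ennreal \<epsilon>} \<le> inf (principal {i. C i \<and> N i \<le> ennreal a}) (principal {i. C i \<and> N i \<le> ennreal b})"
    if "a \<in> {0<..}" "b \<in> {0<..}" for a b :: real
    using that by (intro bexI[of _ "min a b"]) (auto intro: order_trans[OF _ ennreal_leI])
  show "(\<exists>\<epsilon>\<in>{0<..}. eventually X (principal {i. C i \<and> N i \<le> ennreal \<epsilon>})) \<longleftrightarrow> (\<exists>\<epsilon>>0. \<forall>i. C i \<and> N i \<le> ennreal \<epsilon> \<longrightarrow> X i)"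
    by (auto simp: eventually_principal)
qed

theorem renormalization_quantitative:
  assumes "d + 3 \<le> r" "0 < \<delta>" "0 < R"
  shows "\<exists>\<epsilon>>0. \<forall>T P. controlled d r R Kpar Krem Kdist T P \<and> Ck_norm d P (sigmap T) \<le> ennreal \<epsilon> \<longrightarrow>
      henon_like_restricted d r (r - 1) (ennreal \<delta>) (multM T) (renorm_domain T R P) (renorm_family T P)"
    and "\<exists>\<epsilon>>0. \<forall>T P. controlled d r R Kpar Krem Kdist T P \<and> rep_norm d r T P \<le> ennreal Krep \<and> Ck_norm d P (sigmap T) \<le> ennreal \<epsilon> \<longrightarrow>
      henon_like_restricted d r r (ennreal \<delta>) (multM T) (renorm_domain T R P) (renorm_family T P)"
proof -
  let ?N = "\<lambda>i. Ck_norm d (snd i) (sigmap (fst i))"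
  let ?F = "\<lambda>C. INF \<epsilon>\<in>{0<..}. principal {i :: tangency_data \<times> plane set. C i \<and> ?N i \<le> ennreal \<epsilon>}"
  have rf: "renorm_filter (?F C) d r R Kpar Krem Kdist"
    if "\<And>i. C i \<Longrightarrow> controlled d r R Kpar Krem Kdist (fst i) (snd i)" for C
    unfolding renorm_filter_def eventually_small_filter using assms that zero_less_one by blast
  let ?C = "\<lambda>i. controlled d r R Kpar Krem Kdist (fst i) (snd i)"
  interpret A: renorm_filter "?F ?C" d r R Kpar Krem Kdist by (rule rf)
  from A.henon_like_eventually[OF diff_le_self A.gamA_small(1) A.gamB_small(1) assms(2), unfolded eventually_small_filter]
  show "\<exists>\<epsilon>>0. \<forall>T P. controlled d r R Kpar Krem Kdist T P \<and> Ck_norm d P (sigmap T) \<le> ennreal \<epsilon> \<longrightarrow>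
      henon_like_restricted d r (r - 1) (ennreal \<delta>) (multM T) (renorm_domain T R P) (renorm_family T P)"
    by (simp only: split_paired_All fst_conv snd_conv)
  \<comment> \<open>A second filter, with the bound on the normalized representation in its base
    sets: here \<open>\<epsilon>\<close> may also depend on \<open>Krep\<close>.\<close>
  let ?C' = "\<lambda>i. ?C i \<and> rep_norm d r (fst i) (snd i) \<le> ennreal Krep"
  interpret B: renorm_filter "?F ?C'" d r R Kpar Krem Kdist by (rule rf) blast
  have rep: "\<forall>\<^sub>F i in ?F ?C'. rep_norm d r (fst i) (snd i) \<le> ennreal Krep"
    unfolding eventually_small_filter using zero_less_one by blast
  from B.henon_like_eventually[OF order_refl B.gamA_small(2)[OF B.rep_BDD(1)[OF rep]] B.gamB_small(2)[OF B.rep_BDD(2)[OF rep]] assms(2),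
      unfolded eventually_small_filter]
  show "\<exists>\<epsilon>>0. \<forall>T P. controlled d r R Kpar Krem Kdist T P \<and> rep_norm d r T P \<le> ennreal Krep \<and> Ck_norm d P (sigmap T) \<le> ennreal \<epsilon> \<longrightarrow>
      henon_like_restricted d r r (ennreal \<delta>) (multM T) (renorm_domain T R P) (renorm_family T P)"
    by (simp only: split_paired_All fst_conv snd_conv conj_assoc)
qed

theorem renormalization_qualitative:
  assumes "d + 3 \<le> r" "0 < R" "tangency_unfolding d r T" "param_domain d T P" "boxes_in_tube T R P"
  shows "henon_like_restricted d r r \<infinity> (multM T) (renorm_domain T R P) (renorm_family T P)"
proof -
  interpret renorm d r T P R
    using assms by (simp add: renorm_def tangency_def renorm_axioms_def)
  show ?thesis using henon_like_of_bounds[OF henZ_CT henX_CT] by simp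
qed

theorem theoremC:
  fixes d r :: nat
  assumes "d + 3 \<le> r"
  shows
    "(\<forall>T. tangency_unfolding d r T \<and> 1 \<le> d \<longrightarrow> (\<exists>P. param_domain d T P)) \<and>
     (\<forall>R>0. \<forall>T P. tangency_unfolding d r T \<and> param_domain d T P \<and> boxes_in_tube T R P \<longrightarrow>
        henon_like_restricted d r r \<infinity> (multM T) (renorm_domain T R P) (renorm_family T P)) \<and>
     (\<forall>\<delta>>0. \<forall>R>0. \<forall>Kpar Krem Kdist.
        (\<exists>\<epsilon>>0. \<forall>T P. controlled d r R Kpar Krem Kdist T P \<and> Ck_norm d P (sigmap T) \<le> ennreal \<epsilon> \<longrightarrow>
           henon_like_restricted d r (r - 1) (ennreal \<delta>) (multM T) (renorm_domain T R P) (renorm_family T P)) \<and>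
        (\<forall>Krep. \<exists>\<epsilon>>0. \<forall>T P. controlled d r R Kpar Krem Kdist T P \<and> rep_norm d r T P \<le> ennreal Krep \<and>
             Ck_norm d P (sigmap T) \<le> ennreal \<epsilon> \<longrightarrow>
           henon_like_restricted d r r (ennreal \<delta>) (multM T) (renorm_domain T R P) (renorm_family T P)))"
proof (intro conjI allI impI)
  fix T assume "tangency_unfolding d r T \<and> 1 \<le> d"
  then show "\<exists>P. param_domain d T P"
    using assms by (intro tangency.param_domain_exists[of d r]) (auto simp: tangency_def)
next
  fix R :: real and T P
  assume "0 < R" "tangency_unfolding d r T \<and> param_domain d T P \<and> boxes_in_tube T R P"
  then show "henon_like_restricted d r r \<infinity> (multM T) (renorm_domain T R P) (renorm_family T P)"
    using renormalization_qualitative[OF assms] by blast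
qed (rule renormalization_quantitative[OF assms]; assumption)+

end
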